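(* Let $K$ be an algebraically closed field and let $\Lambda$ be a finite-dimensional $K$-algebra. Then the following hold. (1) $\Lambda$ is CM-$\tau$-tilting free if and only if the opposite algebra $\Lambda^{o}$ is CM-$\tau$-tilting free. (2) If $\Lambda$ is a Gorenstein algebra, then $\Lambda$ is CM-$\tau$-tilting free if and only if the lower triangular matrix algebra $T_2(\Lambda)$ is CM-$\tau$-tilting free.
   Context: All algebras are finite-dimensional over an algebraically closed field $K$ and all modules are finitely generated left modules. For an algebra $A$, write $A\text{-}\mathrm{mod}$ for the category of finitely generated left $A$-modules and $A^{o}$ for the opposite algebra. A module $M\in A\text{-}\mathrm{mod}$ is Gorenstein projective if there is an exact sequence $\cdots\to P_{-1}\to P_0\to P_1\to\cdots$ of finitely generated projective left $A$-modules which stays exact under $\mathrm{Hom}_A(-,A)$ and such that $M\simeq \mathrm{Im}(P_{-1}\to P_0)$. A module $M$ is $\tau$-rigid if $\mathrm{Hom}_A(M,\tau M)=0$, where $\tau$ is the Auslander-Reiten translation. A module is Gorenstein projective $\tau$-rigid if it is both Gorenstein projective and $\tau$-rigid. The algebra $A$ is CM-$\tau$-tilting free if all Gorenstein projective $\tau$-rigid modules in $A\text{-}\mathrm{mod}$ are projective. The algebra $A$ is Gorenstein if the injective dimension of $A$ as a left module over itself and the injective dimension of $A$ as a right module over itself are both finite. $T_2(A)=\begin{pmatrix} A & 0 \\ A & A \end{pmatrix}$ is the algebra of lower triangular $2\times 2$ matrices with entries in $A$ (with usual matrix addition and multiplication). *)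

theory Defs
  imports
    "HOL-Algebra.Algebraic_Closure"
    "HOL-Analysis.Finite_Cartesian_Product"
    "HOL-Library.Extended_Nat"
begin

section \<open>Modules over noncommutative rings\<close>

text \<open>
  The library locale \<open>module\<close> is restricted to commutative rings of scalars. We reuse the record type
  \<open>('r, 'm) module\<close> for left modules over an arbitrary ring; the fields \<open>mult\<close> and \<open>one\<close> of such a
  record carry no meaning. Right modules are left modules over the opposite ring.
\<close>

locale left_module = R?: ring R + M?: abelian_group M
  for R :: "('r, 'x) ring_scheme" (structure) and M :: "('r, 'm, 'y) module_scheme" (structure) +
  assumes smult_closed:
      "\<lbrakk>a \<in> carrier R; x \<in> carrier M\<rbrakk> \<Longrightarrow> a \<odot>\<^bsub>M\<^esub> x \<in> carrier M"
    and smult_l_distr: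
      "\<lbrakk>a \<in> carrier R; b \<in> carrier R; x \<in> carrier M\<rbrakk> \<Longrightarrow>
        (a \<oplus>\<^bsub>R\<^esub> b) \<odot>\<^bsub>M\<^esub> x = a \<odot>\<^bsub>M\<^esub> x \<oplus>\<^bsub>M\<^esub> b \<odot>\<^bsub>M\<^esub> x"
    and smult_r_distr:
      "\<lbrakk>a \<in> carrier R; x \<in> carrier M; y \<in> carrier M\<rbrakk> \<Longrightarrow>
        a \<odot>\<^bsub>M\<^esub> (x \<oplus>\<^bsub>M\<^esub> y) = a \<odot>\<^bsub>M\<^esub> x \<oplus>\<^bsub>M\<^esub> a \<odot>\<^bsub>M\<^esub> y"
    and smult_assoc:
      "\<lbrakk>a \<in> carrier R; b \<in> carrier R; x \<in> carrier M\<rbrakk> \<Longrightarrow>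
        (a \<otimes>\<^bsub>R\<^esub> b) \<odot>\<^bsub>M\<^esub> x = a \<odot>\<^bsub>M\<^esub> (b \<odot>\<^bsub>M\<^esub> x)"
    and smult_one:
      "x \<in> carrier M \<Longrightarrow> \<one>\<^bsub>R\<^esub> \<odot>\<^bsub>M\<^esub> x = x"

definition fin_gen :: "('r, 'x) ring_scheme \<Rightarrow> ('r, 'm, 'y) module_scheme \<Rightarrow> bool" where
  "fin_gen R M \<longleftrightarrow>
    (\<exists>S. finite S \<and> S \<subseteq> carrier M \<and> (\<forall>N. submodule N R M \<and> S \<subseteq> N \<longrightarrow> N = carrier M))"

definition fg_module :: "('r, 'x) ring_scheme \<Rightarrow> ('r, 'm, 'y) module_scheme \<Rightarrow> bool" where
  "fg_module R M \<longleftrightarrow> left_module R M \<and> fin_gen R M"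

text \<open>Homomorphisms are extensional, so that the Hom sets are genuine abelian groups.\<close>

definition mod_hom ::
  "('r, 'x) ring_scheme \<Rightarrow> ('r, 'm, 'y) module_scheme \<Rightarrow> ('r, 'n, 'z) module_scheme \<Rightarrow> ('m \<Rightarrow> 'n) set"
  where "mod_hom R M N = {f \<in> carrier M \<rightarrow>\<^sub>E carrier N.
    (\<forall>x\<in>carrier M. \<forall>y\<in>carrier M. f (x \<oplus>\<^bsub>M\<^esub> y) = f x \<oplus>\<^bsub>N\<^esub> f y) \<and>
    (\<forall>a\<in>carrier R. \<forall>x\<in>carrier M. f (a \<odot>\<^bsub>M\<^esub> x) = a \<odot>\<^bsub>N\<^esub> f x)}"

definition mod_iso ::
  "('r, 'x) ring_scheme \<Rightarrow> ('r, 'm, 'y) module_scheme \<Rightarrow> ('r, 'n, 'z) module_scheme \<Rightarrow> bool"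
  where "mod_iso R M N \<longleftrightarrow> (\<exists>f\<in>mod_hom R M N. bij_betw f (carrier M) (carrier N))"

text \<open>Exactness of \<open>L \<rightarrow> M \<rightarrow> N\<close> at \<open>M\<close>.\<close>

definition exact_at ::
  "('r, 'l, 'x) module_scheme \<Rightarrow> ('l \<Rightarrow> 'm) \<Rightarrow> ('r, 'm, 'y) module_scheme \<Rightarrow> ('m \<Rightarrow> 'n) \<Rightarrow>
    ('r, 'n, 'z) module_scheme \<Rightarrow> bool"
  where "exact_at L f M g N \<longleftrightarrow> f ` carrier L = a_kernel M N g"

text \<open>The quotient of a module by a submodule, with the library's cosets.\<close>

definition quot_mod :: "('r, 'm) module \<Rightarrow> 'm set \<Rightarrow> ('r, 'm set) module" where
  "quot_mod M N =
    \<lparr>carrier = a_rcosets\<^bsub>M\<^esub> N, monoid.mult = undefined, one = undefined, zero = N, add = set_add M,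
     smult = (\<lambda>a C. \<Union>x\<in>C. N +>\<^bsub>M\<^esub> (a \<odot>\<^bsub>M\<^esub> x))\<rparr>"

section \<open>Finite-dimensional algebras\<close>

text \<open>
  An algebra over \<open>K\<close> is a record of type \<open>('k, 'a) module\<close> with all its fields used: ring structure
  and \<open>K\<close>-action. The library locale \<open>algebra\<close> cannot be used, as it requires commutativity.
\<close>

locale fd_algebra = K?: field K + A?: ring A + Module.module K A
  for K :: "'k ring" (structure) and A :: "('k, 'a) module" (structure) +
  assumes smult_mult_left:
      "\<lbrakk>c \<in> carrier K; x \<in> carrier A; y \<in> carrier A\<rbrakk> \<Longrightarrow>
        (c \<odot>\<^bsub>A\<^esub> x) \<otimes>\<^bsub>A\<^esub> y = c \<odot>\<^bsub>A\<^esub> (x \<otimes>\<^bsub>A\<^esub> y)"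
    and smult_mult_right:
      "\<lbrakk>c \<in> carrier K; x \<in> carrier A; y \<in> carrier A\<rbrakk> \<Longrightarrow>
        x \<otimes>\<^bsub>A\<^esub> (c \<odot>\<^bsub>A\<^esub> y) = c \<odot>\<^bsub>A\<^esub> (x \<otimes>\<^bsub>A\<^esub> y)"
    and finite_dimensional: "fin_gen K A"

definition opp :: "('k, 'a) module \<Rightarrow> ('k, 'a) module" where
  "opp A = A\<lparr>monoid.mult := (\<lambda>x y. y \<otimes>\<^bsub>A\<^esub> x)\<rparr>"

text \<open>The lower triangular matrices: the entry in row \<open>1\<close>, column \<open>2\<close> vanishes.\<close>

definition T2 :: "('k, 'a) module \<Rightarrow> ('k, 'a ^ 2 ^ 2) module" where
  "T2 A =
    \<lparr>carrier = {B. (\<forall>i j. B $ i $ j \<in> carrier A) \<and> B $ 1 $ 2 = \<zero>\<^bsub>A\<^esub>},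
     monoid.mult = (\<lambda>B C. \<chi> i j. \<Oplus>\<^bsub>A\<^esub>k\<in>UNIV. B $ i $ k \<otimes>\<^bsub>A\<^esub> C $ k $ j),
     one = (\<chi> i j. if i = j then \<one>\<^bsub>A\<^esub> else \<zero>\<^bsub>A\<^esub>),
     zero = (\<chi> i j. \<zero>\<^bsub>A\<^esub>),
     add = (\<lambda>B C. \<chi> i j. B $ i $ j \<oplus>\<^bsub>A\<^esub> C $ i $ j),
     smult = (\<lambda>c B. \<chi> i j. c \<odot>\<^bsub>A\<^esub> B $ i $ j)\<rparr>"

definition regular :: "('k, 'a) module \<Rightarrow> ('a, 'a) module" where
  "regular A = \<lparr>carrier = carrier A, monoid.mult = monoid.mult A, one = one A, zero = zero A, add = add A,
    smult = monoid.mult A\<rparr>"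

text \<open>
  A quantifier over all of \<open>A\<close>-mod has to range over a fixed type of carriers. We use modules whose
  elements are of type \<open>nat \<Rightarrow> 'k\<close>: this type contains every \<open>K\<^sup>n\<close>, so that every finitely generated
  module over a finite-dimensional \<open>K\<close>-algebra has an isomorphic copy there
  (lemma \<open>fg_module_has_copy\<close> below).
\<close>

type_synonym ('k, 'a) std_module = "('a, nat \<Rightarrow> 'k) module"

subsection \<open>Projective and injective modules in \<open>A\<close>-mod\<close>

definition projective :: "('k, 'a) module \<Rightarrow> ('a, 'm) module \<Rightarrow> bool" where
  "projective A P \<longleftrightarrow> fg_module A P \<and>
    (\<forall>(U :: ('k, 'a) std_module) (V :: ('k, 'a) std_module). fg_module A U \<longrightarrow> fg_module A V \<longrightarrow>
      (\<forall>g\<in>mod_hom A U V. g ` carrier U = carrier V \<longrightarrow>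
        (\<forall>f\<in>mod_hom A P V. \<exists>h\<in>mod_hom A P U. f = compose (carrier P) g h)))"

definition injective :: "('k, 'a) module \<Rightarrow> ('a, 'm) module \<Rightarrow> bool" where
  "injective A I \<longleftrightarrow> fg_module A I \<and>
    (\<forall>(U :: ('k, 'a) std_module) (V :: ('k, 'a) std_module). fg_module A U \<longrightarrow> fg_module A V \<longrightarrow>
      (\<forall>g\<in>mod_hom A U V. inj_on g (carrier U) \<longrightarrow>
        (\<forall>f\<in>mod_hom A U I. \<exists>h\<in>mod_hom A V I. f = compose (carrier U) h g)))"

text \<open>An injective coresolution \<open>0 \<rightarrow> M \<rightarrow> I 0 \<rightarrow> \<dots> \<rightarrow> I n \<rightarrow> 0\<close>, continued by zero modules.\<close>

definition inj_coresolution ::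
  "('k, 'a) module \<Rightarrow> ('a, 'm) module \<Rightarrow> nat \<Rightarrow> ('m \<Rightarrow> nat \<Rightarrow> 'k) \<Rightarrow> (nat \<Rightarrow> ('k, 'a) std_module) \<Rightarrow>
    (nat \<Rightarrow> (nat \<Rightarrow> 'k) \<Rightarrow> nat \<Rightarrow> 'k) \<Rightarrow> bool"
  where "inj_coresolution A M n e I d \<longleftrightarrow>
    (\<forall>i. injective A (I i)) \<and> (\<forall>i>n. carrier (I i) = {\<zero>\<^bsub>I i\<^esub>}) \<and>
    e \<in> mod_hom A M (I 0) \<and> (\<forall>i. d i \<in> mod_hom A (I i) (I (Suc i))) \<and>
    inj_on e (carrier M) \<and> exact_at M e (I 0) (d 0) (I 1) \<and>
    (\<forall>i. exact_at (I i) (d i) (I (Suc i)) (d (Suc i)) (I (Suc (Suc i))))"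

definition inj_dim :: "('k, 'a) module \<Rightarrow> ('a, 'm) module \<Rightarrow> enat" where
  "inj_dim A M = Inf {enat n | n. \<exists>e I d. inj_coresolution A M n e I d}"

definition gorenstein :: "('k, 'a) module \<Rightarrow> bool" where
  "gorenstein A \<longleftrightarrow> inj_dim A (regular A) < \<infinity> \<and> inj_dim (opp A) (regular (opp A)) < \<infinity>"

subsection \<open>The functor \<open>Hom\<^sub>A(-, A)\<close> and Gorenstein projective modules\<close>

text \<open>\<open>Hom\<^sub>A(M, A)\<close> as a module over the opposite algebra: \<open>A\<close> acts on the right by \<open>(f a) x = f x a\<close>.\<close>

definition hom_dual :: "('k, 'a) module \<Rightarrow> ('a, 'm) module \<Rightarrow> ('a, 'm \<Rightarrow> 'a) module" where
  "hom_dual A M =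
    \<lparr>carrier = mod_hom A M (regular A), monoid.mult = undefined, one = undefined,
     zero = (\<lambda>x\<in>carrier M. \<zero>\<^bsub>A\<^esub>), add = (\<lambda>f g. \<lambda>x\<in>carrier M. f x \<oplus>\<^bsub>A\<^esub> g x),
     smult = (\<lambda>a f. \<lambda>x\<in>carrier M. f x \<otimes>\<^bsub>A\<^esub> a)\<rparr>"

text \<open>The map \<open>Hom\<^sub>A(N, A) \<rightarrow> Hom\<^sub>A(M, A)\<close> induced by \<open>f : M \<rightarrow> N\<close>.\<close>

definition hom_dual_map ::
  "('k, 'a) module \<Rightarrow> ('a, 'm) module \<Rightarrow> ('m \<Rightarrow> 'n) \<Rightarrow> ('a, 'n) module \<Rightarrow> ('n \<Rightarrow> 'a) \<Rightarrow> 'm \<Rightarrow> 'a"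
  where "hom_dual_map A M f N =
    (\<lambda>h\<in>carrier (hom_dual A N). compose (carrier M) h f)"

definition gorenstein_projective :: "('k, 'a) module \<Rightarrow> ('a, 'm) module \<Rightarrow> bool" where
  "gorenstein_projective A M \<longleftrightarrow> fg_module A M \<and>
    (\<exists>(P :: int \<Rightarrow> ('k, 'a) std_module) d.
      (\<forall>i. projective A (P i)) \<and>
      (\<forall>i. d i \<in> mod_hom A (P i) (P (i + 1))) \<and>
      (\<forall>i. exact_at (P (i - 1)) (d (i - 1)) (P i) (d i) (P (i + 1))) \<and>
      (\<forall>i. exact_at (hom_dual A (P (i + 1))) (hom_dual_map A (P i) (d i) (P (i + 1)))
              (hom_dual A (P i)) (hom_dual_map A (P (i - 1)) (d (i - 1)) (P i))
              (hom_dual A (P (i - 1)))) \<and>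
      mod_iso A M ((P 0)\<lparr>carrier := d (-1) ` carrier (P (-1))\<rparr>))"

subsection \<open>The Auslander-Reiten translation\<close>

text \<open>
  A projective cover is an epimorphism from a projective module which is essential, i.e. which maps
  no proper submodule onto its target.
\<close>

definition projective_cover ::
  "('k, 'a) module \<Rightarrow> ('a, 'p) module \<Rightarrow> ('p \<Rightarrow> 'm) \<Rightarrow> ('a, 'm) module \<Rightarrow> bool"
  where "projective_cover A P g M \<longleftrightarrow>
    projective A P \<and> g \<in> mod_hom A P M \<and> g ` carrier P = carrier M \<and>
    (\<forall>N. submodule N A P \<and> g ` N = carrier M \<longrightarrow> N = carrier P)"

text \<open>\<open>P1 \<rightarrow> P0 \<rightarrow> M \<rightarrow> 0\<close> with maps \<open>f\<close> and \<open>g\<close>.\<close>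

definition min_proj_presentation ::
  "('k, 'a) module \<Rightarrow> ('a, 'q) module \<Rightarrow> ('q \<Rightarrow> 'p) \<Rightarrow> ('a, 'p) module \<Rightarrow> ('p \<Rightarrow> 'm) \<Rightarrow>
    ('a, 'm) module \<Rightarrow> bool"
  where "min_proj_presentation A P1 f P0 g M \<longleftrightarrow>
    projective_cover A P0 g M \<and>
    projective_cover A P1 f (P0\<lparr>carrier := a_kernel P0 M g\<rparr>)"

text \<open>
  The transpose computed from \<open>f : P1 \<rightarrow> P0\<close>: the cokernel of
  \<open>Hom\<^sub>A(P0, A) \<rightarrow> Hom\<^sub>A(P1, A)\<close>, a module over the opposite algebra.
\<close>

definition transpose_of ::
  "('k, 'a) module \<Rightarrow> ('a, 'q) module \<Rightarrow> ('q \<Rightarrow> 'p) \<Rightarrow> ('a, 'p) module \<Rightarrow> ('a, ('q \<Rightarrow> 'a) set) module"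
  where "transpose_of A P1 f P0 =
    quot_mod (hom_dual A P1) (hom_dual_map A P1 f P0 ` carrier (hom_dual A P0))"

text \<open>
  The duality \<open>D = Hom\<^sub>K(-, K)\<close>, applied to a module \<open>U\<close> over the opposite algebra of \<open>A\<close>; the result
  is an \<open>A\<close>-module. A scalar \<open>c\<close> acts on \<open>U\<close> through the element \<open>c \<one>\<close> of the algebra.
\<close>

definition k_dual :: "'k ring \<Rightarrow> ('k, 'a) module \<Rightarrow> ('a, 'm) module \<Rightarrow> ('a, 'm \<Rightarrow> 'k) module" where
  "k_dual K A U =
    \<lparr>carrier = {\<phi> \<in> carrier U \<rightarrow>\<^sub>E carrier K.
       (\<forall>x\<in>carrier U. \<forall>y\<in>carrier U. \<phi> (x \<oplus>\<^bsub>U\<^esub> y) = \<phi> x \<oplus>\<^bsub>K\<^esub> \<phi> y) \<and>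
       (\<forall>c\<in>carrier K. \<forall>x\<in>carrier U. \<phi> ((c \<odot>\<^bsub>A\<^esub> \<one>\<^bsub>A\<^esub>) \<odot>\<^bsub>U\<^esub> x) = c \<otimes>\<^bsub>K\<^esub> \<phi> x)},
     monoid.mult = undefined, one = undefined,
     zero = (\<lambda>x\<in>carrier U. \<zero>\<^bsub>K\<^esub>), add = (\<lambda>\<phi> \<psi>. \<lambda>x\<in>carrier U. \<phi> x \<oplus>\<^bsub>K\<^esub> \<psi> x),
     smult = (\<lambda>a \<phi>. \<lambda>x\<in>carrier U. \<phi> (a \<odot>\<^bsub>U\<^esub> x))\<rparr>"

text \<open>
  \<open>\<tau> M = D Tr M\<close>. Minimal projective presentations are unique up to isomorphism, so the
  isomorphism class of \<open>\<tau> M\<close> does not depend on the one chosen here.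
\<close>

definition ar_translate ::
  "'k ring \<Rightarrow> ('k, 'a) module \<Rightarrow> ('a, 'm) module \<Rightarrow> ('a, ((nat \<Rightarrow> 'k) \<Rightarrow> 'a) set \<Rightarrow> 'k) module"
  where "ar_translate K A M =
    (let (P1, f, P0) =
       (SOME (P1 :: ('k, 'a) std_module, f, P0 :: ('k, 'a) std_module).
          \<exists>g. min_proj_presentation A P1 f P0 g M)
     in k_dual K A (transpose_of A P1 f P0))"

definition tau_rigid :: "'k ring \<Rightarrow> ('k, 'a) module \<Rightarrow> ('a, 'm) module \<Rightarrow> bool" where
  "tau_rigid K A M \<longleftrightarrow> fg_module A M \<and>
    mod_hom A M (ar_translate K A M) = {\<lambda>x\<in>carrier M. \<zero>\<^bsub>ar_translate K A M\<^esub>}"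

definition cm_tau_tilting_free :: "'k ring \<Rightarrow> ('k, 'a) module \<Rightarrow> bool" where
  "cm_tau_tilting_free K A \<longleftrightarrow>
    (\<forall>M :: ('k, 'a) std_module. gorenstein_projective A M \<and> tau_rigid K A M \<longrightarrow> projective A M)"

section \<open>Every finitely generated module has a copy with elements of type \<open>nat \<Rightarrow> 'k\<close>\<close>

lemma left_module_transport:
  assumes M: "left_module R (M :: ('r, 'm) module)" and b: "inj_on \<phi> (carrier M)"
  defines "g \<equiv> inv_into (carrier M) \<phi>"
  defines "N \<equiv> \<lparr>carrier = \<phi> ` carrier M, monoid.mult = undefined, one = undefined,
     zero = \<phi> \<zero>\<^bsub>M\<^esub>, add = (\<lambda>x y. \<phi> (g x \<oplus>\<^bsub>M\<^esub> g y)), smult = (\<lambda>a x. \<phi> (a \<odot>\<^bsub>M\<^esub> g x))\<rparr>"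
  shows "left_module R N" "restrict \<phi> (carrier M) \<in> mod_hom R M N"
proof -
  interpret left_module R M by fact
  have g[simp]: "g (\<phi> x) = x" if "x \<in> carrier M" for x
    using that b by (simp add: g_def)
  have ag: "abelian_group N"
  proof (rule abelian_groupI)
    fix x assume "x \<in> carrier N"
    then obtain u where u: "u \<in> carrier M" "x = \<phi> u" by (auto simp: N_def)
    then show "\<exists>y\<in>carrier N. y \<oplus>\<^bsub>N\<^esub> x = \<zero>\<^bsub>N\<^esub>"
      by (intro bexI[of _ "\<phi> (\<ominus>\<^bsub>M\<^esub> u)"]) (auto simp: N_def M.l_neg)
  qed (auto simp: N_def M.a_ac)
  show "left_module R N"
    by (intro left_module.intro left_module_axioms.intro ag R.ring_axioms)
      (auto simp: N_def smult_closed smult_l_distr smult_r_distr smult_assoc smult_one)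
  show "restrict \<phi> (carrier M) \<in> mod_hom R M N"
    by (auto simp: mod_hom_def N_def smult_closed)
qed

lemma fin_gen_image:
  assumes M: "left_module R M" "fin_gen R M" and N: "left_module R N"
    and f: "f \<in> mod_hom R M N" "f ` carrier M = carrier N"
  shows "fin_gen R N"
proof -
  interpret M: left_module R M by fact
  interpret N: left_module R N by fact
  have fc: "\<And>x. x \<in> carrier M \<Longrightarrow> f x \<in> carrier N"
    and fa: "\<And>x y. x \<in> carrier M \<Longrightarrow> y \<in> carrier M \<Longrightarrow> f (x \<oplus>\<^bsub>M\<^esub> y) = f x \<oplus>\<^bsub>N\<^esub> f y"
    and fs: "\<And>a x. a \<in> carrier R \<Longrightarrow> x \<in> carrier M \<Longrightarrow> f (a \<odot>\<^bsub>M\<^esub> x) = a \<odot>\<^bsub>N\<^esub> f x"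
    using f(1) by (auto simp: mod_hom_def)
  have gh: "group_hom (add_monoid M) (add_monoid N) f"
    using fc fa M.M.a_group N.M.a_group
    by (auto simp: group_hom_def group_hom_axioms_def hom_def)
  obtain S where S: "finite S" "S \<subseteq> carrier M" "\<And>L. submodule L R M \<Longrightarrow> S \<subseteq> L \<Longrightarrow> L = carrier M"
    using M(2) unfolding fin_gen_def by blast
  have "L = carrier N" if L: "submodule L R N" "f ` S \<subseteq> L" for L
  proof -
    interpret L: submodule L R N by fact
    let ?L = "{x \<in> carrier M. f x \<in> L}"
    have "submodule ?L R M"
    proof (intro submodule.intro submodule_axioms.intro subgroup.intro)
      show "?L \<subseteq> carrier (add_monoid M)" by auto
      show "\<one>\<^bsub>add_monoid M\<^esub> \<in> ?L"
        using group_hom.hom_one[OF gh] L.one_closed by simp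
      show "inv\<^bsub>add_monoid M\<^esub> x \<in> ?L" if "x \<in> ?L" for x
        using that group_hom.hom_inv[OF gh, of x] L.m_inv_closed[of "f x"] 
          group.inv_closed[OF M.M.a_group, of x] by simp
      show "x \<otimes>\<^bsub>add_monoid M\<^esub> y \<in> ?L" if xL: "x \<in> ?L" and yL: "y \<in> ?L" for x y
        using that L.m_closed[of "f x" "f y"] by (simp add: fa)
      show "a \<odot>\<^bsub>M\<^esub> x \<in> ?L" if "a \<in> carrier R" "x \<in> ?L" for a x
        using that by (simp add: fs M.smult_closed)
    qed
    then have "?L = carrier M" using S(2) L(2) by (intro S(3)) auto
    then have "f ` carrier M \<subseteq> L" by blast
    then show ?thesis using f(2) L.subset by auto
  qed
  then show ?thesis unfolding fin_gen_def using S(1,2) fc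
    by (intro exI[of _ "f ` S"]) auto
qed


lemma fin_gen_combination:
  fixes R (structure) and M (structure)
  assumes M: "left_module R M" "fin_gen R M"
  shows "\<exists>S. finite S \<and> S \<subseteq> carrier M \<and>
    (\<forall>x\<in>carrier M. \<exists>a\<in>S \<rightarrow> carrier R. x = (\<Oplus>\<^bsub>M\<^esub>s\<in>S. a s \<odot>\<^bsub>M\<^esub> s))"
proof -
  interpret left_module R M by fact
  obtain S where S: "finite S" "S \<subseteq> carrier M" "\<And>L. submodule L R M \<Longrightarrow> S \<subseteq> L \<Longrightarrow> L = carrier M"
    using M(2) unfolding fin_gen_def by blast
  let ?c = "\<lambda>a. \<Oplus>\<^bsub>M\<^esub>s\<in>S. a s \<odot>\<^bsub>M\<^esub> s"
  let ?L = "?c ` (S \<rightarrow> carrier R)"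
  have cl: "(\<lambda>s. a s \<odot>\<^bsub>M\<^esub> s) \<in> S \<rightarrow> carrier M" if "a \<in> S \<rightarrow> carrier R" for a
    using that S(2) by (auto intro!: smult_closed)
  have fc: "?c a \<in> carrier M" if "a \<in> S \<rightarrow> carrier R" for a
    using cl[OF that] by (rule M.finsum_closed)
  have SM: "s \<in> carrier M" if "s \<in> S" for s using that S(2) by blast
  have z: "\<zero> \<odot>\<^bsub>M\<^esub> x = \<zero>\<^bsub>M\<^esub>" if "x \<in> carrier M" for x
  proof -
    have "\<zero> \<odot>\<^bsub>M\<^esub> x \<oplus>\<^bsub>M\<^esub> \<zero> \<odot>\<^bsub>M\<^esub> x = \<zero> \<odot>\<^bsub>M\<^esub> x"
      using smult_l_distr[of \<zero> \<zero> x] that by simp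
    then show ?thesis using that smult_closed[of \<zero> x] by simp
  qed
  have zr: "b \<odot>\<^bsub>M\<^esub> \<zero>\<^bsub>M\<^esub> = \<zero>\<^bsub>M\<^esub>" if "b \<in> carrier R" for b
  proof -
    have "b \<odot>\<^bsub>M\<^esub> \<zero>\<^bsub>M\<^esub> \<oplus>\<^bsub>M\<^esub> b \<odot>\<^bsub>M\<^esub> \<zero>\<^bsub>M\<^esub> = b \<odot>\<^bsub>M\<^esub> \<zero>\<^bsub>M\<^esub>"
      using smult_r_distr[of b "\<zero>\<^bsub>M\<^esub>" "\<zero>\<^bsub>M\<^esub>"] that by simp
    then show ?thesis using that smult_closed[of b "\<zero>\<^bsub>M\<^esub>"] by simp
  qed
  have sc: "b \<odot>\<^bsub>M\<^esub> finsum M f F = (\<Oplus>\<^bsub>M\<^esub>s\<in>F. b \<odot>\<^bsub>M\<^esub> f s)"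
    if "finite F" "b \<in> carrier R" "f \<in> F \<rightarrow> carrier M" for b f F
    using that(1,3)
  proof (induction F)
    case empty then show ?case using that by (simp add: zr)
  next
    case (insert x F)
    then have "f x \<in> carrier M" "f \<in> F \<rightarrow> carrier M" by auto
    moreover have "(\<lambda>s. b \<odot>\<^bsub>M\<^esub> f s) \<in> F \<rightarrow> carrier M" 
      using insert(4) that(2) by (auto intro!: smult_closed)
    ultimately show ?case using insert that(2) by (simp add: smult_r_distr smult_closed)
  qed
  have mem: "s \<in> ?L" if "s \<in> S" for s
  proof
    let ?a = "\<lambda>t. if t = s then \<one> else \<zero>"
    have "?c ?a = (\<Oplus>\<^bsub>M\<^esub>t\<in>S. if s = t then t else \<zero>\<^bsub>M\<^esub>)"
      using S(2) by (intro M.finsum_cong') (auto simp: z smult_one)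
    also have "\<dots> = s" using that S by (intro M.finsum_singleton) auto
    finally show "s = ?c ?a" ..
    show "?a \<in> S \<rightarrow> carrier R" by auto
  qed
  have "submodule ?L R M"
  proof (intro submodule.intro submodule_axioms.intro group.subgroupI)
    show "group (add_monoid M)" by (rule M.a_group)
    show "?L \<subseteq> carrier (add_monoid M)" using fc by auto
    show "?L \<noteq> {}" using R.zero_closed by (auto simp: Pi_eq_empty)
    show sm: "b \<odot>\<^bsub>M\<^esub> x \<in> ?L" if "b \<in> carrier R" and xL: "x \<in> ?L" for b x
    proof -
      obtain a where a2: "x = ?c a" and a1: "a \<in> S \<rightarrow> carrier R" using xL by (rule imageE)
      note a = a1 a2
      have "b \<odot>\<^bsub>M\<^esub> x = (\<Oplus>\<^bsub>M\<^esub>s\<in>S. b \<odot>\<^bsub>M\<^esub> (a s \<odot>\<^bsub>M\<^esub> s))"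
        unfolding a using sc[OF S(1) that(1) cl[OF a(1)]] .
      also have "\<dots> = ?c (\<lambda>s. b \<otimes> a s)"
      proof (rule M.finsum_cong'[OF refl])
        show "(\<lambda>s. (b \<otimes> a s) \<odot>\<^bsub>M\<^esub> s) \<in> S \<rightarrow> carrier M"
          using a(1) that(1) by (intro cl) auto
        show "b \<odot>\<^bsub>M\<^esub> (a s \<odot>\<^bsub>M\<^esub> s) = (b \<otimes> a s) \<odot>\<^bsub>M\<^esub> s" if "s \<in> S" for s
          using SM[OF that] \<open>b \<in> carrier R\<close> funcset_mem[OF a(1) that] by (simp add: smult_assoc)
      qed
      finally show ?thesis using a(1) that(1)
        by (intro image_eqI[of _ ?c "\<lambda>s. b \<otimes> a s"]) auto
    qed
    show "x \<otimes>\<^bsub>add_monoid M\<^esub> y \<in> ?L" if xL: "x \<in> ?L" and yL: "y \<in> ?L" for x y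
    proof -
      obtain a where a2: "x = ?c a" and a1: "a \<in> S \<rightarrow> carrier R" using xL by (rule imageE)
      note a = a1 a2
      obtain b where b2: "y = ?c b" and b1: "b \<in> S \<rightarrow> carrier R" using yL by (rule imageE)
      note b = b1 b2
      have "x \<oplus>\<^bsub>M\<^esub> y = (\<Oplus>\<^bsub>M\<^esub>s\<in>S. a s \<odot>\<^bsub>M\<^esub> s \<oplus>\<^bsub>M\<^esub> b s \<odot>\<^bsub>M\<^esub> s)"
        unfolding a b using M.finsum_addf[OF cl[OF a(1)] cl[OF b(1)]] by simp
      also have "\<dots> = ?c (\<lambda>s. a s \<oplus> b s)"
      proof (rule M.finsum_cong'[OF refl])
        show "(\<lambda>s. (a s \<oplus> b s) \<odot>\<^bsub>M\<^esub> s) \<in> S \<rightarrow> carrier M"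
          using a(1) b(1) by (intro cl) auto
        show "a s \<odot>\<^bsub>M\<^esub> s \<oplus>\<^bsub>M\<^esub> b s \<odot>\<^bsub>M\<^esub> s = (a s \<oplus> b s) \<odot>\<^bsub>M\<^esub> s" if "s \<in> S" for s
          using SM[OF that] funcset_mem[OF a(1) that] funcset_mem[OF b(1) that]
          by (simp add: smult_l_distr)
      qed
      finally show ?thesis using a(1) b(1)
        by (intro image_eqI[of _ ?c "\<lambda>s. a s \<oplus> b s"]) auto
    qed
    show "inv\<^bsub>add_monoid M\<^esub> x \<in> ?L" if "x \<in> ?L" for x
    proof -
      have x: "x \<in> carrier M" using that by (rule imageE) (use fc in simp)
      have "(\<ominus> \<one>) \<odot>\<^bsub>M\<^esub> x \<oplus>\<^bsub>M\<^esub> x = \<zero>\<^bsub>M\<^esub>"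
        using smult_l_distr[of "\<ominus> \<one>" "\<one>" x] x by (simp add: smult_one R.l_neg z)
      then have "\<ominus>\<^bsub>M\<^esub> x = (\<ominus> \<one>) \<odot>\<^bsub>M\<^esub> x"
        using x by (simp add: M.minus_equality smult_closed)
      then show ?thesis using sm[of "\<ominus> \<one>" x] that by (simp add: a_inv_def)
    qed
  qed
  then have "?L = carrier M" using mem by (intro S(3) subsetI)
  then show ?thesis using S(1,2) by (intro exI[of _ S] conjI ballI) (auto elim!: imageE simp flip: \<open>?L = carrier M\<close>)
qed

lemma (in fd_algebra) left_module_scalars: "left_module K A"
  by (intro left_module.intro left_module_axioms.intro K.ring_axioms A.abelian_group_axioms)
    (auto simp: smult_closed smult_l_distr smult_r_distr smult_assoc1)

lemma (in fd_algebra) fg_module_has_copy: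
  fixes M :: "('a, 'm) module"
  assumes M: "fg_module A M"
  shows "\<exists>N :: ('k, 'a) std_module. fg_module A N \<and> mod_iso A M N"
proof -
  interpret M: left_module A M using M by (simp add: fg_module_def)
  obtain S where S: "finite S" "S \<subseteq> carrier M"
    "\<And>x. x \<in> carrier M \<Longrightarrow> \<exists>a\<in>S \<rightarrow> carrier A. x = (\<Oplus>\<^bsub>M\<^esub>s\<in>S. a s \<odot>\<^bsub>M\<^esub> s)"
    using M fin_gen_combination[of A M] unfolding fg_module_def by blast
  obtain T where T: "finite T" "T \<subseteq> carrier A"
    "\<And>x. x \<in> carrier A \<Longrightarrow> \<exists>a\<in>T \<rightarrow> carrier K. x = (\<Oplus>\<^bsub>A\<^esub>t\<in>T. a t \<odot>\<^bsub>A\<^esub> t)"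
    using fin_gen_combination[OF left_module_scalars finite_dimensional] by blast
  obtain h :: "'m \<times> 'a \<Rightarrow> nat" where h: "inj_on h (S \<times> T)"
    using S(1) T(1) finite_imp_inj_to_nat_seg[of "S \<times> T"] by blast
  let ?dec = "\<lambda>v. \<Oplus>\<^bsub>M\<^esub>s\<in>S. (\<Oplus>\<^bsub>A\<^esub>t\<in>T. v (h (s, t)) \<odot>\<^bsub>A\<^esub> t) \<odot>\<^bsub>M\<^esub> s"
  have dec: "\<exists>v. ?dec v = x" if x: "x \<in> carrier M" for x
  proof -
    obtain a where a: "a \<in> S \<rightarrow> carrier A" "x = (\<Oplus>\<^bsub>M\<^esub>s\<in>S. a s \<odot>\<^bsub>M\<^esub> s)"
      using S(3)[OF x] by blast
    have "\<forall>s\<in>S. \<exists>c\<in>T \<rightarrow> carrier K. a s = (\<Oplus>\<^bsub>A\<^esub>t\<in>T. c t \<odot>\<^bsub>A\<^esub> t)"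
      using T(3) a(1) by blast
    then obtain c where c: "\<And>s. s \<in> S \<Longrightarrow> c s \<in> T \<rightarrow> carrier K"
      "\<And>s. s \<in> S \<Longrightarrow> a s = (\<Oplus>\<^bsub>A\<^esub>t\<in>T. c s t \<odot>\<^bsub>A\<^esub> t)" by metis
    let ?v = "\<lambda>i. case inv_into (S \<times> T) h i of (s, t) \<Rightarrow> c s t"
    have inner: "(\<Oplus>\<^bsub>A\<^esub>t\<in>T. ?v (h (s, t)) \<odot>\<^bsub>A\<^esub> t) = a s" if "s \<in> S" for s
      unfolding c(2)[OF that] using that c(1)[OF that] T(2)
      by (intro A.finsum_cong') (auto simp: h intro!: smult_closed)
    have "?dec ?v = x"
      unfolding a(2) using a(1) S(2)
      by (intro M.finsum_cong') (auto simp: inner intro!: M.smult_closed)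
    then show ?thesis by (rule exI[of _ ?v])
  qed
  define \<phi> where "\<phi> x = (SOME v. ?dec v = x)" for x
  have \<phi>: "?dec (\<phi> x) = x" if "x \<in> carrier M" for x
    using someI_ex[OF dec[OF that]] by (simp add: \<phi>_def)
  have inj: "inj_on \<phi> (carrier M)" using \<phi> by (rule inj_on_inverseI[of _ ?dec])
  let ?g = "inv_into (carrier M) \<phi>"
  define N :: "('k, 'a) std_module" where
    "N = \<lparr>carrier = \<phi> ` carrier M, monoid.mult = undefined, one = undefined,
     zero = \<phi> \<zero>\<^bsub>M\<^esub>, add = (\<lambda>x y. \<phi> (?g x \<oplus>\<^bsub>M\<^esub> ?g y)), smult = (\<lambda>a x. \<phi> (a \<odot>\<^bsub>M\<^esub> ?g x))\<rparr>"
  note N = left_module_transport[OF M.left_module_axioms inj, folded N_def]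
  have im: "restrict \<phi> (carrier M) ` carrier M = carrier N" by (auto simp: N_def)
  have "fin_gen A N"
    using fin_gen_image[OF M.left_module_axioms _ N im] M by (simp add: fg_module_def)
  moreover have "bij_betw (restrict \<phi> (carrier M)) (carrier M) (carrier N)"
    using inj im by (auto simp: bij_betw_def)
  ultimately show ?thesis using N unfolding fg_module_def mod_iso_def by blast
qed

section \<open>The opposite algebra and \<open>T2\<close> are finite-dimensional algebras\<close>

lemma fd_algebra_opp:
  assumes "fd_algebra K A" shows "fd_algebra K (opp A)"
proof -
  interpret fd_algebra K A by fact
  have ag: "abelian_group (opp A)"
    by (rule abelian_groupI) (auto simp: opp_def A.a_ac intro: A.add.inv_closed bexI[of _ "\<ominus>\<^bsub>A\<^esub> x" for x] A.l_neg)
  have "ring (opp A)"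
    by (intro ringI ag monoidI) (auto simp: opp_def A.m_assoc A.l_distr A.r_distr)
  moreover have "Module.module K (opp A)"
    by (intro moduleI ag K.cring_axioms)
      (auto simp: opp_def smult_l_distr smult_r_distr smult_assoc1)
  moreover have "submodule L K (opp A) = submodule L K A" for L
    by (simp add: submodule_def submodule_axioms_def opp_def subgroup_def a_inv_def m_inv_def)
  then have "fin_gen K (opp A)"
    using finite_dimensional by (simp add: fin_gen_def) (simp add: opp_def)
  ultimately show ?thesis
    by (intro fd_algebra.intro fd_algebra_axioms.intro K.field_axioms)
      (auto simp: opp_def smult_mult_left smult_mult_right)
qed

lemma two_cases: "(x :: 2) = 1 \<or> x = 2"
proof (induct x)
  case (of_int z)
  then have "z = 0 \<or> z = 1" by simp linarith
  then show ?case by auto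
qed

lemma fd_algebra_T2:
  assumes "fd_algebra K A" shows "fd_algebra K (T2 A)"
proof -
  interpret fd_algebra K A by fact
  have two: "(\<forall>i. P i) \<longleftrightarrow> P 1 \<and> P 2" for P :: "2 \<Rightarrow> bool"
    by (metis two_cases)
  have sum2: "(\<Oplus>\<^bsub>A\<^esub>k\<in>UNIV. f k) = f 1 \<oplus>\<^bsub>A\<^esub> f 2" if "f 1 \<in> carrier A" "f 2 \<in> carrier A" for f :: "2 \<Rightarrow> 'b"
  proof -
    have u: "(UNIV :: 2 set) = {1, 2}" using two_cases by auto
    show ?thesis unfolding u using that by (subst A.finsum_insert) auto
  qed
  have ag: "abelian_group (T2 A)"
  proof (rule abelian_groupI)
    fix x assume "x \<in> carrier (T2 A)"
    then show "\<exists>y\<in>carrier (T2 A). y \<oplus>\<^bsub>T2 A\<^esub> x = \<zero>\<^bsub>T2 A\<^esub>"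
      by (intro bexI[of _ "\<chi> i j. \<ominus>\<^bsub>A\<^esub> (x $ i $ j)"]) (auto simp: T2_def vec_eq_iff A.l_neg)
  qed (auto simp: T2_def vec_eq_iff A.a_ac)
  have ring: "ring (T2 A)"
    by (intro ringI ag monoidI)
     (auto simp: T2_def vec_eq_iff two sum2 A.m_assoc A.l_distr A.r_distr A.a_ac)
  have mod: "Module.module K (T2 A)"
    by (intro moduleI ag K.cring_axioms)
      (auto simp: T2_def vec_eq_iff smult_l_distr smult_r_distr smult_assoc1)
  interpret T: Module.module K "T2 A" by fact
  define E :: "2 \<Rightarrow> 2 \<Rightarrow> 'b \<Rightarrow> 'b ^ 2 ^ 2" where
    "E i j x = (\<chi> k l. if k = i \<and> l = j then x else \<zero>\<^bsub>A\<^esub>)" for i j x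
  have Ec: "E i j x \<in> carrier (T2 A)" if "x \<in> carrier A" "(i, j) \<noteq> (1, 2)" for i j x
    using that by (auto simp: E_def T2_def)
  obtain S where S: "finite S" "S \<subseteq> carrier A" "\<And>L. submodule L K A \<Longrightarrow> S \<subseteq> L \<Longrightarrow> L = carrier A"
    using finite_dimensional unfolding fin_gen_def by blast
  have "L = carrier (T2 A)" 
    if L: "submodule L K (T2 A)" "E 1 1 ` S \<union> E 2 1 ` S \<union> E 2 2 ` S \<subseteq> L" for L
  proof -
    interpret L: submodule L K "T2 A" by fact
    have Lz: "\<zero>\<^bsub>T2 A\<^esub> \<in> L" and La: "\<And>x y. x \<in> L \<Longrightarrow> y \<in> L \<Longrightarrow> x \<oplus>\<^bsub>T2 A\<^esub> y \<in> L"
      using L.one_closed L.m_closed by auto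
    have *: "E i j x \<in> L" if ij: "(i, j) \<noteq> (1, 2)" "E i j ` S \<subseteq> L" and x: "x \<in> carrier A" for i j x
    proof -
      have "submodule {x \<in> carrier A. E i j x \<in> L} K A"
      proof (rule submoduleI)
        have "E i j \<zero>\<^bsub>A\<^esub> = \<zero>\<^bsub>T2 A\<^esub>" by (simp add: E_def T2_def vec_eq_iff)
        then show "\<zero>\<^bsub>A\<^esub> \<in> {x \<in> carrier A. E i j x \<in> L}" using Lz by simp
        show sm: "c \<odot>\<^bsub>A\<^esub> y \<in> {x \<in> carrier A. E i j x \<in> L}" 
          if "c \<in> carrier K" "y \<in> {x \<in> carrier A. E i j x \<in> L}" for c y
        proof -
          have "E i j (c \<odot>\<^bsub>A\<^esub> y) = c \<odot>\<^bsub>T2 A\<^esub> E i j y"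
            using that by (auto simp: E_def T2_def vec_eq_iff)
          then show ?thesis using that by auto
        qed
        show "\<ominus>\<^bsub>A\<^esub> y \<in> {x \<in> carrier A. E i j x \<in> L}" if "y \<in> {x \<in> carrier A. E i j x \<in> L}" for y
        proof -
          have "\<ominus>\<^bsub>A\<^esub> y = (\<ominus>\<^bsub>K\<^esub> \<one>\<^bsub>K\<^esub>) \<odot>\<^bsub>A\<^esub> y" using that by (simp add: smult_l_minus)
          then show ?thesis using sm[of "\<ominus>\<^bsub>K\<^esub> \<one>\<^bsub>K\<^esub>" y] that by simp
        qed
        show "y \<oplus>\<^bsub>A\<^esub> z \<in> {x \<in> carrier A. E i j x \<in> L}" 
          if "y \<in> {x \<in> carrier A. E i j x \<in> L}" "z \<in> {x \<in> carrier A. E i j x \<in> L}" for y z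
        proof -
          have "E i j (y \<oplus>\<^bsub>A\<^esub> z) = E i j y \<oplus>\<^bsub>T2 A\<^esub> E i j z"
            using that by (auto simp: E_def T2_def vec_eq_iff)
          then show ?thesis using that La by auto
        qed
      qed auto
      then have "{x \<in> carrier A. E i j x \<in> L} = carrier A" using S(2) ij by (intro S(3)) auto
      then show ?thesis using x by blast
    qed
    have "x \<in> L" if x: "x \<in> carrier (T2 A)" for x
    proof -
      have "x = E 1 1 (x $ 1 $ 1) \<oplus>\<^bsub>T2 A\<^esub> (E 2 1 (x $ 2 $ 1) \<oplus>\<^bsub>T2 A\<^esub> E 2 2 (x $ 2 $ 2))"
        using x by (auto simp: E_def T2_def vec_eq_iff two)
      also have "\<dots> \<in> L" using x L(2) by (intro La *) (auto simp: T2_def)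
      finally show ?thesis .
    qed
    then show ?thesis using L.subset by auto
  qed
  then have "fin_gen K (T2 A)" unfolding fin_gen_def using S Ec
    by (intro exI[of _ "E 1 1 ` S \<union> E 2 1 ` S \<union> E 2 2 ` S"]) (auto simp: subset_iff)
  then show ?thesis
    by (intro fd_algebra.intro fd_algebra_axioms.intro K.field_axioms ring mod)
      (auto simp: T2_def vec_eq_iff two sum2 smult_mult_left smult_mult_right smult_r_distr)
qed

end

theory Submission
  imports Defs
begin

text \<open>
  The proof replaces the Auslander-Reiten translation by a property of presentations. For a projective
  presentation \<open>P1 \<rightarrow> P0 \<rightarrow> M \<rightarrow> 0\<close> with first map \<open>f\<close>, an element of \<open>Hom\<^sub>A(M, D Tr M)\<close> is a pairing of \<open>M\<close> and
  \<open>Hom\<^sub>A(P1, A)\<close> with values in \<open>K\<close> that vanishes on the maps factoring through \<open>f\<close>. Since \<open>P1\<close> has a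
  dual basis, such a pairing is a linear form on \<open>Hom\<^sub>A(P1, M)\<close> that vanishes on the image of
  \<open>Hom\<^sub>A(P0, M)\<close>. Hence \<open>M\<close> is \<open>\<tau>\<close>-rigid if and only if every map \<open>P1 \<rightarrow> M\<close> factors through \<open>f\<close>
  (lemmas \<open>tau_rigid_imp\<close> and \<open>tau_rigidI\<close>). By comparison with the minimal presentation, \<open>tau_rigidI\<close>
  holds for an arbitrary presentation with this property. Similarly, Gorenstein projective modules are
  the images in totally acyclic complexes of projective modules. From then on the proof only constructs
  such presentations and complexes.

  For the first claim, let \<open>M\<close> be Gorenstein projective and \<open>\<tau>\<close>-rigid. The left half of a totally
  acyclic complex that defines \<open>M\<close> can be replaced by a minimal projective resolution of \<open>M\<close>
  (\<open>totally_acyclic_minimal\<close>). The \<open>A\<close>-dual of a totally acyclic complex is totally acyclic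
  (\<open>totally_acyclic_dual\<close>), so the transpose \<open>N\<close> of \<open>M\<close> is a Gorenstein projective module over the
  opposite algebra. Rigidity of a presentation \<open>f : P1 \<rightarrow> P0\<close> says that every \<open>u : P1 \<rightarrow> P0\<close> has the form
  \<open>v f + f w\<close>, and this condition passes to the dual map; so \<open>N\<close> is \<open>\<tau>\<close>-rigid. If the opposite
  algebra is CM-\<open>\<tau>\<close>-tilting free, then \<open>N\<close> is projective, the dual of \<open>f\<close> and hence \<open>f\<close> itself
  has a generalized inverse, and \<open>M\<close> is a direct summand of \<open>P0\<close> (\<open>projective_of_opp_free\<close>).

  For the second claim, a module over the triangular matrix algebra is a linear map \<open>X \<rightarrow> Y\<close> of modules
  over \<open>A\<close>. The functor that takes \<open>M\<close> to \<open>0 \<rightarrow> M\<close> preserves totally acyclic complexes and rigid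
  presentations and reflects projectivity, which gives one direction (\<open>cm_tau_tilting_free_of_T2\<close>).
  Conversely, both \<open>X\<close> and the cokernel of \<open>X \<rightarrow> Y\<close> depend functorially on the module, and both functors
  preserve totally acyclic complexes and rigid presentations. So if \<open>X \<rightarrow> Y\<close> is Gorenstein projective and
  \<open>\<tau>\<close>-rigid and \<open>A\<close> is CM-\<open>\<tau>\<close>-tilting free, then \<open>X\<close> and the cokernel are projective. Moreover
  \<open>X \<rightarrow> Y\<close> is injective, because this is so for the projective module that contains it. Therefore
  \<open>X \<rightarrow> Y\<close> is an extension of the projective modules \<open>0 \<rightarrow> Coker(X \<rightarrow> Y)\<close> and \<open>X \<rightarrow> X\<close>, and is projective
  (\<open>cm_tau_tilting_free_T2\<close>).
\<close>

section \<open>Linear maps, submodules and quotients\<close>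

text \<open>
  The elements of \<open>mod_hom\<close> are extensional, which makes composition clumsy. Dropping extensionality
  makes linear maps closed under plain composition.
\<close>

definition lin :: "('r, 'x) ring_scheme \<Rightarrow> ('r, 'm) module \<Rightarrow> ('r, 'n) module \<Rightarrow> ('m \<Rightarrow> 'n) \<Rightarrow> bool"
  where "lin R M N f \<longleftrightarrow> (\<forall>x\<in>carrier M. f x \<in> carrier N) \<and>
    (\<forall>x\<in>carrier M. \<forall>y\<in>carrier M. f (x \<oplus>\<^bsub>M\<^esub> y) = f x \<oplus>\<^bsub>N\<^esub> f y) \<and>
    (\<forall>a\<in>carrier R. \<forall>x\<in>carrier M. f (a \<odot>\<^bsub>M\<^esub> x) = a \<odot>\<^bsub>N\<^esub> f x)"

lemma lin_closed: "lin R M N f \<Longrightarrow> x \<in> carrier M \<Longrightarrow> f x \<in> carrier N"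
  and lin_add: "lin R M N f \<Longrightarrow> x \<in> carrier M \<Longrightarrow> y \<in> carrier M \<Longrightarrow> f (x \<oplus>\<^bsub>M\<^esub> y) = f x \<oplus>\<^bsub>N\<^esub> f y"
  and lin_smult: "lin R M N f \<Longrightarrow> a \<in> carrier R \<Longrightarrow> x \<in> carrier M \<Longrightarrow> f (a \<odot>\<^bsub>M\<^esub> x) = a \<odot>\<^bsub>N\<^esub> f x"
  by (auto simp: lin_def)

lemma linI:
  assumes "\<And>x. x \<in> carrier M \<Longrightarrow> f x \<in> carrier N"
    "\<And>x y. x \<in> carrier M \<Longrightarrow> y \<in> carrier M \<Longrightarrow> f (x \<oplus>\<^bsub>M\<^esub> y) = f x \<oplus>\<^bsub>N\<^esub> f y"
    "\<And>a x. a \<in> carrier R \<Longrightarrow> x \<in> carrier M \<Longrightarrow> f (a \<odot>\<^bsub>M\<^esub> x) = a \<odot>\<^bsub>N\<^esub> f x"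
  shows "lin R M N f"
  using assms by (auto simp: lin_def)

lemma mod_hom_iff_lin: "f \<in> mod_hom R M N \<longleftrightarrow> lin R M N f \<and> f \<in> extensional (carrier M)"
  by (auto simp: mod_hom_def lin_def PiE_def)

lemma lin_cong:
  assumes "left_module R M" "lin R M N f" "\<And>x. x \<in> carrier M \<Longrightarrow> f x = g x"
  shows "lin R M N g"
proof -
  interpret left_module R M by fact
  show ?thesis
    by (rule linI) (use assms(2) in \<open>simp_all add: lin_def smult_closed flip: assms(3)\<close>)
qed

lemma restrict_mod_hom: "left_module R M \<Longrightarrow> lin R M N f \<Longrightarrow> restrict f (carrier M) \<in> mod_hom R M N"
  unfolding mod_hom_iff_lin by (auto intro: lin_cong[of R M N f])

lemma lin_comp: "lin R M N f \<Longrightarrow> lin R N L g \<Longrightarrow> lin R M L (\<lambda>x. g (f x))"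
  by (rule linI) (simp_all add: lin_closed lin_add lin_smult)

lemma lin_id: "lin R M M (\<lambda>x. x)"
  by (rule linI) simp_all

lemma diff_eq_zero_iff:
  assumes "abelian_group M" "x \<in> carrier M" "y \<in> carrier M"
  shows "x \<ominus>\<^bsub>M\<^esub> y = \<zero>\<^bsub>M\<^esub> \<longleftrightarrow> x = y"
proof -
  interpret abelian_group M by fact
  have "x = (x \<ominus>\<^bsub>M\<^esub> y) \<oplus>\<^bsub>M\<^esub> y" using assms(2,3) by (simp add: a_minus_def a_assoc l_neg)
  then show ?thesis using assms(2,3) by (auto simp: a_minus_def r_neg)
qed

lemma smult_zero:
  assumes "left_module R M"
  shows "x \<in> carrier M \<Longrightarrow> \<zero>\<^bsub>R\<^esub> \<odot>\<^bsub>M\<^esub> x = \<zero>\<^bsub>M\<^esub>"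
    and "a \<in> carrier R \<Longrightarrow> a \<odot>\<^bsub>M\<^esub> \<zero>\<^bsub>M\<^esub> = \<zero>\<^bsub>M\<^esub>"
    and "x \<in> carrier M \<Longrightarrow> (\<ominus>\<^bsub>R\<^esub> \<one>\<^bsub>R\<^esub>) \<odot>\<^bsub>M\<^esub> x = \<ominus>\<^bsub>M\<^esub> x"
proof -
  interpret left_module R M by fact
  show z: "\<zero>\<^bsub>R\<^esub> \<odot>\<^bsub>M\<^esub> x = \<zero>\<^bsub>M\<^esub>" if "x \<in> carrier M" for x
  proof -
    have "\<zero>\<^bsub>R\<^esub> \<odot>\<^bsub>M\<^esub> x \<oplus>\<^bsub>M\<^esub> \<zero>\<^bsub>R\<^esub> \<odot>\<^bsub>M\<^esub> x = \<zero>\<^bsub>R\<^esub> \<odot>\<^bsub>M\<^esub> x"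
      using smult_l_distr[of "\<zero>\<^bsub>R\<^esub>" "\<zero>\<^bsub>R\<^esub>" x] that by simp
    then show ?thesis using that smult_closed[of "\<zero>\<^bsub>R\<^esub>" x] by simp
  qed
  show "a \<odot>\<^bsub>M\<^esub> \<zero>\<^bsub>M\<^esub> = \<zero>\<^bsub>M\<^esub>" if "a \<in> carrier R"
  proof -
    have "a \<odot>\<^bsub>M\<^esub> \<zero>\<^bsub>M\<^esub> \<oplus>\<^bsub>M\<^esub> a \<odot>\<^bsub>M\<^esub> \<zero>\<^bsub>M\<^esub> = a \<odot>\<^bsub>M\<^esub> \<zero>\<^bsub>M\<^esub>"
      using smult_r_distr[of a "\<zero>\<^bsub>M\<^esub>" "\<zero>\<^bsub>M\<^esub>"] that by simp
    then show ?thesis using that smult_closed[of a "\<zero>\<^bsub>M\<^esub>"] by simp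
  qed
  show "(\<ominus>\<^bsub>R\<^esub> \<one>\<^bsub>R\<^esub>) \<odot>\<^bsub>M\<^esub> x = \<ominus>\<^bsub>M\<^esub> x" if "x \<in> carrier M"
  proof -
    have "(\<ominus>\<^bsub>R\<^esub> \<one>\<^bsub>R\<^esub>) \<odot>\<^bsub>M\<^esub> x \<oplus>\<^bsub>M\<^esub> x = \<zero>\<^bsub>M\<^esub>"
      using smult_l_distr[of "\<ominus>\<^bsub>R\<^esub> \<one>\<^bsub>R\<^esub>" "\<one>\<^bsub>R\<^esub>" x] that by (simp add: smult_one R.l_neg z)
    then show ?thesis using that smult_closed[of "\<ominus>\<^bsub>R\<^esub> \<one>\<^bsub>R\<^esub>" x] by (simp add: M.minus_equality)
  qed
qed

lemma additive_zero:
  assumes "abelian_group M" "abelian_group N"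
    "\<And>x. x \<in> carrier M \<Longrightarrow> h x \<in> carrier N"
    "\<And>x y. x \<in> carrier M \<Longrightarrow> y \<in> carrier M \<Longrightarrow> h (x \<oplus>\<^bsub>M\<^esub> y) = h x \<oplus>\<^bsub>N\<^esub> h y"
  shows "h \<zero>\<^bsub>M\<^esub> = \<zero>\<^bsub>N\<^esub>"
proof -
  interpret M: abelian_group M by fact
  interpret N: abelian_group N by fact
  have "h \<zero>\<^bsub>M\<^esub> \<oplus>\<^bsub>N\<^esub> h \<zero>\<^bsub>M\<^esub> = h \<zero>\<^bsub>M\<^esub>"
    using assms(4)[of "\<zero>\<^bsub>M\<^esub>" "\<zero>\<^bsub>M\<^esub>"] by simp
  then show ?thesis using assms(3)[of "\<zero>\<^bsub>M\<^esub>"] by simp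
qed

lemma additive_minus:
  assumes "abelian_group M" "abelian_group N"
    "\<And>x. x \<in> carrier M \<Longrightarrow> h x \<in> carrier N"
    "\<And>x y. x \<in> carrier M \<Longrightarrow> y \<in> carrier M \<Longrightarrow> h (x \<oplus>\<^bsub>M\<^esub> y) = h x \<oplus>\<^bsub>N\<^esub> h y"
    "x \<in> carrier M"
  shows "h (\<ominus>\<^bsub>M\<^esub> x) = \<ominus>\<^bsub>N\<^esub> h x"
proof -
  interpret M: abelian_group M by fact
  interpret N: abelian_group N by fact
  have "h (\<ominus>\<^bsub>M\<^esub> x) \<oplus>\<^bsub>N\<^esub> h x = \<zero>\<^bsub>N\<^esub>"
    using assms(4)[of "\<ominus>\<^bsub>M\<^esub> x" x] assms(5) by (simp add: M.l_neg additive_zero[OF assms(1-4)])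
  then show ?thesis using assms(3,5) by (simp add: N.minus_equality)
qed

lemma additive_finsum:
  assumes "abelian_group M" "abelian_group N"
    "\<And>x. x \<in> carrier M \<Longrightarrow> h x \<in> carrier N"
    "\<And>x y. x \<in> carrier M \<Longrightarrow> y \<in> carrier M \<Longrightarrow> h (x \<oplus>\<^bsub>M\<^esub> y) = h x \<oplus>\<^bsub>N\<^esub> h y"
    "finite I" "\<And>i. i \<in> I \<Longrightarrow> g i \<in> carrier M"
  shows "h (\<Oplus>\<^bsub>M\<^esub>i\<in>I. g i) = (\<Oplus>\<^bsub>N\<^esub>i\<in>I. h (g i))"
proof -
  interpret M: abelian_group M by fact
  interpret N: abelian_group N by fact
  show ?thesis using assms(5,6)
  proof (induction I)
    case empty show ?case using additive_zero[OF assms(1-4)] by simp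
  next
    case (insert i I)
    then show ?case
      by (simp add: assms(3,4) Pi_iff)
  qed
qed

lemma finsum_swap:
  assumes "abelian_monoid G" "finite I" "finite J" "\<And>i j. i \<in> I \<Longrightarrow> j \<in> J \<Longrightarrow> f i j \<in> carrier G"
  shows "(\<Oplus>\<^bsub>G\<^esub>i\<in>I. \<Oplus>\<^bsub>G\<^esub>j\<in>J. f i j) = (\<Oplus>\<^bsub>G\<^esub>j\<in>J. \<Oplus>\<^bsub>G\<^esub>i\<in>I. f i j)"
proof -
  interpret abelian_monoid G by fact
  show ?thesis using assms(2,4)
  proof (induction I)
    case empty then show ?case by simp
  next
    case (insert i I)
    have "(\<Oplus>\<^bsub>G\<^esub>j\<in>J. \<Oplus>\<^bsub>G\<^esub>i\<in>insert i I. f i j) = (\<Oplus>\<^bsub>G\<^esub>j\<in>J. f i j \<oplus>\<^bsub>G\<^esub> (\<Oplus>\<^bsub>G\<^esub>i\<in>I. f i j))"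
      using insert by (intro finsum_cong') (auto simp: Pi_iff)
    also have "\<dots> = (\<Oplus>\<^bsub>G\<^esub>j\<in>J. f i j) \<oplus>\<^bsub>G\<^esub> (\<Oplus>\<^bsub>G\<^esub>j\<in>J. \<Oplus>\<^bsub>G\<^esub>i\<in>I. f i j)"
      using insert by (intro finsum_addf) (auto simp: Pi_iff)
    finally show ?case using insert by (simp add: Pi_iff)
  qed
qed

lemma lin_zero:
  assumes "left_module R M" "left_module R N" "lin R M N f" shows "f \<zero>\<^bsub>M\<^esub> = \<zero>\<^bsub>N\<^esub>"
  using assms by (intro additive_zero[of M N]) (auto simp: left_module_def lin_def)

lemma lin_neg:
  assumes "left_module R M" "left_module R N" "lin R M N f" "x \<in> carrier M"
  shows "f (\<ominus>\<^bsub>M\<^esub> x) = \<ominus>\<^bsub>N\<^esub> f x"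
  using assms by (intro additive_minus[of M N]) (auto simp: left_module_def lin_def)

lemma lin_minus:
  assumes "left_module R M" "left_module R N" "lin R M N f" "x \<in> carrier M" "y \<in> carrier M"
  shows "f (x \<ominus>\<^bsub>M\<^esub> y) = f x \<ominus>\<^bsub>N\<^esub> f y"
proof -
  interpret M: left_module R M by fact
  show ?thesis using assms by (simp add: a_minus_def lin_add[OF assms(3)] lin_neg[OF assms(1-3)])
qed

lemma lin_finsum:
  assumes "left_module R M" "left_module R N" "lin R M N f" "finite I" "\<And>i. i \<in> I \<Longrightarrow> g i \<in> carrier M"
  shows "f (\<Oplus>\<^bsub>M\<^esub>i\<in>I. g i) = (\<Oplus>\<^bsub>N\<^esub>i\<in>I. f (g i))"
  using assms by (intro additive_finsum[of M N]) (auto simp: left_module_def lin_def)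

lemma smult_finsum:
  assumes "left_module R M" "finite I" "\<And>i. i \<in> I \<Longrightarrow> g i \<in> carrier M" "a \<in> carrier R"
  shows "a \<odot>\<^bsub>M\<^esub> (\<Oplus>\<^bsub>M\<^esub>i\<in>I. g i) = (\<Oplus>\<^bsub>M\<^esub>i\<in>I. a \<odot>\<^bsub>M\<^esub> g i)"
proof -
  interpret left_module R M by fact
  show ?thesis using assms
    by (intro additive_finsum[of M M]) (auto simp: smult_closed smult_r_distr intro: M.abelian_group_axioms)
qed

lemma smult_minus_right:
  assumes "left_module R M" "x \<in> carrier M" "a \<in> carrier R"
  shows "a \<odot>\<^bsub>M\<^esub> (\<ominus>\<^bsub>M\<^esub> x) = \<ominus>\<^bsub>M\<^esub> (a \<odot>\<^bsub>M\<^esub> x)"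
proof -
  interpret left_module R M by fact
  show ?thesis using assms
    by (intro additive_minus[of M M]) (auto simp: smult_closed smult_r_distr intro: M.abelian_group_axioms)
qed

lemma smult_diff_right:
  assumes "left_module R M" "x \<in> carrier M" "y \<in> carrier M" "a \<in> carrier R"
  shows "a \<odot>\<^bsub>M\<^esub> (x \<ominus>\<^bsub>M\<^esub> y) = a \<odot>\<^bsub>M\<^esub> x \<ominus>\<^bsub>M\<^esub> a \<odot>\<^bsub>M\<^esub> y"
proof -
  interpret left_module R M by fact
  show ?thesis using assms by (simp add: a_minus_def smult_r_distr smult_minus_right)
qed

lemma lin_plus:
  assumes N: "left_module R N" and f: "lin R M N f" and g: "lin R M N g"
  shows "lin R M N (\<lambda>x. f x \<oplus>\<^bsub>N\<^esub> g x)"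
proof -
  interpret left_module R N by fact
  show ?thesis
    by (rule linI) (simp_all add: lin_closed[OF f] lin_closed[OF g] lin_add[OF f] lin_add[OF g]
        lin_smult[OF f] lin_smult[OF g] smult_r_distr M.a_ac)
qed

lemma lin_diff:
  assumes N: "left_module R N" and f: "lin R M N f" and g: "lin R M N g"
  shows "lin R M N (\<lambda>x. f x \<ominus>\<^bsub>N\<^esub> g x)"
proof -
  interpret left_module R N by fact
  have d: "lin R N N (a_inv N)"
    by (rule linI) (simp_all add: smult_minus_right[OF N] M.minus_add)
  show ?thesis unfolding a_minus_def by (intro lin_plus[OF N] f lin_comp[OF g d])
qed

lemma lin_sum:
  assumes N: "left_module R N" and fin: "finite I" and f: "\<And>i. i \<in> I \<Longrightarrow> lin R M N (f i)"
  shows "lin R M N (\<lambda>x. \<Oplus>\<^bsub>N\<^esub>i\<in>I. f i x)"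
proof -
  interpret left_module R N by fact
  have c: "(\<lambda>i. f i x) \<in> I \<rightarrow> carrier N" if "x \<in> carrier M" for x using f that by (auto simp: lin_def)
  show ?thesis
  proof (rule linI)
    show "(\<Oplus>\<^bsub>N\<^esub>i\<in>I. f i x) \<in> carrier N" if "x \<in> carrier M" for x
      using c[OF that] by (rule M.finsum_closed)
    show "(\<Oplus>\<^bsub>N\<^esub>i\<in>I. f i (x \<oplus>\<^bsub>M\<^esub> y)) = (\<Oplus>\<^bsub>N\<^esub>i\<in>I. f i x) \<oplus>\<^bsub>N\<^esub> (\<Oplus>\<^bsub>N\<^esub>i\<in>I. f i y)"
      if "x \<in> carrier M" "y \<in> carrier M" for x y
      unfolding M.finsum_addf[OF c c, OF that, symmetric]
      using c that f by (intro M.finsum_cong') (auto simp: lin_def)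
    show "(\<Oplus>\<^bsub>N\<^esub>i\<in>I. f i (a \<odot>\<^bsub>M\<^esub> x)) = a \<odot>\<^bsub>N\<^esub> (\<Oplus>\<^bsub>N\<^esub>i\<in>I. f i x)"
      if "a \<in> carrier R" "x \<in> carrier M" for a x
    proof -
      have 1: "a \<odot>\<^bsub>N\<^esub> (\<Oplus>\<^bsub>N\<^esub>i\<in>I. f i x) = (\<Oplus>\<^bsub>N\<^esub>i\<in>I. a \<odot>\<^bsub>N\<^esub> f i x)"
        using c[OF that(2)] that by (intro smult_finsum[OF N fin]) auto
      show ?thesis unfolding 1
        using c that f by (intro M.finsum_cong') (auto simp: lin_def smult_closed Pi_iff)
    qed
  qed
qed

lemma submodule_iff:
  assumes "left_module R M"
  shows "submodule N R M \<longleftrightarrow> N \<subseteq> carrier M \<and> \<zero>\<^bsub>M\<^esub> \<in> N \<and> (\<forall>x\<in>N. \<forall>y\<in>N. x \<oplus>\<^bsub>M\<^esub> y \<in> N) \<and>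
    (\<forall>a\<in>carrier R. \<forall>x\<in>N. a \<odot>\<^bsub>M\<^esub> x \<in> N)" (is "_ \<longleftrightarrow> ?r")
proof
  assume "submodule N R M"
  then interpret submodule N R M .
  show ?r using subset one_closed m_closed smult_closed by auto
next
  interpret left_module R M by fact
  assume r: ?r
  have "\<ominus>\<^bsub>M\<^esub> x \<in> N" if "x \<in> N" for x
    using r that smult_zero(3)[OF assms, of x] R.a_inv_closed[OF R.one_closed] by (metis subsetD)
  then show "submodule N R M" using r
    by unfold_locales (auto simp: a_inv_def)
qed

lemma submodule_subset: "submodule N R M \<Longrightarrow> N \<subseteq> carrier M"
  using subgroup.subset[of N "add_monoid M"] by (simp add: submodule_def)

lemma left_module_restr:
  assumes M: "left_module R M" and N: "submodule N R M"
  shows "left_module R (M\<lparr>carrier := N\<rparr>)"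
proof -
  interpret left_module R M by fact
  have s: "N \<subseteq> carrier M" "\<zero>\<^bsub>M\<^esub> \<in> N" "\<And>x y. x \<in> N \<Longrightarrow> y \<in> N \<Longrightarrow> x \<oplus>\<^bsub>M\<^esub> y \<in> N"
    "\<And>a x. a \<in> carrier R \<Longrightarrow> x \<in> N \<Longrightarrow> a \<odot>\<^bsub>M\<^esub> x \<in> N"
    using N submodule_iff[OF M] by auto
  then have c: "\<And>x. x \<in> N \<Longrightarrow> x \<in> carrier M" by blast
  have ag: "abelian_group (M\<lparr>carrier := N\<rparr>)"
  proof (rule abelian_groupI)
    fix x assume x: "x \<in> carrier (M\<lparr>carrier := N\<rparr>)"
    have "\<ominus>\<^bsub>M\<^esub> x \<in> N" using s(4)[of "\<ominus>\<^bsub>R\<^esub> \<one>\<^bsub>R\<^esub>" x] x c smult_zero(3)[OF M, of x] by simp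
    then show "\<exists>y\<in>carrier (M\<lparr>carrier := N\<rparr>). y \<oplus>\<^bsub>M\<lparr>carrier := N\<rparr>\<^esub> x = \<zero>\<^bsub>M\<lparr>carrier := N\<rparr>\<^esub>"
      using x c by (intro bexI[of _ "\<ominus>\<^bsub>M\<^esub> x"]) (auto simp: M.l_neg)
  qed (use s c in \<open>auto simp: M.a_ac\<close>)
  show ?thesis
    by (intro left_module.intro left_module_axioms.intro ag R.ring_axioms)
      (use s c in \<open>auto simp: smult_closed smult_l_distr smult_r_distr smult_assoc smult_one\<close>)
qed

lemma lin_incl: "N \<subseteq> carrier M \<Longrightarrow> lin R (M\<lparr>carrier := N\<rparr>) M (\<lambda>x. x)"
  by (rule linI) auto

lemma lin_restr_dom: "lin R M L f \<Longrightarrow> N \<subseteq> carrier M \<Longrightarrow> lin R (M\<lparr>carrier := N\<rparr>) L f"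
  by (auto simp: lin_def subset_iff)

lemma lin_restr_cod_iff:
  assumes "N \<subseteq> carrier M"
  shows "lin R L (M\<lparr>carrier := N\<rparr>) f \<longleftrightarrow> lin R L M f \<and> f ` carrier L \<subseteq> N"
  using assms by (auto simp: lin_def)

lemma submodule_restr_iff:
  assumes M: "left_module R M" and N: "submodule N R M"
  shows "submodule L R (M\<lparr>carrier := N\<rparr>) \<longleftrightarrow> submodule L R M \<and> L \<subseteq> N"
  using N submodule_iff[OF M, of N] unfolding submodule_iff[OF M, of L] submodule_iff[OF left_module_restr[OF M N]]
  by auto

lemma submodule_image:
  assumes M: "left_module R M" and N: "left_module R N" and f: "lin R M N f" and L: "submodule L R M"
  shows "submodule (f ` L) R N"
proof -
  have s: "L \<subseteq> carrier M" "\<zero>\<^bsub>M\<^esub> \<in> L" "\<And>x y. x \<in> L \<Longrightarrow> y \<in> L \<Longrightarrow> x \<oplus>\<^bsub>M\<^esub> y \<in> L"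
    "\<And>a x. a \<in> carrier R \<Longrightarrow> x \<in> L \<Longrightarrow> a \<odot>\<^bsub>M\<^esub> x \<in> L"
    using L submodule_iff[OF M] by auto
  then have c: "\<And>x. x \<in> L \<Longrightarrow> x \<in> carrier M" by blast
  show ?thesis unfolding submodule_iff[OF N]
    using s c lin_zero[OF M N f] f
    by (auto simp: lin_closed[OF f] simp flip: lin_add[OF f] lin_smult[OF f] intro: rev_image_eqI)
qed

lemma submodule_carrier: "left_module R M \<Longrightarrow> submodule (carrier M) R M"
proof -
  assume M: "left_module R M"
  interpret left_module R M by fact
  show ?thesis by (simp add: submodule_iff[OF M] smult_closed)
qed

lemma submodule_vimage:
  assumes M: "left_module R M" and N: "left_module R N" and f: "lin R M N f" and L: "submodule L R N"
  shows "submodule {x \<in> carrier M. f x \<in> L} R M"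
proof -
  interpret left_module R M by fact
  show ?thesis using L unfolding submodule_iff[OF N] submodule_iff[OF M]
    by (auto simp: lin_zero[OF M N f] lin_add[OF f] lin_smult[OF f] smult_closed)
qed

lemma submodule_zero: 
  assumes M: "left_module R M" shows "submodule {\<zero>\<^bsub>M\<^esub>} R M"
proof -
  interpret left_module R M by fact
  show ?thesis by (simp add: submodule_iff[OF M] smult_zero[OF M])
qed

lemma submodule_add_cyclic:
  assumes M: "left_module R M" and U: "submodule U R M" and x: "x \<in> carrier M"
  shows "submodule {u \<oplus>\<^bsub>M\<^esub> a \<odot>\<^bsub>M\<^esub> x | u a. u \<in> U \<and> a \<in> carrier R} R M" (is "submodule ?L R M")
    and "U \<subseteq> {u \<oplus>\<^bsub>M\<^esub> a \<odot>\<^bsub>M\<^esub> x | u a. u \<in> U \<and> a \<in> carrier R}"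
    and "x \<in> {u \<oplus>\<^bsub>M\<^esub> a \<odot>\<^bsub>M\<^esub> x | u a. u \<in> U \<and> a \<in> carrier R}"
proof -
  interpret M: left_module R M by fact
  have s: "\<zero>\<^bsub>M\<^esub> \<in> U" "\<And>x y. x \<in> U \<Longrightarrow> y \<in> U \<Longrightarrow> x \<oplus>\<^bsub>M\<^esub> y \<in> U"
    "\<And>a x. a \<in> carrier R \<Longrightarrow> x \<in> U \<Longrightarrow> a \<odot>\<^bsub>M\<^esub> x \<in> U" and Uc: "\<And>x. x \<in> U \<Longrightarrow> x \<in> carrier M"
    using U unfolding submodule_iff[OF M] by auto
  show UL: "U \<subseteq> ?L"
  proof
    fix u assume "u \<in> U"
    then show "u \<in> ?L" using Uc x by (intro CollectI exI[of _ u] exI[of _ "\<zero>\<^bsub>R\<^esub>"]) (simp add: smult_zero[OF M])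
  qed
  show "x \<in> ?L" using x s by (intro CollectI exI[of _ "\<zero>\<^bsub>M\<^esub>"] exI[of _ "\<one>\<^bsub>R\<^esub>"]) (simp add: M.smult_one)
  show "submodule ?L R M" unfolding submodule_iff[OF M]
  proof (intro conjI ballI)
    show "?L \<subseteq> carrier M" using Uc x by (auto intro!: M.smult_closed)
    show "\<zero>\<^bsub>M\<^esub> \<in> ?L" using UL s(1) by blast
  next
    fix y z assume "y \<in> ?L" "z \<in> ?L"
    then obtain u a u' a' where y: "y = u \<oplus>\<^bsub>M\<^esub> a \<odot>\<^bsub>M\<^esub> x" "u \<in> U" "a \<in> carrier R"
      and z: "z = u' \<oplus>\<^bsub>M\<^esub> a' \<odot>\<^bsub>M\<^esub> x" "u' \<in> U" "a' \<in> carrier R" by auto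
    have "y \<oplus>\<^bsub>M\<^esub> z = (u \<oplus>\<^bsub>M\<^esub> u') \<oplus>\<^bsub>M\<^esub> (a \<oplus>\<^bsub>R\<^esub> a') \<odot>\<^bsub>M\<^esub> x"
      using y z Uc x by (simp add: M.smult_l_distr M.smult_closed M.M.a_ac)
    then show "y \<oplus>\<^bsub>M\<^esub> z \<in> ?L" using y z s by blast
  next
    fix b y assume b: "b \<in> carrier R" and "y \<in> ?L"
    then obtain u a where y: "y = u \<oplus>\<^bsub>M\<^esub> a \<odot>\<^bsub>M\<^esub> x" "u \<in> U" "a \<in> carrier R" by auto
    have "b \<odot>\<^bsub>M\<^esub> y = b \<odot>\<^bsub>M\<^esub> u \<oplus>\<^bsub>M\<^esub> (b \<otimes>\<^bsub>R\<^esub> a) \<odot>\<^bsub>M\<^esub> x"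
      using y b Uc x by (simp add: M.smult_r_distr M.smult_closed M.smult_assoc)
    then show "b \<odot>\<^bsub>M\<^esub> y \<in> ?L" using y b s by blast
  qed
qed

lemma a_kernel_eq: "a_kernel M N f = {x \<in> carrier M. f x = \<zero>\<^bsub>N\<^esub>}"
  by (auto simp: a_kernel_def kernel_def)

lemma submodule_kernel:
  assumes M: "left_module R M" and N: "left_module R N" and f: "lin R M N f"
  shows "submodule (a_kernel M N f) R M"
  using submodule_vimage[OF M N f submodule_zero[OF N]] by (simp add: a_kernel_eq)

lemma lin_inj_iff:
  assumes M: "left_module R M" and N: "left_module R N" and f: "lin R M N f"
  shows "inj_on f (carrier M) \<longleftrightarrow> (\<forall>x\<in>carrier M. f x = \<zero>\<^bsub>N\<^esub> \<longrightarrow> x = \<zero>\<^bsub>M\<^esub>)"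
proof
  interpret M: left_module R M by fact
  interpret N: left_module R N by fact
  show "inj_on f (carrier M) \<Longrightarrow> \<forall>x\<in>carrier M. f x = \<zero>\<^bsub>N\<^esub> \<longrightarrow> x = \<zero>\<^bsub>M\<^esub>"
    using lin_zero[OF M N f] by (metis inj_onD M.M.zero_closed)
  assume a: "\<forall>x\<in>carrier M. f x = \<zero>\<^bsub>N\<^esub> \<longrightarrow> x = \<zero>\<^bsub>M\<^esub>"
  show "inj_on f (carrier M)"
  proof (rule inj_onI)
    fix x y assume "x \<in> carrier M" "y \<in> carrier M" "f x = f y"
    then have "f (x \<ominus>\<^bsub>M\<^esub> y) = \<zero>\<^bsub>N\<^esub>"
      using lin_minus[OF M N f] lin_closed[OF f] by (simp add: diff_eq_zero_iff[OF N.M.abelian_group_axioms])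
    then have "x \<ominus>\<^bsub>M\<^esub> y = \<zero>\<^bsub>M\<^esub>" using a \<open>x \<in> carrier M\<close> \<open>y \<in> carrier M\<close> by simp
    then show "x = y" using \<open>x \<in> carrier M\<close> \<open>y \<in> carrier M\<close>
      by (simp add: diff_eq_zero_iff[OF M.M.abelian_group_axioms])
  qed
qed

lemma lin_inv:
  assumes M: "left_module R M" and f: "lin R M N f" and i: "inj_on f (carrier M)" 
    and s: "f ` carrier M = carrier N"
  shows "lin R N M (inv_into (carrier M) f)"
proof -
  interpret left_module R M by fact
  have g: "\<And>y. y \<in> carrier N \<Longrightarrow> inv_into (carrier M) f y \<in> carrier M"
    "\<And>y. y \<in> carrier N \<Longrightarrow> f (inv_into (carrier M) f y) = y"
    using s by (auto simp: inv_into_into f_inv_into_f)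
  have e: "inv_into (carrier M) f y = x" if "x \<in> carrier M" "f x = y" for x y
    using i that by auto
  show ?thesis
    by (rule linI) (auto intro!: e simp: g lin_add[OF f] lin_smult[OF f] smult_closed)
qed

subsection \<open>Quotient modules\<close>

locale submod = left_module R M
  for R :: "('r, 'x) ring_scheme" (structure) and M :: "('r, 'm) module" (structure) +
  fixes N assumes submodule: "submodule N R M"
begin

sublocale a: abelian_subgroup N M
  using submodule unfolding submodule_def
  by (intro abelian_subgroupI3 additive_subgroup.intro M.abelian_group_axioms) auto

abbreviation "cls \<equiv> a_r_coset M N"

lemma N_smult: "a \<in> carrier R \<Longrightarrow> x \<in> N \<Longrightarrow> a \<odot>\<^bsub>M\<^esub> x \<in> N"
  using submodule by (simp add: submodule_iff[OF left_module_axioms])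

lemma cls_eq_iff: "x \<in> carrier M \<Longrightarrow> y \<in> carrier M \<Longrightarrow> cls x = cls y \<longleftrightarrow> x \<ominus>\<^bsub>M\<^esub> y \<in> N"
proof
  assume x: "x \<in> carrier M" and y: "y \<in> carrier M"
  show "x \<ominus>\<^bsub>M\<^esub> y \<in> N" if "cls x = cls y"
  proof -
    have "x \<in> cls y" using a.a_rcos_self[OF x] that by simp
    then obtain n where "n \<in> N" "x = n \<oplus>\<^bsub>M\<^esub> y" by (auto simp: a_r_coset_def')
    then show ?thesis using y by (simp add: a_minus_def M.a_assoc M.r_neg)
  qed
  show "cls x = cls y" if "x \<ominus>\<^bsub>M\<^esub> y \<in> N"
  proof -
    have "x = (x \<ominus>\<^bsub>M\<^esub> y) \<oplus>\<^bsub>M\<^esub> y" using x y by (simp add: a_minus_def M.a_assoc M.l_neg)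
    then have "x \<in> cls y" using that by (auto simp: a_r_coset_def')
    then show ?thesis using M.a_repr_independence[OF _ y] submodule by (simp add: submodule_def)
  qed
qed

lemma cls_eq_zero_iff: "x \<in> carrier M \<Longrightarrow> cls x = N \<longleftrightarrow> x \<in> N"
  using M.a_coset_join1 M.a_coset_join2 submodule unfolding submodule_def by blast

lemma quot_carrier: "carrier (quot_mod M N) = cls ` carrier M"
  and quot_zero: "\<zero>\<^bsub>quot_mod M N\<^esub> = N"
  by (auto simp: quot_mod_def A_RCOSETS_def')

lemma quot_add: "x \<in> carrier M \<Longrightarrow> y \<in> carrier M \<Longrightarrow> cls x \<oplus>\<^bsub>quot_mod M N\<^esub> cls y = cls (x \<oplus>\<^bsub>M\<^esub> y)"
  by (simp add: quot_mod_def a.a_rcos_sum)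

lemma quot_smult:
  assumes "a \<in> carrier R" "x \<in> carrier M"
  shows "a \<odot>\<^bsub>quot_mod M N\<^esub> cls x = cls (a \<odot>\<^bsub>M\<^esub> x)"
proof -
  have "cls (a \<odot>\<^bsub>M\<^esub> y) = cls (a \<odot>\<^bsub>M\<^esub> x)" if y: "y \<in> cls x" for y
  proof -
    obtain n where n: "n \<in> N" "y = n \<oplus>\<^bsub>M\<^esub> x" using y by (auto simp: a_r_coset_def')
    have nc: "n \<in> carrier M" using n a.a_subset by blast
    have "a \<odot>\<^bsub>M\<^esub> y \<ominus>\<^bsub>M\<^esub> a \<odot>\<^bsub>M\<^esub> x = a \<odot>\<^bsub>M\<^esub> n"
      using assms nc smult_closed[OF assms] smult_closed[OF assms(1) nc]
      by (simp add: n smult_r_distr a_minus_def M.a_assoc M.r_neg)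
    then show ?thesis using assms nc n(1)
      by (subst cls_eq_iff) (auto simp: n(2) smult_closed N_smult)
  qed
  moreover have "x \<in> cls x" using assms(2) by (rule a.a_rcos_self)
  ultimately have "(\<Union>y\<in>cls x. cls (a \<odot>\<^bsub>M\<^esub> y)) = cls (a \<odot>\<^bsub>M\<^esub> x)" by blast
  then show ?thesis by (simp add: quot_mod_def)
qed

lemma left_module_quot: "left_module R (quot_mod M N)"
proof -
  have z: "cls \<zero>\<^bsub>M\<^esub> = N" using cls_eq_zero_iff[of "\<zero>\<^bsub>M\<^esub>"] by simp
  have zc: "N \<in> cls ` carrier M" using z by (intro image_eqI[of _ _ "\<zero>\<^bsub>M\<^esub>"]) auto
  have za: "N \<oplus>\<^bsub>quot_mod M N\<^esub> cls x = cls x" if "x \<in> carrier M" for x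
    using quot_add[of "\<zero>\<^bsub>M\<^esub>" x] that by (simp only: z) simp
  have ag: "abelian_group (quot_mod M N)"
  proof (rule abelian_groupI)
    fix x assume "x \<in> carrier (quot_mod M N)"
    then obtain u where "u \<in> carrier M" "x = cls u" by (auto simp: quot_carrier)
    then show "\<exists>y\<in>carrier (quot_mod M N). y \<oplus>\<^bsub>quot_mod M N\<^esub> x = \<zero>\<^bsub>quot_mod M N\<^esub>"
      by (intro bexI[of _ "cls (\<ominus>\<^bsub>M\<^esub> u)"]) (auto simp: quot_carrier quot_zero quot_add M.l_neg z)
  qed (auto simp: quot_carrier quot_zero quot_add M.a_ac zc za)
  show ?thesis
    by (intro left_module.intro left_module_axioms.intro ag R.ring_axioms)
      (auto simp: quot_carrier quot_add quot_smult smult_closed smult_l_distr smult_r_distr smult_assoc smult_one)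
qed

lemma lin_cls: "lin R M (quot_mod M N) cls"
  by (rule linI) (simp_all add: quot_carrier quot_add quot_smult)

lemma lin_quot_lift:
  assumes f: "lin R M L f" and L: "left_module R L" and z: "\<And>x. x \<in> N \<Longrightarrow> f x = \<zero>\<^bsub>L\<^esub>"
  shows "\<exists>g. lin R (quot_mod M N) L g \<and> (\<forall>x\<in>carrier M. g (cls x) = f x)"
proof -
  interpret L: left_module R L by fact
  define g where "g C = f (SOME x. x \<in> carrier M \<and> cls x = C)" for C
  have g: "g (cls x) = f x" if x: "x \<in> carrier M" for x
  proof -
    let ?y = "SOME y. y \<in> carrier M \<and> cls y = cls x"
    have y: "?y \<in> carrier M \<and> cls ?y = cls x" by (rule someI[of _ x]) (use x in auto)
    then have "?y \<ominus>\<^bsub>M\<^esub> x \<in> N" using cls_eq_iff x by blast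
    then have "f ?y \<ominus>\<^bsub>L\<^esub> f x = \<zero>\<^bsub>L\<^esub>"
      using z lin_minus[OF left_module_axioms L f, of ?y x] x y by simp
    then show ?thesis
      using lin_closed[OF f] x y by (simp add: g_def diff_eq_zero_iff[OF L.M.abelian_group_axioms])
  qed
  have "lin R (quot_mod M N) L g"
    by (rule linI) (auto simp: quot_carrier quot_add quot_smult g lin_closed[OF f] lin_add[OF f] lin_smult[OF f] smult_closed)
  then show ?thesis using g by blast
qed

end

lemma submodI: "left_module R M \<Longrightarrow> submodule N R M \<Longrightarrow> submod R M N"
  by (simp add: submod_def submod_axioms_def)

lemma fg_moduleD: "fg_module R M \<Longrightarrow> left_module R M"
  by (simp add: fg_module_def)

lemma fg_module_image:
  assumes "fg_module R M" "left_module R N" "lin R M N f" "f ` carrier M = carrier N"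
  shows "fg_module R N"
  using fin_gen_image[of R M N "restrict f (carrier M)"] assms restrict_mod_hom[OF fg_moduleD[OF assms(1)] assms(3)]
  by (simp add: fg_module_def)

section \<open>Finite length\<close>

context fd_algebra
begin

definition scal :: "'k \<Rightarrow> 'a" where "scal c = c \<odot>\<^bsub>A\<^esub> \<one>\<^bsub>A\<^esub>"

lemma scal_closed [simp]: "c \<in> carrier K \<Longrightarrow> scal c \<in> carrier A"
  by (simp add: scal_def)

lemma scal_mult: "c \<in> carrier K \<Longrightarrow> a \<in> carrier A \<Longrightarrow> scal c \<otimes>\<^bsub>A\<^esub> a = c \<odot>\<^bsub>A\<^esub> a"
  and mult_scal: "c \<in> carrier K \<Longrightarrow> a \<in> carrier A \<Longrightarrow> a \<otimes>\<^bsub>A\<^esub> scal c = c \<odot>\<^bsub>A\<^esub> a"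
  by (simp_all add: scal_def smult_mult_left smult_mult_right)

lemma scal_add: "c \<in> carrier K \<Longrightarrow> d \<in> carrier K \<Longrightarrow> scal (c \<oplus>\<^bsub>K\<^esub> d) = scal c \<oplus>\<^bsub>A\<^esub> scal d"
  and scal_scal: "c \<in> carrier K \<Longrightarrow> d \<in> carrier K \<Longrightarrow> scal (c \<otimes>\<^bsub>K\<^esub> d) = scal c \<otimes>\<^bsub>A\<^esub> scal d"
  and scal_one: "scal \<one>\<^bsub>K\<^esub> = \<one>\<^bsub>A\<^esub>"
  and scal_zero: "scal \<zero>\<^bsub>K\<^esub> = \<zero>\<^bsub>A\<^esub>"
  by (simp_all add: scal_def smult_l_distr smult_assoc1 smult_mult_left)

text \<open>
  Lists, rather than sets, of spanning vectors: the successive tails span a flag, along which dimensions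
  can be counted.
\<close>

primrec kspan :: "('a, 'm) module \<Rightarrow> 'm list \<Rightarrow> 'm set" where
  "kspan M [] = {\<zero>\<^bsub>M\<^esub>}"
| "kspan M (v # vs) = {scal c \<odot>\<^bsub>M\<^esub> v \<oplus>\<^bsub>M\<^esub> w | c w. c \<in> carrier K \<and> w \<in> kspan M vs}"

text \<open>
  The number of pivots of a subspace \<open>U\<close> with respect to the flag spanned by the tails of a list,
  that is, its dimension over \<open>K\<close> when the list is a spanning list. It is bounded by the length of
  the list and strictly monotone, so it serves as a length function on submodules.
\<close>

primrec rank :: "('a, 'm) module \<Rightarrow> 'm set \<Rightarrow> 'm list \<Rightarrow> nat" where
  "rank M U [] = 0"
| "rank M U (v # vs) = (if U \<inter> kspan M (v # vs) \<subseteq> kspan M vs then 0 else 1) + rank M U vs"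

lemma rank_mono: "U \<subseteq> U' \<Longrightarrow> rank M U vs \<le> rank M U' vs"
  by (induction vs) (auto split: if_splits)

lemma rank_le: "rank M U vs \<le> length vs"
  by (induction vs) auto

lemma kspan_closed:
  assumes "left_module A M" "set vs \<subseteq> carrier M"
  shows "kspan M vs \<subseteq> carrier M"
proof -
  interpret M: left_module A M by fact
  show ?thesis using assms(2) by (induction vs) (auto intro!: M.M.a_closed M.smult_closed)
qed

lemma kspan_add:
  assumes "left_module A M" "set vs \<subseteq> carrier M" "x \<in> kspan M vs" "y \<in> kspan M vs"
  shows "x \<oplus>\<^bsub>M\<^esub> y \<in> kspan M vs"
proof -
  interpret M: left_module A M by fact
  show ?thesis using assms(2-)
  proof (induction vs arbitrary: x y)
    case Nil then show ?case by simp
  next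
    case (Cons v vs)
    obtain c w where x: "x = scal c \<odot>\<^bsub>M\<^esub> v \<oplus>\<^bsub>M\<^esub> w" "c \<in> carrier K" "w \<in> kspan M vs" using Cons.prems by auto
    obtain d u where y: "y = scal d \<odot>\<^bsub>M\<^esub> v \<oplus>\<^bsub>M\<^esub> u" "d \<in> carrier K" "u \<in> kspan M vs" using Cons.prems by auto
    have c: "v \<in> carrier M" "w \<in> carrier M" "u \<in> carrier M"
      using Cons.prems x y kspan_closed[OF M.left_module_axioms, of vs] by auto
    have "x \<oplus>\<^bsub>M\<^esub> y = scal (c \<oplus>\<^bsub>K\<^esub> d) \<odot>\<^bsub>M\<^esub> v \<oplus>\<^bsub>M\<^esub> (w \<oplus>\<^bsub>M\<^esub> u)"
      using x y c by (simp add: scal_add M.smult_l_distr M.smult_closed M.M.a_ac)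
    moreover have "w \<oplus>\<^bsub>M\<^esub> u \<in> kspan M vs" using Cons x y by auto
    ultimately show ?case using x y by (auto intro!: exI[of _ "c \<oplus>\<^bsub>K\<^esub> d"] exI[of _ "w \<oplus>\<^bsub>M\<^esub> u"])
  qed
qed

lemma kspan_scal:
  assumes "left_module A M" "set vs \<subseteq> carrier M" "x \<in> kspan M vs" "c \<in> carrier K"
  shows "scal c \<odot>\<^bsub>M\<^esub> x \<in> kspan M vs"
proof -
  interpret M: left_module A M by fact
  show ?thesis using assms(2-)
  proof (induction vs arbitrary: x)
    case Nil then show ?case by (simp add: smult_zero[OF assms(1)])
  next
    case (Cons v vs)
    obtain d w where x: "x = scal d \<odot>\<^bsub>M\<^esub> v \<oplus>\<^bsub>M\<^esub> w" "d \<in> carrier K" "w \<in> kspan M vs" using Cons.prems by auto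
    have c: "v \<in> carrier M" "w \<in> carrier M"
      using Cons.prems x kspan_closed[OF M.left_module_axioms, of vs] by auto
    have "scal c \<odot>\<^bsub>M\<^esub> x = scal (c \<otimes>\<^bsub>K\<^esub> d) \<odot>\<^bsub>M\<^esub> v \<oplus>\<^bsub>M\<^esub> scal c \<odot>\<^bsub>M\<^esub> w"
      using x c Cons.prems by (simp add: scal_scal M.smult_r_distr M.smult_closed M.smult_assoc)
    moreover have "scal c \<odot>\<^bsub>M\<^esub> w \<in> kspan M vs" using Cons x by auto
    ultimately show ?case using x Cons.prems 
      by (auto intro!: exI[of _ "c \<otimes>\<^bsub>K\<^esub> d"] exI[of _ "scal c \<odot>\<^bsub>M\<^esub> w"])
  qed
qed

lemma kspan_zero: "left_module A M \<Longrightarrow> set vs \<subseteq> carrier M \<Longrightarrow> \<zero>\<^bsub>M\<^esub> \<in> kspan M vs"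
proof (induction vs)
  case (Cons v vs)
  then interpret M: left_module A M by simp
  show ?case using Cons
    by (auto intro!: exI[of _ "\<zero>\<^bsub>K\<^esub>"] exI[of _ "\<zero>\<^bsub>M\<^esub>"] simp: scal_zero smult_zero[OF Cons(2)])
qed auto

lemma kspan_tail:
  assumes "left_module A M" "set (v # vs) \<subseteq> carrier M" "x \<in> kspan M vs"
  shows "x \<in> kspan M (v # vs)"
proof -
  interpret M: left_module A M by fact
  have "x \<in> carrier M" using kspan_closed[OF assms(1), of vs] assms by auto
  then show ?thesis using assms
    by (auto intro!: exI[of _ "\<zero>\<^bsub>K\<^esub>"] exI[of _ x] simp: scal_zero smult_zero[OF assms(1)])
qed

lemma kspan_mem:
  assumes "left_module A M" "set vs \<subseteq> carrier M" "x \<in> set vs"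
  shows "x \<in> kspan M vs"
  using assms(2,3)
proof (induction vs)
  case (Cons v vs)
  interpret M: left_module A M by fact
  show ?case
  proof (cases "x = v")
    case True
    have "v = scal \<one>\<^bsub>K\<^esub> \<odot>\<^bsub>M\<^esub> v \<oplus>\<^bsub>M\<^esub> \<zero>\<^bsub>M\<^esub>"
      using Cons.prems by (simp add: scal_one M.smult_one)
    then show ?thesis using True kspan_zero[OF assms(1), of vs] Cons.prems K.one_closed by auto
  next
    case False
    then have "x \<in> kspan M vs" using Cons by simp
    then show ?thesis using Cons.prems by (intro kspan_tail[OF assms(1)])
  qed
qed simp

text \<open>
  An element of \<open>U'\<close> is moved into the next smaller step of the flag by subtracting a multiple of an
  element of \<open>U\<close> with the same pivot, as in Gaussian elimination.
\<close>

lemma rank_strict: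
  assumes M: "left_module A M" and vs: "set vs \<subseteq> carrier M" and U: "submodule U A M" and U': "submodule U' A M"
    and le: "U \<subseteq> U'" "rank M U' vs \<le> rank M U vs"
  shows "U' \<inter> kspan M vs \<subseteq> U"
  using vs le(2)
proof (induction vs)
  interpret M: left_module A M by fact
  case Nil
  then show ?case using U submodule_iff[OF M] by auto
next
  interpret M: left_module A M by fact
  case (Cons v vs)
  let ?p = "\<lambda>U. U \<inter> kspan M (v # vs) \<subseteq> kspan M vs"
  have m: "rank M U vs \<le> rank M U' vs" using le(1) by (rule rank_mono)
  have pp: "?p U' \<Longrightarrow> ?p U" using le(1) by auto
  have p: "?p U \<longleftrightarrow> ?p U'" and r: "rank M U' vs \<le> rank M U vs"
    using Cons.prems(2) m pp by (auto simp del: kspan.simps split: if_splits)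
  have IH: "U' \<inter> kspan M vs \<subseteq> U" using Cons r by simp
  have sc: "\<And>x y. x \<in> U \<Longrightarrow> y \<in> U \<Longrightarrow> x \<oplus>\<^bsub>M\<^esub> y \<in> U" "\<And>a x. a \<in> carrier A \<Longrightarrow> x \<in> U \<Longrightarrow> a \<odot>\<^bsub>M\<^esub> x \<in> U"
    "\<And>x y. x \<in> U' \<Longrightarrow> y \<in> U' \<Longrightarrow> x \<oplus>\<^bsub>M\<^esub> y \<in> U'" "\<And>a x. a \<in> carrier A \<Longrightarrow> x \<in> U' \<Longrightarrow> a \<odot>\<^bsub>M\<^esub> x \<in> U'"
    "U' \<subseteq> carrier M" 
    using U U' submodule_iff[OF M] by auto
  show ?case
  proof
    fix x assume x: "x \<in> U' \<inter> kspan M (v # vs)"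
    show "x \<in> U"
    proof (cases "?p U'")
      case True then show ?thesis using x IH by blast
    next
      case False
      then obtain u where u: "u \<in> U" "u \<in> kspan M (v # vs)" "u \<notin> kspan M vs" using p by blast
      obtain c w where uc: "u = scal c \<odot>\<^bsub>M\<^esub> v \<oplus>\<^bsub>M\<^esub> w" "c \<in> carrier K" "w \<in> kspan M vs" using u(2) by auto
      obtain d z where xd: "x = scal d \<odot>\<^bsub>M\<^esub> v \<oplus>\<^bsub>M\<^esub> z" "d \<in> carrier K" "z \<in> kspan M vs" using x by auto
      have cl: "v \<in> carrier M" "w \<in> carrier M" "z \<in> carrier M"
        using Cons.prems uc xd kspan_closed[OF M, of vs] by auto
      have "c \<noteq> \<zero>\<^bsub>K\<^esub>" using u(3) uc cl by (auto simp: scal_zero smult_zero[OF M])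
      then have cu: "c \<in> Units K" using uc(2) K.field_Units by simp
      define e where "e = \<ominus>\<^bsub>K\<^esub> (d \<otimes>\<^bsub>K\<^esub> inv\<^bsub>K\<^esub> c)"
      have e: "e \<in> carrier K" using xd cu by (simp add: e_def)
      have ec: "e \<otimes>\<^bsub>K\<^esub> c = \<ominus>\<^bsub>K\<^esub> d" using xd(2) uc(2) cu by (simp add: e_def K.l_minus K.m_assoc)
      \<comment> \<open>The pivot of \<open>u\<close> clears the \<open>v\<close>-component of \<open>x\<close>.\<close>
      have "x \<oplus>\<^bsub>M\<^esub> scal e \<odot>\<^bsub>M\<^esub> u = (scal d \<oplus>\<^bsub>A\<^esub> scal e \<otimes>\<^bsub>A\<^esub> scal c) \<odot>\<^bsub>M\<^esub> v \<oplus>\<^bsub>M\<^esub> (z \<oplus>\<^bsub>M\<^esub> scal e \<odot>\<^bsub>M\<^esub> w)"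
        using uc xd cl e by (simp add: M.smult_l_distr M.smult_r_distr M.smult_assoc M.smult_closed M.M.a_ac)
      also have "scal d \<oplus>\<^bsub>A\<^esub> scal e \<otimes>\<^bsub>A\<^esub> scal c = \<zero>\<^bsub>A\<^esub>"
        using xd(2) e uc(2) by (simp add: scal_zero K.r_neg ec flip: scal_scal scal_add)
      finally have xe: "x \<oplus>\<^bsub>M\<^esub> scal e \<odot>\<^bsub>M\<^esub> u = z \<oplus>\<^bsub>M\<^esub> scal e \<odot>\<^bsub>M\<^esub> w"
        using cl e by (simp add: smult_zero[OF M] M.smult_closed)
      have "z \<oplus>\<^bsub>M\<^esub> scal e \<odot>\<^bsub>M\<^esub> w \<in> kspan M vs"
        using Cons.prems xd uc e by (intro kspan_add[OF M] kspan_scal[OF M]) auto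
      moreover have uU: "u \<in> U'" using u le by auto
      moreover have "x \<oplus>\<^bsub>M\<^esub> scal e \<odot>\<^bsub>M\<^esub> u \<in> U'"
        using x uU e by (intro sc(3) sc(4)) auto
      ultimately have xU: "x \<oplus>\<^bsub>M\<^esub> scal e \<odot>\<^bsub>M\<^esub> u \<in> U" using IH xe by auto
      have xuc: "x \<in> carrier M" "u \<in> carrier M" using x uU sc by auto
      have "x = (x \<oplus>\<^bsub>M\<^esub> scal e \<odot>\<^bsub>M\<^esub> u) \<oplus>\<^bsub>M\<^esub> (\<ominus>\<^bsub>A\<^esub> \<one>\<^bsub>A\<^esub>) \<odot>\<^bsub>M\<^esub> (scal e \<odot>\<^bsub>M\<^esub> u)"
        using xuc e by (simp add: smult_zero[OF M] M.smult_closed M.M.a_assoc M.M.r_neg)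
      also have "\<dots> \<in> U" using u(1) e by (intro sc(1)[OF xU] sc(2)) auto
      finally show ?thesis .
    qed
  qed
qed

text \<open>
  The products of the finitely many generators of the module with a finite spanning set of the algebra.
\<close>

lemma ex_kspan:
  fixes M :: "('a, 'm) module"
  assumes M: "fg_module A M"
  shows "\<exists>vs. set vs \<subseteq> carrier M \<and> kspan M vs = carrier M"
proof -
  have lm: "left_module A M" using M by (rule fg_moduleD)
  interpret M: left_module A M by fact
  obtain S where S: "finite S" "S \<subseteq> carrier M"
    "\<And>x. x \<in> carrier M \<Longrightarrow> \<exists>a\<in>S \<rightarrow> carrier A. x = (\<Oplus>\<^bsub>M\<^esub>s\<in>S. a s \<odot>\<^bsub>M\<^esub> s)"
    using M fin_gen_combination[of A M] unfolding fg_module_def by blast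
  obtain T where T: "finite T" "T \<subseteq> carrier A"
    "\<And>N. submodule N K A \<Longrightarrow> T \<subseteq> N \<Longrightarrow> N = carrier A"
    using finite_dimensional unfolding fin_gen_def by blast
  obtain vs where vs: "set vs = (\<lambda>(s, t). t \<odot>\<^bsub>M\<^esub> s) ` (S \<times> T)"
    using finite_list S(1) T(1) by (metis finite_SigmaI finite_imageI)
  have vc: "set vs \<subseteq> carrier M" unfolding vs using S(2) T(2) by (auto intro!: M.smult_closed)
  let ?W = "kspan M vs"
  have W: "a \<odot>\<^bsub>M\<^esub> s \<in> ?W" if s: "s \<in> S" and a: "a \<in> carrier A" for a s
  proof -
    have sc: "s \<in> carrier M" using s S by auto
    have "submodule {a \<in> carrier A. a \<odot>\<^bsub>M\<^esub> s \<in> ?W} K A"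
      unfolding submodule_iff[OF left_module_scalars]
      using kspan_add[OF lm vc] kspan_scal[OF lm vc] kspan_zero[OF lm vc] sc
      by (auto simp: smult_zero[OF lm] M.smult_l_distr M.smult_assoc simp flip: scal_mult)
    moreover have "T \<subseteq> {a \<in> carrier A. a \<odot>\<^bsub>M\<^esub> s \<in> ?W}"
      using T s kspan_mem[OF lm vc] by (auto simp: vs)
    ultimately show ?thesis using T(3) a by blast
  qed
  have fs: "(\<Oplus>\<^bsub>M\<^esub>s\<in>F. a s \<odot>\<^bsub>M\<^esub> s) \<in> ?W" if "finite F" "F \<subseteq> S" "a \<in> S \<rightarrow> carrier A" for a F
    using that
  proof (induction F)
    case empty then show ?case by (simp add: kspan_zero[OF lm vc])
  next
    case (insert s F)
    then have "(\<lambda>s. a s \<odot>\<^bsub>M\<^esub> s) \<in> F \<rightarrow> carrier M" "a s \<odot>\<^bsub>M\<^esub> s \<in> carrier M"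
      using S(2) by (auto intro!: M.smult_closed)
    then show ?case using insert by (auto intro!: kspan_add[OF lm vc] W)
  qed
  have "carrier M \<subseteq> ?W" using S(3) fs[OF S(1) order.refl] by blast
  then show ?thesis using vc kspan_closed[OF lm vc] by blast
qed

lemma ex_length:
  fixes M :: "('a, 'm) module"
  assumes M: "fg_module A M"
  shows "\<exists>l n. (\<forall>U. l U \<le> (n::nat)) \<and>
    (\<forall>U U'. submodule U A M \<and> submodule U' A M \<and> U \<subseteq> U' \<and> l U' \<le> l U \<longrightarrow> U' = U)"
proof -
  obtain vs where vs: "set vs \<subseteq> carrier M" "kspan M vs = carrier M" using ex_kspan[OF M] by blast
  have *: "U' = U" if U: "submodule U A M" "submodule U' A M" "U \<subseteq> U'" "rank M U' vs \<le> rank M U vs" for U U'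
  proof
    have "U' \<subseteq> kspan M vs" using U(2) submodule_iff[OF fg_moduleD[OF M], of U'] vs(2) by simp
    then show "U' \<subseteq> U" using rank_strict[OF fg_moduleD[OF M] vs(1) U] by blast
  qed (rule U(3))
  show ?thesis
  proof (intro exI conjI allI impI)
    show "rank M U vs \<le> length vs" for U by (rule rank_le)
  qed (elim conjE, rule *)
qed

lemma ex_minimal_submodule:
  fixes M :: "('a, 'm) module"
  assumes M: "fg_module A M" and U: "submodule U A M" "Q U"
  shows "\<exists>N. submodule N A M \<and> Q N \<and> (\<forall>L. submodule L A M \<and> Q L \<and> L \<subseteq> N \<longrightarrow> L = N)"
proof -
  obtain l :: "_ \<Rightarrow> nat" where l: "\<And>U U'. submodule U A M \<and> submodule U' A M \<and> U \<subseteq> U' \<and> l U' \<le> l U \<Longrightarrow> U' = U"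
    using ex_length[OF M] by blast
  obtain N where "submodule N A M \<and> Q N" "\<And>L. submodule L A M \<and> Q L \<Longrightarrow> l N \<le> l L"
    using ex_has_least_nat[of "\<lambda>N. submodule N A M \<and> Q N" U l] U by blast
  then show ?thesis using l by blast
qed

lemma ex_maximal_submodule:
  fixes M :: "('a, 'm) module"
  assumes M: "fg_module A M" and U: "submodule U A M" "Q U"
  shows "\<exists>N. submodule N A M \<and> Q N \<and> (\<forall>L. submodule L A M \<and> Q L \<and> N \<subseteq> L \<longrightarrow> L = N)"
proof -
  obtain l :: "_ \<Rightarrow> nat" and n where n: "\<And>U. l U \<le> n"
    and l: "\<And>U U'. submodule U A M \<and> submodule U' A M \<and> U \<subseteq> U' \<and> l U' \<le> l U \<Longrightarrow> U' = U"
    using ex_length[OF M] by blast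
  obtain N where "submodule N A M \<and> Q N" "\<And>L. submodule L A M \<and> Q L \<Longrightarrow> l L \<le> l N"
    using ex_has_greatest_nat[of "\<lambda>N. submodule N A M \<and> Q N" U l "Suc n"] U n by (auto simp: less_Suc_eq_le)
  then show ?thesis using l by blast
qed

text \<open>
  Fitting's argument: the kernels of the powers of \<open>f\<close> become stationary, and if the kernels of \<open>f\<^sup>n\<close> and
  \<open>f\<^sup>n\<^sup>+\<^sup>1\<close> agree, then \<open>f\<close> is injective on the image of \<open>f\<^sup>n\<close>, which is everything.
\<close>

lemma surj_endo_inj:
  fixes M :: "('a, 'm) module"
  assumes M: "fg_module A M" and f: "lin A M M f" and s: "f ` carrier M = carrier M"
  shows "inj_on f (carrier M)"
proof -
  have lm: "left_module A M" using M by (rule fg_moduleD)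
  interpret M: left_module A M by fact
  have fn: "lin A M M (f ^^ n)" for n
    by (induction n) (auto intro: linI lin_comp[OF _ f, simplified] simp: comp_def)
  have sn: "(f ^^ n) ` carrier M = carrier M" for n
  proof (induction n)
    case (Suc n)
    have "(f ^^ Suc n) ` carrier M = f ` (f ^^ n) ` carrier M" by (simp add: image_comp)
    then show ?case using Suc s by simp
  qed simp
  let ?k = "\<lambda>n. {x \<in> carrier M. (f ^^ n) x = \<zero>\<^bsub>M\<^esub>}"
  have sub: "submodule (?k n) A M" for n
    using submodule_kernel[OF lm lm fn] by (simp add: a_kernel_eq)
  obtain N where N: "submodule N A M" "\<exists>n. N = ?k n"
    and max: "\<And>L. submodule L A M \<and> (\<exists>n. L = ?k n) \<and> N \<subseteq> L \<Longrightarrow> L = N"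
    using ex_maximal_submodule[OF M sub, of "\<lambda>N. \<exists>n. N = ?k n" 0] by blast
  obtain n where n: "N = ?k n" using N(2) by blast
  have "N \<subseteq> ?k (Suc n)" using lin_zero[OF lm lm f] by (auto simp: n)
  then have eq: "?k (Suc n) = ?k n" using max[of "?k (Suc n)"] sub n by blast
  show ?thesis unfolding lin_inj_iff[OF lm lm f]
  proof (intro ballI impI)
    fix x assume x: "x \<in> carrier M" "f x = \<zero>\<^bsub>M\<^esub>"
    obtain y where y: "y \<in> carrier M" "x = (f ^^ n) y" using sn[of n] x by blast
    then have "y \<in> ?k (Suc n)" using x by simp
    then show "x = \<zero>\<^bsub>M\<^esub>" using eq y by auto
  qed
qed

text \<open>
  A maximal finitely generated submodule of \<open>N\<close> contains each element \<open>x\<close> of \<open>N\<close>, since it may be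
  enlarged by the multiples of \<open>x\<close>.
\<close>

lemma fg_module_submodule:
  fixes M :: "('a, 'm) module"
  assumes M: "fg_module A M" and N: "submodule N A M"
  shows "fg_module A (M\<lparr>carrier := N\<rparr>)"
proof -
  have lm: "left_module A M" using M by (rule fg_moduleD)
  interpret M: left_module A M by fact
  define Q where "Q U \<longleftrightarrow> U \<subseteq> N \<and> fin_gen A (M\<lparr>carrier := U\<rparr>)" for U
  have "Q {\<zero>\<^bsub>M\<^esub>}" using N unfolding Q_def
    by (auto simp: submodule_iff[OF lm] fin_gen_def submodule_restr_iff[OF lm submodule_zero[OF lm]] intro!: exI[of _ "{}"])
  from ex_maximal_submodule[where Q = Q, OF M submodule_zero[OF lm] this]
  obtain U where U1: "submodule U A M" and QU: "Q U"
    and max: "\<And>L. submodule L A M \<Longrightarrow> Q L \<Longrightarrow> U \<subseteq> L \<Longrightarrow> L = U"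
    by blast
  note U = U1 QU[unfolded Q_def]
  obtain S where S: "finite S" "S \<subseteq> U" "\<And>L. submodule L A (M\<lparr>carrier := U\<rparr>) \<Longrightarrow> S \<subseteq> L \<Longrightarrow> L = U"
    using U(2) unfolding fin_gen_def by auto
  have sU: "\<zero>\<^bsub>M\<^esub> \<in> U" "\<And>x y. x \<in> U \<Longrightarrow> y \<in> U \<Longrightarrow> x \<oplus>\<^bsub>M\<^esub> y \<in> U" "\<And>a x. a \<in> carrier A \<Longrightarrow> x \<in> U \<Longrightarrow> a \<odot>\<^bsub>M\<^esub> x \<in> U"
    and Uc: "\<And>x. x \<in> U \<Longrightarrow> x \<in> carrier M"
    using U(1) submodule_iff[OF lm] by auto
  have sN: "\<And>x y. x \<in> N \<Longrightarrow> y \<in> N \<Longrightarrow> x \<oplus>\<^bsub>M\<^esub> y \<in> N" "\<And>a x. a \<in> carrier A \<Longrightarrow> x \<in> N \<Longrightarrow> a \<odot>\<^bsub>M\<^esub> x \<in> N"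
    "N \<subseteq> carrier M" using N submodule_iff[OF lm] by auto
  have "x \<in> U" if x: "x \<in> N" for x
  proof -
    have xc: "x \<in> carrier M" using x sN by auto
    let ?L = "{u \<oplus>\<^bsub>M\<^esub> a \<odot>\<^bsub>M\<^esub> x | u a. u \<in> U \<and> a \<in> carrier A}"
    note L = submodule_add_cyclic(1)[OF lm U(1) xc] and UL = submodule_add_cyclic(2)[OF lm U(1) xc]
      and xL = submodule_add_cyclic(3)[OF lm U(1) xc]
    have LN: "?L \<subseteq> N" using U(2) x sN(1,2) by blast
    have "V = ?L" if V: "submodule V A (M\<lparr>carrier := ?L\<rparr>)" "insert x S \<subseteq> V" for V
    proof -
      have V': "submodule V A M" "V \<subseteq> ?L" using V(1) submodule_restr_iff[OF lm L] by auto
      have sV: "\<zero>\<^bsub>M\<^esub> \<in> V" "\<And>x y. x \<in> V \<Longrightarrow> y \<in> V \<Longrightarrow> x \<oplus>\<^bsub>M\<^esub> y \<in> V" "\<And>a x. a \<in> carrier A \<Longrightarrow> x \<in> V \<Longrightarrow> a \<odot>\<^bsub>M\<^esub> x \<in> V"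
        using V'(1) submodule_iff[OF lm] by auto
      have "submodule (V \<inter> U) A (M\<lparr>carrier := U\<rparr>)"
        unfolding submodule_restr_iff[OF lm U(1)] submodule_iff[OF lm] using sV sU Uc by auto
      then have "U \<subseteq> V" using S(3)[of "V \<inter> U"] S(2) V(2) by auto
      then show ?thesis using V'(2) V(2) sV by auto
    qed
    then have "fin_gen A (M\<lparr>carrier := ?L\<rparr>)"
      unfolding fin_gen_def using S(1,2) UL xL by (intro exI[of _ "insert x S"]) auto
    then have "?L = U" using max[OF L] LN UL unfolding Q_def by blast
    then show "x \<in> U" using xL by blast
  qed
  then have "U = N" using U by blast
  then show ?thesis using U N left_module_restr[OF lm] by (simp add: fg_module_def)
qed

end

section \<open>Dual bases\<close>

lemma left_module_regular: "ring A \<Longrightarrow> left_module A (regular A)"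
proof -
  assume "ring A"
  then interpret ring A .
  have "abelian_group (regular A)"
    by (rule abelian_groupI)
      (auto simp: regular_def a_ac intro: bexI[of _ "\<ominus>\<^bsub>A\<^esub> x" for x] l_neg)
  then show ?thesis
    by (intro left_module.intro left_module_axioms.intro ring_axioms)
      (auto simp: regular_def l_distr r_distr m_assoc)
qed

lemma regular_simps [simp]:
  "carrier (regular A) = carrier A" "\<zero>\<^bsub>regular A\<^esub> = \<zero>\<^bsub>A\<^esub>" 
  "x \<oplus>\<^bsub>regular A\<^esub> y = x \<oplus>\<^bsub>A\<^esub> y" "x \<odot>\<^bsub>regular A\<^esub> y = x \<otimes>\<^bsub>A\<^esub> y"
  "finsum (regular A) f I = finsum A f I"
  by (simp_all add: regular_def finsum_def finprod_def)

text \<open>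
  Having a finite dual basis characterizes the finitely generated projective modules. Unlike the lifting
  property, which ranges over modules of one fixed type, it involves no other module, so it transfers to
  duals and to modules over other algebras by computing with coordinates.
\<close>

definition dual_basis ::
  "('k, 'a) module \<Rightarrow> ('a, 'm) module \<Rightarrow> 'i set \<Rightarrow> ('i \<Rightarrow> 'm) \<Rightarrow> ('i \<Rightarrow> 'm \<Rightarrow> 'a) \<Rightarrow> bool"
  where "dual_basis A P I x \<phi> \<longleftrightarrow> finite I \<and>
    (\<forall>i\<in>I. x i \<in> carrier P \<and> lin A P (regular A) (\<phi> i)) \<and>
    (\<forall>p\<in>carrier P. p = (\<Oplus>\<^bsub>P\<^esub>i\<in>I. \<phi> i p \<odot>\<^bsub>P\<^esub> x i))"

lemma lin_smult_const:
  assumes U: "left_module A U" and f: "lin A P (regular A) f" and u: "u \<in> carrier U"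
  shows "lin A P U (\<lambda>p. f p \<odot>\<^bsub>U\<^esub> u)"
proof -
  interpret left_module A U by fact
  show ?thesis
    by (rule linI)
      (use lin_closed[OF f] lin_add[OF f] lin_smult[OF f] u in
        \<open>simp_all add: smult_closed smult_l_distr smult_assoc\<close>)
qed

text \<open>
  A linear map is determined by its values on the \<open>x i\<close>. Conversely arbitrary values give a map by the
  same formula, although its values on the \<open>x i\<close> may then be different ones; they are the right ones up
  to the kernel of \<open>g\<close> in the lifting lemma below.
\<close>

lemma dual_basis_expand:
  assumes P: "left_module A P" and V: "left_module A V" and b: "dual_basis A P I x \<phi>" 
    and f: "lin A P V f" and p: "p \<in> carrier P"
  shows "f p = (\<Oplus>\<^bsub>V\<^esub>i\<in>I. \<phi> i p \<odot>\<^bsub>V\<^esub> f (x i))"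
proof -
  interpret P: left_module A P by fact
  interpret V: left_module A V by fact
  have c: "\<phi> i p \<in> carrier A" "x i \<in> carrier P" if "i \<in> I" for i
    using b p that by (auto simp: dual_basis_def lin_def)
  have "f p = f (\<Oplus>\<^bsub>P\<^esub>i\<in>I. \<phi> i p \<odot>\<^bsub>P\<^esub> x i)" using b p by (simp add: dual_basis_def)
  also have "\<dots> = (\<Oplus>\<^bsub>V\<^esub>i\<in>I. f (\<phi> i p \<odot>\<^bsub>P\<^esub> x i))"
    using b c by (intro lin_finsum[OF P V f]) (auto simp: dual_basis_def P.smult_closed)
  also have "\<dots> = (\<Oplus>\<^bsub>V\<^esub>i\<in>I. \<phi> i p \<odot>\<^bsub>V\<^esub> f (x i))"
    using c by (intro V.M.finsum_cong') (auto simp: lin_smult[OF f] lin_closed[OF f] V.smult_closed)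
  finally show ?thesis .
qed

lemma lin_dual_basis:
  assumes U: "left_module A U" and b: "dual_basis A P I x \<phi>" and u: "\<And>i. i \<in> I \<Longrightarrow> u i \<in> carrier U"
  shows "lin A P U (\<lambda>p. \<Oplus>\<^bsub>U\<^esub>i\<in>I. \<phi> i p \<odot>\<^bsub>U\<^esub> u i)"
  using b u by (intro lin_sum[OF U] lin_smult_const[OF U]) (auto simp: dual_basis_def)

lemma dual_basis_lift:
  assumes b: "dual_basis A P I x \<phi>" and P: "left_module A P" and U: "left_module A U" and V: "left_module A V"
    and g: "lin A U V g" and f: "lin A P V f" and s: "\<And>p. p \<in> carrier P \<Longrightarrow> f p \<in> g ` carrier U"
  shows "\<exists>h. lin A P U h \<and> (\<forall>p\<in>carrier P. g (h p) = f p)"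
proof -
  interpret U: left_module A U by fact
  interpret V: left_module A V by fact
  have "\<exists>u\<in>carrier U. g u = f (x i)" if "i \<in> I" for i
    using s[of "x i"] b that by (auto simp: dual_basis_def)
  then obtain u where u: "\<And>i. i \<in> I \<Longrightarrow> u i \<in> carrier U \<and> g (u i) = f (x i)" by metis
  let ?h = "\<lambda>p. \<Oplus>\<^bsub>U\<^esub>i\<in>I. \<phi> i p \<odot>\<^bsub>U\<^esub> u i"
  have "g (?h p) = f p" if p: "p \<in> carrier P" for p
  proof -
    have c: "\<phi> i p \<in> carrier A" if "i \<in> I" for i
      using b p that by (auto simp: dual_basis_def lin_def)
    have "g (?h p) = (\<Oplus>\<^bsub>V\<^esub>i\<in>I. g (\<phi> i p \<odot>\<^bsub>U\<^esub> u i))"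
      using b c u by (intro lin_finsum[OF U V g]) (auto simp: dual_basis_def U.smult_closed)
    also have "\<dots> = (\<Oplus>\<^bsub>V\<^esub>i\<in>I. \<phi> i p \<odot>\<^bsub>V\<^esub> f (x i))"
      using c u b lin_closed[OF f]
      by (intro V.M.finsum_cong') (auto simp: lin_smult[OF g] dual_basis_def intro!: V.smult_closed)
    finally show ?thesis using dual_basis_expand[OF P V b f p] by simp
  qed
  then show ?thesis using lin_dual_basis[OF U b, of u] u by blast
qed

lemma lin_eq_on_generators:
  assumes M: "left_module A M" and N: "left_module A N" and f: "lin A M N f" and g: "lin A M N g"
    and S: "S \<subseteq> carrier M" "\<And>L. submodule L A M \<Longrightarrow> S \<subseteq> L \<Longrightarrow> L = carrier M"
    and eq: "\<And>s. s \<in> S \<Longrightarrow> f s = g s" and x: "x \<in> carrier M"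
  shows "f x = g x"
proof -
  interpret M: left_module A M by fact
  interpret N: left_module A N by fact
  have "submodule {x \<in> carrier M. f x = g x} A M" unfolding submodule_iff[OF M]
    by (auto simp: lin_zero[OF M N f] lin_zero[OF M N g] lin_add[OF f] lin_add[OF g] lin_smult[OF f] lin_smult[OF g]
        M.smult_closed)
  then have "{x \<in> carrier M. f x = g x} = carrier M" using S eq by (intro S(2)) auto
  then show ?thesis using x by blast
qed

section \<open>Free modules\<close>

definition free_mod :: "('k, 'a) module \<Rightarrow> nat \<Rightarrow> ('a, nat \<Rightarrow> 'a) module" where
  "free_mod A n = \<lparr>carrier = {..<n} \<rightarrow>\<^sub>E carrier A, monoid.mult = undefined, one = undefined,
    zero = (\<lambda>i\<in>{..<n}. \<zero>\<^bsub>A\<^esub>), add = (\<lambda>x y. \<lambda>i\<in>{..<n}. x i \<oplus>\<^bsub>A\<^esub> y i),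
    smult = (\<lambda>a x. \<lambda>i\<in>{..<n}. a \<otimes>\<^bsub>A\<^esub> x i)\<rparr>"

definition unit_vec :: "('k, 'a) module \<Rightarrow> nat \<Rightarrow> nat \<Rightarrow> nat \<Rightarrow> 'a" where
  "unit_vec A n j = (\<lambda>i\<in>{..<n}. if j = i then \<one>\<^bsub>A\<^esub> else \<zero>\<^bsub>A\<^esub>)"

lemma left_module_free:
  assumes "ring A" shows "left_module A (free_mod A n)"
proof -
  interpret ring A by fact
  have ext: "(\<lambda>i\<in>{..<n}. x i) = x \<longleftrightarrow> x \<in> extensional {..<n}" for x :: "nat \<Rightarrow> 'b"
    by (auto simp: extensional_def restrict_def fun_eq_iff)
  have "abelian_group (free_mod A n)"
  proof (rule abelian_groupI)
    fix x assume "x \<in> carrier (free_mod A n)"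
    then show "\<exists>y\<in>carrier (free_mod A n). y \<oplus>\<^bsub>free_mod A n\<^esub> x = \<zero>\<^bsub>free_mod A n\<^esub>"
      by (intro bexI[of _ "\<lambda>i\<in>{..<n}. \<ominus>\<^bsub>A\<^esub> x i"])
        (auto simp: free_mod_def fun_eq_iff l_neg PiE_iff restrict_def extensional_def)
  qed (auto simp: free_mod_def fun_eq_iff a_ac restrict_def PiE_iff extensional_def)
  then show ?thesis
    by (intro left_module.intro left_module_axioms.intro ring_axioms)
      (auto simp: free_mod_def fun_eq_iff l_distr r_distr m_assoc restrict_def PiE_iff extensional_def)
qed

lemma unit_vec_generate:
  assumes "ring A" and L: "submodule L A (free_mod A n)" "unit_vec A n ` {..<n} \<subseteq> L"
  shows "L = carrier (free_mod A n)"
proof -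
  interpret ring A by fact
  have s: "L \<subseteq> carrier (free_mod A n)" "\<zero>\<^bsub>free_mod A n\<^esub> \<in> L"
    "\<And>x y. x \<in> L \<Longrightarrow> y \<in> L \<Longrightarrow> x \<oplus>\<^bsub>free_mod A n\<^esub> y \<in> L"
    "\<And>a x. a \<in> carrier A \<Longrightarrow> x \<in> L \<Longrightarrow> a \<odot>\<^bsub>free_mod A n\<^esub> x \<in> L"
    using L(1) submodule_iff[OF left_module_free[OF assms(1)]] by auto
  have "x \<in> L" if x: "x \<in> carrier (free_mod A n)" for x
  proof -
    let ?t = "\<lambda>k. \<lambda>i\<in>{..<n}. if i < k then x i else \<zero>\<^bsub>A\<^esub>"
    have t: "?t k \<in> L" if "k \<le> n" for k
      using that
    proof (induction k)
      case 0 then show ?case using s(2) by (simp add: free_mod_def restrict_def)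
    next
      case (Suc k)
      have "?t (Suc k) = ?t k \<oplus>\<^bsub>free_mod A n\<^esub> x k \<odot>\<^bsub>free_mod A n\<^esub> unit_vec A n k"
        using x Suc.prems
        by (auto simp: free_mod_def unit_vec_def fun_eq_iff restrict_def PiE_iff less_Suc_eq)
      also have "\<dots> \<in> L"
      proof (rule s(3))
        show "?t k \<in> L" using Suc.IH Suc.prems by linarith
        show "x k \<odot>\<^bsub>free_mod A n\<^esub> unit_vec A n k \<in> L"
          using Suc.prems x L(2) by (intro s(4)) (auto simp: free_mod_def)
      qed
      finally show ?case .
    qed
    have "?t n = x" using x by (auto simp: free_mod_def fun_eq_iff restrict_def PiE_iff extensional_def)
    then show ?thesis using t[of n] by simp
  qed
  then show ?thesis using s by blast
qed

lemma unit_vec_closed: "ring A \<Longrightarrow> unit_vec A n j \<in> carrier (free_mod A n)"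
proof -
  assume "ring A" then interpret ring A .
  show ?thesis by (auto simp: unit_vec_def free_mod_def)
qed

lemma fg_module_free:
  assumes "ring A" shows "fg_module A (free_mod A n)"
proof -
  have "fin_gen A (free_mod A n)" unfolding fin_gen_def
  proof (intro exI[of _ "unit_vec A n ` {..<n}"] conjI allI impI)
    show "N = carrier (free_mod A n)" if "submodule N A (free_mod A n) \<and> unit_vec A n ` {..<n} \<subseteq> N" for N
      using that unit_vec_generate[OF assms] by blast
  qed (use unit_vec_closed[OF assms] in auto)
  then show ?thesis using left_module_free[OF assms] by (simp add: fg_module_def)
qed

lemma lin_free_coord: "i < n \<Longrightarrow> lin A (free_mod A n) (regular A) (\<lambda>v. v i)"
  by (rule linI) (auto simp: free_mod_def)

lemma lin_free_combination:
  assumes M: "left_module A M" and x: "\<And>i. i < n \<Longrightarrow> x i \<in> carrier M"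
  shows "lin A (free_mod A n) M (\<lambda>v. \<Oplus>\<^bsub>M\<^esub>i\<in>{..<n}. v i \<odot>\<^bsub>M\<^esub> x i)"
  using x by (intro lin_sum[OF M] lin_smult_const[OF M] lin_free_coord) auto

lemma dual_basis_free:
  assumes "ring A"
  shows "dual_basis A (free_mod A n) {..<n} (unit_vec A n) (\<lambda>i v. v i)"
proof -
  interpret ring A by fact
  have F: "left_module A (free_mod A n)" using assms by (rule left_module_free)
  interpret F: left_module A "free_mod A n" by fact
  have u: "(\<Oplus>\<^bsub>free_mod A n\<^esub>i\<in>{..<n}. unit_vec A n j i \<odot>\<^bsub>free_mod A n\<^esub> unit_vec A n i) = unit_vec A n j"
    if "j < n" for j
  proof -
    have "(\<Oplus>\<^bsub>free_mod A n\<^esub>i\<in>{..<n}. unit_vec A n j i \<odot>\<^bsub>free_mod A n\<^esub> unit_vec A n i)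
      = (\<Oplus>\<^bsub>free_mod A n\<^esub>i\<in>{..<n}. if j = i then unit_vec A n i else \<zero>\<^bsub>free_mod A n\<^esub>)"
      using unit_vec_closed[OF assms] smult_zero(1)[OF F] F.smult_one
      by (intro F.M.finsum_cong') (auto simp: unit_vec_def)
    also have "\<dots> = unit_vec A n j"
      using that unit_vec_closed[OF assms] by (intro F.M.finsum_singleton) auto
    finally show ?thesis .
  qed
  have "p = (\<Oplus>\<^bsub>free_mod A n\<^esub>i\<in>{..<n}. p i \<odot>\<^bsub>free_mod A n\<^esub> unit_vec A n i)"
    if p: "p \<in> carrier (free_mod A n)" for p
  proof (rule lin_eq_on_generators[OF F F lin_id _ _ _ _ p])
    show "lin A (free_mod A n) (free_mod A n) (\<lambda>v. \<Oplus>\<^bsub>free_mod A n\<^esub>i\<in>{..<n}. v i \<odot>\<^bsub>free_mod A n\<^esub> unit_vec A n i)"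
      using unit_vec_closed[OF assms] by (intro lin_free_combination[OF F])
    show "unit_vec A n ` {..<n} \<subseteq> carrier (free_mod A n)" using unit_vec_closed[OF assms] by auto
  qed (use u unit_vec_generate[OF assms] in auto)
  then show ?thesis unfolding dual_basis_def
    using unit_vec_closed[OF assms] lin_free_coord by auto
qed

section \<open>Projective modules and projective covers\<close>

context fd_algebra
begin

lemma ring_A: "ring A" by (rule A.ring_axioms)

lemmas reg = left_module_regular[OF ring_A]

text \<open>
  Needed because projectivity refers to the type \<open>nat \<Rightarrow> 'k\<close> only.
\<close>

lemma ex_copy:
  fixes M :: "('a, 'm) module"
  assumes "fg_module A M"
  shows "\<exists>(N :: ('k, 'a) std_module) u v. fg_module A N \<and> lin A M N u \<and> lin A N M v \<and>
    (\<forall>x\<in>carrier M. v (u x) = x) \<and> (\<forall>y\<in>carrier N. u (v y) = y)"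
proof -
  obtain N :: "('k, 'a) std_module" and u where N: "fg_module A N" and u: "lin A M N u" "bij_betw u (carrier M) (carrier N)"
    using fg_module_has_copy[OF assms] by (auto simp: mod_iso_def mod_hom_iff_lin)
  have "lin A N M (inv_into (carrier M) u)"
    using u by (intro lin_inv fg_moduleD[OF assms]) (auto simp: bij_betw_def)
  then show ?thesis using N u
    by (intro exI[of _ N] exI[of _ u] exI[of _ "inv_into (carrier M) u"])
      (auto simp: bij_betw_inv_into_left bij_betw_inv_into_right)
qed

lemma projectiveI:
  fixes P :: "('a, 'm) module"
  assumes P: "fg_module A P" and
    lift: "\<And>(U :: ('k, 'a) std_module) (V :: ('k, 'a) std_module) g f. left_module A U \<Longrightarrow> left_module A V \<Longrightarrow>
      lin A U V g \<Longrightarrow> g ` carrier U = carrier V \<Longrightarrow> lin A P V f \<Longrightarrow>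
      \<exists>h. lin A P U h \<and> (\<forall>p\<in>carrier P. g (h p) = f p)"
  shows "projective A P"
  unfolding projective_def
proof (intro conjI P allI impI ballI)
  fix U V :: "('k, 'a) std_module" and g f
  assume U: "fg_module A U" and V: "fg_module A V" and g: "g \<in> mod_hom A U V" "g ` carrier U = carrier V"
    and f: "f \<in> mod_hom A P V"
  obtain h where h: "lin A P U h" "\<And>p. p \<in> carrier P \<Longrightarrow> g (h p) = f p"
    using lift[OF fg_moduleD[OF U] fg_moduleD[OF V], of g f] f g unfolding mod_hom_iff_lin by blast
  then have "f = compose (carrier P) g (restrict h (carrier P))"
    using f by (auto simp: compose_def restrict_def mod_hom_def PiE_iff extensional_def fun_eq_iff)
  then show "\<exists>h\<in>mod_hom A P U. f = compose (carrier P) g h"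
    using restrict_mod_hom[OF fg_moduleD[OF P] h(1)] by blast
qed

lemma projective_of_dual_basis:
  assumes "fg_module A P" "dual_basis A P I x \<phi>"
  shows "projective A P"
  using assms(1)
  by (rule projectiveI) (rule dual_basis_lift[OF assms(2) fg_moduleD[OF assms(1)]], auto simp: lin_closed)

lemma ex_free_epi:
  fixes M :: "('a, 'm) module"
  assumes M: "fg_module A M"
  shows "\<exists>n x. (\<forall>i<n. x i \<in> carrier M) \<and>
    (\<forall>m\<in>carrier M. \<exists>v\<in>carrier (free_mod A n). (\<Oplus>\<^bsub>M\<^esub>i\<in>{..<n}. v i \<odot>\<^bsub>M\<^esub> x i) = m)"
proof -
  interpret M: left_module A M using M by (rule fg_moduleD)
  obtain S where S: "finite S" "S \<subseteq> carrier M"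
    "\<And>m. m \<in> carrier M \<Longrightarrow> \<exists>a\<in>S \<rightarrow> carrier A. m = (\<Oplus>\<^bsub>M\<^esub>s\<in>S. a s \<odot>\<^bsub>M\<^esub> s)"
    using M fin_gen_combination[of A M] unfolding fg_module_def by blast
  obtain x n where x: "S = x ` {..<n::nat}" "inj_on x {..<n}"
    using finite_imp_nat_seg_image_inj_on[OF S(1)] by (metis lessThan_def)
  have "\<exists>v\<in>carrier (free_mod A n). (\<Oplus>\<^bsub>M\<^esub>i\<in>{..<n}. v i \<odot>\<^bsub>M\<^esub> x i) = m" if m: "m \<in> carrier M" for m
  proof -
    obtain a where a: "a \<in> S \<rightarrow> carrier A" "m = (\<Oplus>\<^bsub>M\<^esub>s\<in>S. a s \<odot>\<^bsub>M\<^esub> s)" using S(3)[OF m] by blast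
    have "m = (\<Oplus>\<^bsub>M\<^esub>i\<in>{..<n}. a (x i) \<odot>\<^bsub>M\<^esub> x i)"
      unfolding a(2) x(1) using a(1) S(2) x
      by (intro M.M.finsum_reindex) (auto intro!: M.smult_closed)
    also have "\<dots> = (\<Oplus>\<^bsub>M\<^esub>i\<in>{..<n}. (\<lambda>i\<in>{..<n}. a (x i)) i \<odot>\<^bsub>M\<^esub> x i)"
      using a(1) S(2) x by (intro M.M.finsum_cong') (auto intro!: M.smult_closed)
    finally show ?thesis using a(1) x 
      by (intro bexI[of _ "\<lambda>i\<in>{..<n}. a (x i)"]) (auto simp: free_mod_def)
  qed
  then show ?thesis using S(2) x(1) by blast
qed

text \<open>
  A section of an epimorphism \<open>A\<^sup>n \<rightarrow> P\<close> has coordinates, and these with the images of the unit vectors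
  form a dual basis. The section exists by the lifting property after passing to copies with elements of
  the type over which this property ranges.
\<close>

lemma projective_dual_basis:
  fixes P :: "('a, 'm) module"
  assumes P: "projective A P"
  shows "\<exists>(n::nat) x \<phi>. dual_basis A P {..<n} x \<phi>"
proof -
  have fP: "fg_module A P" using P by (simp add: projective_def)
  have lP: "left_module A P" using fP by (rule fg_moduleD)
  obtain n x where x: "\<And>i. i < n \<Longrightarrow> x i \<in> carrier P"
    and s: "\<And>m. m \<in> carrier P \<Longrightarrow> \<exists>v\<in>carrier (free_mod A n). (\<Oplus>\<^bsub>P\<^esub>i\<in>{..<n}. v i \<odot>\<^bsub>P\<^esub> x i) = m"
    using ex_free_epi[OF fP] by metis
  let ?F = "free_mod A n" and ?c = "\<lambda>v. \<Oplus>\<^bsub>P\<^esub>i\<in>{..<n}. v i \<odot>\<^bsub>P\<^esub> x i"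
  have c: "lin A ?F P ?c" using x by (intro lin_free_combination[OF lP]) auto
  obtain F :: "('k, 'a) std_module" and u v where F: "fg_module A F" and u: "lin A ?F F u" and v: "lin A F ?F v"
    and vu: "\<And>x. x \<in> carrier ?F \<Longrightarrow> v (u x) = x"
    using ex_copy[OF fg_module_free[OF ring_A, of n]] by metis
  obtain Q :: "('k, 'a) std_module" and s t where Q: "fg_module A Q" and s': "lin A P Q s" and t: "lin A Q P t"
    and ts: "\<And>x. x \<in> carrier P \<Longrightarrow> t (s x) = x" and st: "\<And>x. x \<in> carrier Q \<Longrightarrow> s (t x) = x"
    using ex_copy[OF fP] by metis
  let ?g = "restrict (\<lambda>y. s (?c (v y))) (carrier F)" and ?f = "restrict s (carrier P)"
  have g: "?g \<in> mod_hom A F Q"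
    by (intro restrict_mod_hom fg_moduleD[OF F] lin_comp[OF lin_comp[OF v c] s'])
  have f: "?f \<in> mod_hom A P Q" by (intro restrict_mod_hom lP s')
  have "carrier Q \<subseteq> ?g ` carrier F"
  proof
    fix y assume y: "y \<in> carrier Q"
    then obtain w where w: "w \<in> carrier ?F" "?c w = t y" using s[OF lin_closed[OF t y]] by blast
    then have "?g (u w) = y" using vu st[OF y] lin_closed[OF u] by simp
    then show "y \<in> ?g ` carrier F" using lin_closed[OF u w(1)] by blast
  qed
  moreover have "?g ` carrier F \<subseteq> carrier Q"
    using g by (auto simp: mod_hom_def PiE_iff)
  ultimately have sg: "?g ` carrier F = carrier Q" by (rule equalityI[rotated])
  obtain h where h: "h \<in> mod_hom A P F" "?f = compose (carrier P) ?g h"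
    using P F Q g f sg unfolding projective_def by blast
  have h': "lin A P F h" using h(1) by (simp add: mod_hom_iff_lin)
  have "?c (v (h p)) = p" if p: "p \<in> carrier P" for p
  proof -
    have "s p = s (?c (v (h p)))"
      using fun_cong[OF h(2), of p] p lin_closed[OF h'] by (simp add: compose_def)
    then show ?thesis using ts p lin_closed[OF lin_comp[OF lin_comp[OF h' v] c] p] by metis
  qed
  then have "dual_basis A P {..<n} x (\<lambda>i p. v (h p) i)"
    unfolding dual_basis_def using x lin_comp[OF lin_comp[OF h' v] lin_free_coord] by auto
  then show ?thesis by blast
qed

lemma projective_fg: "projective A P \<Longrightarrow> fg_module A P"
  by (simp add: projective_def)

lemma projective_left_module: "projective A P \<Longrightarrow> left_module A P"
  by (simp add: projective_def fg_module_def)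

text \<open>With a dual basis, lifting is possible along epimorphisms between modules of any type.\<close>

lemma projective_lift:
  assumes P: "projective A P" and "left_module A U" "left_module A V" "lin A U V g" "lin A P V f"
    "\<And>p. p \<in> carrier P \<Longrightarrow> f p \<in> g ` carrier U"
  shows "\<exists>h. lin A P U h \<and> (\<forall>p\<in>carrier P. g (h p) = f p)"
  using projective_dual_basis[OF P] dual_basis_lift[OF _ projective_left_module[OF P] assms(2-)] by blast

lemma projective_retract:
  fixes M :: "('a, 'm) module"
  assumes P: "projective A P" and M: "left_module A M" and a: "lin A P M a" and b: "lin A M P b"
    and ab: "\<And>m. m \<in> carrier M \<Longrightarrow> a (b m) = m"
  shows "projective A M"
proof (rule projectiveI)
  have "a ` carrier P = carrier M" using lin_closed[OF a] lin_closed[OF b] ab by (force simp: image_iff)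
  then show "fg_module A M" by (rule fg_module_image[OF projective_fg[OF P] M a])
  fix U V :: "('k, 'a) std_module" and g f
  assume U: "left_module A U" and V: "left_module A V" and g: "lin A U V g" "g ` carrier U = carrier V"
    and f: "lin A M V f"
  obtain h where "lin A P U h" "\<And>p. p \<in> carrier P \<Longrightarrow> g (h p) = f (a p)"
    using projective_lift[OF P U V g(1) lin_comp[OF a f]] g(2) lin_closed[OF f] lin_closed[OF a] by metis
  then show "\<exists>h. lin A M U h \<and> (\<forall>p\<in>carrier M. g (h p) = f p)"
    using lin_comp[OF b] lin_closed[OF b] ab by (intro exI[of _ "\<lambda>m. h (b m)"]) auto
qed

definition cover :: "('a, 'p) module \<Rightarrow> ('p \<Rightarrow> 'm) \<Rightarrow> ('a, 'm) module \<Rightarrow> bool" where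
  "cover P g M \<longleftrightarrow> projective A P \<and> lin A P M g \<and> g ` carrier P = carrier M \<and>
    (\<forall>N. submodule N A P \<and> g ` N = carrier M \<longrightarrow> N = carrier P)"

lemma projective_cover_iff: "projective_cover A P g M \<longleftrightarrow> cover P g M \<and> g \<in> extensional (carrier P)"
  by (auto simp: projective_cover_def cover_def mod_hom_iff_lin)

text \<open>
  A submodule \<open>N\<close> of a projective module \<open>F\<close> that is minimal among those mapped onto \<open>M\<close> is a retract
  of \<open>F\<close>: the epimorphism \<open>F \<rightarrow> M\<close> lifts to \<open>h : F \<rightarrow> N\<close>, and \<open>h\<close> is onto already on \<open>N\<close> by
  minimality, hence bijective there.
\<close>

lemma ex_cover:
  fixes M :: "('a, 'm) module"
  assumes M: "fg_module A M"
  shows "\<exists>(P :: ('k, 'a) std_module) g. cover P g M"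
proof -
  have lM: "left_module A M" using M by (rule fg_moduleD)
  obtain n x where x: "\<And>i. i < n \<Longrightarrow> x i \<in> carrier M"
    and s: "\<And>m. m \<in> carrier M \<Longrightarrow> \<exists>v\<in>carrier (free_mod A n). (\<Oplus>\<^bsub>M\<^esub>i\<in>{..<n}. v i \<odot>\<^bsub>M\<^esub> x i) = m"
    using ex_free_epi[OF M] by metis
  let ?F = "free_mod A n" and ?c = "\<lambda>v. \<Oplus>\<^bsub>M\<^esub>i\<in>{..<n}. v i \<odot>\<^bsub>M\<^esub> x i"
  have c: "lin A ?F M ?c" using x by (intro lin_free_combination[OF lM]) auto
  obtain F :: "('k, 'a) std_module" and u v where F: "fg_module A F" and u: "lin A ?F F u" and v: "lin A F ?F v"
    and vu: "\<And>x. x \<in> carrier ?F \<Longrightarrow> v (u x) = x" and uv: "\<And>x. x \<in> carrier F \<Longrightarrow> u (v x) = x"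
    using ex_copy[OF fg_module_free[OF ring_A, of n]] by metis
  have lF: "left_module A F" using F by (rule fg_moduleD)
  have "projective A ?F"
    using projective_of_dual_basis[OF fg_module_free[OF ring_A] dual_basis_free[OF ring_A]] .
  then have pF: "projective A F" by (rule projective_retract[OF _ lF u v]) (rule uv)
  define g where "g y = ?c (v y)" for y
  have g: "lin A F M g" unfolding g_def by (rule lin_comp[OF v c])
  have sg: "g ` carrier F = carrier M"
  proof
    show "g ` carrier F \<subseteq> carrier M" using lin_closed[OF g] by blast
    show "carrier M \<subseteq> g ` carrier F"
    proof
      fix m assume "m \<in> carrier M"
      then obtain w where w: "w \<in> carrier ?F" "?c w = m" using s by blast
      then have "g (u w) = m" by (simp add: g_def vu)
      then show "m \<in> g ` carrier F" using lin_closed[OF u w(1)] by blast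
    qed
  qed
  define onto where "onto N \<longleftrightarrow> g ` N = carrier M" for N
  have "onto (carrier F)" using sg by (simp add: onto_def)
  from ex_minimal_submodule[where Q = onto, OF F submodule_carrier[OF lF] this]
  obtain N where N: "submodule N A F" "onto N" and minN: "\<forall>L. submodule L A F \<and> onto L \<and> L \<subseteq> N \<longrightarrow> L = N"
    by (elim exE conjE)
  have min: "L = N" if "submodule L A F" "g ` L = carrier M" "L \<subseteq> N" for L
    using minN that by (simp add: onto_def)
  note N = N(1) N(2)[unfolded onto_def]
  let ?N = "F\<lparr>carrier := N\<rparr>"
  have Nc: "N \<subseteq> carrier F" using N(1) by (rule submodule_subset)
  have lN: "left_module A ?N" using left_module_restr[OF lF N(1)] .
  have fN: "fg_module A ?N" using fg_module_submodule[OF F N(1)] .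
  have gN: "lin A ?N M g" using g Nc by (rule lin_restr_dom)
  obtain h where h: "lin A F ?N h" "\<And>y. y \<in> carrier F \<Longrightarrow> g (h y) = g y"
    using projective_lift[OF pF lN lM gN g] lin_closed[OF g] N(2) by auto
  have hN: "lin A ?N ?N h" using h(1) Nc by (rule lin_restr_dom)
  have hsub: "h ` N \<subseteq> N" using lin_closed[OF hN] by auto
  have "g ` h ` N = g ` N" unfolding image_image using h(2) Nc by (intro image_cong) auto
  then have "g ` h ` N = carrier M" using N(2) by simp
  moreover have "submodule (h ` N) A F"
    using submodule_image[OF lN lN hN submodule_carrier[OF lN]] submodule_restr_iff[OF lF N(1)] by simp
  ultimately have hs: "h ` N = N" using min hsub by blast
  have hi: "inj_on h (carrier ?N)" using hs by (intro surj_endo_inj[OF fN hN]) simp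
  let ?k = "inv_into (carrier ?N) h"
  have k: "lin A ?N ?N ?k" using hs by (intro lin_inv[OF lN hN hi]) simp
  have "projective A ?N"
  proof (rule projective_retract[OF pF lN lin_comp[OF h(1) k] lin_incl[OF Nc]])
    show "inv_into (carrier ?N) h (h m) = m" if "m \<in> carrier ?N" for m
      using hi that by (rule inv_into_f_f)
  qed
  then have "cover ?N g M" unfolding cover_def
    using gN N min submodule_restr_iff[OF lF N(1)] by auto
  then show ?thesis by blast
qed

end

section \<open>Linear functionals over a field\<close>

text \<open>
  A submodule maximal among those that contain \<open>W\<close> and avoid \<open>v\<close> has the multiples of \<open>v\<close> as a
  complement, and the functional is the coordinate with respect to \<open>v\<close>.
\<close>

lemma ex_functional:
  fixes K :: "'k ring" and V :: "('k, 'v) module"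
  assumes K: "field K" and V: "left_module K V" and W: "submodule W K V" and v: "v \<in> carrier V" "v \<notin> W"
  shows "\<exists>B. (\<forall>x\<in>carrier V. B x \<in> carrier K) \<and>
    (\<forall>x\<in>carrier V. \<forall>y\<in>carrier V. B (x \<oplus>\<^bsub>V\<^esub> y) = B x \<oplus>\<^bsub>K\<^esub> B y) \<and>
    (\<forall>c\<in>carrier K. \<forall>x\<in>carrier V. B (c \<odot>\<^bsub>V\<^esub> x) = c \<otimes>\<^bsub>K\<^esub> B x) \<and>
    (\<forall>x\<in>W. B x = \<zero>\<^bsub>K\<^esub>) \<and> B v = \<one>\<^bsub>K\<^esub>"
proof -
  interpret K: field K by fact
  interpret V: left_module K V by fact
  define \<A> where "\<A> = {N. submodule N K V \<and> W \<subseteq> N \<and> v \<notin> N}"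
  have "\<exists>N\<in>\<A>. \<forall>L\<in>\<A>. N \<subseteq> L \<longrightarrow> L = N"
  proof (rule subset_Zorn_nonempty)
    show "\<A> \<noteq> {}" using W v unfolding \<A>_def by blast
    fix C assume C: "C \<noteq> {}" "subset.chain \<A> C"
    then have Cs: "\<And>L. L \<in> C \<Longrightarrow> submodule L K V \<and> W \<subseteq> L \<and> v \<notin> L"
      and ch: "\<And>L L'. L \<in> C \<Longrightarrow> L' \<in> C \<Longrightarrow> L \<subseteq> L' \<or> L' \<subseteq> L"
      by (auto simp: subset.chain_def subset_iff \<A>_def)
    have s: "L \<subseteq> carrier V" "\<zero>\<^bsub>V\<^esub> \<in> L" "\<And>x y. x \<in> L \<Longrightarrow> y \<in> L \<Longrightarrow> x \<oplus>\<^bsub>V\<^esub> y \<in> L"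
      "\<And>a x. a \<in> carrier K \<Longrightarrow> x \<in> L \<Longrightarrow> a \<odot>\<^bsub>V\<^esub> x \<in> L" if "L \<in> C" for L
      using Cs[OF that] submodule_iff[OF V, of L] by simp_all
    obtain L0 where L0: "L0 \<in> C" using C(1) by blast
    have "submodule (\<Union>C) K V" unfolding submodule_iff[OF V]
    proof (intro conjI ballI)
      show "\<Union>C \<subseteq> carrier V" using s(1) by blast
      show "\<zero>\<^bsub>V\<^esub> \<in> \<Union>C" using s(2) L0 by blast
      fix x y assume "x \<in> \<Union>C" "y \<in> \<Union>C"
      then obtain L L' where "L \<in> C" "x \<in> L" "L' \<in> C" "y \<in> L'" by blast
      then show "x \<oplus>\<^bsub>V\<^esub> y \<in> \<Union>C" using ch[of L L'] s(3) by blast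
    next
      fix a x assume "a \<in> carrier K" "x \<in> \<Union>C"
      then show "a \<odot>\<^bsub>V\<^esub> x \<in> \<Union>C" using s(4) by blast
    qed
    then show "\<Union>C \<in> \<A>" using Cs L0 unfolding \<A>_def by blast
  qed
  then obtain N where N\<A>: "N \<in> \<A>" and maxN: "\<forall>L\<in>\<A>. N \<subseteq> L \<longrightarrow> L = N" by (elim bexE)
  have N: "submodule N K V" "W \<subseteq> N" "v \<notin> N" using N\<A> by (simp_all add: \<A>_def)
  have max: "L = N" if "submodule L K V" "N \<subseteq> L" "v \<notin> L" for L
    using maxN that N(2) by (auto simp: \<A>_def)
  have s: "\<zero>\<^bsub>V\<^esub> \<in> N" "\<And>x y. x \<in> N \<Longrightarrow> y \<in> N \<Longrightarrow> x \<oplus>\<^bsub>V\<^esub> y \<in> N"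
    "\<And>a x. a \<in> carrier K \<Longrightarrow> x \<in> N \<Longrightarrow> a \<odot>\<^bsub>V\<^esub> x \<in> N" and Nc: "\<And>x. x \<in> N \<Longrightarrow> x \<in> carrier V"
    using N(1) unfolding submodule_iff[OF V, of N] by auto
  \<comment> \<open>If \<open>x\<close> is not in \<open>N\<close>, then \<open>N\<close> and \<open>x\<close> span \<open>v\<close> by maximality, and this can be solved for \<open>x\<close>.\<close>
  have ex: "\<exists>c n. c \<in> carrier K \<and> n \<in> N \<and> x = n \<oplus>\<^bsub>V\<^esub> c \<odot>\<^bsub>V\<^esub> v" if x: "x \<in> carrier V" for x
  proof (cases "x \<in> N")
    case True
    then show ?thesis using x v by (intro exI[of _ "\<zero>\<^bsub>K\<^esub>"] exI[of _ x]) (simp add: smult_zero[OF V])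
  next
    case False
    let ?L = "{n \<oplus>\<^bsub>V\<^esub> c \<odot>\<^bsub>V\<^esub> x | n c. n \<in> N \<and> c \<in> carrier K}"
    note sub = submodule_add_cyclic(1)[OF V N(1) x] and NL = submodule_add_cyclic(2)[OF V N(1) x]
      and xL = submodule_add_cyclic(3)[OF V N(1) x]
    have "v \<in> ?L"
    proof (rule ccontr)
      assume "v \<notin> ?L"
      then have "?L = N" by (rule max[OF sub NL])
      then show False using xL False by blast
    qed
    then obtain n d where nd: "v = n \<oplus>\<^bsub>V\<^esub> d \<odot>\<^bsub>V\<^esub> x" "n \<in> N" "d \<in> carrier K" by blast
    have "d \<noteq> \<zero>\<^bsub>K\<^esub>" using nd N(3) Nc x by (auto simp: smult_zero[OF V])
    then have du: "d \<in> Units K" using nd(3) K.field_Units by simp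
    let ?e = "inv\<^bsub>K\<^esub> d"
    have e: "?e \<in> carrier K" "?e \<otimes>\<^bsub>K\<^esub> d = \<one>\<^bsub>K\<^esub>" using du by auto
    have "?e \<odot>\<^bsub>V\<^esub> v = ?e \<odot>\<^bsub>V\<^esub> n \<oplus>\<^bsub>V\<^esub> (?e \<otimes>\<^bsub>K\<^esub> d) \<odot>\<^bsub>V\<^esub> x"
      unfolding nd(1) using nd(2,3) e(1) Nc x by (simp add: V.smult_r_distr V.smult_closed V.smult_assoc)
    then have ev: "?e \<odot>\<^bsub>V\<^esub> v = ?e \<odot>\<^bsub>V\<^esub> n \<oplus>\<^bsub>V\<^esub> x" using x by (simp add: e(2) V.smult_one)
    have mn: "(\<ominus>\<^bsub>K\<^esub> \<one>\<^bsub>K\<^esub>) \<odot>\<^bsub>V\<^esub> (?e \<odot>\<^bsub>V\<^esub> n) = \<ominus>\<^bsub>V\<^esub> (?e \<odot>\<^bsub>V\<^esub> n)"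
      using nd e Nc by (intro smult_zero(3)[OF V] V.smult_closed) auto
    have "x = (\<ominus>\<^bsub>V\<^esub> (?e \<odot>\<^bsub>V\<^esub> n)) \<oplus>\<^bsub>V\<^esub> ?e \<odot>\<^bsub>V\<^esub> v"
      unfolding ev using nd(2) Nc e x V.smult_closed[of ?e n]
      by (simp add: V.M.a_assoc[symmetric] V.M.l_neg)
    moreover have "\<ominus>\<^bsub>V\<^esub> (?e \<odot>\<^bsub>V\<^esub> n) \<in> N" using nd e by (simp flip: mn add: s)
    ultimately show ?thesis using e by blast
  qed
  have uniq: "c = d" if c: "c \<in> carrier K" "d \<in> carrier K" "n \<in> N" "m \<in> N"
    and eq: "n \<oplus>\<^bsub>V\<^esub> c \<odot>\<^bsub>V\<^esub> v = m \<oplus>\<^bsub>V\<^esub> d \<odot>\<^bsub>V\<^esub> v" for c d n m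
  proof (rule ccontr)
    assume "c \<noteq> d"
    then have "c \<ominus>\<^bsub>K\<^esub> d \<noteq> \<zero>\<^bsub>K\<^esub>" using c by (simp add: diff_eq_zero_iff[OF K.abelian_group_axioms])
    then have u: "c \<ominus>\<^bsub>K\<^esub> d \<in> Units K" using c K.field_Units by simp
    have nm: "n \<in> carrier V" "m \<in> carrier V" using c Nc by auto
    have cd: "c \<odot>\<^bsub>V\<^esub> v \<in> carrier V" "d \<odot>\<^bsub>V\<^esub> v \<in> carrier V" using c v by (auto intro: V.smult_closed)
    have "(c \<ominus>\<^bsub>K\<^esub> d) \<odot>\<^bsub>V\<^esub> v \<oplus>\<^bsub>V\<^esub> d \<odot>\<^bsub>V\<^esub> v = c \<odot>\<^bsub>V\<^esub> v"
      using c v by (simp add: a_minus_def K.a_assoc K.l_neg flip: V.smult_l_distr)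
    then have "(n \<oplus>\<^bsub>V\<^esub> (c \<ominus>\<^bsub>K\<^esub> d) \<odot>\<^bsub>V\<^esub> v) \<oplus>\<^bsub>V\<^esub> d \<odot>\<^bsub>V\<^esub> v = m \<oplus>\<^bsub>V\<^esub> d \<odot>\<^bsub>V\<^esub> v"
      using eq nm cd c v by (simp add: V.M.a_assoc V.smult_closed)
    then have e1: "n \<oplus>\<^bsub>V\<^esub> (c \<ominus>\<^bsub>K\<^esub> d) \<odot>\<^bsub>V\<^esub> v = m" 
      using nm cd c v by (simp add: V.smult_closed)
    have "(c \<ominus>\<^bsub>K\<^esub> d) \<odot>\<^bsub>V\<^esub> v = (\<ominus>\<^bsub>K\<^esub> \<one>\<^bsub>K\<^esub>) \<odot>\<^bsub>V\<^esub> n \<oplus>\<^bsub>V\<^esub> m"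
      unfolding e1[symmetric] using nm c v
      by (simp add: smult_zero[OF V] V.M.a_assoc[symmetric] V.M.l_neg V.smult_closed)
    also have "\<dots> \<in> N" using c s by auto
    finally have "(c \<ominus>\<^bsub>K\<^esub> d) \<odot>\<^bsub>V\<^esub> v \<in> N" .
    with u have "inv\<^bsub>K\<^esub> (c \<ominus>\<^bsub>K\<^esub> d) \<odot>\<^bsub>V\<^esub> ((c \<ominus>\<^bsub>K\<^esub> d) \<odot>\<^bsub>V\<^esub> v) \<in> N"
      by (intro s(3)[OF K.Units_inv_closed])
    moreover have "inv\<^bsub>K\<^esub> (c \<ominus>\<^bsub>K\<^esub> d) \<odot>\<^bsub>V\<^esub> ((c \<ominus>\<^bsub>K\<^esub> d) \<odot>\<^bsub>V\<^esub> v) = v"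
      using u v by (subst V.smult_assoc[symmetric]) (auto simp: V.smult_one)
    ultimately show False using N(3) by simp
  qed
  define B where "B x = (THE c. c \<in> carrier K \<and> (\<exists>n\<in>N. x = n \<oplus>\<^bsub>V\<^esub> c \<odot>\<^bsub>V\<^esub> v))" for x
  have Beq: "B x = c" if "c \<in> carrier K" "n \<in> N" "x = n \<oplus>\<^bsub>V\<^esub> c \<odot>\<^bsub>V\<^esub> v" for x n c
    unfolding B_def using that uniq by (intro the_equality) blast+
  have vc: "c \<odot>\<^bsub>V\<^esub> v \<in> carrier V" if "c \<in> carrier K" for c using that v by (intro V.smult_closed)
  show ?thesis
  proof (intro exI[of _ B] conjI ballI)
    fix x assume x: "x \<in> carrier V"
    obtain c n where c: "c \<in> carrier K" "n \<in> N" "x = n \<oplus>\<^bsub>V\<^esub> c \<odot>\<^bsub>V\<^esub> v" using ex[OF x] by blast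
    show "B x \<in> carrier K" using Beq[OF c] c by simp
    show "B (x \<oplus>\<^bsub>V\<^esub> y) = B x \<oplus>\<^bsub>K\<^esub> B y" if y: "y \<in> carrier V" for y
    proof -
      obtain d m where d: "d \<in> carrier K" "m \<in> N" "y = m \<oplus>\<^bsub>V\<^esub> d \<odot>\<^bsub>V\<^esub> v" using ex[OF y] by blast
      have "x \<oplus>\<^bsub>V\<^esub> y = (n \<oplus>\<^bsub>V\<^esub> m) \<oplus>\<^bsub>V\<^esub> (c \<oplus>\<^bsub>K\<^esub> d) \<odot>\<^bsub>V\<^esub> v"
        using c d Nc v vc by (simp add: V.smult_l_distr V.M.a_ac)
      then show ?thesis using Beq[OF _ s(2)[OF c(2) d(2)]] c d Beq[OF c] Beq[OF d] by simp
    qed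
  next
    fix a x assume a: "a \<in> carrier K" and x: "x \<in> carrier V"
    obtain c n where c: "c \<in> carrier K" "n \<in> N" "x = n \<oplus>\<^bsub>V\<^esub> c \<odot>\<^bsub>V\<^esub> v" using ex[OF x] by blast
    have "a \<odot>\<^bsub>V\<^esub> x = a \<odot>\<^bsub>V\<^esub> n \<oplus>\<^bsub>V\<^esub> (a \<otimes>\<^bsub>K\<^esub> c) \<odot>\<^bsub>V\<^esub> v"
      using a c Nc v vc by (simp add: V.smult_r_distr V.smult_assoc)
    then show "B (a \<odot>\<^bsub>V\<^esub> x) = a \<otimes>\<^bsub>K\<^esub> B x" using Beq[OF _ s(3)[OF a c(2)]] a c Beq[OF c] by simp
  next
    fix x assume x: "x \<in> W"
    then show "B x = \<zero>\<^bsub>K\<^esub>" using N(2) Nc v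
      by (intro Beq[of _ x]) (auto simp: smult_zero[OF V] subset_iff)
  next
    show "B v = \<one>\<^bsub>K\<^esub>" using v s by (intro Beq[of _ "\<zero>\<^bsub>V\<^esub>"]) (auto simp: V.smult_one)
  qed
qed

section \<open>Dual modules\<close>

lemma opp_simps [simp]:
  "carrier (opp A) = carrier A" "\<zero>\<^bsub>opp A\<^esub> = \<zero>\<^bsub>A\<^esub>" "\<one>\<^bsub>opp A\<^esub> = \<one>\<^bsub>A\<^esub>" "x \<oplus>\<^bsub>opp A\<^esub> y = x \<oplus>\<^bsub>A\<^esub> y"
  "x \<otimes>\<^bsub>opp A\<^esub> y = y \<otimes>\<^bsub>A\<^esub> x" "c \<odot>\<^bsub>opp A\<^esub> x = c \<odot>\<^bsub>A\<^esub> x" "opp (opp A) = A"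
  "finsum (opp A) f I = finsum A f I"
  by (simp_all add: opp_def finsum_def finprod_def)

lemma hom_dual_carrier: "h \<in> carrier (hom_dual A P) \<longleftrightarrow> lin A P (regular A) h \<and> h \<in> extensional (carrier P)"
  by (simp add: hom_dual_def mod_hom_iff_lin)

lemma hom_dual_ext:
  "h \<in> carrier (hom_dual A P) \<Longrightarrow> h' \<in> carrier (hom_dual A P) \<Longrightarrow> (\<And>x. x \<in> carrier P \<Longrightarrow> h x = h' x) \<Longrightarrow> h = h'"
  by (auto simp: hom_dual_carrier intro: extensionalityI)

lemma hom_dual_zero: "x \<in> carrier P \<Longrightarrow> \<zero>\<^bsub>hom_dual A P\<^esub> x = \<zero>\<^bsub>A\<^esub>"
  and hom_dual_add: "x \<in> carrier P \<Longrightarrow> (g \<oplus>\<^bsub>hom_dual A P\<^esub> h) x = g x \<oplus>\<^bsub>A\<^esub> h x"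
  and hom_dual_smult: "x \<in> carrier P \<Longrightarrow> (a \<odot>\<^bsub>hom_dual A P\<^esub> h) x = h x \<otimes>\<^bsub>A\<^esub> a"
  by (simp_all add: hom_dual_def)

lemma restrict_hom_dual:
  "left_module A P \<Longrightarrow> lin A P (regular A) h \<Longrightarrow> restrict h (carrier P) \<in> carrier (hom_dual A P)"
  using restrict_mod_hom[of A P "regular A" h] by (simp add: hom_dual_def)

context fd_algebra
begin

lemma left_module_hom_dual:
  fixes P :: "('a, 'm) module"
  assumes P: "left_module A P"
  shows "left_module (opp A) (hom_dual A P)"
proof -
  interpret P: left_module A P by fact
  interpret O: fd_algebra K "opp A" by (rule fd_algebra_opp[OF fd_algebra_axioms])
  let ?H = "hom_dual A P"
  have lc: "lin A P (regular A) h" if "h \<in> carrier ?H" for h using that by (simp add: hom_dual_carrier)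
  have vc: "h x \<in> carrier A" if "h \<in> carrier ?H" "x \<in> carrier P" for h x
    using lin_closed[OF lc[OF that(1)] that(2)] by simp
  have z: "\<zero>\<^bsub>?H\<^esub> \<in> carrier ?H"
    using restrict_hom_dual[OF P, of "\<lambda>x. \<zero>\<^bsub>A\<^esub>"] by (auto simp: hom_dual_def lin_def)
  have a: "g \<oplus>\<^bsub>?H\<^esub> h \<in> carrier ?H" if "g \<in> carrier ?H" "h \<in> carrier ?H" for g h
    using restrict_hom_dual[OF P lin_plus[OF reg lc[OF that(1)] lc[OF that(2)]]] by (simp add: hom_dual_def)
  have s: "b \<odot>\<^bsub>?H\<^esub> h \<in> carrier ?H" if b: "b \<in> carrier A" and h: "h \<in> carrier ?H" for b h
  proof -
    have "lin A P (regular A) (\<lambda>x. h x \<otimes>\<^bsub>A\<^esub> b)"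
      using lin_smult_const[OF reg lc[OF h], of b] b by simp
    then show ?thesis using restrict_hom_dual[OF P] by (simp add: hom_dual_def)
  qed
  have n: "\<exists>g\<in>carrier ?H. g \<oplus>\<^bsub>?H\<^esub> h = \<zero>\<^bsub>?H\<^esub>" if h: "h \<in> carrier ?H" for h
  proof
    show g: "(\<ominus>\<^bsub>A\<^esub> \<one>\<^bsub>A\<^esub>) \<odot>\<^bsub>?H\<^esub> h \<in> carrier ?H" using h by (intro s) auto
    show "(\<ominus>\<^bsub>A\<^esub> \<one>\<^bsub>A\<^esub>) \<odot>\<^bsub>?H\<^esub> h \<oplus>\<^bsub>?H\<^esub> h = \<zero>\<^bsub>?H\<^esub>"
      using g h z a vc by (intro hom_dual_ext[of _ A P]) (simp_all add: hom_dual_add hom_dual_zero hom_dual_smult A.r_minus A.l_neg)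
  qed
  have ag: "abelian_group ?H"
  proof (rule abelian_groupI)
    fix x y w assume xyw: "x \<in> carrier ?H" "y \<in> carrier ?H" "w \<in> carrier ?H"
    show "x \<oplus>\<^bsub>?H\<^esub> y \<oplus>\<^bsub>?H\<^esub> w = x \<oplus>\<^bsub>?H\<^esub> (y \<oplus>\<^bsub>?H\<^esub> w)" "x \<oplus>\<^bsub>?H\<^esub> y = y \<oplus>\<^bsub>?H\<^esub> x"
      by (rule hom_dual_ext[of _ A P]; simp add: xyw a hom_dual_add vc A.a_ac)+
  next
    fix x assume x: "x \<in> carrier ?H"
    show "\<zero>\<^bsub>?H\<^esub> \<oplus>\<^bsub>?H\<^esub> x = x"
      by (rule hom_dual_ext[of _ A P]) (simp_all add: x a z hom_dual_add hom_dual_zero vc)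
  qed (fact a z n)+
  show ?thesis
    by (intro left_module.intro left_module_axioms.intro ag O.A.ring_axioms)
      ((simp add: s)?; rule hom_dual_ext[of _ A P];
        simp add: a z s hom_dual_add hom_dual_zero hom_dual_smult vc A.a_ac A.l_distr A.r_distr A.m_assoc)+
qed

text \<open>Precomposition with \<open>f\<close>, the contravariant action of \<open>Hom\<^sub>A(-, A)\<close>.\<close>

definition dual_map :: "('a, 'm) module \<Rightarrow> ('m \<Rightarrow> 'n) \<Rightarrow> ('n \<Rightarrow> 'a) \<Rightarrow> 'm \<Rightarrow> 'a" where
  "dual_map P f h = (\<lambda>x\<in>carrier P. h (f x))"

lemma dual_map_apply: "x \<in> carrier P \<Longrightarrow> dual_map P f h x = h (f x)"
  by (simp add: dual_map_def)

lemma hom_dual_map_eq: "h \<in> carrier (hom_dual A Q) \<Longrightarrow> hom_dual_map A P f Q h = dual_map P f h"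
  by (simp add: hom_dual_map_def dual_map_def compose_def)

lemma lin_dual_map:
  fixes P :: "('a, 'm) module"
  assumes P: "left_module A P" and Q: "left_module A Q" and f: "lin A P Q f"
  shows "lin (opp A) (hom_dual A Q) (hom_dual A P) (dual_map P f)"
proof -
  interpret HP: left_module "opp A" "hom_dual A P" using P by (rule left_module_hom_dual)
  interpret HQ: left_module "opp A" "hom_dual A Q" using Q by (rule left_module_hom_dual)
  have c: "dual_map P f h \<in> carrier (hom_dual A P)" if "h \<in> carrier (hom_dual A Q)" for h
    unfolding dual_map_def using that
    by (intro restrict_hom_dual[OF P] lin_comp[OF f]) (simp add: hom_dual_carrier)
  show ?thesis
  proof (rule linI)
    show "dual_map P f (g \<oplus>\<^bsub>hom_dual A Q\<^esub> h) = dual_map P f g \<oplus>\<^bsub>hom_dual A P\<^esub> dual_map P f h"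
      if "g \<in> carrier (hom_dual A Q)" "h \<in> carrier (hom_dual A Q)" for g h
      using that c lin_closed[OF f]
      by (intro hom_dual_ext[of _ A P]) (auto simp: dual_map_apply hom_dual_add)
    show "dual_map P f (a \<odot>\<^bsub>hom_dual A Q\<^esub> h) = a \<odot>\<^bsub>hom_dual A P\<^esub> dual_map P f h"
      if "a \<in> carrier (opp A)" "h \<in> carrier (hom_dual A Q)" for a h
      using that c lin_closed[OF f] HP.smult_closed HQ.smult_closed
      by (intro hom_dual_ext[of _ A P]) (auto simp: dual_map_apply hom_dual_smult)
  qed (rule c)
qed

end

section \<open>Rigid presentations\<close>

context fd_algebra
begin

definition presentation ::
  "('a, 'q) module \<Rightarrow> ('q \<Rightarrow> 'p) \<Rightarrow> ('a, 'p) module \<Rightarrow> ('p \<Rightarrow> 'm) \<Rightarrow> ('a, 'm) module \<Rightarrow> bool" where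
  "presentation P1 f P0 g M \<longleftrightarrow> projective A P1 \<and> projective A P0 \<and> lin A P1 P0 f \<and> lin A P0 M g \<and>
    g ` carrier P0 = carrier M \<and> (\<forall>x\<in>carrier P0. g x = \<zero>\<^bsub>M\<^esub> \<longleftrightarrow> x \<in> f ` carrier P1)"

text \<open>
  Lifting maps \<open>P1 \<rightarrow> M\<close> to \<open>P0\<close>, this says that every map \<open>P1 \<rightarrow> P0\<close> has the form \<open>v f + f w\<close>: the
  presentation, seen as a complex in two degrees, has no nonzero map to its shift up to homotopy.
\<close>

definition rigid_presentation ::
  "('a, 'q) module \<Rightarrow> ('q \<Rightarrow> 'p) \<Rightarrow> ('a, 'p) module \<Rightarrow> ('p \<Rightarrow> 'm) \<Rightarrow> ('a, 'm) module \<Rightarrow> bool" where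
  "rigid_presentation P1 f P0 g M \<longleftrightarrow> presentation P1 f P0 g M \<and>
    (\<forall>u. lin A P1 M u \<longrightarrow> (\<exists>v. lin A P0 M v \<and> (\<forall>y\<in>carrier P1. u y = v (f y))))"

definition minimal_presentation ::
  "('a, 'q) module \<Rightarrow> ('q \<Rightarrow> 'p) \<Rightarrow> ('a, 'p) module \<Rightarrow> ('p \<Rightarrow> 'm) \<Rightarrow> ('a, 'm) module \<Rightarrow> bool" where
  "minimal_presentation P1 f P0 g M \<longleftrightarrow>
    cover P0 g M \<and> cover P1 f (P0\<lparr>carrier := a_kernel P0 M g\<rparr>)"

lemma cover_essential: "cover P g M \<Longrightarrow> submodule N A P \<Longrightarrow> g ` N = carrier M \<Longrightarrow> N = carrier P"
  unfolding cover_def by blast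

lemma cover_cong:
  assumes "cover P g M" "\<And>x. x \<in> carrier P \<Longrightarrow> g x = g' x"
  shows "cover P g' M"
proof -
  have i: "g ` N = g' ` N" if "N \<subseteq> carrier P" for N
    using assms(2) that by (intro image_cong) auto
  have "lin A P M g'" using assms
    by (intro lin_cong[of A P M g g'] projective_left_module) (auto simp: cover_def)
  then show ?thesis using assms(1) i[OF order.refl] i[OF submodule_subset[of _ A P]]
    unfolding cover_def by metis
qed

lemma min_proj_presentation_minimal: "min_proj_presentation A P1 f P0 g M \<Longrightarrow> minimal_presentation P1 f P0 g M"
  by (simp add: min_proj_presentation_def minimal_presentation_def projective_cover_iff)

lemma minimal_presentation_presentation:
  assumes "minimal_presentation P1 f P0 g M"
  shows "presentation P1 f P0 g M"
proof -
  have c0: "cover P0 g M" and c1: "cover P1 f (P0\<lparr>carrier := a_kernel P0 M g\<rparr>)"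
    using assms by (auto simp: minimal_presentation_def)
  have k: "a_kernel P0 M g \<subseteq> carrier P0" by (auto simp: a_kernel_eq)
  have "lin A P1 P0 f" "f ` carrier P1 = a_kernel P0 M g"
    using c1 lin_restr_cod_iff[OF k] by (auto simp: cover_def)
  then show ?thesis using c0 c1 by (auto simp: presentation_def cover_def a_kernel_eq)
qed

lemma ex_min_proj_presentation:
  fixes M :: "('a, 'm) module"
  assumes M: "fg_module A M"
  shows "\<exists>(P1 :: ('k, 'a) std_module) f (P0 :: ('k, 'a) std_module) g. min_proj_presentation A P1 f P0 g M"
proof -
  obtain P0 :: "('k, 'a) std_module" and g' where g': "cover P0 g' M" using ex_cover[OF M] by blast
  define g where "g = restrict g' (carrier P0)"
  have g: "cover P0 g M" using cover_cong[OF g', of g] by (simp add: g_def)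
  then have pP: "projective A P0" and gl: "lin A P0 M g" by (auto simp: cover_def)
  let ?k = "P0\<lparr>carrier := a_kernel P0 M g\<rparr>"
  have "fg_module A ?k"
    using projective_fg[OF pP] fg_moduleD[OF M] gl projective_left_module[OF pP]
    by (intro fg_module_submodule submodule_kernel)
  then obtain P1 :: "('k, 'a) std_module" and f' where f': "cover P1 f' ?k" using ex_cover by blast
  have f: "cover P1 (restrict f' (carrier P1)) ?k" using cover_cong[OF f'] by simp
  have "projective_cover A P0 g M" "projective_cover A P1 (restrict f' (carrier P1)) ?k"
    using f g by (simp_all add: projective_cover_iff g_def)
  then show ?thesis unfolding min_proj_presentation_def by blast
qed

text \<open>
  The image of \<open>e\<close> is mapped onto \<open>M\<close>, so \<open>e\<close> is onto because \<open>g\<close> is essential, and a surjective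
  endomorphism of a module of finite length is bijective.
\<close>

lemma cover_endo_bij:
  assumes c: "cover P g M" and e: "lin A P P e" and ge: "\<And>p. p \<in> carrier P \<Longrightarrow> g (e p) = g p"
  shows "e ` carrier P = carrier P" "inj_on e (carrier P)"
proof -
  have P: "projective A P" and gs: "g ` carrier P = carrier M" using c by (auto simp: cover_def)
  have lP: "left_module A P" using P by (rule projective_left_module)
  have "g ` e ` carrier P = carrier M" using ge gs by (simp add: image_image)
  then show s: "e ` carrier P = carrier P"
    by (rule cover_essential[OF c submodule_image[OF lP lP e submodule_carrier[OF lP]]])
  show "inj_on e (carrier P)" using projective_fg[OF P] e s by (rule surj_endo_inj)
qed

text \<open>
  Comparing the two presentations in both directions gives an endomorphism \<open>(e1, e0)\<close> of the minimal
  one over the identity of \<open>M\<close>; by minimality both components are bijective, so the factorization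
  through \<open>f\<close> can be carried over.
\<close>

lemma rigid_presentation_minimal:
  fixes Q1 :: "('a, 'q1) module" and Q0 :: "('a, 'q0) module" and M :: "('a, 'm) module"
  assumes r: "rigid_presentation P1 f P0 g M" and m: "minimal_presentation Q1 fq Q0 gq M" and lM: "left_module A M"
  shows "rigid_presentation Q1 fq Q0 gq M"
proof -
  have q: "presentation Q1 fq Q0 gq M" using m by (rule minimal_presentation_presentation)
  have p: "presentation P1 f P0 g M" using r by (simp add: rigid_presentation_def)
  note p' = p[unfolded presentation_def] and q' = q[unfolded presentation_def]
  have P1: "projective A P1" and P0: "projective A P0" and f: "lin A P1 P0 f" and g: "lin A P0 M g"
    and gs: "g ` carrier P0 = carrier M" and gk: "\<And>x. x \<in> carrier P0 \<Longrightarrow> g x = \<zero>\<^bsub>M\<^esub> \<longleftrightarrow> x \<in> f ` carrier P1"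
    using p' by auto
  have Q1: "projective A Q1" and Q0: "projective A Q0" and fq: "lin A Q1 Q0 fq" and gq: "lin A Q0 M gq"
    and gqs: "gq ` carrier Q0 = carrier M" and gqk: "\<And>x. x \<in> carrier Q0 \<Longrightarrow> gq x = \<zero>\<^bsub>M\<^esub> \<longleftrightarrow> x \<in> fq ` carrier Q1"
    using q' by auto
  note lm = projective_left_module[OF P1] projective_left_module[OF P0]
    projective_left_module[OF Q1] projective_left_module[OF Q0]
  obtain b0 where b0: "lin A Q0 P0 b0" "\<And>x. x \<in> carrier Q0 \<Longrightarrow> g (b0 x) = gq x"
    using projective_lift[OF Q0 lm(2) lM g gq] gs lin_closed[OF gq] by metis
  obtain a0 where a0: "lin A P0 Q0 a0" "\<And>x. x \<in> carrier P0 \<Longrightarrow> gq (a0 x) = g x"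
    using projective_lift[OF P0 lm(4) lM gq g] gqs lin_closed[OF g] by metis
  have "b0 (fq y) \<in> f ` carrier P1" if "y \<in> carrier Q1" for y
    using that lin_closed[OF fq that] b0(2)[of "fq y"] gqk[of "fq y"] gk[of "b0 (fq y)"] lin_closed[OF b0(1)] by auto
  then obtain b1 where b1: "lin A Q1 P1 b1" "\<And>y. y \<in> carrier Q1 \<Longrightarrow> f (b1 y) = b0 (fq y)"
    using projective_lift[OF Q1 lm(1) lm(2) f lin_comp[OF fq b0(1)]] by metis
  have "a0 (f y) \<in> fq ` carrier Q1" if "y \<in> carrier P1" for y
    using that lin_closed[OF f that] a0(2)[of "f y"] gk[of "f y"] gqk[of "a0 (f y)"] lin_closed[OF a0(1)] by auto
  then obtain a1 where a1: "lin A P1 Q1 a1" "\<And>y. y \<in> carrier P1 \<Longrightarrow> fq (a1 y) = a0 (f y)"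
    using projective_lift[OF P1 lm(3) lm(4) fq lin_comp[OF f a0(1)]] by metis
  define e0 where "e0 x = a0 (b0 x)" for x
  define e1 where "e1 x = a1 (b1 x)" for x
  have e0: "lin A Q0 Q0 e0" unfolding e0_def using b0(1) a0(1) by (rule lin_comp)
  have e1: "lin A Q1 Q1 e1" unfolding e1_def using b1(1) a1(1) by (rule lin_comp)
  have ge: "gq (e0 x) = gq x" if "x \<in> carrier Q0" for x
    using that a0(2) b0(2) lin_closed[OF b0(1)] by (simp add: e0_def)
  have fe: "fq (e1 y) = e0 (fq y)" if "y \<in> carrier Q1" for y
    using that a1(2) b1(2) lin_closed[OF b1(1)] by (simp add: e0_def e1_def)
  have c0: "cover Q0 gq M" and c1: "cover Q1 fq (Q0\<lparr>carrier := a_kernel Q0 M gq\<rparr>)"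
    using m by (auto simp: minimal_presentation_def)
  note s0 = cover_endo_bij[OF c0 e0 ge]
  have ker: "a_kernel Q0 M gq = fq ` carrier Q1" using gqk lin_closed[OF fq] by (auto simp: a_kernel_eq)
  have "fq ` e1 ` carrier Q1 = fq ` carrier Q1"
  proof
    show "fq ` e1 ` carrier Q1 \<subseteq> fq ` carrier Q1" using lin_closed[OF e1] by blast
    show "fq ` carrier Q1 \<subseteq> fq ` e1 ` carrier Q1"
    proof
      fix z assume z: "z \<in> fq ` carrier Q1"
      then have zc: "z \<in> carrier Q0" using lin_closed[OF fq] by auto
      then have "z \<in> e0 ` carrier Q0" using s0(1) by simp
      then obtain x where x: "e0 x = z" "x \<in> carrier Q0" by auto
      then have "gq x = \<zero>\<^bsub>M\<^esub>" using ge[OF x(2)] gqk[OF zc] z x(1) by simp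
      then have "x \<in> fq ` carrier Q1" using gqk[OF x(2)] by simp
      then obtain y where "y \<in> carrier Q1" "x = fq y" by auto
      then have "z = fq (e1 y)" "e1 y \<in> e1 ` carrier Q1" using fe x(1) by auto
      then show "z \<in> fq ` e1 ` carrier Q1" by blast
    qed
  qed
  then have s1: "e1 ` carrier Q1 = carrier Q1"
    by (intro cover_essential[OF c1 submodule_image[OF lm(3) lm(3) e1 submodule_carrier[OF lm(3)]]])
      (simp add: ker)
  let ?i = "inv_into (carrier Q0) e0"
  have i: "lin A Q0 Q0 ?i" using s0 by (intro lin_inv[OF lm(4) e0])
  have "\<exists>v. lin A Q0 M v \<and> (\<forall>y\<in>carrier Q1. u y = v (fq y))" if u: "lin A Q1 M u" for u
  proof -
    obtain v where v: "lin A P0 M v" "\<And>y. y \<in> carrier P1 \<Longrightarrow> u (a1 y) = v (f y)"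
      using r lin_comp[OF a1(1) u] unfolding rigid_presentation_def by metis
    have "u y = v (b0 (?i (fq y)))" if "y \<in> carrier Q1" for y
    proof -
      have "y \<in> e1 ` carrier Q1" using that s1 by simp
      then obtain z where z: "y = e1 z" "z \<in> carrier Q1" by (rule imageE)
      have "u y = v (f (b1 z))" using z v(2) lin_closed[OF b1(1)] by (simp add: e1_def)
      also have "f (b1 z) = b0 (fq z)" using z by (simp add: b1)
      also have "fq z = ?i (fq y)" using z fe s0(2) lin_closed[OF fq] by simp
      finally show ?thesis .
    qed
    then show ?thesis using lin_comp[OF lin_comp[OF i b0(1)] v(1)] by blast
  qed
  then show ?thesis using q by (simp add: rigid_presentation_def)
qed

section \<open>The Auslander-Reiten translation\<close>

lemma submodule_dual_image:
  fixes P1 :: "('a, 'q) module" and P0 :: "('a, 'p) module"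
  assumes P1: "left_module A P1" and P0: "left_module A P0" and f: "lin A P1 P0 f"
  shows "submod (opp A) (hom_dual A P1) (hom_dual_map A P1 f P0 ` carrier (hom_dual A P0))"
proof (rule submodI)
  show "left_module (opp A) (hom_dual A P1)" using P1 by (rule left_module_hom_dual)
  have "hom_dual_map A P1 f P0 ` carrier (hom_dual A P0) = dual_map P1 f ` carrier (hom_dual A P0)"
    by (rule image_cong) (simp_all add: hom_dual_map_eq)
  then show "submodule (hom_dual_map A P1 f P0 ` carrier (hom_dual A P0)) (opp A) (hom_dual A P1)"
    using submodule_image[OF left_module_hom_dual[OF P0] left_module_hom_dual[OF P1] lin_dual_map[OF P1 P0 f]
        submodule_carrier[OF left_module_hom_dual[OF P0]]] by simp
qed

lemma lin_dual_eval:
  fixes P :: "('a, 'm) module"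
  assumes "x \<in> carrier P"
  shows "lin (opp A) (hom_dual A P) (regular (opp A)) (\<lambda>h. h x)"
  by (rule linI) (use assms lin_closed[of A P "regular A"] in \<open>auto simp: hom_dual_add hom_dual_smult hom_dual_carrier\<close>)

text \<open>Vectors and coordinate forms exchange their roles.\<close>

lemma dual_basis_dual:
  fixes P :: "('a, 'm) module"
  assumes P: "left_module A P" and d: "dual_basis A P I x \<phi>"
  shows "dual_basis (opp A) (hom_dual A P) I (\<lambda>i. restrict (\<phi> i) (carrier P)) (\<lambda>i h. h (x i))"
proof -
  let ?H = "hom_dual A P" and ?X = "\<lambda>i. restrict (\<phi> i) (carrier P)"
  interpret H: left_module "opp A" ?H using P by (rule left_module_hom_dual)
  have I: "finite I" using d by (simp add: dual_basis_def)
  have xc: "x i \<in> carrier P" and \<phi>: "lin A P (regular A) (\<phi> i)" and Xc: "?X i \<in> carrier ?H" if "i \<in> I" for i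
    using d that restrict_hom_dual[OF P] by (auto simp: dual_basis_def)
  have "h = (\<Oplus>\<^bsub>?H\<^esub>i\<in>I. h (x i) \<odot>\<^bsub>?H\<^esub> ?X i)" if h: "h \<in> carrier ?H" for h
  proof (rule hom_dual_ext[OF h])
    have hl: "lin A P (regular A) h" using h by (simp add: hom_dual_carrier)
    have hc: "h (x i) \<in> carrier A" if "i \<in> I" for i using lin_closed[OF hl xc[OF that]] by simp
    have c: "h (x i) \<odot>\<^bsub>?H\<^esub> ?X i \<in> carrier ?H" if "i \<in> I" for i
      using H.smult_closed[of "h (x i)" "?X i"] hc[OF that] Xc[OF that] by simp
    then show "(\<Oplus>\<^bsub>?H\<^esub>i\<in>I. h (x i) \<odot>\<^bsub>?H\<^esub> ?X i) \<in> carrier ?H" by (intro H.M.finsum_closed funcsetI)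
    fix p assume p: "p \<in> carrier P"
    have "(\<Oplus>\<^bsub>?H\<^esub>i\<in>I. h (x i) \<odot>\<^bsub>?H\<^esub> ?X i) p = (\<Oplus>\<^bsub>A\<^esub>i\<in>I. (h (x i) \<odot>\<^bsub>?H\<^esub> ?X i) p)"
      using p c I lin_closed[of A P "regular A"]
      by (intro additive_finsum[OF H.M.abelian_group_axioms A.abelian_group_axioms, where h = "\<lambda>h. h p"])
        (simp_all add: hom_dual_add hom_dual_carrier)
    also have "\<dots> = (\<Oplus>\<^bsub>A\<^esub>i\<in>I. \<phi> i p \<otimes>\<^bsub>A\<^esub> h (x i))"
      using p lin_closed[OF \<phi> p] hc by (intro A.finsum_cong') (simp_all add: hom_dual_smult)
    also have "\<dots> = h p" using dual_basis_expand[OF P reg d hl p] by simp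
    finally show "h p = (\<Oplus>\<^bsub>?H\<^esub>i\<in>I. h (x i) \<odot>\<^bsub>?H\<^esub> ?X i) p" by simp
  qed
  then show ?thesis using I Xc lin_dual_eval[OF xc] by (simp add: dual_basis_def)
qed

text \<open>
  The pairings \<open>M \<times> Hom\<^sub>A(P1, A) \<rightarrow> K\<close> considered here are the additive maps to \<open>K\<close> on
  \<open>Hom\<^sub>A(P1, A) \<otimes>\<^sub>A M = Hom\<^sub>A(P1, M)\<close>, the element \<open>h \<otimes> m\<close> being the map \<open>x \<mapsto> h x m\<close>. Such a map vanishes
  if it vanishes on the maps that factor through \<open>f\<close> and all maps do.
\<close>

lemma pairing_vanishes:
  fixes M :: "('a, 'm) module"
  assumes r: "rigid_presentation P1 f P0 g M" and M: "left_module A M"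
    and c: "\<And>m h. m \<in> carrier M \<Longrightarrow> h \<in> carrier (hom_dual A P1) \<Longrightarrow> \<beta> m h \<in> carrier K"
    and am: "\<And>m m' h. m \<in> carrier M \<Longrightarrow> m' \<in> carrier M \<Longrightarrow> h \<in> carrier (hom_dual A P1) \<Longrightarrow>
      \<beta> (m \<oplus>\<^bsub>M\<^esub> m') h = \<beta> m h \<oplus>\<^bsub>K\<^esub> \<beta> m' h"
    and ah: "\<And>m h h'. m \<in> carrier M \<Longrightarrow> h \<in> carrier (hom_dual A P1) \<Longrightarrow> h' \<in> carrier (hom_dual A P1) \<Longrightarrow>
      \<beta> m (h \<oplus>\<^bsub>hom_dual A P1\<^esub> h') = \<beta> m h \<oplus>\<^bsub>K\<^esub> \<beta> m h'"
    and bal: "\<And>a m h. a \<in> carrier A \<Longrightarrow> m \<in> carrier M \<Longrightarrow> h \<in> carrier (hom_dual A P1) \<Longrightarrow>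
      \<beta> (a \<odot>\<^bsub>M\<^esub> m) h = \<beta> m (a \<odot>\<^bsub>hom_dual A P1\<^esub> h)"
    and van: "\<And>m h. m \<in> carrier M \<Longrightarrow> h \<in> carrier (hom_dual A P0) \<Longrightarrow> \<beta> m (dual_map P1 f h) = \<zero>\<^bsub>K\<^esub>"
    and m: "m \<in> carrier M" and h: "h \<in> carrier (hom_dual A P1)"
  shows "\<beta> m h = \<zero>\<^bsub>K\<^esub>"
proof -
  let ?H = "hom_dual A P1"
  have P1: "projective A P1" and P0: "projective A P0" and f: "lin A P1 P0 f"
    using r by (auto simp: rigid_presentation_def presentation_def)
  have l1: "left_module A P1" and l0: "left_module A P0" using P1 P0 by (auto intro: projective_left_module)
  interpret P1: left_module A P1 by fact
  interpret P0: left_module A P0 by fact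
  interpret M: left_module A M by fact
  interpret H: left_module "opp A" ?H using l1 by (rule left_module_hom_dual)
  have hl: "lin A P1 (regular A) h" using h by (simp add: hom_dual_carrier)
  obtain n1 :: nat and x \<xi> where d1: "dual_basis A P1 {..<n1} x \<xi>" using projective_dual_basis[OF P1] by blast
  obtain n0 :: nat and y \<psi> where d0: "dual_basis A P0 {..<n0} y \<psi>" using projective_dual_basis[OF P0] by blast
  let ?X = "\<lambda>j. restrict (\<xi> j) (carrier P1)" and ?Y = "\<lambda>i. restrict (\<psi> i) (carrier P0)"
  have xc: "x j \<in> carrier P1" and \<xi>: "lin A P1 (regular A) (\<xi> j)" and Xc: "?X j \<in> carrier ?H" if "j < n1" for j
    using d1 that restrict_hom_dual[OF l1] by (auto simp: dual_basis_def)
  have yc: "y i \<in> carrier P0" and \<psi>: "lin A P0 (regular A) (\<psi> i)" and Yc: "?Y i \<in> carrier (hom_dual A P0)" if "i < n0" for i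
    using d0 that restrict_hom_dual[OF l0] by (auto simp: dual_basis_def)
  have \<beta>h: "\<beta> m (\<Oplus>\<^bsub>?H\<^esub>i\<in>I. t i) = (\<Oplus>\<^bsub>K\<^esub>i\<in>I. \<beta> m (t i))"
    if "m \<in> carrier M" "finite I" "\<And>i. i \<in> I \<Longrightarrow> t i \<in> carrier ?H" for m t and I :: "nat set"
    using that ah c by (intro additive_finsum[OF H.M.abelian_group_axioms K.abelian_group_axioms]) auto
  have \<beta>m: "\<beta> (\<Oplus>\<^bsub>M\<^esub>i\<in>I. t i) h = (\<Oplus>\<^bsub>K\<^esub>i\<in>I. \<beta> (t i) h)"
    if "h \<in> carrier ?H" "finite I" "\<And>i. i \<in> I \<Longrightarrow> t i \<in> carrier M" for h t and I :: "nat set"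
    using that am c by (intro additive_finsum[OF M.M.abelian_group_axioms K.abelian_group_axioms, where h = "\<lambda>m. \<beta> m h"]) auto
  have expand: "k = (\<Oplus>\<^bsub>?H\<^esub>j\<in>{..<n1}. k (x j) \<odot>\<^bsub>?H\<^esub> ?X j)" if k: "k \<in> carrier ?H" for k
    using dual_basis_dual[OF l1 d1] k by (simp add: dual_basis_def)
  have "lin A P1 M (\<lambda>p. h p \<odot>\<^bsub>M\<^esub> m)" using M hl m by (rule lin_smult_const)
  then obtain v where v: "lin A P0 M v" "\<And>p. p \<in> carrier P1 \<Longrightarrow> h p \<odot>\<^bsub>M\<^esub> m = v (f p)"
    using r unfolding rigid_presentation_def by metis
  have hc: "h (x j) \<in> carrier A" if "j < n1" for j using lin_closed[OF hl xc[OF that]] by simp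
  have fx: "f (x j) \<in> carrier P0" if "j < n1" for j using lin_closed[OF f xc[OF that]] .
  have \<psi>f: "\<psi> i (f (x j)) \<in> carrier A" if "i < n0" "j < n1" for i j
    using lin_closed[OF \<psi>[OF that(1)] fx[OF that(2)]] by simp
  have vy: "v (y i) \<in> carrier M" if "i < n0" for i using lin_closed[OF v(1) yc[OF that]] .
  have yf: "dual_map P1 f (?Y i) \<in> carrier ?H" if "i < n0" for i
    using lin_closed[OF lin_dual_map[OF l1 l0 f] Yc[OF that]] .
  have sc: "\<psi> i (f (x j)) \<odot>\<^bsub>?H\<^esub> ?X j \<in> carrier ?H" if "i < n0" "j < n1" for i j
    using H.smult_closed[of "\<psi> i (f (x j))" "?X j"] \<psi>f[OF that] Xc[OF that(2)] by simp
  have hs: "h (x j) \<odot>\<^bsub>?H\<^esub> ?X j \<in> carrier ?H" if "j < n1" for j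
    using H.smult_closed[of "h (x j)" "?X j"] hc[OF that] Xc[OF that] by simp
  \<comment> \<open>Expanding \<open>h\<close> in the dual basis of \<open>P1\<close>, using \<open>h p m = v (f p)\<close> and expanding \<open>v\<close> in that of \<open>P0\<close>
    leaves values of \<open>\<beta>\<close> at \<open>\<psi> i \<circ> f\<close>, where it vanishes.\<close>
  have "\<beta> m h = \<beta> m (\<Oplus>\<^bsub>?H\<^esub>j\<in>{..<n1}. h (x j) \<odot>\<^bsub>?H\<^esub> ?X j)"
    using expand[OF h] by (rule arg_cong)
  also have "\<dots> = (\<Oplus>\<^bsub>K\<^esub>j\<in>{..<n1}. \<beta> m (h (x j) \<odot>\<^bsub>?H\<^esub> ?X j))"
    using m hs by (intro \<beta>h) auto
  also have "\<dots> = (\<Oplus>\<^bsub>K\<^esub>j\<in>{..<n1}. \<Oplus>\<^bsub>K\<^esub>i\<in>{..<n0}. \<beta> (v (y i)) (\<psi> i (f (x j)) \<odot>\<^bsub>?H\<^esub> ?X j))"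
  proof (rule K.finsum_cong'[OF refl])
    show "(\<lambda>j. \<Oplus>\<^bsub>K\<^esub>i\<in>{..<n0}. \<beta> (v (y i)) (\<psi> i (f (x j)) \<odot>\<^bsub>?H\<^esub> ?X j)) \<in> {..<n1} \<rightarrow> carrier K"
      using c vy sc by (auto intro!: K.finsum_closed)
    fix j assume j': "j \<in> {..<n1}"
    then have j: "j < n1" by simp
    have "\<beta> m (h (x j) \<odot>\<^bsub>?H\<^esub> ?X j) = \<beta> (v (f (x j))) (?X j)"
      using bal[OF hc[OF j] m Xc[OF j]] v(2)[OF xc[OF j]] by simp
    also have "v (f (x j)) = (\<Oplus>\<^bsub>M\<^esub>i\<in>{..<n0}. \<psi> i (f (x j)) \<odot>\<^bsub>M\<^esub> v (y i))"
      by (rule dual_basis_expand[OF l0 M d0 v(1) fx[OF j]])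
    also have "\<beta> \<dots> (?X j) = (\<Oplus>\<^bsub>K\<^esub>i\<in>{..<n0}. \<beta> (\<psi> i (f (x j)) \<odot>\<^bsub>M\<^esub> v (y i)) (?X j))"
      using Xc[OF j] \<psi>f[OF _ j] vy by (intro \<beta>m) (auto intro: M.smult_closed)
    also have "\<dots> = (\<Oplus>\<^bsub>K\<^esub>i\<in>{..<n0}. \<beta> (v (y i)) (\<psi> i (f (x j)) \<odot>\<^bsub>?H\<^esub> ?X j))"
      using Xc[OF j] \<psi>f[OF _ j] vy c sc[OF _ j] by (intro K.finsum_cong') (auto simp: bal)
    finally show "\<beta> m (h (x j) \<odot>\<^bsub>?H\<^esub> ?X j) = (\<Oplus>\<^bsub>K\<^esub>i\<in>{..<n0}. \<beta> (v (y i)) (\<psi> i (f (x j)) \<odot>\<^bsub>?H\<^esub> ?X j))" .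
  qed
  also have "\<dots> = (\<Oplus>\<^bsub>K\<^esub>i\<in>{..<n0}. \<Oplus>\<^bsub>K\<^esub>j\<in>{..<n1}. \<beta> (v (y i)) (\<psi> i (f (x j)) \<odot>\<^bsub>?H\<^esub> ?X j))"
    using c vy sc by (intro finsum_swap[OF K.abelian_monoid_axioms]) auto
  also have "\<dots> = (\<Oplus>\<^bsub>K\<^esub>i\<in>{..<n0}. \<zero>\<^bsub>K\<^esub>)"
  proof (rule K.finsum_cong'[OF refl])
    fix i assume i': "i \<in> {..<n0}"
    then have i: "i < n0" by simp
    have "(\<Oplus>\<^bsub>K\<^esub>j\<in>{..<n1}. \<beta> (v (y i)) (\<psi> i (f (x j)) \<odot>\<^bsub>?H\<^esub> ?X j))
      = \<beta> (v (y i)) (\<Oplus>\<^bsub>?H\<^esub>j\<in>{..<n1}. \<psi> i (f (x j)) \<odot>\<^bsub>?H\<^esub> ?X j)"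
      using vy[OF i] sc[OF i] by (intro \<beta>h[symmetric]) auto
    also have "(\<Oplus>\<^bsub>?H\<^esub>j\<in>{..<n1}. \<psi> i (f (x j)) \<odot>\<^bsub>?H\<^esub> ?X j)
      = (\<Oplus>\<^bsub>?H\<^esub>j\<in>{..<n1}. dual_map P1 f (?Y i) (x j) \<odot>\<^bsub>?H\<^esub> ?X j)"
      using xc fx sc[OF i] by (intro H.M.finsum_cong') (auto simp: dual_map_apply)
    also have "\<dots> = dual_map P1 f (?Y i)" using expand[OF yf[OF i]] by simp
    also note van[OF vy[OF i] Yc[OF i]]
    finally show "(\<Oplus>\<^bsub>K\<^esub>j\<in>{..<n1}. \<beta> (v (y i)) (\<psi> i (f (x j)) \<odot>\<^bsub>?H\<^esub> ?X j)) = \<zero>\<^bsub>K\<^esub>" .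
  qed simp
  finally show ?thesis by simp
qed

definition hom_space :: "('a, 'p) module \<Rightarrow> ('a, 'm) module \<Rightarrow> ('k, 'p \<Rightarrow> 'm) module" where
  "hom_space P M = \<lparr>carrier = mod_hom A P M, monoid.mult = undefined, one = undefined,
    zero = (\<lambda>x\<in>carrier P. \<zero>\<^bsub>M\<^esub>), add = (\<lambda>g h. \<lambda>x\<in>carrier P. g x \<oplus>\<^bsub>M\<^esub> h x),
    smult = (\<lambda>c g. \<lambda>x\<in>carrier P. scal c \<odot>\<^bsub>M\<^esub> g x)\<rparr>"

lemma hom_space_carrier: "h \<in> carrier (hom_space P M) \<longleftrightarrow> lin A P M h \<and> h \<in> extensional (carrier P)"
  by (simp add: hom_space_def mod_hom_iff_lin)

lemma hom_space_ext:
  "h \<in> carrier (hom_space P M) \<Longrightarrow> h' \<in> carrier (hom_space P M) \<Longrightarrow> (\<And>x. x \<in> carrier P \<Longrightarrow> h x = h' x) \<Longrightarrow> h = h'"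
  by (auto simp: hom_space_carrier intro: extensionalityI)

lemma hom_space_zero: "x \<in> carrier P \<Longrightarrow> \<zero>\<^bsub>hom_space P M\<^esub> x = \<zero>\<^bsub>M\<^esub>"
  and hom_space_add: "x \<in> carrier P \<Longrightarrow> (g \<oplus>\<^bsub>hom_space P M\<^esub> h) x = g x \<oplus>\<^bsub>M\<^esub> h x"
  and hom_space_smult: "x \<in> carrier P \<Longrightarrow> (c \<odot>\<^bsub>hom_space P M\<^esub> h) x = scal c \<odot>\<^bsub>M\<^esub> h x"
  by (simp_all add: hom_space_def)

lemma restrict_hom_space:
  "left_module A P \<Longrightarrow> lin A P M h \<Longrightarrow> restrict h (carrier P) \<in> carrier (hom_space P M)"
  using restrict_mod_hom[of A P M h] by (simp add: hom_space_def)

lemma lin_scal: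
  assumes M: "left_module A M" and c: "c \<in> carrier K"
  shows "lin A M M (\<lambda>x. scal c \<odot>\<^bsub>M\<^esub> x)"
proof -
  interpret M: left_module A M by fact
  show ?thesis
  proof (rule linI)
    show "scal c \<odot>\<^bsub>M\<^esub> (a \<odot>\<^bsub>M\<^esub> x) = a \<odot>\<^bsub>M\<^esub> (scal c \<odot>\<^bsub>M\<^esub> x)" if "a \<in> carrier A" "x \<in> carrier M" for a x
      using that c by (simp add: scal_mult mult_scal flip: M.smult_assoc)
  qed (use c in \<open>simp_all add: M.smult_closed M.smult_r_distr\<close>)
qed

lemma left_module_hom_space:
  fixes P :: "('a, 'p) module" and M :: "('a, 'm) module"
  assumes P: "left_module A P" and M: "left_module A M"
  shows "left_module K (hom_space P M)"
proof -
  interpret P: left_module A P by fact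
  interpret M: left_module A M by fact
  let ?H = "hom_space P M"
  have lc: "lin A P M h" if "h \<in> carrier ?H" for h using that by (simp add: hom_space_carrier)
  have vc: "h x \<in> carrier M" if "h \<in> carrier ?H" "x \<in> carrier P" for h x
    using lin_closed[OF lc[OF that(1)] that(2)] .
  have z: "\<zero>\<^bsub>?H\<^esub> \<in> carrier ?H"
    using restrict_hom_space[OF P, of M "\<lambda>x. \<zero>\<^bsub>M\<^esub>"] by (auto simp: hom_space_def lin_def smult_zero[OF M])
  have a: "g \<oplus>\<^bsub>?H\<^esub> h \<in> carrier ?H" if "g \<in> carrier ?H" "h \<in> carrier ?H" for g h
    using restrict_hom_space[OF P lin_plus[OF M lc[OF that(1)] lc[OF that(2)]]] by (simp add: hom_space_def)
  have s: "c \<odot>\<^bsub>?H\<^esub> h \<in> carrier ?H" if "c \<in> carrier K" "h \<in> carrier ?H" for c h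
    using restrict_hom_space[OF P lin_comp[OF lc[OF that(2)] lin_scal[OF M that(1)]]] by (simp add: hom_space_def)
  have n: "\<exists>g\<in>carrier ?H. g \<oplus>\<^bsub>?H\<^esub> h = \<zero>\<^bsub>?H\<^esub>" if h: "h \<in> carrier ?H" for h
  proof
    have "(\<ominus>\<^bsub>K\<^esub> \<one>\<^bsub>K\<^esub>) \<odot>\<^bsub>A\<^esub> \<one>\<^bsub>A\<^esub> = \<ominus>\<^bsub>A\<^esub> \<one>\<^bsub>A\<^esub>" using smult_l_minus[of "\<one>\<^bsub>K\<^esub>" "\<one>\<^bsub>A\<^esub>"] by simp
    then have e: "scal (\<ominus>\<^bsub>K\<^esub> \<one>\<^bsub>K\<^esub>) = \<ominus>\<^bsub>A\<^esub> \<one>\<^bsub>A\<^esub>" by (simp add: scal_def)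
    show g: "(\<ominus>\<^bsub>K\<^esub> \<one>\<^bsub>K\<^esub>) \<odot>\<^bsub>?H\<^esub> h \<in> carrier ?H" using h by (intro s) auto
    show "(\<ominus>\<^bsub>K\<^esub> \<one>\<^bsub>K\<^esub>) \<odot>\<^bsub>?H\<^esub> h \<oplus>\<^bsub>?H\<^esub> h = \<zero>\<^bsub>?H\<^esub>"
      using g h z a vc by (intro hom_space_ext[of _ P M])
        (simp_all add: hom_space_add hom_space_zero hom_space_smult e smult_zero[OF M] M.M.l_neg)
  qed
  have ag: "abelian_group ?H"
  proof (rule abelian_groupI)
    fix x y w assume xyw: "x \<in> carrier ?H" "y \<in> carrier ?H" "w \<in> carrier ?H"
    show "x \<oplus>\<^bsub>?H\<^esub> y \<oplus>\<^bsub>?H\<^esub> w = x \<oplus>\<^bsub>?H\<^esub> (y \<oplus>\<^bsub>?H\<^esub> w)" "x \<oplus>\<^bsub>?H\<^esub> y = y \<oplus>\<^bsub>?H\<^esub> x"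
      by (rule hom_space_ext[of _ P M]; simp add: xyw a hom_space_add vc M.M.a_ac)+
  next
    fix x assume x: "x \<in> carrier ?H"
    show "\<zero>\<^bsub>?H\<^esub> \<oplus>\<^bsub>?H\<^esub> x = x"
      by (rule hom_space_ext[of _ P M]) (simp_all add: x a z hom_space_add hom_space_zero vc)
  qed (fact a z n)+
  show ?thesis
    by (intro left_module.intro left_module_axioms.intro ag K.ring_axioms)
      ((simp add: s)?; rule hom_space_ext[of _ P M];
        simp add: a z s hom_space_add hom_space_zero hom_space_smult vc M.smult_l_distr M.smult_r_distr
          M.smult_assoc scal_add scal_scal scal_one M.smult_one M.smult_closed)+
qed

text \<open>
  A map \<open>\<theta>\<close> from \<open>M\<close> to the dual of the cokernel is the pairing of \<open>m\<close> and \<open>h\<close> given by applying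
  \<open>\<theta> m\<close> to the class of \<open>h\<close>.
\<close>

lemma hom_translate_zero:
  fixes P1 :: "('a, 'q) module" and P0 :: "('a, 'p) module" and M :: "('a, 'm) module"
  assumes r: "rigid_presentation P1 f P0 g M" and M: "left_module A M"
  defines "D \<equiv> k_dual K A (transpose_of A P1 f P0)"
  assumes \<theta>: "\<theta> \<in> mod_hom A M D"
  shows "\<theta> = (\<lambda>x\<in>carrier M. \<zero>\<^bsub>D\<^esub>)"
proof -
  have P1: "projective A P1" and P0: "projective A P0" and f: "lin A P1 P0 f"
    using r by (auto simp: rigid_presentation_def presentation_def)
  have l1: "left_module A P1" and l0: "left_module A P0" using P1 P0 by (auto intro: projective_left_module)
  let ?H = "hom_dual A P1" and ?I = "hom_dual_map A P1 f P0 ` carrier (hom_dual A P0)"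
  interpret S: submod "opp A" ?H ?I using l1 l0 f by (rule submodule_dual_image)
  let ?U = "quot_mod ?H ?I"
  have D: "D = k_dual K A ?U" by (simp add: D_def transpose_of_def)
  interpret U: left_module "opp A" ?U by (rule S.left_module_quot)
  have tl: "lin A M D \<theta>" using \<theta> by (simp add: mod_hom_iff_lin)
  have Dc: "\<phi> C \<in> carrier K" "C' \<in> carrier ?U \<Longrightarrow> \<phi> (C \<oplus>\<^bsub>?U\<^esub> C') = \<phi> C \<oplus>\<^bsub>K\<^esub> \<phi> C'"
    if "\<phi> \<in> carrier D" "C \<in> carrier ?U" for \<phi> C C'
    using that by (auto simp: D k_dual_def)
  have clsU: "S.cls h \<in> carrier ?U" if "h \<in> carrier ?H" for h using that by (simp add: S.quot_carrier)
  have *: "\<theta> m (S.cls h) = \<zero>\<^bsub>K\<^esub>" if m: "m \<in> carrier M" and h: "h \<in> carrier ?H" for m h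
  proof (rule pairing_vanishes[OF r M _ _ _ _ _ m h, where \<beta> = "\<lambda>m h. \<theta> m (S.cls h)"])
    fix m h assume m: "m \<in> carrier M" and h: "h \<in> carrier ?H"
    have tm: "\<theta> m \<in> carrier D" using lin_closed[OF tl m] .
    show "\<theta> m (S.cls h) \<in> carrier K" using Dc(1)[OF tm clsU[OF h]] .
    show "\<theta> (m \<oplus>\<^bsub>M\<^esub> m') (S.cls h) = \<theta> m (S.cls h) \<oplus>\<^bsub>K\<^esub> \<theta> m' (S.cls h)" if "m' \<in> carrier M" for m'
      using lin_add[OF tl m that] clsU[OF h] by (simp add: D k_dual_def)
    show "\<theta> m (S.cls (h \<oplus>\<^bsub>?H\<^esub> h')) = \<theta> m (S.cls h) \<oplus>\<^bsub>K\<^esub> \<theta> m (S.cls h')" if "h' \<in> carrier ?H" for h'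
      using Dc(2)[OF tm clsU[OF h] clsU[OF that]] h that by (simp add: S.quot_add)
    show "\<theta> (a \<odot>\<^bsub>M\<^esub> m) (S.cls h) = \<theta> m (S.cls (a \<odot>\<^bsub>?H\<^esub> h))" if "a \<in> carrier A" for a
      using lin_smult[OF tl that m] clsU[OF h] S.quot_smult[of a h] that h by (simp add: D k_dual_def)
  next
    fix m h assume m: "m \<in> carrier M" and h: "h \<in> carrier (hom_dual A P0)"
    have "dual_map P1 f h \<in> ?I" using h by (intro image_eqI[of _ _ h]) (simp_all add: hom_dual_map_eq)
    then have "S.cls (dual_map P1 f h) = \<zero>\<^bsub>?U\<^esub>" using S.cls_eq_zero_iff S.a.a_subset by (auto simp: S.quot_zero)
    moreover have "\<theta> m \<zero>\<^bsub>?U\<^esub> = \<zero>\<^bsub>K\<^esub>"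
      using Dc[OF lin_closed[OF tl m]] by (intro additive_zero[OF U.M.abelian_group_axioms K.abelian_group_axioms]) auto
    ultimately show "\<theta> m (S.cls (dual_map P1 f h)) = \<zero>\<^bsub>K\<^esub>" by simp
  qed
  have "\<theta> m = \<zero>\<^bsub>D\<^esub>" if m: "m \<in> carrier M" for m
  proof (rule extensionalityI[of _ "carrier ?U"])
    show "\<theta> m \<in> extensional (carrier ?U)" using lin_closed[OF tl m] by (simp add: D k_dual_def PiE_def)
    show "\<zero>\<^bsub>D\<^esub> \<in> extensional (carrier ?U)" by (simp add: D k_dual_def)
    fix C assume "C \<in> carrier ?U"
    then show "\<theta> m C = \<zero>\<^bsub>D\<^esub> C" using *[OF m] by (auto simp: D k_dual_def S.quot_carrier)
  qed
  then show ?thesis using \<theta> by (auto simp: mod_hom_iff_lin extensional_def fun_eq_iff)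
qed

text \<open>
  Conversely, a map \<open>u\<close> not factoring through \<open>f\<close> is separated by a linear form \<open>B\<close> on \<open>Hom\<^sub>A(P1, M)\<close>
  from those that do. Applied to the maps \<open>x \<mapsto> h x m\<close>, the form \<open>B\<close> is a pairing and thus a map from
  \<open>M\<close> to the translate. It is nonzero, because the maps \<open>x \<mapsto> h x m\<close> span \<open>Hom\<^sub>A(P1, M)\<close>.
\<close>

lemma rigid_of_hom_translate_zero:
  fixes P1 :: "('a, 'q) module" and P0 :: "('a, 'p) module" and M :: "('a, 'm) module"
  assumes p: "presentation P1 f P0 g M" and M: "left_module A M"
  defines "D \<equiv> k_dual K A (transpose_of A P1 f P0)"
  assumes zero: "mod_hom A M D \<subseteq> {\<lambda>x\<in>carrier M. \<zero>\<^bsub>D\<^esub>}"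
  shows "rigid_presentation P1 f P0 g M"
proof (rule ccontr)
  assume "\<not> rigid_presentation P1 f P0 g M"
  then obtain u where u: "lin A P1 M u" and nu: "\<And>v. lin A P0 M v \<Longrightarrow> \<exists>y\<in>carrier P1. u y \<noteq> v (f y)"
    using p unfolding rigid_presentation_def by blast
  have P1: "projective A P1" and P0: "projective A P0" and f: "lin A P1 P0 f"
    using p by (auto simp: presentation_def)
  have l1: "left_module A P1" and l0: "left_module A P0" using P1 P0 by (auto intro: projective_left_module)
  interpret M: left_module A M by fact
  let ?H = "hom_dual A P1" and ?I = "hom_dual_map A P1 f P0 ` carrier (hom_dual A P0)"
  interpret S: submod "opp A" ?H ?I using l1 l0 f by (rule submodule_dual_image)
  let ?U = "quot_mod ?H ?I" and ?V = "hom_space P1 M"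
  have D: "D = k_dual K A ?U" by (simp add: D_def transpose_of_def)
  interpret U: left_module "opp A" ?U by (rule S.left_module_quot)
  interpret V: left_module K ?V using l1 M by (rule left_module_hom_space)
  let ?W = "(\<lambda>v. \<lambda>y\<in>carrier P1. v (f y)) ` carrier (hom_space P0 M)"
  have fc: "f y \<in> carrier P0" if "y \<in> carrier P1" for y using lin_closed[OF f that] .
  have Wl: "lin K (hom_space P0 M) ?V (\<lambda>v. \<lambda>y\<in>carrier P1. v (f y))"
  proof (rule linI)
    interpret V0: left_module K "hom_space P0 M" using l0 M by (rule left_module_hom_space)
    show c: "(\<lambda>y\<in>carrier P1. v (f y)) \<in> carrier ?V" if "v \<in> carrier (hom_space P0 M)" for v
      using that by (intro restrict_hom_space[OF l1] lin_comp[OF f]) (simp add: hom_space_carrier)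
    show "(\<lambda>y\<in>carrier P1. (v \<oplus>\<^bsub>hom_space P0 M\<^esub> w) (f y)) =
      (\<lambda>y\<in>carrier P1. v (f y)) \<oplus>\<^bsub>?V\<^esub> (\<lambda>y\<in>carrier P1. w (f y))"
      if "v \<in> carrier (hom_space P0 M)" "w \<in> carrier (hom_space P0 M)" for v w
      using that c fc by (intro hom_space_ext[of _ P1 M]) (auto simp: hom_space_add)
    show "(\<lambda>y\<in>carrier P1. (a \<odot>\<^bsub>hom_space P0 M\<^esub> v) (f y)) = a \<odot>\<^bsub>?V\<^esub> (\<lambda>y\<in>carrier P1. v (f y))"
      if "a \<in> carrier K" "v \<in> carrier (hom_space P0 M)" for a v
      using that c fc V.smult_closed V0.smult_closed by (intro hom_space_ext[of _ P1 M]) (auto simp: hom_space_smult)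
  qed
  have W: "submodule ?W K ?V"
    by (intro submodule_image[OF left_module_hom_space[OF l0 M] V.left_module_axioms Wl] submodule_carrier
        left_module_hom_space l0 M)
  let ?u = "restrict u (carrier P1)"
  have uV: "?u \<in> carrier ?V" using l1 u by (rule restrict_hom_space)
  have uW: "?u \<notin> ?W"
  proof
    assume "?u \<in> ?W"
    then obtain v where v: "v \<in> carrier (hom_space P0 M)" "?u = (\<lambda>y\<in>carrier P1. v (f y))" by (elim imageE)
    have "lin A P0 M v" using v(1) by (simp add: hom_space_carrier)
    then obtain y where "y \<in> carrier P1" "u y \<noteq> v (f y)" using nu by blast
    then show False using fun_cong[OF v(2), of y] by simp
  qed
  from ex_functional[OF K.field_axioms V.left_module_axioms W uV uW]
  obtain B where B0: "\<forall>x\<in>carrier ?V. B x \<in> carrier K"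
    "\<forall>x\<in>carrier ?V. \<forall>y\<in>carrier ?V. B (x \<oplus>\<^bsub>?V\<^esub> y) = B x \<oplus>\<^bsub>K\<^esub> B y"
    "\<forall>c\<in>carrier K. \<forall>x\<in>carrier ?V. B (c \<odot>\<^bsub>?V\<^esub> x) = c \<otimes>\<^bsub>K\<^esub> B x"
    "\<forall>x\<in>?W. B x = \<zero>\<^bsub>K\<^esub>" "B ?u = \<one>\<^bsub>K\<^esub>"
    by (elim exE conjE)
  note B = B0(1)[rule_format] B0(2)[rule_format] B0(3)[rule_format] B0(4)[rule_format] B0(5)
  define t where "t h m = (\<lambda>x\<in>carrier P1. h x \<odot>\<^bsub>M\<^esub> m)" for h :: "'q \<Rightarrow> 'a" and m
  have hl: "lin A P1 (regular A) h" if "h \<in> carrier ?H" for h using that by (simp add: hom_dual_carrier)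
  have hc: "h x \<in> carrier A" if "h \<in> carrier ?H" "x \<in> carrier P1" for h x using lin_closed[OF hl[OF that(1)] that(2)] by simp
  have tV: "t h m \<in> carrier ?V" if "h \<in> carrier ?H" "m \<in> carrier M" for h m
    unfolding t_def using that by (intro restrict_hom_space[OF l1] lin_smult_const[OF M] hl)
  have th: "t (h \<oplus>\<^bsub>?H\<^esub> h') m = t h m \<oplus>\<^bsub>?V\<^esub> t h' m"
    if "h \<in> carrier ?H" "h' \<in> carrier ?H" "m \<in> carrier M" for h h' m
    using that tV hc by (intro hom_space_ext[of _ P1 M])
      (auto simp: hom_space_add hom_dual_add t_def M.smult_l_distr)
  have tm: "t h (m \<oplus>\<^bsub>M\<^esub> m') = t h m \<oplus>\<^bsub>?V\<^esub> t h m'"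
    if "h \<in> carrier ?H" "m \<in> carrier M" "m' \<in> carrier M" for h m m'
    using that tV hc by (intro hom_space_ext[of _ P1 M]) (auto simp: hom_space_add t_def M.smult_r_distr)
  have ta: "t (a \<odot>\<^bsub>?H\<^esub> h) m = t h (a \<odot>\<^bsub>M\<^esub> m)"
    if "h \<in> carrier ?H" "m \<in> carrier M" "a \<in> carrier A" for h m a
    using that hc by (auto simp: t_def hom_dual_smult M.smult_assoc fun_eq_iff)
  have tc: "t (scal c \<odot>\<^bsub>?H\<^esub> h) m = c \<odot>\<^bsub>?V\<^esub> t h m"
    if "h \<in> carrier ?H" "m \<in> carrier M" "c \<in> carrier K" for h m c
  proof (rule hom_space_ext[of _ P1 M])
    show "t (scal c \<odot>\<^bsub>?H\<^esub> h) m \<in> carrier ?V" using that S.smult_closed[of "scal c" h] by (intro tV) auto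
    fix x assume x: "x \<in> carrier P1"
    have "h x \<otimes>\<^bsub>A\<^esub> scal c = scal c \<otimes>\<^bsub>A\<^esub> h x" using that hc x by (simp add: scal_mult mult_scal)
    then show "t (scal c \<odot>\<^bsub>?H\<^esub> h) m x = (c \<odot>\<^bsub>?V\<^esub> t h m) x"
      using that hc x by (simp add: t_def hom_dual_smult hom_space_smult M.smult_assoc)
  qed (use that tV V.smult_closed in auto)
  have tI: "B (t h m) = \<zero>\<^bsub>K\<^esub>" if h: "h \<in> ?I" and m: "m \<in> carrier M" for h m
  proof -
    obtain k where k: "k \<in> carrier (hom_dual A P0)" "h = dual_map P1 f k" using h by (auto simp: hom_dual_map_eq)
    have kl: "lin A P0 (regular A) k" using k by (simp add: hom_dual_carrier)
    have "t h m = (\<lambda>y\<in>carrier P1. (\<lambda>x\<in>carrier P0. k x \<odot>\<^bsub>M\<^esub> m) (f y))"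
      using fc by (auto simp: t_def k(2) dual_map_apply fun_eq_iff)
    moreover have "(\<lambda>x\<in>carrier P0. k x \<odot>\<^bsub>M\<^esub> m) \<in> carrier (hom_space P0 M)"
      using kl m by (intro restrict_hom_space[OF l0] lin_smult_const[OF M])
    ultimately show ?thesis by (intro B(4)) blast
  qed
  have Badd: "B (t (h \<oplus>\<^bsub>?H\<^esub> h') m) = B (t h m) \<oplus>\<^bsub>K\<^esub> B (t h' m)"
    if "h \<in> carrier ?H" "h' \<in> carrier ?H" "m \<in> carrier M" for h h' m
    using that by (simp add: th B(2) tV)
  \<comment> \<open>The form vanishes on the image of \<open>Hom\<^sub>A(P0, A)\<close>, so representatives may be chosen at will.\<close>
  define rep where "rep C = (SOME h. h \<in> carrier ?H \<and> S.cls h = C)" for C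
  have Brep: "B (t (rep (S.cls h)) m) = B (t h m)" if h: "h \<in> carrier ?H" and m: "m \<in> carrier M" for h m
  proof -
    let ?r = "rep (S.cls h)"
    have r: "?r \<in> carrier ?H \<and> S.cls ?r = S.cls h"
      unfolding rep_def by (rule someI[of _ h]) (use h in simp)
    then have d: "?r \<ominus>\<^bsub>?H\<^esub> h \<in> ?I" using S.cls_eq_iff[of ?r h] h by blast
    have "?r = (?r \<ominus>\<^bsub>?H\<^esub> h) \<oplus>\<^bsub>?H\<^esub> h" using r h by (simp add: a_minus_def S.M.a_assoc S.M.l_neg)
    then have "B (t ?r m) = B (t ((?r \<ominus>\<^bsub>?H\<^esub> h) \<oplus>\<^bsub>?H\<^esub> h) m)" by simp
    also have "\<dots> = B (t (?r \<ominus>\<^bsub>?H\<^esub> h) m) \<oplus>\<^bsub>K\<^esub> B (t h m)" using r h m by (intro Badd) auto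
    finally show ?thesis using tI[OF d m] B(1)[OF tV[OF h m]] by simp
  qed
  define \<theta> where "\<theta> = (\<lambda>m\<in>carrier M. \<lambda>C\<in>carrier ?U. B (t (rep C) m))"
  have \<theta>: "\<theta> m (S.cls h) = B (t h m)" if "m \<in> carrier M" "h \<in> carrier ?H" for m h
    using that Brep by (simp add: \<theta>_def S.quot_carrier)
  have \<theta>e: "\<theta> m \<in> extensional (carrier ?U)" if "m \<in> carrier M" for m using that by (simp add: \<theta>_def)
  have \<theta>D: "\<theta> m \<in> carrier D" if m: "m \<in> carrier M" for m
  proof -
    have "\<theta> m C \<in> carrier K" if "C \<in> carrier ?U" for C
      using that m B(1)[OF tV] by (auto simp: S.quot_carrier \<theta>)
    moreover have "\<theta> m (C \<oplus>\<^bsub>?U\<^esub> C') = \<theta> m C \<oplus>\<^bsub>K\<^esub> \<theta> m C'" if "C \<in> carrier ?U" "C' \<in> carrier ?U" for C C'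
      using that m by (auto simp: S.quot_carrier S.quot_add \<theta> Badd)
    moreover have "\<theta> m (scal c \<odot>\<^bsub>?U\<^esub> C) = c \<otimes>\<^bsub>K\<^esub> \<theta> m C" if c: "c \<in> carrier K" and C: "C \<in> carrier ?U" for c C
    proof -
      obtain h where h: "h \<in> carrier ?H" "C = S.cls h" using C by (auto simp: S.quot_carrier)
      show ?thesis using S.quot_smult[of "scal c" h] S.smult_closed[of "scal c" h] c h m
        by (simp add: \<theta> tc B(3) tV)
    qed
    ultimately show ?thesis using \<theta>e[OF m] by (auto simp: D k_dual_def scal_def PiE_def)
  qed
  have "lin A M D \<theta>"
  proof (rule linI)
    fix m assume m: "m \<in> carrier M"
    show "\<theta> m \<in> carrier D" using m by (rule \<theta>D)
    show "\<theta> (m \<oplus>\<^bsub>M\<^esub> m') = \<theta> m \<oplus>\<^bsub>D\<^esub> \<theta> m'" if m': "m' \<in> carrier M" for m'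
    proof (rule extensionalityI[of _ "carrier ?U"])
      show "\<theta> (m \<oplus>\<^bsub>M\<^esub> m') \<in> extensional (carrier ?U)" using m m' by (intro \<theta>e) auto
      show "\<theta> m \<oplus>\<^bsub>D\<^esub> \<theta> m' \<in> extensional (carrier ?U)" by (simp add: D k_dual_def)
      fix C assume "C \<in> carrier ?U"
      then show "\<theta> (m \<oplus>\<^bsub>M\<^esub> m') C = (\<theta> m \<oplus>\<^bsub>D\<^esub> \<theta> m') C"
        using m m' by (auto simp: S.quot_carrier \<theta> tm B(2) tV D k_dual_def)
    qed
    show "\<theta> (a \<odot>\<^bsub>M\<^esub> m) = a \<odot>\<^bsub>D\<^esub> \<theta> m" if a: "a \<in> carrier A" for a
    proof (rule extensionalityI[of _ "carrier ?U"])
      show "\<theta> (a \<odot>\<^bsub>M\<^esub> m) \<in> extensional (carrier ?U)" using a m by (intro \<theta>e M.smult_closed)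
      show "a \<odot>\<^bsub>D\<^esub> \<theta> m \<in> extensional (carrier ?U)" by (simp add: D k_dual_def)
      fix C assume "C \<in> carrier ?U"
      then obtain h where h: "h \<in> carrier ?H" "C = S.cls h" by (auto simp: S.quot_carrier)
      have ah: "a \<odot>\<^bsub>?H\<^esub> h \<in> carrier ?H" using S.smult_closed[of a h] a h by simp
      have "(a \<odot>\<^bsub>D\<^esub> \<theta> m) C = \<theta> m (S.cls (a \<odot>\<^bsub>?H\<^esub> h))"
        using h a S.quot_smult[of a h] by (simp add: D k_dual_def S.quot_carrier)
      also have "\<dots> = \<theta> (a \<odot>\<^bsub>M\<^esub> m) C" using a m h ah by (simp add: \<theta> ta M.smult_closed)
      finally show "\<theta> (a \<odot>\<^bsub>M\<^esub> m) C = (a \<odot>\<^bsub>D\<^esub> \<theta> m) C" by simp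
    qed
  qed
  then have "\<theta> \<in> mod_hom A M D" by (simp add: mod_hom_iff_lin \<theta>_def)
  then have "\<theta> = (\<lambda>x\<in>carrier M. \<zero>\<^bsub>D\<^esub>)" using zero by blast
  then have Bt: "B (t h m) = \<zero>\<^bsub>K\<^esub>" if "h \<in> carrier ?H" "m \<in> carrier M" for h m
    using \<theta>[OF that(2,1)] that by (simp add: D k_dual_def S.quot_carrier)
  \<comment> \<open>By the dual basis \<open>u\<close> is a sum of maps \<open>x \<mapsto> h x m\<close>, which contradicts \<open>B u = 1\<close>.\<close>
  obtain n :: nat and x \<xi> where d: "dual_basis A P1 {..<n} x \<xi>" using projective_dual_basis[OF P1] by blast
  have xc: "x j \<in> carrier P1" and Xc: "restrict (\<xi> j) (carrier P1) \<in> carrier ?H" if "j < n" for j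
    using d that restrict_hom_dual[OF l1] by (auto simp: dual_basis_def)
  have ux: "u (x j) \<in> carrier M" if "j < n" for j using lin_closed[OF u xc[OF that]] .
  let ?t = "\<lambda>j. t (restrict (\<xi> j) (carrier P1)) (u (x j))"
  have tc': "?t j \<in> carrier ?V" if "j < n" for j using Xc[OF that] ux[OF that] by (rule tV)
  have "?u = (\<Oplus>\<^bsub>?V\<^esub>j\<in>{..<n}. ?t j)"
  proof (rule hom_space_ext[OF uV])
    show "(\<Oplus>\<^bsub>?V\<^esub>j\<in>{..<n}. ?t j) \<in> carrier ?V" using tc' by (auto intro!: V.M.finsum_closed)
    fix p assume p: "p \<in> carrier P1"
    have "(\<Oplus>\<^bsub>?V\<^esub>j\<in>{..<n}. ?t j) p = (\<Oplus>\<^bsub>M\<^esub>j\<in>{..<n}. ?t j p)"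
      using p tc' lin_closed[of A P1 M]
      by (intro additive_finsum[OF V.M.abelian_group_axioms M.M.abelian_group_axioms, where h = "\<lambda>h. h p"])
        (auto simp: hom_space_add hom_space_carrier)
    also have "\<dots> = (\<Oplus>\<^bsub>M\<^esub>j\<in>{..<n}. \<xi> j p \<odot>\<^bsub>M\<^esub> u (x j))"
      using p ux hc[OF Xc p] by (intro M.M.finsum_cong') (auto simp: t_def intro!: M.smult_closed)
    finally show "?u p = (\<Oplus>\<^bsub>?V\<^esub>j\<in>{..<n}. ?t j) p"
      using dual_basis_expand[OF l1 M d u p] p by simp
  qed
  then have "B ?u = B (\<Oplus>\<^bsub>?V\<^esub>j\<in>{..<n}. ?t j)" by (rule arg_cong)
  also have "\<dots> = (\<Oplus>\<^bsub>K\<^esub>j\<in>{..<n}. B (?t j))"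
    by (rule additive_finsum[OF V.M.abelian_group_axioms K.abelian_group_axioms])
      (assumption | rule B(1) B(2) finite_lessThan | rule tc', simp only: lessThan_iff)+
  also have "\<dots> = (\<Oplus>\<^bsub>K\<^esub>j\<in>{..<n}. \<zero>\<^bsub>K\<^esub>)"
    using Bt Xc ux by (intro K.finsum_cong') auto
  finally show False using B(5) by simp
qed

lemma zero_in_hom_translate:
  fixes P1 :: "('a, 'q) module" and P0 :: "('a, 'p) module" and M :: "('a, 'm) module"
  assumes p: "presentation P1 f P0 g M" and M: "left_module A M"
  defines "D \<equiv> k_dual K A (transpose_of A P1 f P0)"
  shows "(\<lambda>x\<in>carrier M. \<zero>\<^bsub>D\<^esub>) \<in> mod_hom A M D"
proof -
  have l1: "left_module A P1" and l0: "left_module A P0" and f: "lin A P1 P0 f"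
    using p by (auto simp: presentation_def intro: projective_left_module)
  interpret M: left_module A M by fact
  let ?H = "hom_dual A P1" and ?I = "hom_dual_map A P1 f P0 ` carrier (hom_dual A P0)"
  interpret S: submod "opp A" ?H ?I using l1 l0 f by (rule submodule_dual_image)
  let ?U = "quot_mod ?H ?I"
  interpret U: left_module "opp A" ?U by (rule S.left_module_quot)
  have D: "D = k_dual K A ?U" by (simp add: D_def transpose_of_def)
  have s: "a \<odot>\<^bsub>?U\<^esub> C \<in> carrier ?U" if "a \<in> carrier A" "C \<in> carrier ?U" for a C
    using U.smult_closed[of a C] that by simp
  have z: "\<zero>\<^bsub>D\<^esub> \<in> carrier D" using s scal_closed by (auto simp: D k_dual_def scal_def)
  have "lin A M D (\<lambda>x. \<zero>\<^bsub>D\<^esub>)"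
  proof (rule linI)
    show "\<zero>\<^bsub>D\<^esub> \<in> carrier D" by (rule z)
    show "\<zero>\<^bsub>D\<^esub> = \<zero>\<^bsub>D\<^esub> \<oplus>\<^bsub>D\<^esub> \<zero>\<^bsub>D\<^esub>" by (auto simp: D k_dual_def)
    show "\<zero>\<^bsub>D\<^esub> = a \<odot>\<^bsub>D\<^esub> \<zero>\<^bsub>D\<^esub>" if "a \<in> carrier A" for a
      using s[OF that] by (auto simp: D k_dual_def fun_eq_iff)
  qed
  then show ?thesis by (rule restrict_mod_hom[OF M])
qed

lemma ar_translate_eq:
  fixes M :: "('a, 'm) module"
  assumes "fg_module A M"
  shows "\<exists>(P1 :: ('k, 'a) std_module) f (P0 :: ('k, 'a) std_module) g. minimal_presentation P1 f P0 g M \<and>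
    ar_translate K A M = k_dual K A (transpose_of A P1 f P0)"
proof -
  let ?P = "\<lambda>(P1 :: ('k, 'a) std_module, f, P0 :: ('k, 'a) std_module). \<exists>g. min_proj_presentation A P1 f P0 g M"
  obtain P1 f P0 where t: "(SOME t. ?P t) = (P1, f, P0)" by (rule prod_cases3)
  have "\<exists>t. ?P t" using ex_min_proj_presentation[OF assms] by auto
  then have "?P (SOME t. ?P t)" by (rule someI_ex)
  then obtain g where "min_proj_presentation A P1 f P0 g M" unfolding t by auto
  moreover have "ar_translate K A M = k_dual K A (transpose_of A P1 f P0)"
    unfolding ar_translate_def t by simp
  ultimately show ?thesis using min_proj_presentation_minimal by blast
qed

lemma tau_rigid_imp:
  fixes M :: "('a, 'm) module"
  assumes "tau_rigid K A M"
  shows "\<exists>(P1 :: ('k, 'a) std_module) f (P0 :: ('k, 'a) std_module) g.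
    minimal_presentation P1 f P0 g M \<and> rigid_presentation P1 f P0 g M"
proof -
  have M: "fg_module A M" and h: "mod_hom A M (ar_translate K A M) = {\<lambda>x\<in>carrier M. \<zero>\<^bsub>ar_translate K A M\<^esub>}"
    using assms by (auto simp: tau_rigid_def)
  obtain P1 f P0 g where p: "minimal_presentation (P1 :: ('k, 'a) std_module) f (P0 :: ('k, 'a) std_module) g M"
    and e: "ar_translate K A M = k_dual K A (transpose_of A P1 f P0)"
    using ar_translate_eq[OF M] by blast
  have "rigid_presentation P1 f P0 g M"
    using minimal_presentation_presentation[OF p] fg_moduleD[OF M] h unfolding e
    by (intro rigid_of_hom_translate_zero) auto
  then show ?thesis using p by blast
qed

lemma tau_rigidI:
  fixes M :: "('a, 'm) module"
  assumes M: "fg_module A M" and r: "rigid_presentation Q1 q Q0 g M"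
  shows "tau_rigid K A M"
proof -
  have lM: "left_module A M" using M by (rule fg_moduleD)
  obtain P1 f P0 g' where p: "minimal_presentation (P1 :: ('k, 'a) std_module) f (P0 :: ('k, 'a) std_module) g' M"
    and e: "ar_translate K A M = k_dual K A (transpose_of A P1 f P0)"
    using ar_translate_eq[OF M] by blast
  have "rigid_presentation P1 f P0 g' M" using r p lM by (rule rigid_presentation_minimal)
  then show ?thesis unfolding tau_rigid_def e
    using hom_translate_zero[OF _ lM] zero_in_hom_translate[OF minimal_presentation_presentation[OF p] lM] M
    by blast
qed

end

section \<open>Totally acyclic complexes\<close>

text \<open>
  The last condition is exactness of the complex of maps to \<open>A\<close>, stated for linear maps instead of for
  the modules \<open>Hom\<^sub>A(P i, A)\<close>; the inclusion that it omits holds because consecutive differentials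
  compose to zero.
\<close>

definition totally_acyclic ::
  "('k, 'a) module \<Rightarrow> (int \<Rightarrow> ('a, 'm) module) \<Rightarrow> (int \<Rightarrow> 'm \<Rightarrow> 'm) \<Rightarrow> bool" where
  "totally_acyclic A P d \<longleftrightarrow>
    (\<forall>i. projective A (P i)) \<and> (\<forall>i. lin A (P i) (P (i + 1)) (d i)) \<and>
    (\<forall>i. \<forall>x\<in>carrier (P i). d i x = \<zero>\<^bsub>P (i + 1)\<^esub> \<longleftrightarrow> x \<in> d (i - 1) ` carrier (P (i - 1))) \<and>
    (\<forall>i h. lin A (P i) (regular A) h \<and> (\<forall>y\<in>carrier (P (i - 1)). h (d (i - 1) y) = \<zero>\<^bsub>A\<^esub>) \<longrightarrow>
      (\<exists>h'. lin A (P (i + 1)) (regular A) h' \<and> (\<forall>x\<in>carrier (P i). h' (d i x) = h x)))"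

lemma totally_acyclicD:
  assumes "totally_acyclic A P d"
  shows "projective A (P i)" "lin A (P i) (P (i + 1)) (d i)"
    "x \<in> carrier (P i) \<Longrightarrow> d i x = \<zero>\<^bsub>P (i + 1)\<^esub> \<longleftrightarrow> x \<in> d (i - 1) ` carrier (P (i - 1))"
    "lin A (P i) (regular A) h \<Longrightarrow> (\<And>y. y \<in> carrier (P (i - 1)) \<Longrightarrow> h (d (i - 1) y) = \<zero>\<^bsub>A\<^esub>) \<Longrightarrow>
      \<exists>h'. lin A (P (i + 1)) (regular A) h' \<and> (\<forall>x\<in>carrier (P i). h' (d i x) = h x)"
  using assms unfolding totally_acyclic_def by blast+

lemma totally_acyclic_shift:
  assumes "totally_acyclic A P d"
  shows "totally_acyclic A (\<lambda>i. P (i + j)) (\<lambda>i. d (i + j))"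
proof -
  have e: "i + 1 + j = (i + j) + 1" "i - 1 + j = (i + j) - 1" for i by simp_all
  show ?thesis using assms unfolding totally_acyclic_def e by blast
qed

lemma submodule_finsum:
  assumes M: "left_module R M" and L: "submodule L R M" and I: "finite I" and g: "\<And>i. i \<in> I \<Longrightarrow> g i \<in> L"
  shows "(\<Oplus>\<^bsub>M\<^esub>i\<in>I. g i) \<in> L"
proof -
  interpret left_module R M by fact
  have L': "\<zero>\<^bsub>M\<^esub> \<in> L" "\<And>x y. x \<in> L \<Longrightarrow> y \<in> L \<Longrightarrow> x \<oplus>\<^bsub>M\<^esub> y \<in> L" "\<And>x. x \<in> L \<Longrightarrow> x \<in> carrier M"
    using L unfolding submodule_iff[OF M] by auto
  show ?thesis using I g
  proof (induction I)
    case empty then show ?case using L' by simp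
  next
    case (insert i I)
    then have "(\<lambda>i. g i) \<in> I \<rightarrow> carrier M" "g i \<in> carrier M" using L' by auto
    then show ?case using insert L' by simp
  qed
qed

lemma fg_module_of_dual_basis:
  assumes P: "left_module A P" and d: "dual_basis A P I x \<phi>"
  shows "fg_module A P"
proof -
  interpret left_module A P by fact
  have I: "finite I" and x: "\<And>i. i \<in> I \<Longrightarrow> x i \<in> carrier P"
    and c: "\<And>i p. i \<in> I \<Longrightarrow> p \<in> carrier P \<Longrightarrow> \<phi> i p \<in> carrier A"
    and e: "\<And>p. p \<in> carrier P \<Longrightarrow> p = (\<Oplus>\<^bsub>P\<^esub>i\<in>I. \<phi> i p \<odot>\<^bsub>P\<^esub> x i)"
    using d by (auto simp: dual_basis_def lin_def)
  have "L = carrier P" if L: "submodule L A P" "x ` I \<subseteq> L" for L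
  proof
    show "L \<subseteq> carrier P" using L(1) by (rule submodule_subset)
    show "carrier P \<subseteq> L"
    proof
      fix p assume p: "p \<in> carrier P"
      have "(\<Oplus>\<^bsub>P\<^esub>i\<in>I. \<phi> i p \<odot>\<^bsub>P\<^esub> x i) \<in> L"
        using L c[OF _ p] unfolding submodule_iff[OF P] 
        by (intro submodule_finsum[OF P L(1) I]) auto
      then show "p \<in> L" using e[OF p] by simp
    qed
  qed
  then have "fin_gen A P" unfolding fin_gen_def using I x by (intro exI[of _ "x ` I"]) auto
  then show ?thesis using P by (simp add: fg_module_def)
qed

context fd_algebra
begin

lemma totally_acyclic_zero:
  assumes t: "totally_acyclic A P d" and y: "y \<in> carrier (P (i - 1))"
  shows "d i (d (i - 1) y) = \<zero>\<^bsub>P (i + 1)\<^esub>"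
  using totally_acyclicD(3)[OF t, of "d (i - 1) y" i] lin_closed[OF totally_acyclicD(2)[OF t, of "i - 1"] y] y by simp

lemma totally_acyclic_iso:
  fixes P :: "int \<Rightarrow> ('a, 'm) module" and Q :: "int \<Rightarrow> ('a, 'n) module"
  assumes t: "totally_acyclic A P d" and Q: "\<And>i. left_module A (Q i)"
    and u: "\<And>i. lin A (P i) (Q i) (u i)" and v: "\<And>i. lin A (Q i) (P i) (v i)"
    and vu: "\<And>i x. x \<in> carrier (P i) \<Longrightarrow> v i (u i x) = x" and uv: "\<And>i x. x \<in> carrier (Q i) \<Longrightarrow> u i (v i x) = x"
  shows "totally_acyclic A Q (\<lambda>i y. u (i + 1) (d i (v i y)))"
  unfolding totally_acyclic_def
proof (intro conjI allI ballI impI)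
  note T = totally_acyclicD[OF t]
  have P: "left_module A (P i)" for i using T(1) by (rule projective_left_module)
  fix i
  show "projective A (Q i)" by (rule projective_retract[OF T(1) Q u v uv])
  show "lin A (Q i) (Q (i + 1)) (\<lambda>y. u (i + 1) (d i (v i y)))"
    by (intro lin_comp[OF lin_comp[OF v T(2)] u])
  show "u (i + 1) (d i (v i x)) = \<zero>\<^bsub>Q (i + 1)\<^esub> \<longleftrightarrow> x \<in> (\<lambda>y. u (i - 1 + 1) (d (i - 1) (v (i - 1) y))) ` carrier (Q (i - 1))"
    if x: "x \<in> carrier (Q i)" for x
  proof -
    have vx: "v i x \<in> carrier (P i)" using lin_closed[OF v x] .
    have "u (i + 1) (d i (v i x)) = \<zero>\<^bsub>Q (i + 1)\<^esub> \<longleftrightarrow> d i (v i x) = \<zero>\<^bsub>P (i + 1)\<^esub>"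
      using vu[OF lin_closed[OF T(2) vx]] lin_zero[OF P Q u] lin_zero[OF Q P v] by metis
    also have "\<dots> \<longleftrightarrow> v i x \<in> d (i - 1) ` carrier (P (i - 1))" by (rule T(3)[OF vx])
    also have "\<dots> \<longleftrightarrow> x \<in> (\<lambda>y. u i (d (i - 1) (v (i - 1) y))) ` carrier (Q (i - 1))"
    proof
      assume "v i x \<in> d (i - 1) ` carrier (P (i - 1))"
      then obtain y where y: "y \<in> carrier (P (i - 1))" "v i x = d (i - 1) y" by auto
      then have "x = u i (d (i - 1) (v (i - 1) (u (i - 1) y)))" using uv[OF x] vu by simp
      then show "x \<in> (\<lambda>y. u i (d (i - 1) (v (i - 1) y))) ` carrier (Q (i - 1))"
        using lin_closed[OF u y(1)] by blast
    next
      assume "x \<in> (\<lambda>y. u i (d (i - 1) (v (i - 1) y))) ` carrier (Q (i - 1))"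
      then obtain y where y: "y \<in> carrier (Q (i - 1))" "x = u i (d (i - 1) (v (i - 1) y))" by auto
      have "d (i - 1) (v (i - 1) y) \<in> carrier (P i)"
        using lin_closed[OF T(2)[of "i - 1"] lin_closed[OF v y(1)]] by simp
      then have "v i x = d (i - 1) (v (i - 1) y)" using y vu by simp
      then show "v i x \<in> d (i - 1) ` carrier (P (i - 1))" using lin_closed[OF v y(1)] by blast
    qed
    finally show ?thesis by simp
  qed
  fix h assume h: "lin A (Q i) (regular A) h \<and>
    (\<forall>y\<in>carrier (Q (i - 1)). h (u (i - 1 + 1) (d (i - 1) (v (i - 1) y))) = \<zero>\<^bsub>A\<^esub>)"
  have "h (u i (d (i - 1) y)) = \<zero>\<^bsub>A\<^esub>" if "y \<in> carrier (P (i - 1))" for y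
    using h lin_closed[OF u that] vu[OF that] by fastforce
  then obtain h' where h': "lin A (P (i + 1)) (regular A) h'" "\<forall>x\<in>carrier (P i). h' (d i x) = h (u i x)"
    using T(4)[OF lin_comp[OF u], of i h] h by blast
  show "\<exists>h'. lin A (Q (i + 1)) (regular A) h' \<and> (\<forall>x\<in>carrier (Q i). h' (u (i + 1) (d i (v i x))) = h x)"
  proof (intro exI conjI ballI)
    show "lin A (Q (i + 1)) (regular A) (\<lambda>x. h' (v (i + 1) x))" using v h'(1) by (rule lin_comp)
    show "h' (v (i + 1) (u (i + 1) (d i (v i x)))) = h x" if "x \<in> carrier (Q i)" for x
      using that vu[OF lin_closed[OF T(2) lin_closed[OF v that]]] h'(2) lin_closed[OF v that] uv by simp
  qed
qed

lemma gorenstein_projective_imp_totally_acyclic: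
  fixes M :: "('a, 'm) module"
  assumes "gorenstein_projective A M"
  shows "\<exists>(P :: int \<Rightarrow> ('k, 'a) std_module) d \<iota>. totally_acyclic A P d \<and> lin A M (P 0) \<iota> \<and>
    inj_on \<iota> (carrier M) \<and> \<iota> ` carrier M = d (-1) ` carrier (P (-1))"
proof -
  obtain P :: "int \<Rightarrow> ('k, 'a) std_module" and d where P: "\<And>i. projective A (P i)"
    and d: "\<And>i. d i \<in> mod_hom A (P i) (P (i + 1))"
    and ex: "\<And>i. exact_at (P (i - 1)) (d (i - 1)) (P i) (d i) (P (i + 1))"
    and hom: "\<And>i. exact_at (hom_dual A (P (i + 1))) (hom_dual_map A (P i) (d i) (P (i + 1)))
              (hom_dual A (P i)) (hom_dual_map A (P (i - 1)) (d (i - 1)) (P i))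
              (hom_dual A (P (i - 1)))"
    and iso: "mod_iso A M ((P 0)\<lparr>carrier := d (-1) ` carrier (P (-1))\<rparr>)"
    using assms unfolding gorenstein_projective_def by blast
  have lP: "left_module A (P i)" for i using P by (rule projective_left_module)
  have dl: "lin A (P i) (P (i + 1)) (d i)" for i using d by (simp add: mod_hom_iff_lin)
  have "totally_acyclic A P d" unfolding totally_acyclic_def
  proof (intro conjI allI ballI impI)
    fix i
    show "d i x = \<zero>\<^bsub>P (i + 1)\<^esub> \<longleftrightarrow> x \<in> d (i - 1) ` carrier (P (i - 1))" if "x \<in> carrier (P i)" for x
      using ex[of i] that by (simp add: exact_at_def a_kernel_eq)
    fix h assume h: "lin A (P i) (regular A) h \<and> (\<forall>y\<in>carrier (P (i - 1)). h (d (i - 1) y) = \<zero>\<^bsub>A\<^esub>)"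
    let ?h = "restrict h (carrier (P i))"
    have dc: "d (i - 1) y \<in> carrier (P i)" if "y \<in> carrier (P (i - 1))" for y
      using lin_closed[OF dl[of "i - 1"] that] by simp
    have hc: "?h \<in> carrier (hom_dual A (P i))" using h lP by (intro restrict_hom_dual) auto
    have "hom_dual_map A (P (i - 1)) (d (i - 1)) (P i) ?h = \<zero>\<^bsub>hom_dual A (P (i - 1))\<^esub>"
      using h hc dc by (auto simp: hom_dual_map_eq dual_map_def hom_dual_def fun_eq_iff)
    then have "?h \<in> a_kernel (hom_dual A (P i)) (hom_dual A (P (i - 1))) (hom_dual_map A (P (i - 1)) (d (i - 1)) (P i))"
      using hc by (simp add: a_kernel_eq)
    then have "?h \<in> hom_dual_map A (P i) (d i) (P (i + 1)) ` carrier (hom_dual A (P (i + 1)))"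
      using hom[of i] by (simp add: exact_at_def)
    then obtain h' where h': "h' \<in> carrier (hom_dual A (P (i + 1)))" "?h = dual_map (P i) (d i) h'"
      by (auto simp: hom_dual_map_eq)
    have "h' (d i x) = h x" if "x \<in> carrier (P i)" for x
      using fun_cong[OF h'(2), of x] that by (simp add: dual_map_def)
    then show "\<exists>h'. lin A (P (i + 1)) (regular A) h' \<and> (\<forall>x\<in>carrier (P i). h' (d i x) = h x)"
      using h'(1) by (auto simp: hom_dual_carrier)
  qed (fact P dl)+
  moreover obtain \<iota> where \<iota>: "\<iota> \<in> mod_hom A M ((P 0)\<lparr>carrier := d (-1) ` carrier (P (-1))\<rparr>)"
    "bij_betw \<iota> (carrier M) (d (-1) ` carrier (P (-1)))"
    using iso by (auto simp: mod_iso_def)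
  moreover have "lin A M (P 0) \<iota>"
    using \<iota>(1) lin_closed[OF dl[of "-1"]] by (subst (asm) mod_hom_iff_lin, subst (asm) lin_restr_cod_iff) auto
  ultimately show ?thesis by (auto simp: bij_betw_def)
qed

lemma totally_acyclic_dual_exact:
  fixes P :: "int \<Rightarrow> ('a, 'm) module"
  assumes t: "totally_acyclic A P d" and h: "h \<in> carrier (hom_dual A (P i))"
  shows "dual_map (P (i - 1)) (d (i - 1)) h = \<zero>\<^bsub>hom_dual A (P (i - 1))\<^esub> \<longleftrightarrow>
    h \<in> dual_map (P i) (d i) ` carrier (hom_dual A (P (i + 1)))"
proof
  note T = totally_acyclicD[OF t]
  have lP: "left_module A (P i)" for i using T(1) by (rule projective_left_module)
  {
    assume z: "dual_map (P (i - 1)) (d (i - 1)) h = \<zero>\<^bsub>hom_dual A (P (i - 1))\<^esub>"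
    have "h (d (i - 1) y) = \<zero>\<^bsub>A\<^esub>" if "y \<in> carrier (P (i - 1))" for y
      using fun_cong[OF z, of y] that by (simp add: dual_map_def hom_dual_def)
    then obtain h' where h': "lin A (P (i + 1)) (regular A) h'" "\<forall>x\<in>carrier (P i). h' (d i x) = h x"
      using T(4)[of i h] h by (auto simp: hom_dual_carrier)
    let ?h = "restrict h' (carrier (P (i + 1)))"
    have hc: "?h \<in> carrier (hom_dual A (P (i + 1)))" using lP h'(1) by (rule restrict_hom_dual)
    have "h = dual_map (P i) (d i) ?h"
      using lin_closed[OF lin_dual_map[OF lP lP T(2)] hc] h'(2) lin_closed[OF T(2)]
      by (intro hom_dual_ext[OF h]) (auto simp: dual_map_apply)
    then show "h \<in> dual_map (P i) (d i) ` carrier (hom_dual A (P (i + 1)))" using hc by blast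
  next
    assume "h \<in> dual_map (P i) (d i) ` carrier (hom_dual A (P (i + 1)))"
    then obtain h' where h': "h' \<in> carrier (hom_dual A (P (i + 1)))" "h = dual_map (P i) (d i) h'" by blast
    have hl: "lin A (P (i + 1)) (regular A) h'" using h' by (simp add: hom_dual_carrier)
    have dl: "lin A (P (i - 1)) (P i) (d (i - 1))" using T(2)[of "i - 1"] by simp
    show "dual_map (P (i - 1)) (d (i - 1)) h = \<zero>\<^bsub>hom_dual A (P (i - 1))\<^esub>"
      using lin_closed[OF dl] totally_acyclic_zero[OF t] lin_zero[OF lP reg hl]
      by (auto simp: h'(2) dual_map_def hom_dual_def intro!: restrict_ext)
  }
qed

lemma gorenstein_projective_of_std:
  fixes M :: "('a, 'm) module" and P :: "int \<Rightarrow> ('k, 'a) std_module"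
  assumes M: "fg_module A M" and t: "totally_acyclic A P d" and \<iota>: "lin A M (P 0) \<iota>" "inj_on \<iota> (carrier M)"
    "\<iota> ` carrier M = d (-1) ` carrier (P (-1))"
  shows "gorenstein_projective A M"
proof -
  note T = totally_acyclicD[OF t]
  have lP: "left_module A (P i)" for i using T(1) by (rule projective_left_module)
  define e where "e i = restrict (d i) (carrier (P i))" for i
  have em: "e i x = d i x" if "x \<in> carrier (P i)" for i x using that by (simp add: e_def)
  have ei: "e i ` carrier (P i) = d i ` carrier (P i)" for i using em by (intro image_cong) auto
  have dc: "d (i - 1) y \<in> carrier (P i)" if "y \<in> carrier (P (i - 1))" for y i
    using lin_closed[OF T(2)[of "i - 1"] that] by simp
  show ?thesis unfolding gorenstein_projective_def
  proof (intro conjI exI[of _ P] exI[of _ e] allI)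
    fix i
    show "projective A (P i)" by (rule T(1))
    show "e i \<in> mod_hom A (P i) (P (i + 1))" unfolding e_def by (intro restrict_mod_hom lP T)
    show "exact_at (P (i - 1)) (e (i - 1)) (P i) (e i) (P (i + 1))"
      using T(3)[of _ i] dc by (auto simp: exact_at_def a_kernel_eq ei em)
    have de: "hom_dual_map A (P i) (e i) (P (i + 1)) h = dual_map (P i) (d i) h"
      if "h \<in> carrier (hom_dual A (P (i + 1)))" for h i
      using that em by (auto simp: hom_dual_map_eq dual_map_def)
    have de': "hom_dual_map A (P (i - 1)) (e (i - 1)) (P i) h = dual_map (P (i - 1)) (d (i - 1)) h"
      if "h \<in> carrier (hom_dual A (P i))" for h
      using de[of h "i - 1"] that by simp
    show "exact_at (hom_dual A (P (i + 1))) (hom_dual_map A (P i) (e i) (P (i + 1)))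
              (hom_dual A (P i)) (hom_dual_map A (P (i - 1)) (e (i - 1)) (P i)) (hom_dual A (P (i - 1)))"
    proof -
      have "hom_dual_map A (P i) (e i) (P (i + 1)) ` carrier (hom_dual A (P (i + 1)))
        = dual_map (P i) (d i) ` carrier (hom_dual A (P (i + 1)))"
        using de by (intro image_cong) auto
      moreover have "dual_map (P i) (d i) h \<in> carrier (hom_dual A (P i))" if "h \<in> carrier (hom_dual A (P (i + 1)))" for h
        by (rule lin_closed[OF lin_dual_map[OF lP lP T(2)] that])
      ultimately show ?thesis
        using totally_acyclic_dual_exact[OF t] by (auto simp: exact_at_def a_kernel_eq de')
    qed
  next
    let ?N = "(P 0)\<lparr>carrier := e (-1) ` carrier (P (-1))\<rparr>"
    have s: "e (-1) ` carrier (P (-1)) \<subseteq> carrier (P 0)" using dc[of _ 0] by (auto simp: ei)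
    have "lin A M ?N \<iota>" using \<iota> unfolding lin_restr_cod_iff[OF s] by (simp add: ei)
    then have "restrict \<iota> (carrier M) \<in> mod_hom A M ?N" by (rule restrict_mod_hom[OF fg_moduleD[OF M]])
    moreover have "bij_betw (restrict \<iota> (carrier M)) (carrier M) (carrier ?N)"
      using \<iota> by (simp add: bij_betw_def ei inj_on_restrict_eq)
    ultimately show "mod_iso A M ?N" unfolding mod_iso_def by blast
  qed (fact M)
qed

text \<open>
  The index \<open>j\<close> and the type of elements of the complex are arbitrary, as duals and quotients change both;
  the complex is moved to copies of its terms.
\<close>

lemma gorenstein_projectiveI:
  fixes M :: "('a, 'm) module" and P :: "int \<Rightarrow> ('a, 'n) module"
  assumes M: "fg_module A M" and t: "totally_acyclic A P d" and \<iota>: "lin A M (P j) \<iota>" "inj_on \<iota> (carrier M)"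
    "\<iota> ` carrier M = d (j - 1) ` carrier (P (j - 1))"
  shows "gorenstein_projective A M"
proof -
  have t': "totally_acyclic A (\<lambda>i. P (i + j)) (\<lambda>i. d (i + j))" using t by (rule totally_acyclic_shift)
  define copy where "copy i = (\<lambda>(N :: ('k, 'a) std_module, u, v). fg_module A N \<and> lin A (P (i + j)) N u \<and>
    lin A N (P (i + j)) v \<and> (\<forall>x\<in>carrier (P (i + j)). v (u x) = x) \<and> (\<forall>y\<in>carrier N. u (v y) = y))" for i
  have "\<forall>i. \<exists>t. copy i t"
    using ex_copy[OF projective_fg[OF totally_acyclicD(1)[OF t]]] by (simp add: copy_def)
  from choice[OF this] obtain c where c: "\<forall>i. copy i (c i)" by (elim exE)
  define Q u v where "Q i = fst (c i)" and "u i = fst (snd (c i))" and "v i = snd (snd (c i))" for i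
  have Q: "fg_module A (Q i)" and u: "lin A (P (i + j)) (Q i) (u i)" and v: "lin A (Q i) (P (i + j)) (v i)"
    and vu: "\<And>x. x \<in> carrier (P (i + j)) \<Longrightarrow> v i (u i x) = x" and uv: "\<And>y. y \<in> carrier (Q i) \<Longrightarrow> u i (v i y) = y" for i
    using spec[OF c, of i] by (auto simp: copy_def Q_def u_def v_def split: prod.splits)
  have tQ: "totally_acyclic A Q (\<lambda>i y. u (i + 1) (d (i + j) (v i y)))"
  proof (rule totally_acyclic_iso[where u = u and v = v, OF t'])
    fix i
    show "left_module A (Q i)" using Q by (rule fg_moduleD)
    show "lin A (P (i + j)) (Q i) (u i)" "lin A (Q i) (P (i + j)) (v i)" by (fact u v)+
    show "v i (u i x) = x" if "x \<in> carrier (P (i + j))" for x using that by (rule vu)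
    show "u i (v i x) = x" if "x \<in> carrier (Q i)" for x using that by (rule uv)
  qed
  show ?thesis
  proof (rule gorenstein_projective_of_std[OF M tQ])
    show "lin A M (Q 0) (\<lambda>m. u 0 (\<iota> m))" using lin_comp[OF \<iota>(1)] u[of 0] by simp
    show "inj_on (\<lambda>m. u 0 (\<iota> m)) (carrier M)"
    proof (rule inj_onI)
      fix x y assume xy: "x \<in> carrier M" "y \<in> carrier M" "u 0 (\<iota> x) = u 0 (\<iota> y)"
      have vi: "v 0 (u 0 (\<iota> m)) = \<iota> m" if "m \<in> carrier M" for m using lin_closed[OF \<iota>(1) that] by (intro vu) simp
      have "\<iota> x = \<iota> y" using arg_cong[OF xy(3), of "v 0"] unfolding vi[OF xy(1)] vi[OF xy(2)] .
      then show "x = y" by (rule inj_onD[OF \<iota>(2) _ xy(1,2)])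
    qed
    have "(\<lambda>m. u 0 (\<iota> m)) ` carrier M = u 0 ` d (j - 1) ` carrier (P (j - 1))" unfolding \<iota>(3)[symmetric] by auto
    also have "carrier (P (j - 1)) = v (-1) ` carrier (Q (-1))"
    proof
      show "v (-1) ` carrier (Q (-1)) \<subseteq> carrier (P (j - 1))" using lin_closed[OF v[of "-1"]] by auto
      show "carrier (P (j - 1)) \<subseteq> v (-1) ` carrier (Q (-1))"
        using vu[of _ "-1"] lin_closed[OF u[of "-1"]] by (auto intro!: image_eqI[where f = "v (-1)", OF sym])
    qed
    finally show "(\<lambda>m. u 0 (\<iota> m)) ` carrier M = (\<lambda>y. u (-1 + 1) (d (-1 + j) (v (-1) y))) ` carrier (Q (-1))"
      by (simp add: image_image)
  qed
qed

section \<open>Duality of totally acyclic complexes\<close>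

lemma projective_dual:
  fixes P :: "('a, 'm) module"
  assumes P: "projective A P" shows "projective (opp A) (hom_dual A P)"
proof -
  interpret O: fd_algebra K "opp A" by (rule fd_algebra_opp[OF fd_algebra_axioms])
  have lP: "left_module A P" using P by (rule projective_left_module)
  obtain n :: nat and x \<phi> where d: "dual_basis A P {..<n} x \<phi>" using projective_dual_basis[OF P] by blast
  note d' = dual_basis_dual[OF lP d]
  show ?thesis
    using fg_module_of_dual_basis[OF left_module_hom_dual[OF lP] d'] d' by (rule O.projective_of_dual_basis)
qed

text \<open>
  Projective modules are reflexive: a form \<open>H\<close> on the dual is evaluation at the element whose coordinates
  are the values of \<open>H\<close> at the coordinate forms.
\<close>

lemma projective_reflexive:
  fixes P :: "('a, 'm) module"
  assumes P: "projective A P" and H: "lin (opp A) (hom_dual A P) (regular (opp A)) H"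
  shows "\<exists>x\<in>carrier P. \<forall>h\<in>carrier (hom_dual A P). H h = h x"
proof -
  interpret O: fd_algebra K "opp A" by (rule fd_algebra_opp[OF fd_algebra_axioms])
  have lP: "left_module A P" using P by (rule projective_left_module)
  interpret P: left_module A P by fact
  obtain n :: nat and x \<phi> where d: "dual_basis A P {..<n} x \<phi>" using projective_dual_basis[OF P] by blast
  let ?X = "\<lambda>i. restrict (\<phi> i) (carrier P)"
  have xc: "x i \<in> carrier P" and Xc: "?X i \<in> carrier (hom_dual A P)" if "i < n" for i
    using d that restrict_hom_dual[OF lP] by (auto simp: dual_basis_def)
  have Hc: "H (?X i) \<in> carrier A" if "i < n" for i using lin_closed[OF H Xc[OF that]] by simp
  let ?p = "\<Oplus>\<^bsub>P\<^esub>i\<in>{..<n}. H (?X i) \<odot>\<^bsub>P\<^esub> x i"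
  show ?thesis
  proof (intro bexI ballI)
    show "?p \<in> carrier P" using xc Hc by (intro P.M.finsum_closed funcsetI P.smult_closed) auto
    fix h assume h: "h \<in> carrier (hom_dual A P)"
    have hl: "lin A P (regular A) h" using h by (simp add: hom_dual_carrier)
    have "H h = (\<Oplus>\<^bsub>A\<^esub>i\<in>{..<n}. H (?X i) \<otimes>\<^bsub>A\<^esub> h (x i))"
      using dual_basis_expand[OF left_module_hom_dual[OF lP] O.reg dual_basis_dual[OF lP d] H h] by simp
    also have "\<dots> = (\<Oplus>\<^bsub>A\<^esub>i\<in>{..<n}. h (H (?X i) \<odot>\<^bsub>P\<^esub> x i))"
      using lin_smult[OF hl Hc xc] Hc lin_closed[OF hl xc] by (intro A.finsum_cong') simp_all
    also have "\<dots> = h ?p"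
      using lin_finsum[OF lP reg hl, of "{..<n}" "\<lambda>i. H (?X i) \<odot>\<^bsub>P\<^esub> x i"] P.smult_closed[OF Hc xc] by simp
    finally show "H h = h ?p" .
  qed
qed

lemma projective_separate:
  fixes P :: "('a, 'm) module"
  assumes P: "projective A P" and x: "x \<in> carrier P" and z: "\<And>h. h \<in> carrier (hom_dual A P) \<Longrightarrow> h x = \<zero>\<^bsub>A\<^esub>"
  shows "x = \<zero>\<^bsub>P\<^esub>"
proof -
  have lP: "left_module A P" using P by (rule projective_left_module)
  interpret P: left_module A P by fact
  obtain n :: nat and y \<phi> where d: "dual_basis A P {..<n} y \<phi>" using projective_dual_basis[OF P] by blast
  have yc: "y i \<in> carrier P" and \<phi>: "\<phi> i x = \<zero>\<^bsub>A\<^esub>" if "i < n" for i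
    using d that z[of "restrict (\<phi> i) (carrier P)"] restrict_hom_dual[OF lP] x by (auto simp: dual_basis_def)
  have "x = (\<Oplus>\<^bsub>P\<^esub>i\<in>{..<n}. \<phi> i x \<odot>\<^bsub>P\<^esub> y i)" using d x by (simp add: dual_basis_def)
  also have "\<dots> = (\<Oplus>\<^bsub>P\<^esub>i\<in>{..<n}. \<zero>\<^bsub>P\<^esub>)"
    using yc \<phi> by (intro P.M.finsum_cong') (auto simp: smult_zero[OF lP])
  finally show ?thesis by simp
qed

text \<open>
  Exactness of the dual complex is exactness under maps to \<open>A\<close>, and by reflexivity the double dual is the
  complex itself. The indices are negated so that the differentials again raise the index.
\<close>

lemma totally_acyclic_dual:
  fixes P :: "int \<Rightarrow> ('a, 'm) module"
  assumes t: "totally_acyclic A P d"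
  shows "totally_acyclic (opp A) (\<lambda>i. hom_dual A (P (-i))) (\<lambda>i. dual_map (P (-i - 1)) (d (-i - 1)))"
  unfolding totally_acyclic_def
proof (intro conjI allI ballI impI)
  interpret O: fd_algebra K "opp A" by (rule fd_algebra_opp[OF fd_algebra_axioms])
  note T = totally_acyclicD[OF t]
  have lP: "left_module A (P i)" for i using T(1) by (rule projective_left_module)
  have dl: "lin A (P (k - 1)) (P k) (d (k - 1))" for k using T(2)[of "k - 1"] by simp
  fix i :: int
  define k where "k = -i"
  have k: "-i = k" "-(i + 1) = k - 1" "-(i - 1) = k + 1" "k + 1 - 1 = k"
    by (simp_all add: k_def)
  show "projective (opp A) (hom_dual A (P (-i)))" using T(1) by (rule projective_dual)
  show "lin (opp A) (hom_dual A (P (-i))) (hom_dual A (P (-(i + 1)))) (dual_map (P (-i - 1)) (d (-i - 1)))"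
    unfolding k by (intro lin_dual_map lP dl)
  show "dual_map (P (-i - 1)) (d (-i - 1)) h = \<zero>\<^bsub>hom_dual A (P (-(i + 1)))\<^esub> \<longleftrightarrow>
    h \<in> dual_map (P (-(i - 1) - 1)) (d (-(i - 1) - 1)) ` carrier (hom_dual A (P (-(i - 1))))"
    if "h \<in> carrier (hom_dual A (P (-i)))" for h
    using totally_acyclic_dual_exact[OF t that] unfolding k .
  show "\<exists>H'. lin (opp A) (hom_dual A (P (-(i + 1)))) (regular (opp A)) H' \<and>
    (\<forall>h\<in>carrier (hom_dual A (P (-i))). H' (dual_map (P (-i - 1)) (d (-i - 1)) h) = H h)"
    if "lin (opp A) (hom_dual A (P (-i))) (regular (opp A)) H \<and>
    (\<forall>h\<in>carrier (hom_dual A (P (-(i - 1)))). H (dual_map (P (-(i - 1) - 1)) (d (-(i - 1) - 1)) h) = \<zero>\<^bsub>opp A\<^esub>)" for H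
  proof -
    have H: "lin (opp A) (hom_dual A (P k)) (regular (opp A)) H"
      and z: "\<And>h. h \<in> carrier (hom_dual A (P (k + 1))) \<Longrightarrow> H (dual_map (P k) (d k) h) = \<zero>\<^bsub>A\<^esub>"
      using that unfolding k by auto
    obtain x where x: "x \<in> carrier (P k)" "\<And>h. h \<in> carrier (hom_dual A (P k)) \<Longrightarrow> H h = h x"
      using projective_reflexive[OF T(1) H] by blast
    have "d k x = \<zero>\<^bsub>P (k + 1)\<^esub>"
    proof (rule projective_separate[OF T(1) lin_closed[OF T(2) x(1)]])
      fix h assume h: "h \<in> carrier (hom_dual A (P (k + 1)))"
      show "h (d k x) = \<zero>\<^bsub>A\<^esub>"
        using z[OF h] x(2)[OF lin_closed[OF lin_dual_map[OF lP lP T(2)] h]] x(1) by (simp add: dual_map_apply)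
    qed
    then obtain y where y: "y \<in> carrier (P (k - 1))" "x = d (k - 1) y" using T(3)[OF x(1)] by blast
    show ?thesis unfolding k
    proof (intro exI conjI ballI)
      show "lin (opp A) (hom_dual A (P (k - 1))) (regular (opp A)) (\<lambda>h. h y)" using y(1) by (rule lin_dual_eval)
      show "dual_map (P (k - 1)) (d (k - 1)) h y = H h" if "h \<in> carrier (hom_dual A (P k))" for h
        using x(2)[OF that] y by (simp add: dual_map_apply)
    qed
  qed
qed

end

section \<open>Replacing the left half of a complex by a minimal resolution\<close>

lemma lin_factor:
  assumes P: "left_module R P" and M: "left_module R M" and L: "left_module R L" 
    and g: "lin R P M g" "g ` carrier P = carrier M" and k: "lin R P L k"
    and z: "\<And>x. x \<in> carrier P \<Longrightarrow> g x = \<zero>\<^bsub>M\<^esub> \<Longrightarrow> k x = \<zero>\<^bsub>L\<^esub>"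
  shows "\<exists>h. lin R M L h \<and> (\<forall>x\<in>carrier P. h (g x) = k x)"
proof -
  interpret P: left_module R P by fact
  interpret M: left_module R M by fact
  interpret L: left_module R L by fact
  have eq: "k x = k y" if "x \<in> carrier P" "y \<in> carrier P" "g x = g y" for x y
  proof -
    have "k (x \<ominus>\<^bsub>P\<^esub> y) = \<zero>\<^bsub>L\<^esub>"
      using that lin_closed[OF g(1)]
      by (intro z) (simp_all add: lin_minus[OF P M g(1)] diff_eq_zero_iff[OF M.M.abelian_group_axioms])
    then show ?thesis using that lin_closed[OF k]
      by (simp add: lin_minus[OF P L k] diff_eq_zero_iff[OF L.M.abelian_group_axioms])
  qed
  define h where "h m = k (inv_into (carrier P) g m)" for m
  have h: "h (g x) = k x" if x: "x \<in> carrier P" for x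
    unfolding h_def using x by (intro eq) (auto intro: inv_into_into f_inv_into_f)
  have m: "\<exists>x\<in>carrier P. m = g x" if "m \<in> carrier M" for m using that g(2) by auto
  have "lin R M L h"
  proof (rule linI)
    fix m assume "m \<in> carrier M"
    then obtain x where x: "x \<in> carrier P" "m = g x" using m by blast
    show "h m \<in> carrier L" using x lin_closed[OF k] by (simp add: h)
    show "h (a \<odot>\<^bsub>M\<^esub> m) = a \<odot>\<^bsub>L\<^esub> h m" if "a \<in> carrier R" for a
      using x that h[of "a \<odot>\<^bsub>P\<^esub> x"] by (simp add: h P.smult_closed lin_smult[OF g(1)] lin_smult[OF k])
    fix m' assume "m' \<in> carrier M"
    then obtain x' where x': "x' \<in> carrier P" "m' = g x'" using m by blast
    show "h (m \<oplus>\<^bsub>M\<^esub> m') = h m \<oplus>\<^bsub>L\<^esub> h m'"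
      using x x' h[of "x \<oplus>\<^bsub>P\<^esub> x'"] by (simp add: h lin_add[OF g(1)] lin_add[OF k])
  qed
  then show ?thesis using h by blast
qed

context fd_algebra
begin

text \<open>
  If \<open>N\<close> is a retract of \<open>L\<close>, then lifting the retraction to a projective cover \<open>Q\<close> of \<open>N\<close> and a
  projective module \<open>S\<close> above \<open>L\<close> gives an endomorphism of \<open>Q\<close> over the identity of \<open>N\<close>. It is bijective,
  so the syzygy of \<open>N\<close> in \<open>Q\<close> is in turn a retract of the kernel of \<open>S \<rightarrow> L\<close>. Therefore the extension of
  maps to \<open>A\<close> from the kernel to \<open>S\<close>, i.e. \<open>Ext\<^sup>1(L, A) = 0\<close>, implies the same for the syzygy and \<open>Q\<close>.
\<close>

lemma retract_syzygy:
  fixes S :: "('a, 's) module" and L :: "('a, 'l) module" and Q :: "('a, 'q) module" and N :: "('a, 'n) module"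
  assumes S: "projective A S" and L: "left_module A L" and N: "left_module A N"
    and p: "lin A S L p" "p ` carrier S = carrier L" and c: "cover Q q N"
    and a: "lin A L N a" and b: "lin A N L b" and ab: "\<And>x. x \<in> carrier N \<Longrightarrow> a (b x) = x"
    and ext: "\<And>h. lin A (S\<lparr>carrier := a_kernel S L p\<rparr>) (regular A) h \<Longrightarrow>
      \<exists>h'. lin A S (regular A) h' \<and> (\<forall>x\<in>a_kernel S L p. h' x = h x)"
  shows "\<exists>a' b'. lin A (S\<lparr>carrier := a_kernel S L p\<rparr>) (Q\<lparr>carrier := a_kernel Q N q\<rparr>) a' \<and>
      lin A (Q\<lparr>carrier := a_kernel Q N q\<rparr>) (S\<lparr>carrier := a_kernel S L p\<rparr>) b' \<and>
      (\<forall>x\<in>a_kernel Q N q. a' (b' x) = x)"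
    and "\<And>h. lin A (Q\<lparr>carrier := a_kernel Q N q\<rparr>) (regular A) h \<Longrightarrow>
      \<exists>h'. lin A Q (regular A) h' \<and> (\<forall>x\<in>a_kernel Q N q. h' x = h x)"
proof -
  have Q: "projective A Q" and q: "lin A Q N q" "q ` carrier Q = carrier N" using c by (auto simp: cover_def)
  note lS = projective_left_module[OF S] and lQ = projective_left_module[OF Q]
  let ?kS = "S\<lparr>carrier := a_kernel S L p\<rparr>" and ?kQ = "Q\<lparr>carrier := a_kernel Q N q\<rparr>"
  have kS: "a_kernel S L p \<subseteq> carrier S" and kQ: "a_kernel Q N q \<subseteq> carrier Q" by (auto simp: a_kernel_eq)
  obtain b0 where b0: "lin A Q S b0" "\<And>x. x \<in> carrier Q \<Longrightarrow> p (b0 x) = b (q x)"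
    using projective_lift[OF Q lS L p(1) lin_comp[OF q(1) b]] p(2) lin_closed[OF b] lin_closed[OF q(1)] by auto
  obtain a0 where a0: "lin A S Q a0" "\<And>x. x \<in> carrier S \<Longrightarrow> q (a0 x) = a (p x)"
    using projective_lift[OF S lQ N q(1) lin_comp[OF p(1) a]] q(2) lin_closed[OF a] lin_closed[OF p(1)] by auto
  define e where "e x = a0 (b0 x)" for x
  have e: "lin A Q Q e" unfolding e_def using b0(1) a0(1) by (rule lin_comp)
  have qe: "q (e x) = q x" if "x \<in> carrier Q" for x
    using that b0 a0(2)[OF lin_closed[OF b0(1) that]] ab[OF lin_closed[OF q(1) that]] by (simp add: e_def)
  note bij = cover_endo_bij[OF c e qe]
  let ?i = "inv_into (carrier Q) e"
  have i: "lin A Q Q ?i" by (rule lin_inv[OF lQ e bij(2) bij(1)])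
  have ie: "?i (e x) = x" if "x \<in> carrier Q" for x using bij(2) that by (rule inv_into_f_f)
  have qi: "q (?i z) = q z" if z: "z \<in> carrier Q" for z
  proof -
    have "e (?i z) = z" using z bij(1) by (intro f_inv_into_f) simp
    then show ?thesis using qe[OF lin_closed[OF i z]] by simp
  qed
  have a': "lin A ?kS ?kQ (\<lambda>x. ?i (a0 x))"
    unfolding lin_restr_cod_iff[OF kQ]
  proof
    show "lin A ?kS Q (\<lambda>x. ?i (a0 x))" by (rule lin_restr_dom[OF lin_comp[OF a0(1) i] kS])
    show "(\<lambda>x. ?i (a0 x)) ` carrier ?kS \<subseteq> a_kernel Q N q"
      using lin_closed[OF i] lin_closed[OF a0(1)] qi a0(2) lin_zero[OF L N a] by (auto simp: a_kernel_eq)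
  qed
  have b': "lin A ?kQ ?kS b0"
    unfolding lin_restr_cod_iff[OF kS]
  proof
    show "lin A ?kQ S b0" using b0(1) kQ by (rule lin_restr_dom)
    show "b0 ` carrier ?kQ \<subseteq> a_kernel S L p"
      using lin_closed[OF b0(1)] b0(2) lin_zero[OF N L b] by (auto simp: a_kernel_eq)
  qed
  have id: "?i (a0 (b0 x)) = x" if "x \<in> a_kernel Q N q" for x
    using ie[of x] that kQ by (auto simp: e_def)
  show "\<exists>a' b'. lin A ?kS ?kQ a' \<and> lin A ?kQ ?kS b' \<and> (\<forall>x\<in>a_kernel Q N q. a' (b' x) = x)"
    using a' b' id by blast
  fix h assume h: "lin A ?kQ (regular A) h"
  obtain k where k: "lin A S (regular A) k" "\<forall>x\<in>a_kernel S L p. k x = h (?i (a0 x))"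
    using ext[OF lin_comp[OF a' h]] by blast
  have "k (b0 x) = h x" if "x \<in> a_kernel Q N q" for x
    using k(2) id[OF that] lin_closed[OF b', of x] that by simp
  then show "\<exists>h'. lin A Q (regular A) h' \<and> (\<forall>x\<in>a_kernel Q N q. h' x = h x)"
    using lin_comp[OF b0(1) k(1)] by blast
qed

text \<open>
  The first two steps are prescribed by the given presentation; from then on a projective cover of the
  last syzygy \<open>N n\<close> is chosen at each step.
\<close>

lemma ex_minimal_resolution:
  fixes M Q0 Q1 :: "('k, 'a) std_module"
  assumes M: "fg_module A M" and m: "minimal_presentation Q1 f Q0 g M"
  shows "\<exists>(N :: nat \<Rightarrow> ('k, 'a) std_module) (Q :: nat \<Rightarrow> ('k, 'a) std_module) q.
    N 0 = M \<and> Q 0 = Q0 \<and> q 0 = g \<and> Q 1 = Q1 \<and> q 1 = f \<and>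
    (\<forall>n. cover (Q n) (q n) (N n)) \<and> (\<forall>n. fg_module A (N n)) \<and>
    (\<forall>n. N (Suc n) = (Q n)\<lparr>carrier := a_kernel (Q n) (N n) (q n)\<rparr>)"
proof -
  define pc where "pc N = (SOME t. cover (fst t :: ('k, 'a) std_module) (snd t) N)" for N :: "('k, 'a) std_module"
  have pc: "cover (fst (pc N)) (snd (pc N)) N" if "fg_module A N" for N
  proof -
    obtain P g where "cover (P :: ('k, 'a) std_module) g N" using ex_cover[OF \<open>fg_module A N\<close>] by blast
    then have "\<exists>t. cover (fst t :: ('k, 'a) std_module) (snd t) N" by (intro exI[of _ "(P, g)"]) simp
    then show ?thesis unfolding pc_def by (rule someI_ex)
  qed
  define syz where "syz t = (fst (snd t))\<lparr>carrier := a_kernel (fst (snd t)) (fst t) (snd (snd t))\<rparr>"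
    for t :: "('k, 'a) std_module \<times> ('k, 'a) std_module \<times> ((nat \<Rightarrow> 'k) \<Rightarrow> (nat \<Rightarrow> 'k))"
  define st where "st = rec_nat (M, Q0, g) (\<lambda>n t. (syz t, if n = 0 then (Q1, f) else pc (syz t)))"
  have st0: "st 0 = (M, Q0, g)" and stS: "\<And>n. st (Suc n) = (syz (st n), if n = 0 then (Q1, f) else pc (syz (st n)))"
    by (simp_all add: st_def)
  define N Q q where "N n = fst (st n)" and "Q n = fst (snd (st n))" and "q n = snd (snd (st n))" for n
  have NS: "N (Suc n) = (Q n)\<lparr>carrier := a_kernel (Q n) (N n) (q n)\<rparr>" for n
    by (simp add: N_def Q_def q_def stS syz_def)
  have "cover (Q n) (q n) (N n) \<and> fg_module A (N n)" for n
  proof (induction n)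
    case 0 then show ?case using m M by (simp add: N_def Q_def q_def st0 minimal_presentation_def)
  next
    case (Suc n)
    then have Q: "projective A (Q n)" and q: "lin A (Q n) (N n) (q n)" by (auto simp: cover_def)
    have fg: "fg_module A (N (Suc n))" unfolding NS
      using Suc q projective_left_module[OF Q] projective_fg[OF Q]
      by (intro fg_module_submodule submodule_kernel) (auto dest: fg_moduleD)
    show ?case
    proof (cases "n = 0")
      case True
      then show ?thesis using fg m by (simp add: N_def Q_def q_def stS st0 syz_def minimal_presentation_def)
    next
      case False
      then show ?thesis using fg pc[OF fg] by (simp add: N_def Q_def q_def stS)
    qed
  qed
  then show ?thesis using NS
    by (intro exI[of _ N] exI[of _ Q] exI[of _ q]) (simp add: N_def Q_def q_def st0 stS)
qed

text \<open>
  The right half of \<open>P\<close> is glued to the minimal resolution \<open>Q\<close> of \<open>M\<close> along \<open>Q 0 \<rightarrow> M \<rightarrow> P 0\<close>. The new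
  complex is exact by construction. It stays exact under maps to \<open>A\<close> because maps from the syzygies
  \<open>N (Suc n)\<close> of the resolution extend to \<open>Q n\<close>, the syzygies being retracts of those of \<open>P\<close>.
\<close>

lemma totally_acyclic_minimal:
  fixes M Q0 Q1 :: "('k, 'a) std_module" and P :: "int \<Rightarrow> ('k, 'a) std_module"
  assumes M: "fg_module A M" and m: "minimal_presentation Q1 f Q0 g M" and t: "totally_acyclic A P d"
    and \<iota>: "lin A M (P 0) \<iota>" "inj_on \<iota> (carrier M)" "\<iota> ` carrier M = d (-1) ` carrier (P (-1))"
  shows "\<exists>(T :: int \<Rightarrow> ('k, 'a) std_module) e. totally_acyclic A T e \<and> T (-1) = Q0 \<and> T (-2) = Q1 \<and> e (-2) = f"
proof -
  note tz = totally_acyclic_zero[OF t]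
  note t = totally_acyclicD[OF t]
  have lP: "left_module A (P i)" for i using t(1) by (rule projective_left_module)
  have lM: "left_module A M" using M by (rule fg_moduleD)
  from ex_minimal_resolution[OF M m]
  obtain N Q :: "nat \<Rightarrow> ('k, 'a) std_module" and q where N0: "N 0 = M" and Q0: "Q 0 = Q0" and q0: "q 0 = g"
    and Q1: "Q 1 = Q1" and q1: "q 1 = f" and cov: "\<forall>n. cover (Q n) (q n) (N n)" and fgN: "\<forall>n. fg_module A (N n)"
    and NS: "\<forall>n. N (Suc n) = (Q n)\<lparr>carrier := a_kernel (Q n) (N n) (q n)\<rparr>"
    by (elim exE conjE)
  have lN: "left_module A (N n)" for n using fgN fg_moduleD by blast
  have pQ: "projective A (Q n)" and qN: "lin A (Q n) (N n) (q n)" and qs: "q n ` carrier (Q n) = carrier (N n)" for n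
    using cov by (auto simp: cover_def)
  have lQ: "left_module A (Q n)" for n using pQ by (rule projective_left_module)
  have NSc: "carrier (N (Suc n)) = {x \<in> carrier (Q n). q n x = \<zero>\<^bsub>N n\<^esub>}" for n
    using NS by (simp add: a_kernel_eq)
  have qS: "lin A (Q (Suc n)) (Q n) (q (Suc n))" for n
  proof -
    have "lin A (Q (Suc n)) ((Q n)\<lparr>carrier := a_kernel (Q n) (N n) (q n)\<rparr>) (q (Suc n))"
      using qN[of "Suc n"] spec[OF NS, of n] by simp
    then show ?thesis by (subst (asm) lin_restr_cod_iff) (auto simp: a_kernel_eq)
  qed
  have zN: "\<zero>\<^bsub>N (Suc n)\<^esub> = \<zero>\<^bsub>Q n\<^esub>" for n using spec[OF NS, of n] by simp
  have qk: "q n x = \<zero>\<^bsub>N n\<^esub> \<longleftrightarrow> x \<in> q (Suc n) ` carrier (Q (Suc n))" if "x \<in> carrier (Q n)" for n x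
    using qs[of "Suc n"] NSc[of n] that by simp
  \<comment> \<open>The syzygies \<open>L n\<close> of \<open>M\<close> in the given complex, with \<open>p n\<close> the projection onto \<open>L n\<close>.\<close>
  define L where "L n = (P (-int n))\<lparr>carrier := d (-int n - 1) ` carrier (P (-int n - 1))\<rparr>" for n
  define p where "p n = d (-int n - 1)" for n
  have dn: "lin A (P (-int n - 1)) (P (-int n)) (p n)" for n using t(2)[of "-int n - 1"] by (simp add: p_def)
  have dsub: "d (-int n - 1) ` carrier (P (-int n - 1)) \<subseteq> carrier (P (-int n))" for n
    using lin_closed[OF dn[of n]] by (auto simp: p_def)
  have lL: "left_module A (L n)" for n
    unfolding L_def using submodule_image[OF lP lP dn submodule_carrier[OF lP]]
    by (intro left_module_restr[OF lP]) (simp add: p_def)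
  have pL: "lin A (P (-int n - 1)) (L n) (p n)" for n
    unfolding L_def lin_restr_cod_iff[OF dsub] using dn by (simp add: p_def)
  have ps: "p n ` carrier (P (-int n - 1)) = carrier (L n)" for n by (simp add: L_def p_def)
  have i2: "-int n - 1 - 1 = -int (Suc n) - 1" "-int n - 1 = -int (Suc n)" for n by simp_all
  have pk: "a_kernel (P (-int n - 1)) (L n) (p n) = carrier (L (Suc n))" for n
  proof -
    have "d (-int n - 1) x = \<zero>\<^bsub>P (-int n)\<^esub> \<longleftrightarrow> x \<in> d (-int (Suc n) - 1) ` carrier (P (-int (Suc n) - 1))"
      if "x \<in> carrier (P (-int n - 1))" for x using t(3)[OF that] by (simp add: i2)
    moreover have "d (-int (Suc n) - 1) ` carrier (P (-int (Suc n) - 1)) \<subseteq> carrier (P (-int n - 1))"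
      using dsub[of "Suc n"] unfolding i2(2) .
    ultimately show ?thesis by (auto simp: a_kernel_eq L_def p_def)
  qed
  have LS: "(P (-int n - 1))\<lparr>carrier := a_kernel (P (-int n - 1)) (L n) (p n)\<rparr> = L (Suc n)" for n
  proof -
    have upd: "R\<lparr>carrier := carrier (R\<lparr>carrier := D\<rparr>)\<rparr> = R\<lparr>carrier := D\<rparr>" for R :: "('k, 'a) std_module" and D
      by simp
    show ?thesis unfolding pk unfolding L_def i2(2) by (rule upd)
  qed
  have Lext: "\<exists>h'. lin A (P (-int n - 1)) (regular A) h' \<and> (\<forall>x\<in>a_kernel (P (-int n - 1)) (L n) (p n). h' x = h x)"
    if h: "lin A ((P (-int n - 1))\<lparr>carrier := a_kernel (P (-int n - 1)) (L n) (p n)\<rparr>) (regular A) h" for n h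
  proof -
    let ?j = "-int (Suc n) - 1"
    have hL: "lin A (P ?j) (regular A) (\<lambda>y. h (d ?j y))"
      using lin_comp[OF pL[of "Suc n"] h[unfolded LS]] by (simp add: p_def)
    have "h (d ?j (d (?j - 1) y)) = \<zero>\<^bsub>A\<^esub>" if "y \<in> carrier (P (?j - 1))" for y
      using tz[OF that] lin_zero[OF lL reg h[unfolded LS]] by (simp add: L_def)
    then obtain h' where h': "lin A (P (?j + 1)) (regular A) h'" "\<forall>x\<in>carrier (P ?j). h' (d ?j x) = h (d ?j x)"
      using t(4)[OF hL] by blast
    have j: "?j + 1 = -int n - 1" by simp
    show ?thesis unfolding pk using h'(1)[unfolded j] h'(2) by (intro exI[of _ h'] conjI) (auto simp: L_def)
  qed
  have NSr: "(Q n)\<lparr>carrier := a_kernel (Q n) (N n) (q n)\<rparr> = N (Suc n)" for n using NS by simp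
  have NSk: "a_kernel (Q n) (N n) (q n) = carrier (N (Suc n))" for n by (simp add: NS[rule_format, of n])
  have ret: "\<exists>a b. lin A (L n) (N n) a \<and> lin A (N n) (L n) b \<and> (\<forall>x\<in>carrier (N n). a (b x) = x)" for n
  proof (induction n)
    case 0
    have \<iota>L: "lin A M (L 0) \<iota>" unfolding L_def lin_restr_cod_iff[OF dsub[of 0]] using \<iota> by simp
    have "\<iota> ` carrier M = carrier (L 0)" using \<iota>(3) by (simp add: L_def)
    then have "lin A (L 0) M (inv_into (carrier M) \<iota>)" by (intro lin_inv[OF lM \<iota>L \<iota>(2)])
    then show ?case using \<iota>L \<iota>(2) unfolding N0
      by (intro exI[of _ "inv_into (carrier M) \<iota>"] exI[of _ \<iota>]) simp
  next
    case (Suc n)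
    then obtain a b where ab: "lin A (L n) (N n) a" "lin A (N n) (L n) b" "\<And>x. x \<in> carrier (N n) \<Longrightarrow> a (b x) = x"
      by blast
    show ?case
      by (rule retract_syzygy(1)[OF t(1) lL lN pL ps spec[OF cov, of n] ab(1,2), unfolded LS NSr, unfolded NSk])
        (rule ab(3), assumption, rule Lext[unfolded LS], assumption)
  qed
  have Next: "\<exists>h'. lin A (Q n) (regular A) h' \<and> (\<forall>x\<in>carrier (N (Suc n)). h' x = h x)"
    if h: "lin A (N (Suc n)) (regular A) h" for n h
  proof -
    obtain a b where ab: "lin A (L n) (N n) a" "lin A (N n) (L n) b" "\<And>x. x \<in> carrier (N n) \<Longrightarrow> a (b x) = x"
      using ret[of n] by blast
    show ?thesis
      by (rule retract_syzygy(2)[OF t(1) lL lN pL ps spec[OF cov, of n] ab(1,2), unfolded LS NSr, unfolded NSk])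
        (rule ab(3), assumption, rule Lext[unfolded LS], assumption, rule h)
  qed
  \<comment> \<open>Index \<open>-1 - n\<close> of the new complex is step \<open>n\<close> of the resolution.\<close>
  define T where "T j = (if j \<ge> 0 then P j else Q (nat (-1 - j)))" for j :: int
  define e where "e j = (if j \<ge> 0 then d j else if j = -1 then (\<lambda>x. \<iota> (g x)) else q (nat (-1 - j)))" for j :: int
  have TP: "T j = P j" "e j = d j" if "j \<ge> 0" for j using that by (simp_all add: T_def e_def)
  have TQ: "T (-1 - int n) = Q n" for n by (simp add: T_def)
  have T1: "T (-1) = Q0" "T (-2) = Q1" using TQ[of 0] TQ[of 1] by (simp_all add: Q0 Q1[unfolded One_nat_def])
  have e1: "e (-1) = (\<lambda>x. \<iota> (g x))" by (simp add: e_def)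
  have eq: "e (-2 - int n) = q (Suc n)" for n by (simp add: e_def nat_add_distrib)
  have TQ2: "T (-2 - int n) = Q (Suc n)" "T (-2 - int n + 1) = Q n" "T (-2 - int n - 1) = Q (Suc (Suc n))"
    "e (-2 - int n - 1) = q (Suc (Suc n))" for n
  proof -
    have i: "-2 - int n = -1 - int (Suc n)" "-2 - int n + 1 = -1 - int n"
      "-2 - int n - 1 = -1 - int (Suc (Suc n))" "-2 - int n - 1 = -2 - int (Suc n)" by simp_all
    show "T (-2 - int n) = Q (Suc n)" unfolding i(1) by (rule TQ)
    show "T (-2 - int n + 1) = Q n" unfolding i(2) by (rule TQ)
    show "T (-2 - int n - 1) = Q (Suc (Suc n))" unfolding i(3) by (rule TQ)
    show "e (-2 - int n - 1) = q (Suc (Suc n))" unfolding i(4) by (rule eq)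
  qed
  have g: "lin A Q0 M g" "g ` carrier Q0 = carrier M" using qN[of 0] qs[of 0] by (simp_all add: Q0 q0 N0)
  have \<iota>z: "\<iota> x = \<zero>\<^bsub>P 0\<^esub> \<longleftrightarrow> x = \<zero>\<^bsub>M\<^esub>" if "x \<in> carrier M" for x
    using lin_inj_iff[OF lM lP \<iota>(1)] \<iota>(2) lin_zero[OF lM lP \<iota>(1)] that by auto
  have cases: "(j \<ge> 1) \<or> j = 0 \<or> j = -1 \<or> (\<exists>n. j = -2 - int n)" for j :: int
  proof (cases "j \<ge> -1")
    case True then show ?thesis by auto
  next
    case False
    then have "j = -2 - int (nat (-2 - j))" by simp
    then show ?thesis by blast
  qed
  have "totally_acyclic A T e" unfolding totally_acyclic_def
  proof (intro conjI allI)
    fix j :: int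
    show "projective A (T j)" by (simp add: T_def t(1) pQ)
    show "lin A (T j) (T (j + 1)) (e j)"
      using cases[of j]
    proof (elim disjE exE)
      assume "j = -1"
      then show ?thesis using lin_comp[OF g(1) \<iota>(1)] by (simp add: T1 e1 TP)
    next
      fix n assume "j = -2 - int n"
      then show ?thesis using qS[of n] by (simp only: TQ2 eq)
    qed (use t(2)[of j] in \<open>simp_all add: TP\<close>)
    show "\<forall>x\<in>carrier (T j). e j x = \<zero>\<^bsub>T (j + 1)\<^esub> \<longleftrightarrow> x \<in> e (j - 1) ` carrier (T (j - 1))"
      using cases[of j]
    proof (elim disjE exE)
      assume "j \<ge> 1"
      then show ?thesis using t(3)[of _ j] by (simp add: TP)
    next
      assume j: "j = 0"
      have "(\<lambda>x. \<iota> (g x)) ` carrier Q0 = d (-1) ` carrier (P (-1))"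
        unfolding \<iota>(3)[symmetric] g(2)[symmetric] by (simp add: image_image)
      then show ?thesis using t(3)[of _ 0] by (simp add: j TP T1 e1)
    next
      assume j: "j = -1"
      show ?thesis using qk[of _ 0] \<iota>z lin_closed[OF g(1)]
        by (simp add: j TP T1 e1 Q0 q0 N0 Q1 q1[unfolded One_nat_def] Q1[unfolded One_nat_def] eq[of 0, simplified])
    next
      fix n assume j: "j = -2 - int n"
      show ?thesis using qk[of _ "Suc n"] unfolding j TQ2 eq zN by blast
    qed
    show "lin A (T j) (regular A) h \<and> (\<forall>y\<in>carrier (T (j - 1)). h (e (j - 1) y) = \<zero>\<^bsub>A\<^esub>) \<longrightarrow>
      (\<exists>h'. lin A (T (j + 1)) (regular A) h' \<and> (\<forall>x\<in>carrier (T j). h' (e j x) = h x))" for h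
    proof (intro impI, elim conjE)
      assume h: "lin A (T j) (regular A) h" and z: "\<forall>y\<in>carrier (T (j - 1)). h (e (j - 1) y) = \<zero>\<^bsub>A\<^esub>"
      show "\<exists>h'. lin A (T (j + 1)) (regular A) h' \<and> (\<forall>x\<in>carrier (T j). h' (e j x) = h x)"
        using cases[of j]
      proof (elim disjE exE)
        assume "j \<ge> 1"
        then show ?thesis using t(4)[of j h] h z by (simp add: TP)
      next
        assume j: "j = 0"
        have hP: "lin A (P 0) (regular A) h" using h by (simp add: j TP)
        have "h (d (-1) y) = \<zero>\<^bsub>A\<^esub>" if "y \<in> carrier (P (-1))" for y
        proof -
          have "d (-1) y \<in> \<iota> ` g ` carrier Q0" using that unfolding \<iota>(3) g(2) by blast
          then show ?thesis using z by (auto simp: j T1 e1)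
        qed
        then show ?thesis using t(4)[of 0 h] hP by (simp add: j TP)
      next
        assume j: "j = -1"
        have hQ: "lin A Q0 (regular A) h" using h by (simp add: j T1)
        have "h x = \<zero>\<^bsub>A\<^esub>" if "x \<in> carrier Q0" "g x = \<zero>\<^bsub>M\<^esub>" for x
        proof -
          have "x \<in> f ` carrier Q1" using qk[of x 0] that by (simp add: Q0 q0 N0 Q1[unfolded One_nat_def] q1[unfolded One_nat_def])
          then show ?thesis using z by (auto simp: j T1 eq[of 0, simplified] q1[unfolded One_nat_def])
        qed
        then obtain k where k: "lin A M (regular A) k" "\<forall>x\<in>carrier Q0. k (g x) = h x"
          using lin_factor[OF lQ[of 0, unfolded Q0] lM reg g hQ] by auto
        have \<iota>L: "lin A M (L 0) \<iota>" unfolding L_def lin_restr_cod_iff[OF dsub[of 0]] using \<iota> by simp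
        have "\<iota> ` carrier M = carrier (L 0)" using \<iota>(3) by (simp add: L_def)
        then have \<iota>i: "lin A (L 0) M (inv_into (carrier M) \<iota>)" by (intro lin_inv[OF lM \<iota>L \<iota>(2)])
        have dL: "lin A (P (-1)) (L 0) (d (-1))" using pL[of 0] by (simp add: p_def)
        \<comment> \<open>At the joint, \<open>k\<close> is extended from \<open>M\<close>, embedded by \<open>\<iota>\<close>, to \<open>P 0\<close>: it is seen as a
          cocycle on \<open>P (-1)\<close>, which factors through the differential of the given complex.\<close>
        let ?k = "\<lambda>x. k (inv_into (carrier M) \<iota> (d (-1) x))"
        have kl: "lin A (P (-1)) (regular A) ?k" by (rule lin_comp[OF lin_comp[OF dL \<iota>i] k(1)])
        have "?k (d (-1 - 1) y) = \<zero>\<^bsub>A\<^esub>" if "y \<in> carrier (P (-1 - 1))" for y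
          using tz[OF that] lin_zero[OF lL lM \<iota>i] lin_zero[OF lM reg k(1)] by (simp add: L_def)
        then obtain h' where h': "lin A (P (-1 + 1)) (regular A) h'" "\<forall>x\<in>carrier (P (-1)). h' (d (-1) x) = ?k x"
          using t(4)[OF kl] by blast
        have "h' (\<iota> m) = k m" if m: "m \<in> carrier M" for m
        proof -
          have "\<iota> m \<in> d (-1) ` carrier (P (-1))" using m \<iota>(3) by blast
          then obtain y where "y \<in> carrier (P (-1))" "\<iota> m = d (-1) y" by blast
          then show ?thesis using h'(2) inv_into_f_f[OF \<iota>(2) m] by metis
        qed
        then show ?thesis using h'(1) k(2) lin_closed[OF g(1)]
          by (intro exI[of _ h']) (simp add: j T1 e1 TP)
      next
        fix n assume j: "j = -2 - int n"
        have hQ: "lin A (Q (Suc n)) (regular A) h" using h unfolding j TQ2 .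
        have "h x = \<zero>\<^bsub>A\<^esub>" if "x \<in> carrier (Q (Suc n))" "q (Suc n) x = \<zero>\<^bsub>N (Suc n)\<^esub>" for x
          using qk[OF that(1)] that(2) z unfolding j TQ2 by auto
        then obtain k where k: "lin A (N (Suc n)) (regular A) k" "\<forall>x\<in>carrier (Q (Suc n)). k (q (Suc n) x) = h x"
          using lin_factor[OF lQ lN reg qN qs hQ] by auto
        obtain h' where "lin A (Q n) (regular A) h'" "\<forall>x\<in>carrier (N (Suc n)). h' x = k x"
          using Next[OF k(1)] by blast
        then show ?thesis unfolding j TQ2 eq using k(2) lin_closed[OF qN[of "Suc n"]]
          by (intro exI[of _ h']) simp
      qed
    qed
  qed
  moreover have "e (-2) = f" using eq[of 0] by (simp add: q1[unfolded One_nat_def])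
  ultimately show ?thesis using T1 by blast
qed

end

section \<open>Passing to the opposite algebra\<close>

context fd_algebra
begin

text \<open>
  For fixed \<open>y\<close> the values \<open>V h y\<close> are a linear form in \<open>h\<close>, which is evaluation at an element of the
  reflexive module \<open>Q\<close>; the dual basis makes the choice of this element linear in \<open>y\<close>.
\<close>

lemma dual_map_full:
  fixes P :: "('a, 'p) module" and Q :: "('a, 'q) module"
  assumes P: "left_module A P" and Q: "projective A Q"
    and V: "lin (opp A) (hom_dual A Q) (hom_dual A P) V"
  shows "\<exists>u. lin A P Q u \<and> (\<forall>h\<in>carrier (hom_dual A Q). V h = dual_map P u h)"
proof -
  have lQ: "left_module A Q" using Q by (rule projective_left_module)
  interpret Q: left_module A Q by fact
  obtain n :: nat and x \<phi> where d: "dual_basis A Q {..<n} x \<phi>" using projective_dual_basis[OF Q] by blast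
  let ?X = "\<lambda>i. restrict (\<phi> i) (carrier Q)"
  have xc: "x i \<in> carrier Q" and Xc: "?X i \<in> carrier (hom_dual A Q)" if "i < n" for i
    using d that restrict_hom_dual[OF lQ] by (auto simp: dual_basis_def)
  have Vl: "lin A P (regular A) (V (?X i))" if "i < n" for i
    using lin_closed[OF V Xc[OF that]] by (simp add: hom_dual_carrier)
  have Vc: "V (?X i) y \<in> carrier A" if "i < n" "y \<in> carrier P" for i y
    using lin_closed[OF Vl[OF that(1)] that(2)] by simp
  let ?u = "\<lambda>y. \<Oplus>\<^bsub>Q\<^esub>i\<in>{..<n}. V (?X i) y \<odot>\<^bsub>Q\<^esub> x i"
  have u: "lin A P Q ?u" using Vl xc by (intro lin_sum[OF lQ] lin_smult_const[OF lQ]) auto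
  have "V h = dual_map P ?u h" if h: "h \<in> carrier (hom_dual A Q)" for h
  proof (rule hom_dual_ext[OF lin_closed[OF V h] lin_closed[OF lin_dual_map[OF P lQ u] h]])
    have hl: "lin A Q (regular A) h" using h by (simp add: hom_dual_carrier)
    fix y assume y: "y \<in> carrier P"
    have Vy: "lin (opp A) (hom_dual A Q) (regular (opp A)) (\<lambda>h. V h y)"
      using lin_comp[OF V lin_dual_eval[OF y]] .
    interpret O: fd_algebra K "opp A" by (rule fd_algebra_opp[OF fd_algebra_axioms])
    have "V h y = (\<Oplus>\<^bsub>A\<^esub>i\<in>{..<n}. V (?X i) y \<otimes>\<^bsub>A\<^esub> h (x i))"
      using dual_basis_expand[OF left_module_hom_dual[OF lQ] O.reg dual_basis_dual[OF lQ d] Vy h] by simp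
    also have "\<dots> = (\<Oplus>\<^bsub>A\<^esub>i\<in>{..<n}. h (V (?X i) y \<odot>\<^bsub>Q\<^esub> x i))"
      using lin_smult[OF hl Vc[OF _ y] xc] Vc[OF _ y] lin_closed[OF hl xc] by (intro A.finsum_cong') simp_all
    also have "\<dots> = h (?u y)"
      using lin_finsum[OF lQ reg hl, of "{..<n}" "\<lambda>i. V (?X i) y \<odot>\<^bsub>Q\<^esub> x i"] Q.smult_closed[OF Vc[OF _ y] xc] by simp
    finally show "V h y = dual_map P ?u h y" using y by (simp add: dual_map_apply)
  qed
  then show ?thesis using u by blast
qed

text \<open>
  The defining condition quantifies over modules with a fixed type of elements; it holds for modules
  with elements of any type.
\<close>

lemma cm_tau_tilting_free_projective:
  fixes M :: "('a, 'm) module" and P :: "int \<Rightarrow> ('a, 'n) module" and Q1 :: "('a, 'q) module" and Q0 :: "('a, 'p) module"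
  assumes free: "cm_tau_tilting_free K A" and M: "fg_module A M" and t: "totally_acyclic A P d"
    and \<iota>: "lin A M (P j) \<iota>" "inj_on \<iota> (carrier M)" "\<iota> ` carrier M = d (j - 1) ` carrier (P (j - 1))"
    and r: "rigid_presentation Q1 f Q0 g M"
  shows "projective A M"
proof -
  have lM: "left_module A M" using M by (rule fg_moduleD)
  obtain N :: "('k, 'a) std_module" and u v where N: "fg_module A N" and u: "lin A M N u" and v: "lin A N M v"
    and vu: "\<And>x. x \<in> carrier M \<Longrightarrow> v (u x) = x" and uv: "\<And>x. x \<in> carrier N \<Longrightarrow> u (v x) = x"
    using ex_copy[OF M] by metis
  have lN: "left_module A N" using N by (rule fg_moduleD)
  have vs: "v ` carrier N = carrier M"
  proof
    show "v ` carrier N \<subseteq> carrier M" using lin_closed[OF v] by blast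
    show "carrier M \<subseteq> v ` carrier N"
    proof
      fix x assume "x \<in> carrier M"
      then have "x = v (u x)" "u x \<in> carrier N" using vu lin_closed[OF u] by simp_all
      then show "x \<in> v ` carrier N" by (rule image_eqI)
    qed
  qed
  have "gorenstein_projective A N"
  proof (rule gorenstein_projectiveI[OF N t])
    show "lin A N (P j) (\<lambda>x. \<iota> (v x))" using v \<iota>(1) by (rule lin_comp)
    show "inj_on (\<lambda>x. \<iota> (v x)) (carrier N)"
    proof (rule inj_onI)
      fix x y assume xy: "x \<in> carrier N" "y \<in> carrier N" "\<iota> (v x) = \<iota> (v y)"
      have "v x = v y" using lin_closed[OF v] xy by (intro inj_onD[OF \<iota>(2) xy(3)])
      then show "x = y" using uv xy(1,2) by metis
    qed
    show "(\<lambda>x. \<iota> (v x)) ` carrier N = d (j - 1) ` carrier (P (j - 1))"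
      unfolding \<iota>(3)[symmetric] vs[symmetric] by (simp add: image_image)
  qed
  moreover have "rigid_presentation Q1 f Q0 (\<lambda>x. u (g x)) N"
    unfolding rigid_presentation_def presentation_def
  proof (intro conjI allI impI ballI)
    note r' = r[unfolded rigid_presentation_def presentation_def]
    have g: "lin A Q0 M g" "g ` carrier Q0 = carrier M" using r' by auto
    show "projective A Q1" "projective A Q0" "lin A Q1 Q0 f" using r' by auto
    show "lin A Q0 N (\<lambda>x. u (g x))" using g(1) u by (rule lin_comp)
    have "u ` carrier M = carrier N"
    proof
      show "u ` carrier M \<subseteq> carrier N" using lin_closed[OF u] by blast
      show "carrier N \<subseteq> u ` carrier M"
      proof
        fix x assume "x \<in> carrier N"
        then have "x = u (v x)" "v x \<in> carrier M" using uv lin_closed[OF v] by simp_all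
        then show "x \<in> u ` carrier M" by (rule image_eqI)
      qed
    qed
    then show "(\<lambda>x. u (g x)) ` carrier Q0 = carrier N" unfolding g(2)[symmetric] by (simp add: image_image)
    show "u (g x) = \<zero>\<^bsub>N\<^esub> \<longleftrightarrow> x \<in> f ` carrier Q1" if x: "x \<in> carrier Q0" for x
    proof -
      have "u (g x) = \<zero>\<^bsub>N\<^esub> \<longleftrightarrow> g x = \<zero>\<^bsub>M\<^esub>"
        using vu[OF lin_closed[OF g(1) x]] lin_zero[OF lM lN u] lin_zero[OF lN lM v] by metis
      then show ?thesis using r' x by auto
    qed
    fix w assume w: "lin A Q1 N w"
    obtain k where k: "lin A Q0 M k" "\<forall>y\<in>carrier Q1. v (w y) = k (f y)" using r' lin_comp[OF w v] by blast
    have "w y = u (k (f y))" if "y \<in> carrier Q1" for y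
      using k(2) that uv[OF lin_closed[OF w that]] by simp
    then show "\<exists>v. lin A Q0 N v \<and> (\<forall>y\<in>carrier Q1. w y = v (f y))" using lin_comp[OF k(1) u] by blast
  qed
  then have "tau_rigid K A N" by (rule tau_rigidI[OF N])
  ultimately have "projective A N" using free by (simp add: cm_tau_tilting_free_def)
  then show ?thesis by (rule projective_retract[OF _ lM v u]) (rule vu)
qed

text \<open>
  The module over the opposite algebra used here is the transpose \<open>N = Coker(Q0\<^sup>* \<rightarrow> Q1\<^sup>*)\<close> of \<open>M\<close> for a
  minimal presentation. It is Gorenstein projective as an image in the dual of a complex through
  \<open>Q1 \<rightarrow> Q0\<close>. For its rigidity, let \<open>u : Q1 \<rightarrow> Q0\<close> be arbitrary: rigidity of \<open>M\<close> writes \<open>u\<close> as \<open>v f + f w\<close>,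
  and this condition is self-dual. If \<open>N\<close> is projective, then \<open>f\<^sup>*\<close> and hence \<open>f\<close> has a generalized
  inverse \<open>r\<close> with \<open>f r f = f\<close>, and \<open>id - f r\<close> induces a section of \<open>Q0 \<rightarrow> M\<close>.
\<close>

lemma projective_of_opp_free:
  fixes M :: "('k, 'a) std_module"
  assumes free: "cm_tau_tilting_free K (opp A)" and gp: "gorenstein_projective A M" and tr: "tau_rigid K A M"
  shows "projective A M"
proof -
  interpret O: fd_algebra K "opp A" by (rule fd_algebra_opp[OF fd_algebra_axioms])
  have M: "fg_module A M" using tr by (simp add: tau_rigid_def)
  have lM: "left_module A M" using M by (rule fg_moduleD)
  from tau_rigid_imp[OF tr] obtain Q1 f Q0 g
    where m: "minimal_presentation (Q1 :: ('k, 'a) std_module) f (Q0 :: ('k, 'a) std_module) g M"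
    and r: "rigid_presentation Q1 f Q0 g M" by (elim exE conjE)
  note r' = r[unfolded rigid_presentation_def presentation_def]
  have Q1: "projective A Q1" and Q0: "projective A Q0" and f: "lin A Q1 Q0 f" and g: "lin A Q0 M g" "g ` carrier Q0 = carrier M"
    and gk: "\<And>x. x \<in> carrier Q0 \<Longrightarrow> g x = \<zero>\<^bsub>M\<^esub> \<longleftrightarrow> x \<in> f ` carrier Q1"
    and rig: "\<And>u. lin A Q1 M u \<Longrightarrow> \<exists>v. lin A Q0 M v \<and> (\<forall>y\<in>carrier Q1. u y = v (f y))" using r' by auto
  note l1 = projective_left_module[OF Q1] and l0 = projective_left_module[OF Q0]
  interpret Q0: left_module A Q0 by (rule l0)
  from gorenstein_projective_imp_totally_acyclic[OF gp]
  obtain P :: "int \<Rightarrow> ('k, 'a) std_module" and d \<iota> where P: "totally_acyclic A P d" "lin A M (P 0) \<iota>"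
    "inj_on \<iota> (carrier M)" "\<iota> ` carrier M = d (-1) ` carrier (P (-1))" by (elim exE conjE)
  from totally_acyclic_minimal[OF M m P]
  obtain T :: "int \<Rightarrow> ('k, 'a) std_module" and e where T: "totally_acyclic A T e"
    and T1: "T (-1) = Q0" and T2: "T (-2) = Q1" and e2: "e (-2) = f" by (elim exE conjE)
  define D where "D i = hom_dual A (T (-i))" for i
  define \<delta> where "\<delta> i = dual_map (T (-i - 1)) (e (-i - 1))" for i
  have tD: "totally_acyclic (opp A) D \<delta>"
    using totally_acyclic_dual[OF T] unfolding D_def[abs_def] \<delta>_def[abs_def] .
  note tD' = totally_acyclicD[OF tD]
  have D1: "D 1 = hom_dual A Q0" and D2: "D 2 = hom_dual A Q1" and \<delta>1: "\<delta> 1 = dual_map Q1 f"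
    by (simp_all add: D_def \<delta>_def T1 T2 e2)
  have lD: "left_module (opp A) (D i)" for i using tD'(1) by (rule O.projective_left_module)
  have \<delta>12: "lin (opp A) (D 1) (D 2) (\<delta> 1)" and \<delta>23: "lin (opp A) (D 2) (D 3) (\<delta> 2)"
    using tD'(2)[of 1] tD'(2)[of 2] by simp_all
  define N where "N = (D 3)\<lparr>carrier := \<delta> 2 ` carrier (D 2)\<rparr>"
  have Nsub: "\<delta> 2 ` carrier (D 2) \<subseteq> carrier (D 3)" using lin_closed[OF \<delta>23] by blast
  have lN: "left_module (opp A) N" unfolding N_def
    by (rule left_module_restr[OF lD submodule_image[OF lD lD \<delta>23 submodule_carrier[OF lD]]])
  have \<delta>N: "lin (opp A) (D 2) N (\<delta> 2)" and \<delta>s: "\<delta> 2 ` carrier (D 2) = carrier N" 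
    unfolding N_def lin_restr_cod_iff[OF Nsub] using \<delta>23 by simp_all
  have fgN: "fg_module (opp A) N"
    using fg_module_image[OF O.projective_fg[OF tD'(1)] lN \<delta>N \<delta>s] .
  have \<delta>k: "\<delta> 2 h = \<zero>\<^bsub>N\<^esub> \<longleftrightarrow> h \<in> \<delta> 1 ` carrier (D 1)" if "h \<in> carrier (D 2)" for h
    using tD'(3)[OF that] by (simp add: N_def)
  have "O.rigid_presentation (D 1) (\<delta> 1) (D 2) (\<delta> 2) N"
    unfolding O.rigid_presentation_def O.presentation_def
  proof (intro conjI allI impI ballI)
    fix U assume U: "lin (opp A) (D 1) N U"
    obtain V where V: "lin (opp A) (D 1) (D 2) V" "\<And>h. h \<in> carrier (D 1) \<Longrightarrow> \<delta> 2 (V h) = U h"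
      using O.projective_lift[OF tD'(1) lD lN \<delta>N U] lin_closed[OF U] unfolding \<delta>s by auto
    obtain u where u: "lin A Q1 Q0 u" "\<And>h. h \<in> carrier (D 1) \<Longrightarrow> V h = dual_map Q1 u h"
      using dual_map_full[OF l1 Q0 V(1)[unfolded D1 D2]] unfolding D1 by blast
    obtain v0 where v0: "lin A Q0 M v0" "\<And>y. y \<in> carrier Q1 \<Longrightarrow> g (u y) = v0 (f y)"
      using rig[OF lin_comp[OF u(1) g(1)]] by blast
    obtain v where v: "lin A Q0 Q0 v" "\<And>y. y \<in> carrier Q0 \<Longrightarrow> g (v y) = v0 y"
      using projective_lift[OF Q0 l0 lM g(1) v0(1)] lin_closed[OF v0(1)] unfolding g(2) by auto
    let ?c = "\<lambda>y. u y \<ominus>\<^bsub>Q0\<^esub> v (f y)"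
    have c: "lin A Q1 Q0 ?c" using u(1) lin_comp[OF f v(1)] by (rule lin_diff[OF l0])
    have "?c y \<in> f ` carrier Q1" if y: "y \<in> carrier Q1" for y
    proof -
      have "g (?c y) = \<zero>\<^bsub>M\<^esub>"
        using lin_closed[OF u(1) y] lin_closed[OF f y] lin_closed[OF lin_comp[OF f v(1)] y] lin_closed[OF v0(1)] y
        by (simp add: lin_minus[OF l0 lM g(1)] v0(2) v(2) diff_eq_zero_iff[OF left_module.axioms(2)[OF lM]])
      then show ?thesis using gk[OF lin_closed[OF c y]] by simp
    qed
    then obtain w where w: "lin A Q1 Q1 w" "\<And>y. y \<in> carrier Q1 \<Longrightarrow> f (w y) = ?c y"
      using projective_lift[OF Q1 l1 l0 f c] by blast
    have ud: "u y = v (f y) \<oplus>\<^bsub>Q0\<^esub> f (w y)" if y: "y \<in> carrier Q1" for y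
    proof -
      have "u y \<in> carrier Q0" "v (f y) \<in> carrier Q0"
        using lin_closed[OF u(1) y] lin_closed[OF lin_comp[OF f v(1)] y] .
      then show ?thesis
        using w(2)[OF y] Q0.M.a_lcomm[of "v (f y)" "u y" "\<ominus>\<^bsub>Q0\<^esub> v (f y)"] by (simp add: a_minus_def Q0.M.r_neg)
    qed
    let ?v = "dual_map Q0 v" and ?w = "dual_map Q1 w"
    have wl: "lin (opp A) (D 2) (D 2) ?w" unfolding D2 using l1 l1 w(1) by (rule lin_dual_map)
    have vl: "lin (opp A) (D 1) (D 1) ?v" unfolding D1 using l0 l0 v(1) by (rule lin_dual_map)
    have "U h = \<delta> 2 (?w (\<delta> 1 h))" if h: "h \<in> carrier (D 1)" for h
    proof -
      have hl: "lin A Q0 (regular A) h" using h by (simp add: D1 hom_dual_carrier)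
      have c1: "\<delta> 1 (?v h) \<in> carrier (D 2)" "?w (\<delta> 1 h) \<in> carrier (D 2)"
        using lin_closed[OF \<delta>12 lin_closed[OF vl h]] lin_closed[OF wl lin_closed[OF \<delta>12 h]] .
      interpret D2: left_module "opp A" "D 2" by (rule lD)
      have sum: "V h = \<delta> 1 (?v h) \<oplus>\<^bsub>D 2\<^esub> ?w (\<delta> 1 h)"
      proof (rule hom_dual_ext[of _ A Q1])
        show "V h \<in> carrier (hom_dual A Q1)" using lin_closed[OF V(1) h] by (simp add: D2)
        show "\<delta> 1 (?v h) \<oplus>\<^bsub>D 2\<^esub> ?w (\<delta> 1 h) \<in> carrier (hom_dual A Q1)"
          using D2.M.a_closed[OF c1] by (simp add: D2)
        fix y assume y: "y \<in> carrier Q1"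
        show "V h y = (\<delta> 1 (?v h) \<oplus>\<^bsub>D 2\<^esub> ?w (\<delta> 1 h)) y"
          using y lin_closed[OF f] lin_closed[OF v(1)] lin_closed[OF w(1)]
          by (simp add: u(2)[OF h] D2 hom_dual_add \<delta>1 dual_map_apply ud lin_add[OF hl])
      qed
      have "\<delta> 2 (\<delta> 1 (?v h)) = \<zero>\<^bsub>N\<^esub>" using \<delta>k[OF c1(1)] lin_closed[OF vl h] by simp
      then show ?thesis using V(2)[OF h] lin_add[OF \<delta>N c1] lin_closed[OF \<delta>N c1(2)]
        left_module.axioms(2)[OF lN] by (simp add: sum abelian_monoid.l_zero abelian_group.axioms)
    qed
    then show "\<exists>v. lin (opp A) (D 2) N v \<and> (\<forall>h\<in>carrier (D 1). U h = v (\<delta> 1 h))"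
      using lin_comp[OF wl \<delta>N] by blast
  qed (use tD'(1) \<delta>12 \<delta>N \<delta>s \<delta>k in auto)
  then have "projective (opp A) N"
  proof (rule O.cm_tau_tilting_free_projective[OF free fgN tD, where \<iota> = "\<lambda>x. x" and j = 3, rotated 3])
    show "lin (opp A) N (D 3) (\<lambda>x. x)" unfolding N_def using Nsub by (rule lin_incl)
  qed (simp_all add: N_def)
  then obtain s where s: "lin (opp A) N (D 2) s" "\<And>x. x \<in> carrier N \<Longrightarrow> \<delta> 2 (s x) = x"
    using O.projective_lift[OF _ lD lN \<delta>N lin_id] \<delta>s by blast
  let ?e = "\<lambda>h. h \<ominus>\<^bsub>D 2\<^esub> s (\<delta> 2 h)"
  have el: "lin (opp A) (D 2) (D 2) ?e" by (intro lin_diff[OF lD] lin_id lin_comp[OF \<delta>N s(1)])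
  have "?e h \<in> \<delta> 1 ` carrier (D 1)" if h: "h \<in> carrier (D 2)" for h
  proof -
    have "\<delta> 2 (?e h) = \<zero>\<^bsub>N\<^esub>"
      using h s(2)[OF lin_closed[OF \<delta>N h]] lin_closed[OF \<delta>N h] lin_closed[OF s(1) lin_closed[OF \<delta>N h]]
      by (simp add: lin_minus[OF lD lN \<delta>N] diff_eq_zero_iff[OF left_module.axioms(2)[OF lN]])
    then show ?thesis using \<delta>k[OF lin_closed[OF el h]] by simp
  qed
  then obtain t where t: "lin (opp A) (D 2) (D 1) t" "\<And>h. h \<in> carrier (D 2) \<Longrightarrow> \<delta> 1 (t h) = ?e h"
    using O.projective_lift[OF tD'(1) lD lD \<delta>12 el] by blast
  obtain \<rho> where \<rho>: "lin A Q0 Q1 \<rho>" "\<And>h. h \<in> carrier (D 2) \<Longrightarrow> t h = dual_map Q0 \<rho> h"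
    using dual_map_full[OF l0 Q1 t(1)[unfolded D1 D2]] unfolding D2 by blast
  have frf: "f (\<rho> (f y)) = f y" if y: "y \<in> carrier Q1" for y
  proof -
    have fy: "f y \<in> carrier Q0" "f (\<rho> (f y)) \<in> carrier Q0"
      using lin_closed[OF f y] lin_closed[OF f lin_closed[OF lin_comp[OF f \<rho>(1)] y]] .
    have "f (\<rho> (f y)) \<ominus>\<^bsub>Q0\<^esub> f y = \<zero>\<^bsub>Q0\<^esub>"
    proof (rule projective_separate[OF Q0])
      show "f (\<rho> (f y)) \<ominus>\<^bsub>Q0\<^esub> f y \<in> carrier Q0" using fy by simp
      fix h assume h: "h \<in> carrier (hom_dual A Q0)"
      then have hD: "h \<in> carrier (D 1)" and hl: "lin A Q0 (regular A) h" by (simp_all add: D1 hom_dual_carrier)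
      have \<delta>h: "\<delta> 1 h \<in> carrier (D 2)" using lin_closed[OF \<delta>12 hD] .
      interpret D2: left_module "opp A" "D 2" by (rule lD)
      have z: "\<delta> 2 (\<delta> 1 h) = \<zero>\<^bsub>N\<^esub>" using \<delta>k[OF \<delta>h] hD by simp
      have "\<delta> 1 (t (\<delta> 1 h)) = \<delta> 1 h \<ominus>\<^bsub>D 2\<^esub> \<zero>\<^bsub>D 2\<^esub>"
        unfolding t(2)[OF \<delta>h] z lin_zero[OF lN lD s(1)] ..
      then have "\<delta> 1 (t (\<delta> 1 h)) = \<delta> 1 h" using \<delta>h by (simp add: a_minus_def)
      from fun_cong[OF this, of y] have "h (f (\<rho> (f y))) = h (f y)"
        using y fy lin_closed[OF \<rho>(1)] \<delta>h by (simp add: \<rho>(2) \<delta>1 dual_map_apply)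
      then show "h (f (\<rho> (f y)) \<ominus>\<^bsub>Q0\<^esub> f y) = \<zero>\<^bsub>A\<^esub>"
        using fy lin_closed[OF hl] by (simp add: lin_minus[OF l0 reg hl] diff_eq_zero_iff[OF left_module.axioms(2)[OF reg], simplified])
    qed
    then show ?thesis using fy by (simp add: diff_eq_zero_iff[OF Q0.M.abelian_group_axioms])
  qed
  let ?k = "\<lambda>x. x \<ominus>\<^bsub>Q0\<^esub> f (\<rho> x)"
  have k: "lin A Q0 Q0 ?k" by (intro lin_diff[OF l0] lin_id lin_comp[OF \<rho>(1) f])
  have "?k x = \<zero>\<^bsub>Q0\<^esub>" if x: "x \<in> carrier Q0" "g x = \<zero>\<^bsub>M\<^esub>" for x
  proof -
    obtain y where y: "y \<in> carrier Q1" "x = f y" using gk[OF x(1)] x(2) by blast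
    then show ?thesis using frf[OF y(1)] x(1) by (simp add: diff_eq_zero_iff[OF Q0.M.abelian_group_axioms])
  qed
  then obtain \<sigma> where \<sigma>: "lin A M Q0 \<sigma>" "\<And>x. x \<in> carrier Q0 \<Longrightarrow> \<sigma> (g x) = ?k x"
    using lin_factor[OF l0 lM l0 g k] by blast
  show ?thesis
  proof (rule projective_retract[OF Q0 lM g(1) \<sigma>(1)])
    fix m assume "m \<in> carrier M"
    then have "m \<in> g ` carrier Q0" unfolding g(2) .
    then obtain x where x: "m = g x" "x \<in> carrier Q0" by (rule imageE)
    have \<rho>x: "\<rho> x \<in> carrier Q1" using lin_closed[OF \<rho>(1) x(2)] .
    interpret M: left_module A M by (rule lM)
    have "g (f (\<rho> x)) = \<zero>\<^bsub>M\<^esub>" using gk[OF lin_closed[OF f \<rho>x]] \<rho>x by simp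
    then show "g (\<sigma> m) = m"
      using x lin_minus[OF l0 lM g(1) x(2) lin_closed[OF f \<rho>x]] lin_closed[OF g(1) x(2)]
      by (simp add: \<sigma>(2)) (simp add: a_minus_def)
  qed
qed

lemma cm_tau_tilting_free_of_opp:
  "cm_tau_tilting_free K (opp A) \<Longrightarrow> cm_tau_tilting_free K A"
  unfolding cm_tau_tilting_free_def[of K A] using projective_of_opp_free by blast

end

theorem cm_tau_tilting_free_opp_iff:
  assumes "fd_algebra K A"
  shows "cm_tau_tilting_free K A \<longleftrightarrow> cm_tau_tilting_free K (opp A)"
  using fd_algebra.cm_tau_tilting_free_of_opp[OF assms]
    fd_algebra.cm_tau_tilting_free_of_opp[OF fd_algebra_opp[OF assms]] by auto

section \<open>Extensions of projective modules\<close>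

text \<open>
  The quotient map has a section \<open>s\<close>, and \<open>m \<mapsto> m - s [m]\<close> is a projection onto \<open>N\<close>. Lifting is done on \<open>N\<close>
  and on the quotient separately.
\<close>

lemma (in fd_algebra) projective_extension:
  fixes M :: "('a, 'm) module"
  assumes M: "fg_module A M" and N: "submodule N A M"
    and pN: "projective A (M\<lparr>carrier := N\<rparr>)" and pQ: "projective A (quot_mod M N)"
  shows "projective A M"
proof (rule projectiveI[OF M])
  have lM: "left_module A M" using M by (rule fg_moduleD)
  interpret S: submod A M N using lM N by (rule submodI)
  let ?Q = "quot_mod M N"
  have lQ: "left_module A ?Q" by (rule S.left_module_quot)
  obtain s where s: "lin A ?Q M s" "\<And>z. z \<in> carrier ?Q \<Longrightarrow> S.cls (s z) = z"
    using projective_lift[OF pQ lM lQ S.lin_cls lin_id] unfolding S.quot_carrier by blast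
  have clsQ: "S.cls m \<in> carrier ?Q" if "m \<in> carrier M" for m using lin_closed[OF S.lin_cls that] .
  fix U V :: "('k, 'a) std_module" and g f
  assume U: "left_module A U" and V: "left_module A V" and g: "lin A U V g" "g ` carrier U = carrier V"
    and f: "lin A M V f"
  interpret V: left_module A V by (rule V)
  have Nc: "N \<subseteq> carrier M" using N by (rule submodule_subset)
  obtain hN where hN: "lin A (M\<lparr>carrier := N\<rparr>) U hN" "\<And>n. n \<in> N \<Longrightarrow> g (hN n) = f n"
    using projective_lift[OF pN U V g(1) lin_restr_dom[OF f Nc]] lin_closed[OF f] Nc g(2) by auto
  obtain hQ where hQ: "lin A ?Q U hQ" "\<And>z. z \<in> carrier ?Q \<Longrightarrow> g (hQ z) = f (s z)"
    using projective_lift[OF pQ U V g(1) lin_comp[OF s(1) f]] lin_closed[OF f] lin_closed[OF s(1)] g(2) by auto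
  let ?r = "\<lambda>m. m \<ominus>\<^bsub>M\<^esub> s (S.cls m)"
  have sc: "s (S.cls m) \<in> carrier M" if "m \<in> carrier M" for m using lin_closed[OF s(1) clsQ[OF that]] .
  have rN: "?r m \<in> N" if m: "m \<in> carrier M" for m
    using s(2)[OF clsQ[OF m]] S.cls_eq_iff[OF m sc[OF m]] by simp
  have r: "lin A M (M\<lparr>carrier := N\<rparr>) ?r" unfolding lin_restr_cod_iff[OF Nc]
    using rN by (auto intro!: lin_diff[OF lM] lin_id lin_comp[OF S.lin_cls s(1)])
  show "\<exists>h. lin A M U h \<and> (\<forall>m\<in>carrier M. g (h m) = f m)"
  proof (intro exI conjI ballI)
    show "lin A M U (\<lambda>m. hN (?r m) \<oplus>\<^bsub>U\<^esub> hQ (S.cls m))"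
      by (intro lin_plus[OF U] lin_comp[OF r hN(1)] lin_comp[OF S.lin_cls hQ(1)])
    fix m assume m: "m \<in> carrier M"
    have "g (hN (?r m) \<oplus>\<^bsub>U\<^esub> hQ (S.cls m)) = f (?r m) \<oplus>\<^bsub>V\<^esub> f (s (S.cls m))"
      using lin_closed[OF hN(1), of "?r m"] rN[OF m] lin_closed[OF hQ(1) clsQ[OF m]]
      by (simp add: lin_add[OF g(1)] hN(2) hQ(2) clsQ[OF m])
    also have "\<dots> = f m"
      using m sc[OF m] lin_closed[OF f] by (simp add: lin_minus[OF lM V f]) (simp add: a_minus_def V.M.a_assoc V.M.l_neg)
    finally show "g (hN (?r m) \<oplus>\<^bsub>U\<^esub> hQ (S.cls m)) = f m" .
  qed
qed

section \<open>Modules over the triangular matrix algebra\<close>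

text \<open>The module on an additive subgroup \<open>C\<close> of \<open>U\<close> on which \<open>a\<close> acts as \<open>\<iota> a\<close> does on \<open>U\<close>.\<close>

definition pull :: "('r \<Rightarrow> 's) \<Rightarrow> 'm set \<Rightarrow> ('s, 'm) module \<Rightarrow> ('r, 'm) module" where
  "pull \<iota> C U = \<lparr>carrier = C, monoid.mult = undefined, one = undefined, zero = \<zero>\<^bsub>U\<^esub>, add = add U,
    smult = (\<lambda>a x. \<iota> a \<odot>\<^bsub>U\<^esub> x)\<rparr>"

lemma pull_simps [simp]:
  "carrier (pull \<iota> C U) = C" "\<zero>\<^bsub>pull \<iota> C U\<^esub> = \<zero>\<^bsub>U\<^esub>" "x \<oplus>\<^bsub>pull \<iota> C U\<^esub> y = x \<oplus>\<^bsub>U\<^esub> y"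
  "a \<odot>\<^bsub>pull \<iota> C U\<^esub> x = \<iota> a \<odot>\<^bsub>U\<^esub> x"
  by (simp_all add: pull_def)

lemma left_module_pull:
  assumes R: "ring R" and U: "left_module S U" and C: "C \<subseteq> carrier U" "\<zero>\<^bsub>U\<^esub> \<in> C"
    "\<And>x y. x \<in> C \<Longrightarrow> y \<in> C \<Longrightarrow> x \<oplus>\<^bsub>U\<^esub> y \<in> C" "\<And>a x. a \<in> carrier R \<Longrightarrow> x \<in> C \<Longrightarrow> \<iota> a \<odot>\<^bsub>U\<^esub> x \<in> C"
    and \<iota>: "\<And>a. a \<in> carrier R \<Longrightarrow> \<iota> a \<in> carrier S"
    "\<And>a b. a \<in> carrier R \<Longrightarrow> b \<in> carrier R \<Longrightarrow> \<iota> (a \<oplus>\<^bsub>R\<^esub> b) = \<iota> a \<oplus>\<^bsub>S\<^esub> \<iota> b"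
    "\<And>a b. a \<in> carrier R \<Longrightarrow> b \<in> carrier R \<Longrightarrow> \<iota> (a \<otimes>\<^bsub>R\<^esub> b) = \<iota> a \<otimes>\<^bsub>S\<^esub> \<iota> b"
    and one: "\<And>x. x \<in> C \<Longrightarrow> \<iota> \<one>\<^bsub>R\<^esub> \<odot>\<^bsub>U\<^esub> x = x"
  shows "left_module R (pull \<iota> C U)"
proof -
  interpret R: ring R by fact
  interpret U: left_module S U by fact
  have Cc: "\<And>x. x \<in> C \<Longrightarrow> x \<in> carrier U" using C(1) by blast
  have z: "\<iota> \<zero>\<^bsub>R\<^esub> = \<zero>\<^bsub>S\<^esub>"
    using \<iota> by (intro additive_zero[OF R.abelian_group_axioms U.R.abelian_group_axioms]) auto
  have "abelian_group (pull \<iota> C U)"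
  proof (rule abelian_groupI)
    fix x assume x: "x \<in> carrier (pull \<iota> C U)"
    have "\<iota> (\<ominus>\<^bsub>R\<^esub> \<one>\<^bsub>R\<^esub>) \<odot>\<^bsub>U\<^esub> x \<oplus>\<^bsub>U\<^esub> \<iota> \<one>\<^bsub>R\<^esub> \<odot>\<^bsub>U\<^esub> x = (\<iota> (\<ominus>\<^bsub>R\<^esub> \<one>\<^bsub>R\<^esub> \<oplus>\<^bsub>R\<^esub> \<one>\<^bsub>R\<^esub>)) \<odot>\<^bsub>U\<^esub> x"
      using x Cc \<iota>(1) by (subst \<iota>(2)) (auto simp: U.smult_l_distr)
    then have "\<iota> (\<ominus>\<^bsub>R\<^esub> \<one>\<^bsub>R\<^esub>) \<odot>\<^bsub>U\<^esub> x \<oplus>\<^bsub>U\<^esub> x = \<zero>\<^bsub>U\<^esub>"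
      using x Cc one by (simp add: R.l_neg z smult_zero[OF U])
    then show "\<exists>y\<in>carrier (pull \<iota> C U). y \<oplus>\<^bsub>pull \<iota> C U\<^esub> x = \<zero>\<^bsub>pull \<iota> C U\<^esub>"
      using x C(4) by (intro bexI[of _ "\<iota> (\<ominus>\<^bsub>R\<^esub> \<one>\<^bsub>R\<^esub>) \<odot>\<^bsub>U\<^esub> x"]) auto
  qed (auto simp: C(2,3) Cc U.M.a_ac)
  then show ?thesis
    by (intro left_module.intro left_module_axioms.intro R)
      (auto simp: C(4) Cc \<iota> one U.smult_l_distr U.smult_r_distr U.smult_assoc)
qed

lemma finsum_pull:
  assumes "abelian_group (pull \<iota> C U)" "abelian_group U" "C \<subseteq> carrier U" "finite I" "\<And>i. i \<in> I \<Longrightarrow> g i \<in> C"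
  shows "(\<Oplus>\<^bsub>pull \<iota> C U\<^esub>i\<in>I. g i) = (\<Oplus>\<^bsub>U\<^esub>i\<in>I. g i)"
  using assms by (intro additive_finsum[OF assms(1,2), where h = "\<lambda>x. x"]) auto

definition tri :: "('k, 'a) module \<Rightarrow> 'a \<Rightarrow> 'a \<Rightarrow> 'a \<Rightarrow> 'a ^ 2 ^ 2" where
  "tri A a b c = (\<chi> i j. if i = 1 then (if j = 1 then a else \<zero>\<^bsub>A\<^esub>) else (if j = 1 then b else c))"

lemma tri_entry [simp]: "tri A a b c $ 1 $ 1 = a" "tri A a b c $ 2 $ 1 = b" "tri A a b c $ 2 $ 2 = c"
  by (simp_all add: tri_def)

lemma tri_eq_iff: "tri A a b c = tri A a' b' c' \<longleftrightarrow> a = a' \<and> b = b' \<and> c = c'"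
  using tri_entry[of A a b c] tri_entry[of A a' b' c'] by metis

lemma all_two: "(\<forall>i. Q i) \<longleftrightarrow> Q 1 \<and> Q 2" for Q :: "2 \<Rightarrow> bool"
  by (metis two_cases)

context fd_algebra
begin

lemma tri_closed: "a \<in> carrier A \<Longrightarrow> b \<in> carrier A \<Longrightarrow> c \<in> carrier A \<Longrightarrow> tri A a b c \<in> carrier (T2 A)"
  by (simp add: T2_def all_two) (simp add: tri_def)

lemma tri_collapse: "x \<in> carrier (T2 A) \<Longrightarrow> tri A (x $ 1 $ 1) (x $ 2 $ 1) (x $ 2 $ 2) = x"
proof -
  assume x: "x \<in> carrier (T2 A)"
  have "x $ 1 $ 2 = \<zero>\<^bsub>A\<^esub>" using x by (simp add: T2_def)
  then show ?thesis unfolding vec_eq_iff all_two by (simp add: tri_def)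
qed

lemma entry_closed: "x \<in> carrier (T2 A) \<Longrightarrow> x $ i $ j \<in> carrier A"
  by (auto simp: T2_def)

lemma T2_cases:
  assumes "x \<in> carrier (T2 A)"
  obtains a b c where "a \<in> carrier A" "b \<in> carrier A" "c \<in> carrier A" "x = tri A a b c"
proof (rule that)
  show "x = tri A (x $ 1 $ 1) (x $ 2 $ 1) (x $ 2 $ 2)" using tri_collapse[OF assms] by (rule sym)
qed (rule entry_closed[OF assms])+

lemma tri_add: "a \<in> carrier A \<Longrightarrow> b \<in> carrier A \<Longrightarrow> c \<in> carrier A \<Longrightarrow> a' \<in> carrier A \<Longrightarrow> b' \<in> carrier A \<Longrightarrow> c' \<in> carrier A \<Longrightarrow>
    tri A a b c \<oplus>\<^bsub>T2 A\<^esub> tri A a' b' c' = tri A (a \<oplus>\<^bsub>A\<^esub> a') (b \<oplus>\<^bsub>A\<^esub> b') (c \<oplus>\<^bsub>A\<^esub> c')"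
  unfolding vec_eq_iff all_two by (simp add: tri_def T2_def)

lemma tri_mult: 
  assumes "a \<in> carrier A" "b \<in> carrier A" "c \<in> carrier A" "a' \<in> carrier A" "b' \<in> carrier A" "c' \<in> carrier A"
  shows "tri A a b c \<otimes>\<^bsub>T2 A\<^esub> tri A a' b' c' = tri A (a \<otimes>\<^bsub>A\<^esub> a') (b \<otimes>\<^bsub>A\<^esub> a' \<oplus>\<^bsub>A\<^esub> c \<otimes>\<^bsub>A\<^esub> b') (c \<otimes>\<^bsub>A\<^esub> c')"
proof -
  have u: "(UNIV :: 2 set) = {1, 2}" using two_cases by auto
  have sum2: "(\<Oplus>\<^bsub>A\<^esub>k\<in>UNIV. f k) = f 1 \<oplus>\<^bsub>A\<^esub> f 2" if "f 1 \<in> carrier A" "f 2 \<in> carrier A" for f :: "2 \<Rightarrow> 'a"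
    unfolding u using that by (subst A.finsum_insert) auto
  have 12: "tri A a b c $ 1 $ 2 = \<zero>\<^bsub>A\<^esub>" for a b c by (simp add: tri_def)
  show ?thesis unfolding vec_eq_iff all_two using assms by (simp add: 12 T2_def sum2)
qed

lemma tri_one: "\<one>\<^bsub>T2 A\<^esub> = tri A \<one>\<^bsub>A\<^esub> \<zero>\<^bsub>A\<^esub> \<one>\<^bsub>A\<^esub>"
  unfolding vec_eq_iff all_two by (simp add: tri_def T2_def)

lemma tri_zero: "\<zero>\<^bsub>T2 A\<^esub> = tri A \<zero>\<^bsub>A\<^esub> \<zero>\<^bsub>A\<^esub> \<zero>\<^bsub>A\<^esub>"
  unfolding vec_eq_iff all_two by (simp add: tri_def T2_def)

lemma entry_add: "x \<in> carrier (T2 A) \<Longrightarrow> y \<in> carrier (T2 A) \<Longrightarrow> (x \<oplus>\<^bsub>T2 A\<^esub> y) $ i $ j = x $ i $ j \<oplus>\<^bsub>A\<^esub> y $ i $ j"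
  by (simp add: T2_def)

lemma entry_zero: "\<zero>\<^bsub>T2 A\<^esub> $ i $ j = \<zero>\<^bsub>A\<^esub>"
  by (simp add: T2_def)

end

locale triangular = fd_algebra K A
  for K :: "'k ring" (structure) and A :: "('k, 'a) module" (structure)
begin

abbreviation "B \<equiv> T2 A"
abbreviation "t a b c \<equiv> tri A a b c"
abbreviation "e11 \<equiv> tri A \<one>\<^bsub>A\<^esub> \<zero>\<^bsub>A\<^esub> \<zero>\<^bsub>A\<^esub>"
abbreviation "e21 \<equiv> tri A \<zero>\<^bsub>A\<^esub> \<one>\<^bsub>A\<^esub> \<zero>\<^bsub>A\<^esub>"

sublocale B: fd_algebra K "T2 A"
  by (rule fd_algebra_T2[OF fd_algebra_axioms])

lemma entry_mult:
  assumes "x \<in> carrier B" "y \<in> carrier B"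
  shows "(x \<otimes>\<^bsub>B\<^esub> y) $ 1 $ 1 = x $ 1 $ 1 \<otimes>\<^bsub>A\<^esub> y $ 1 $ 1"
    "(x \<otimes>\<^bsub>B\<^esub> y) $ 2 $ 1 = x $ 2 $ 1 \<otimes>\<^bsub>A\<^esub> y $ 1 $ 1 \<oplus>\<^bsub>A\<^esub> x $ 2 $ 2 \<otimes>\<^bsub>A\<^esub> y $ 2 $ 1"
    "(x \<otimes>\<^bsub>B\<^esub> y) $ 2 $ 2 = x $ 2 $ 2 \<otimes>\<^bsub>A\<^esub> y $ 2 $ 2"
proof -
  obtain a b c where x: "a \<in> carrier A" "b \<in> carrier A" "c \<in> carrier A" "x = t a b c" using assms(1) by (rule T2_cases)
  obtain a' b' c' where y: "a' \<in> carrier A" "b' \<in> carrier A" "c' \<in> carrier A" "y = t a' b' c'" using assms(2) by (rule T2_cases)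
  show "(x \<otimes>\<^bsub>B\<^esub> y) $ 1 $ 1 = x $ 1 $ 1 \<otimes>\<^bsub>A\<^esub> y $ 1 $ 1"
    "(x \<otimes>\<^bsub>B\<^esub> y) $ 2 $ 1 = x $ 2 $ 1 \<otimes>\<^bsub>A\<^esub> y $ 1 $ 1 \<oplus>\<^bsub>A\<^esub> x $ 2 $ 2 \<otimes>\<^bsub>A\<^esub> y $ 2 $ 1"
    "(x \<otimes>\<^bsub>B\<^esub> y) $ 2 $ 2 = x $ 2 $ 2 \<otimes>\<^bsub>A\<^esub> y $ 2 $ 2"
    using x(1-3) y(1-3) unfolding x(4) y(4) by (simp_all add: tri_mult)
qed

lemma entry_one: "\<one>\<^bsub>B\<^esub> $ 1 $ 1 = \<one>\<^bsub>A\<^esub>" "\<one>\<^bsub>B\<^esub> $ 2 $ 1 = \<zero>\<^bsub>A\<^esub>" "\<one>\<^bsub>B\<^esub> $ 2 $ 2 = \<one>\<^bsub>A\<^esub>"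
  by (simp_all add: tri_one)

declare entry_closed [simp] tri_closed [simp]

subsection \<open>Modules concentrated in the second component\<close>

definition second :: "('a, 'm) module \<Rightarrow> ('a ^ 2 ^ 2, 'm) module" where
  "second M = pull (\<lambda>b. b $ 2 $ 2) (carrier M) M"

lemma second_simps [simp]:
  "carrier (second M) = carrier M" "\<zero>\<^bsub>second M\<^esub> = \<zero>\<^bsub>M\<^esub>" "x \<oplus>\<^bsub>second M\<^esub> y = x \<oplus>\<^bsub>M\<^esub> y"
  "b \<odot>\<^bsub>second M\<^esub> x = b $ 2 $ 2 \<odot>\<^bsub>M\<^esub> x" "finsum (second M) f I = finsum M f I"
  by (simp_all add: second_def finsum_def finprod_def pull_def)

lemma left_module_second:
  fixes M :: "('a, 'm) module"
  assumes M: "left_module A M" shows "left_module B (second M)"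
proof -
  interpret M: left_module A M by fact
  show ?thesis unfolding second_def
    by (rule left_module_pull[OF B.ring_A M])
      (auto simp: M.smult_closed entry_add entry_mult entry_one M.smult_one)
qed

lemma lin_second_iff:
  fixes M :: "('a, 'm) module"
  shows "lin B (second M) (second N) f \<longleftrightarrow> lin A M N f"
proof
  assume f: "lin B (second M) (second N) f"
  show "lin A M N f"
  proof (rule linI)
    show "f (a \<odot>\<^bsub>M\<^esub> x) = a \<odot>\<^bsub>N\<^esub> f x" if "a \<in> carrier A" "x \<in> carrier M" for a x
      using lin_smult[OF f, of "t \<zero>\<^bsub>A\<^esub> \<zero>\<^bsub>A\<^esub> a" x] that by simp
  qed (use lin_closed[OF f] lin_add[OF f] in auto)
next
  assume f: "lin A M N f"
  show "lin B (second M) (second N) f"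
    by (rule linI) (use lin_closed[OF f] lin_add[OF f] lin_smult[OF f] in auto)
qed

text \<open>
  The lower row of \<open>B\<close> is a left ideal, and each of its two columns is a copy of \<open>second (regular A)\<close>. So
  two maps to the latter combine to a map to \<open>B\<close>.
\<close>

lemma lin_lower:
  fixes P :: "('a ^ 2 ^ 2, 'm) module"
  assumes k: "lin B P (second (regular A)) k" and l: "lin B P (second (regular A)) l"
  shows "lin B P (regular B) (\<lambda>p. t \<zero>\<^bsub>A\<^esub> (k p) (l p))"
proof (rule linI)
  have kc: "k p \<in> carrier A" "l p \<in> carrier A" if "p \<in> carrier P" for p
    using lin_closed[OF k that] lin_closed[OF l that] by auto
  fix p assume p: "p \<in> carrier P"
  show "t \<zero>\<^bsub>A\<^esub> (k p) (l p) \<in> carrier (regular B)" using kc p by simp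
  show "t \<zero>\<^bsub>A\<^esub> (k (p \<oplus>\<^bsub>P\<^esub> q)) (l (p \<oplus>\<^bsub>P\<^esub> q)) = t \<zero>\<^bsub>A\<^esub> (k p) (l p) \<oplus>\<^bsub>regular B\<^esub> t \<zero>\<^bsub>A\<^esub> (k q) (l q)"
    if "q \<in> carrier P" for q
    using kc p that by (simp add: lin_add[OF k] lin_add[OF l] tri_add)
  show "t \<zero>\<^bsub>A\<^esub> (k (b \<odot>\<^bsub>P\<^esub> p)) (l (b \<odot>\<^bsub>P\<^esub> p)) = b \<odot>\<^bsub>regular B\<^esub> t \<zero>\<^bsub>A\<^esub> (k p) (l p)" if "b \<in> carrier B" for b
    using that
  proof (rule T2_cases)
    fix x y z assume "x \<in> carrier A" "y \<in> carrier A" "z \<in> carrier A" "b = t x y z"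
    then show ?thesis using kc p lin_smult[OF k that p] lin_smult[OF l that p] by (simp add: tri_mult)
  qed
qed

lemma lin_entry22:
  fixes P :: "('a ^ 2 ^ 2, 'm) module"
  assumes h: "lin B P (regular B) h"
  shows "lin B P (second (regular A)) (\<lambda>p. h p $ 2 $ 2)"
proof -
  have c: "h p \<in> carrier B" if "p \<in> carrier P" for p using lin_closed[OF h that] by simp
  show ?thesis
    by (rule linI) (simp_all add: c entry_add entry_mult lin_add[OF h] lin_smult[OF h])
qed

lemma lin_entry21:
  fixes P :: "('a ^ 2 ^ 2, 'm) module"
  assumes h: "lin B P (regular B) h" and z: "\<And>p. p \<in> carrier P \<Longrightarrow> h p $ 1 $ 1 = \<zero>\<^bsub>A\<^esub>"
  shows "lin B P (second (regular A)) (\<lambda>p. h p $ 2 $ 1)"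
proof -
  have c: "h p \<in> carrier B" if "p \<in> carrier P" for p using lin_closed[OF h that] by simp
  show ?thesis
    by (rule linI) (simp_all add: c entry_add entry_mult lin_add[OF h] lin_smult[OF h] z)
qed

lemma dual_basis_second:
  fixes P :: "('a, 'm) module"
  assumes P: "left_module A P" and d: "dual_basis A P I x \<phi>"
  shows "dual_basis B (second P) I x (\<lambda>i p. t \<zero>\<^bsub>A\<^esub> \<zero>\<^bsub>A\<^esub> (\<phi> i p))"
proof -
  have "lin B (second P) (regular B) (\<lambda>p. t \<zero>\<^bsub>A\<^esub> \<zero>\<^bsub>A\<^esub> (\<phi> i p))" if "i \<in> I" for i
  proof (rule lin_lower)
    show "lin B (second P) (second (regular A)) (\<phi> i)" using d that by (simp add: lin_second_iff dual_basis_def)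
    show "lin B (second P) (second (regular A)) (\<lambda>p. \<zero>\<^bsub>A\<^esub>)" by (rule linI) auto
  qed
  then show ?thesis using d by (simp add: dual_basis_def)
qed

lemma projective_second:
  fixes P :: "('a, 'm) module"
  assumes P: "projective A P" shows "projective B (second P)"
proof -
  have lP: "left_module A P" using P by (rule projective_left_module)
  obtain n :: nat and x \<phi> where d: "dual_basis A P {..<n} x \<phi>" using projective_dual_basis[OF P] by blast
  note d' = dual_basis_second[OF lP d]
  show ?thesis by (rule B.projective_of_dual_basis[OF fg_module_of_dual_basis[OF left_module_second[OF lP] d'] d'])
qed

lemma projective_of_second:
  fixes M :: "('a, 'm) module"
  assumes M: "fg_module A M" and p: "projective B (second M)" shows "projective A M"
proof -
  have lM: "left_module A M" using M by (rule fg_moduleD)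
  obtain n :: nat and x \<phi> where d: "dual_basis B (second M) {..<n} x \<phi>" using B.projective_dual_basis[OF p] by blast
  have "dual_basis A M {..<n} x (\<lambda>i p. \<phi> i p $ 2 $ 2)"
    using d lin_entry22[of "second M"] by (simp add: dual_basis_def lin_second_iff)
  then show ?thesis by (rule projective_of_dual_basis[OF M])
qed

text \<open>A map from \<open>second P\<close> to \<open>B\<close> takes its values in the lower row, hence is a pair of maps to \<open>A\<close>.\<close>

lemma totally_acyclic_second:
  fixes P :: "int \<Rightarrow> ('a, 'm) module"
  assumes T: "totally_acyclic A P d"
  shows "totally_acyclic B (\<lambda>i. second (P i)) d"
  unfolding totally_acyclic_def
proof (intro conjI allI impI)
  note T' = totally_acyclicD[OF T]
  fix i
  show "projective B (second (P i))" by (intro projective_second T')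
  show "lin B (second (P i)) (second (P (i + 1))) (d i)" unfolding lin_second_iff by (rule T')
  show "\<forall>x\<in>carrier (second (P i)). d i x = \<zero>\<^bsub>second (P (i + 1))\<^esub> \<longleftrightarrow> x \<in> d (i - 1) ` carrier (second (P (i - 1)))"
    using T'(3)[of _ i] by simp
  fix h assume h: "lin B (second (P i)) (regular B) h \<and> (\<forall>y\<in>carrier (second (P (i - 1))). h (d (i - 1) y) = \<zero>\<^bsub>B\<^esub>)"
  then have hl: "lin B (second (P i)) (regular B) h" by blast
  interpret Pi: left_module A "P i" using T'(1) by (rule projective_left_module)
  have hc: "h p \<in> carrier B" if "p \<in> carrier (P i)" for p using lin_closed[OF hl, of p] that by simp
  have h0: "h p $ 1 $ 1 = \<zero>\<^bsub>A\<^esub>" if p: "p \<in> carrier (P i)" for p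
  proof -
    have "h (t \<zero>\<^bsub>A\<^esub> \<zero>\<^bsub>A\<^esub> \<one>\<^bsub>A\<^esub> \<odot>\<^bsub>second (P i)\<^esub> p) = t \<zero>\<^bsub>A\<^esub> \<zero>\<^bsub>A\<^esub> \<one>\<^bsub>A\<^esub> \<otimes>\<^bsub>B\<^esub> h p"
      using lin_smult[OF hl, of "t \<zero>\<^bsub>A\<^esub> \<zero>\<^bsub>A\<^esub> \<one>\<^bsub>A\<^esub>" p] p by simp
    then have "h p = t \<zero>\<^bsub>A\<^esub> \<zero>\<^bsub>A\<^esub> \<one>\<^bsub>A\<^esub> \<otimes>\<^bsub>B\<^esub> h p" using p by (simp add: Pi.smult_one)
    then have "h p $ 1 $ 1 = (t \<zero>\<^bsub>A\<^esub> \<zero>\<^bsub>A\<^esub> \<one>\<^bsub>A\<^esub> \<otimes>\<^bsub>B\<^esub> h p) $ 1 $ 1" by simp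
    also have "\<dots> = \<zero>\<^bsub>A\<^esub>" using hc[OF p] by (simp add: entry_mult)
    finally show ?thesis .
  qed
  have l2: "lin A (P i) (regular A) (\<lambda>p. h p $ 2 $ 2)" "lin A (P i) (regular A) (\<lambda>p. h p $ 2 $ 1)"
    using lin_entry22[OF hl] lin_entry21[OF hl] h0 by (simp_all add: lin_second_iff)
  have z: "h (d (i - 1) y) $ 2 $ 2 = \<zero>\<^bsub>A\<^esub>" "h (d (i - 1) y) $ 2 $ 1 = \<zero>\<^bsub>A\<^esub>" if "y \<in> carrier (P (i - 1))" for y
    using h that by (simp_all add: entry_zero)
  obtain k where k: "lin A (P (i + 1)) (regular A) k" "\<forall>x\<in>carrier (P i). k (d i x) = h x $ 2 $ 2"
    using T'(4)[OF l2(1) z(1)] by blast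
  obtain l where l: "lin A (P (i + 1)) (regular A) l" "\<forall>x\<in>carrier (P i). l (d i x) = h x $ 2 $ 1"
    using T'(4)[OF l2(2) z(2)] by blast
  show "\<exists>h'. lin B (second (P (i + 1))) (regular B) h' \<and> (\<forall>x\<in>carrier (second (P i)). h' (d i x) = h x)"
  proof (intro exI conjI ballI)
    show "lin B (second (P (i + 1))) (regular B) (\<lambda>p. t \<zero>\<^bsub>A\<^esub> (l p) (k p))"
      using k(1) l(1) by (intro lin_lower) (simp_all add: lin_second_iff)
    show "t \<zero>\<^bsub>A\<^esub> (l (d i x)) (k (d i x)) = h x" if "x \<in> carrier (second (P i))" for x
      using that k(2) l(2) h0[of x] tri_collapse[OF hc[of x]] by simp
  qed
qed

lemma rigid_presentation_second:
  fixes P1 :: "('a, 'q) module" and P0 :: "('a, 'p) module" and M :: "('a, 'm) module"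
  assumes "rigid_presentation P1 f P0 g M"
  shows "B.rigid_presentation (second P1) f (second P0) g (second M)"
  using assms projective_second[of P1] projective_second[of P0]
  unfolding rigid_presentation_def presentation_def B.rigid_presentation_def B.presentation_def lin_second_iff
  by simp

lemma cm_tau_tilting_free_of_T2:
  assumes free: "cm_tau_tilting_free K B"
  shows "cm_tau_tilting_free K A"
  unfolding cm_tau_tilting_free_def
proof (intro allI impI, elim conjE)
  fix M :: "('k, 'a) std_module"
  assume gp: "gorenstein_projective A M" and tr: "tau_rigid K A M"
  have M: "fg_module A M" using tr by (simp add: tau_rigid_def)
  from gorenstein_projective_imp_totally_acyclic[OF gp]
  obtain P :: "int \<Rightarrow> ('k, 'a) std_module" and d \<iota> where P: "totally_acyclic A P d" "lin A M (P 0) \<iota>"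
    "inj_on \<iota> (carrier M)" "\<iota> ` carrier M = d (-1) ` carrier (P (-1))" by (elim exE conjE)
  from tau_rigid_imp[OF tr] obtain Q1 f Q0 g
    where r: "rigid_presentation (Q1 :: ('k, 'a) std_module) f (Q0 :: ('k, 'a) std_module) g M" by (elim exE conjE)
  have fgs: "fg_module B (second M)"
  proof (rule fg_module_image)
    have r': "projective A Q0" "lin A Q0 M g" "g ` carrier Q0 = carrier M"
      using r by (auto simp: rigid_presentation_def presentation_def)
    show "fg_module B (second Q0)" using projective_second[OF r'(1)] by (rule B.projective_fg)
    show "left_module B (second M)" using left_module_second[OF fg_moduleD[OF M]] .
    show "lin B (second Q0) (second M) g" unfolding lin_second_iff by (rule r'(2))
    show "g ` carrier (second Q0) = carrier (second M)" using r'(3) by simp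
  qed
  have "projective B (second M)"
  proof (rule B.cm_tau_tilting_free_projective[OF free fgs totally_acyclic_second[OF P(1)] _ _ _ rigid_presentation_second[OF r]])
    show "lin B (second M) (second (P 0)) \<iota>" unfolding lin_second_iff by (rule P(2))
    show "inj_on \<iota> (carrier (second M))" using P(3) by simp
    show "\<iota> ` carrier (second M) = d (0 - 1) ` carrier (second (P (0 - 1)))" using P(4) by simp
  qed
  then show "projective A M" by (rule projective_of_second[OF M])
qed

end

section \<open>The two components of a module over the triangular matrix algebra\<close>

context triangular
begin

text \<open>
  A module \<open>U\<close> over the triangular matrix algebra is a linear map \<open>X \<rightarrow> Y\<close> of modules over \<open>A\<close>, with
  \<open>X = e11 U\<close> and the map given by \<open>e21\<close>. Here \<open>first U\<close> is \<open>X\<close>, \<open>gen U\<close> is the submodule generated by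
  \<open>X\<close>, i.e. \<open>X\<close> with its image in \<open>Y\<close>, and \<open>coker U\<close> is the cokernel of \<open>X \<rightarrow> Y\<close>, as a module over \<open>A\<close>.
\<close>

definition xpart :: "('a ^ 2 ^ 2, 'm) module \<Rightarrow> 'm set" where
  "xpart U = {x \<in> carrier U. e11 \<odot>\<^bsub>U\<^esub> x = x}"

definition first :: "('a ^ 2 ^ 2, 'm) module \<Rightarrow> ('a, 'm) module" where
  "first U = pull (\<lambda>a. t a \<zero>\<^bsub>A\<^esub> \<zero>\<^bsub>A\<^esub>) (xpart U) U"

definition gen :: "('a ^ 2 ^ 2, 'm) module \<Rightarrow> 'm set" where
  "gen U = {x \<oplus>\<^bsub>U\<^esub> e21 \<odot>\<^bsub>U\<^esub> y | x y. x \<in> xpart U \<and> y \<in> xpart U}"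

definition coker :: "('a ^ 2 ^ 2, 'm) module \<Rightarrow> ('a, 'm set) module" where
  "coker U = pull (\<lambda>c. t \<zero>\<^bsub>A\<^esub> \<zero>\<^bsub>A\<^esub> c) (carrier (quot_mod U (gen U))) (quot_mod U (gen U))"

abbreviation "zc U \<equiv> a_r_coset U (gen U)"

lemma first_simps [simp]:
  "carrier (first U) = xpart U" "\<zero>\<^bsub>first U\<^esub> = \<zero>\<^bsub>U\<^esub>" "x \<oplus>\<^bsub>first U\<^esub> y = x \<oplus>\<^bsub>U\<^esub> y"
  "a \<odot>\<^bsub>first U\<^esub> x = t a \<zero>\<^bsub>A\<^esub> \<zero>\<^bsub>A\<^esub> \<odot>\<^bsub>U\<^esub> x"
  by (simp_all add: first_def)

lemma xpartD [simp]: "x \<in> xpart U \<Longrightarrow> x \<in> carrier U" "x \<in> xpart U \<Longrightarrow> e11 \<odot>\<^bsub>U\<^esub> x = x"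
  by (simp_all add: xpart_def)

context
  fixes U :: "('a ^ 2 ^ 2, 'm) module"
  assumes U: "left_module B U"
begin

interpretation U: left_module "T2 A" U by (rule U)

lemma smult_smult:
  "a \<in> carrier A \<Longrightarrow> b \<in> carrier A \<Longrightarrow> c \<in> carrier A \<Longrightarrow> a' \<in> carrier A \<Longrightarrow> b' \<in> carrier A \<Longrightarrow> c' \<in> carrier A \<Longrightarrow>
    u \<in> carrier U \<Longrightarrow> t a b c \<odot>\<^bsub>U\<^esub> (t a' b' c' \<odot>\<^bsub>U\<^esub> u) =
      t (a \<otimes>\<^bsub>A\<^esub> a') (b \<otimes>\<^bsub>A\<^esub> a' \<oplus>\<^bsub>A\<^esub> c \<otimes>\<^bsub>A\<^esub> b') (c \<otimes>\<^bsub>A\<^esub> c') \<odot>\<^bsub>U\<^esub> u"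
  by (simp add: tri_mult flip: U.smult_assoc)

lemma xpart_smult: "a \<in> carrier A \<Longrightarrow> x \<in> carrier U \<Longrightarrow> t a \<zero>\<^bsub>A\<^esub> \<zero>\<^bsub>A\<^esub> \<odot>\<^bsub>U\<^esub> x \<in> xpart U"
  by (simp del: xpartD add: xpart_def smult_smult U.smult_closed)

lemma xpart_add: "x \<in> xpart U \<Longrightarrow> y \<in> xpart U \<Longrightarrow> x \<oplus>\<^bsub>U\<^esub> y \<in> xpart U"
  by (simp del: xpartD add: xpart_def U.smult_r_distr)

lemma xpart_zero: "\<zero>\<^bsub>U\<^esub> \<in> xpart U"
  by (simp del: xpartD add: xpart_def smult_zero[OF U])

lemma smult_xpart:
  assumes x: "x \<in> xpart U" and a: "a \<in> carrier A" "b \<in> carrier A" "c \<in> carrier A"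
  shows "t a b c \<odot>\<^bsub>U\<^esub> x = t a \<zero>\<^bsub>A\<^esub> \<zero>\<^bsub>A\<^esub> \<odot>\<^bsub>U\<^esub> x \<oplus>\<^bsub>U\<^esub> e21 \<odot>\<^bsub>U\<^esub> (t b \<zero>\<^bsub>A\<^esub> \<zero>\<^bsub>A\<^esub> \<odot>\<^bsub>U\<^esub> x)"
proof -
  have xc: "x \<in> carrier U" using x by (rule xpartD)
  have "t a b c \<odot>\<^bsub>U\<^esub> x = t a b c \<odot>\<^bsub>U\<^esub> (e11 \<odot>\<^bsub>U\<^esub> x)" using xpartD(2)[OF x] by simp
  also have "\<dots> = (t a \<zero>\<^bsub>A\<^esub> \<zero>\<^bsub>A\<^esub> \<oplus>\<^bsub>B\<^esub> t \<zero>\<^bsub>A\<^esub> b \<zero>\<^bsub>A\<^esub>) \<odot>\<^bsub>U\<^esub> x"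
    using a xc by (simp add: smult_smult tri_add)
  also have "\<dots> = t a \<zero>\<^bsub>A\<^esub> \<zero>\<^bsub>A\<^esub> \<odot>\<^bsub>U\<^esub> x \<oplus>\<^bsub>U\<^esub> e21 \<odot>\<^bsub>U\<^esub> (t b \<zero>\<^bsub>A\<^esub> \<zero>\<^bsub>A\<^esub> \<odot>\<^bsub>U\<^esub> x)"
    using a xc by (simp add: U.smult_l_distr smult_smult)
  finally show ?thesis .
qed

lemma smult_e21:
  assumes x: "x \<in> xpart U" and a: "a \<in> carrier A" "b \<in> carrier A" "c \<in> carrier A"
  shows "t a b c \<odot>\<^bsub>U\<^esub> (e21 \<odot>\<^bsub>U\<^esub> x) = e21 \<odot>\<^bsub>U\<^esub> (t c \<zero>\<^bsub>A\<^esub> \<zero>\<^bsub>A\<^esub> \<odot>\<^bsub>U\<^esub> x)"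
  using a xpartD(1)[OF x] by (simp add: smult_smult)

lemma e21_closed: "x \<in> xpart U \<Longrightarrow> e21 \<odot>\<^bsub>U\<^esub> x \<in> carrier U"
  by (intro U.smult_closed) auto

lemma e11_gen:
  assumes "x \<in> xpart U" "y \<in> xpart U"
  shows "e11 \<odot>\<^bsub>U\<^esub> (x \<oplus>\<^bsub>U\<^esub> e21 \<odot>\<^bsub>U\<^esub> y) = x"
proof -
  have "e11 \<odot>\<^bsub>U\<^esub> (e21 \<odot>\<^bsub>U\<^esub> y) = t \<zero>\<^bsub>A\<^esub> \<zero>\<^bsub>A\<^esub> \<zero>\<^bsub>A\<^esub> \<odot>\<^bsub>U\<^esub> y"
    using xpartD(1)[OF assms(2)] by (simp add: smult_smult)
  then have "e11 \<odot>\<^bsub>U\<^esub> (e21 \<odot>\<^bsub>U\<^esub> y) = \<zero>\<^bsub>U\<^esub>"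
    using xpartD(1)[OF assms(2)] by (simp add: smult_zero[OF U] flip: tri_zero)
  then show ?thesis using assms e21_closed[OF assms(2)] by (simp add: U.smult_r_distr)
qed

lemma gen_zero_iff:
  assumes "x \<in> xpart U" "y \<in> xpart U" "x \<oplus>\<^bsub>U\<^esub> e21 \<odot>\<^bsub>U\<^esub> y = \<zero>\<^bsub>U\<^esub>"
  shows "x = \<zero>\<^bsub>U\<^esub>" "e21 \<odot>\<^bsub>U\<^esub> y = \<zero>\<^bsub>U\<^esub>"
proof -
  show "x = \<zero>\<^bsub>U\<^esub>" using e11_gen[OF assms(1,2)] unfolding assms(3) by (simp add: smult_zero[OF U])
  then show "e21 \<odot>\<^bsub>U\<^esub> y = \<zero>\<^bsub>U\<^esub>" using assms e21_closed[OF assms(2)] by simp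
qed

lemma smult_gen:
  assumes x: "x \<in> xpart U" and y: "y \<in> xpart U" 
    and a: "a \<in> carrier A" "b \<in> carrier A" "c \<in> carrier A"
  shows "t a b c \<odot>\<^bsub>U\<^esub> (x \<oplus>\<^bsub>U\<^esub> e21 \<odot>\<^bsub>U\<^esub> y) = t a \<zero>\<^bsub>A\<^esub> \<zero>\<^bsub>A\<^esub> \<odot>\<^bsub>U\<^esub> x \<oplus>\<^bsub>U\<^esub>
    e21 \<odot>\<^bsub>U\<^esub> (t b \<zero>\<^bsub>A\<^esub> \<zero>\<^bsub>A\<^esub> \<odot>\<^bsub>U\<^esub> x \<oplus>\<^bsub>U\<^esub> t c \<zero>\<^bsub>A\<^esub> \<zero>\<^bsub>A\<^esub> \<odot>\<^bsub>U\<^esub> y)"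
proof -
  have xy: "t a \<zero>\<^bsub>A\<^esub> \<zero>\<^bsub>A\<^esub> \<odot>\<^bsub>U\<^esub> x \<in> xpart U" "t b \<zero>\<^bsub>A\<^esub> \<zero>\<^bsub>A\<^esub> \<odot>\<^bsub>U\<^esub> x \<in> xpart U" "t c \<zero>\<^bsub>A\<^esub> \<zero>\<^bsub>A\<^esub> \<odot>\<^bsub>U\<^esub> y \<in> xpart U"
    using a x y by (auto intro: xpart_smult)
  have "t a b c \<odot>\<^bsub>U\<^esub> (x \<oplus>\<^bsub>U\<^esub> e21 \<odot>\<^bsub>U\<^esub> y) = t a b c \<odot>\<^bsub>U\<^esub> x \<oplus>\<^bsub>U\<^esub> t a b c \<odot>\<^bsub>U\<^esub> (e21 \<odot>\<^bsub>U\<^esub> y)"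
    using a x e21_closed[OF y] by (simp add: U.smult_r_distr)
  also have "t a b c \<odot>\<^bsub>U\<^esub> x = t a \<zero>\<^bsub>A\<^esub> \<zero>\<^bsub>A\<^esub> \<odot>\<^bsub>U\<^esub> x \<oplus>\<^bsub>U\<^esub> e21 \<odot>\<^bsub>U\<^esub> (t b \<zero>\<^bsub>A\<^esub> \<zero>\<^bsub>A\<^esub> \<odot>\<^bsub>U\<^esub> x)"
    using x a by (rule smult_xpart)
  also have "t a b c \<odot>\<^bsub>U\<^esub> (e21 \<odot>\<^bsub>U\<^esub> y) = e21 \<odot>\<^bsub>U\<^esub> (t c \<zero>\<^bsub>A\<^esub> \<zero>\<^bsub>A\<^esub> \<odot>\<^bsub>U\<^esub> y)"
    using y a by (rule smult_e21)
  finally show ?thesis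
    using xy e21_closed[OF xy(2)] e21_closed[OF xy(3)] by (simp add: U.smult_r_distr U.M.a_assoc)
qed

lemma gen_submodule: "submodule (gen U) B U"
  unfolding submodule_iff[OF U]
proof (intro conjI ballI)
  show "gen U \<subseteq> carrier U" using e21_closed by (auto simp: gen_def)
  have "\<zero>\<^bsub>U\<^esub> = \<zero>\<^bsub>U\<^esub> \<oplus>\<^bsub>U\<^esub> e21 \<odot>\<^bsub>U\<^esub> \<zero>\<^bsub>U\<^esub>" by (simp add: smult_zero[OF U])
  then show "\<zero>\<^bsub>U\<^esub> \<in> gen U" using xpart_zero unfolding gen_def by blast
next
  fix u v assume "u \<in> gen U" "v \<in> gen U"
  then obtain x y x' y' where u: "x \<in> xpart U" "y \<in> xpart U" "u = x \<oplus>\<^bsub>U\<^esub> e21 \<odot>\<^bsub>U\<^esub> y"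
    and v: "x' \<in> xpart U" "y' \<in> xpart U" "v = x' \<oplus>\<^bsub>U\<^esub> e21 \<odot>\<^bsub>U\<^esub> y'" by (auto simp: gen_def)
  have "u \<oplus>\<^bsub>U\<^esub> v = (x \<oplus>\<^bsub>U\<^esub> x') \<oplus>\<^bsub>U\<^esub> e21 \<odot>\<^bsub>U\<^esub> (y \<oplus>\<^bsub>U\<^esub> y')"
    using u v e21_closed by (simp add: U.smult_r_distr U.M.a_ac)
  then show "u \<oplus>\<^bsub>U\<^esub> v \<in> gen U" using u v xpart_add unfolding gen_def by blast
next
  fix b u assume b: "b \<in> carrier B" and "u \<in> gen U"
  then obtain x y where u: "x \<in> xpart U" "y \<in> xpart U" "u = x \<oplus>\<^bsub>U\<^esub> e21 \<odot>\<^bsub>U\<^esub> y" by (auto simp: gen_def)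
  obtain a c d where b': "a \<in> carrier A" "c \<in> carrier A" "d \<in> carrier A" "b = t a c d" using b by (rule T2_cases)
  let ?x = "t a \<zero>\<^bsub>A\<^esub> \<zero>\<^bsub>A\<^esub> \<odot>\<^bsub>U\<^esub> x" and ?y = "t c \<zero>\<^bsub>A\<^esub> \<zero>\<^bsub>A\<^esub> \<odot>\<^bsub>U\<^esub> x \<oplus>\<^bsub>U\<^esub> t d \<zero>\<^bsub>A\<^esub> \<zero>\<^bsub>A\<^esub> \<odot>\<^bsub>U\<^esub> y"
  have xy: "?x \<in> xpart U" "t c \<zero>\<^bsub>A\<^esub> \<zero>\<^bsub>A\<^esub> \<odot>\<^bsub>U\<^esub> x \<in> xpart U" "t d \<zero>\<^bsub>A\<^esub> \<zero>\<^bsub>A\<^esub> \<odot>\<^bsub>U\<^esub> y \<in> xpart U"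
    using b' u by (auto intro: xpart_smult)
  have "b \<odot>\<^bsub>U\<^esub> u = ?x \<oplus>\<^bsub>U\<^esub> e21 \<odot>\<^bsub>U\<^esub> ?y"
    unfolding b'(4) u(3) using u(1,2) b'(1-3) by (rule smult_gen)
  then show "b \<odot>\<^bsub>U\<^esub> u \<in> gen U" using xy xpart_add[OF xy(2,3)] unfolding gen_def by blast
qed

interpretation S: submod "T2 A" U "gen U" by (rule submodI[OF U gen_submodule])

lemma zc_eq_zero_iff: "u \<in> carrier U \<Longrightarrow> zc U u = gen U \<longleftrightarrow> u \<in> gen U"
  by (rule S.cls_eq_zero_iff)

lemma coker_carrier: "carrier (coker U) = zc U ` carrier U"
  by (simp add: coker_def S.quot_carrier)

lemma coker_zero: "\<zero>\<^bsub>coker U\<^esub> = gen U"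
  by (simp add: coker_def S.quot_zero)

lemma left_module_first: "left_module A (first U)"
  unfolding first_def
  by (rule left_module_pull[OF ring_A U])
    (use xpart_zero xpart_add xpart_smult in \<open>auto simp: tri_add tri_mult\<close>)

lemma quot_smult_eq:
  assumes a: "a \<in> carrier A" "b \<in> carrier A" "c \<in> carrier A" and z: "z \<in> carrier (quot_mod U (gen U))"
  shows "t a b c \<odot>\<^bsub>quot_mod U (gen U)\<^esub> z = t \<zero>\<^bsub>A\<^esub> \<zero>\<^bsub>A\<^esub> c \<odot>\<^bsub>quot_mod U (gen U)\<^esub> z"
proof -
  obtain u where u: "u \<in> carrier U" "z = zc U u" using z by (auto simp: S.quot_carrier)
  have e: "t a b c = t a b \<zero>\<^bsub>A\<^esub> \<oplus>\<^bsub>B\<^esub> t \<zero>\<^bsub>A\<^esub> \<zero>\<^bsub>A\<^esub> c" using a by (simp add: tri_add)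
  have "t a b \<zero>\<^bsub>A\<^esub> \<odot>\<^bsub>U\<^esub> u = t a b \<zero>\<^bsub>A\<^esub> \<odot>\<^bsub>U\<^esub> (e11 \<odot>\<^bsub>U\<^esub> u)" using a u by (simp add: smult_smult)
  also have "\<dots> \<in> gen U"
    using smult_xpart[OF xpart_smult[of "\<one>\<^bsub>A\<^esub>" u], of a b "\<zero>\<^bsub>A\<^esub>"] a u
      xpart_smult[of a "e11 \<odot>\<^bsub>U\<^esub> u"] xpart_smult[of b "e11 \<odot>\<^bsub>U\<^esub> u"] U.smult_closed[of e11 u]
    unfolding gen_def by auto
  finally have "t a b \<zero>\<^bsub>A\<^esub> \<odot>\<^bsub>U\<^esub> u \<in> gen U" .
  moreover have "t a b c \<odot>\<^bsub>U\<^esub> u \<ominus>\<^bsub>U\<^esub> t \<zero>\<^bsub>A\<^esub> \<zero>\<^bsub>A\<^esub> c \<odot>\<^bsub>U\<^esub> u = t a b \<zero>\<^bsub>A\<^esub> \<odot>\<^bsub>U\<^esub> u"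
    unfolding e using a u U.smult_closed[of "t a b \<zero>\<^bsub>A\<^esub>" u] U.smult_closed[of "t \<zero>\<^bsub>A\<^esub> \<zero>\<^bsub>A\<^esub> c" u]
    by (simp add: U.smult_l_distr a_minus_def U.M.a_assoc U.M.r_neg)
  ultimately show ?thesis using a u
    by (simp add: S.quot_smult S.cls_eq_iff U.smult_closed)
qed

lemma left_module_coker: "left_module A (coker U)"
  unfolding coker_def
proof (rule left_module_pull[OF ring_A S.left_module_quot])
  interpret Q: left_module "T2 A" "quot_mod U (gen U)" by (rule S.left_module_quot)
  show "t \<zero>\<^bsub>A\<^esub> \<zero>\<^bsub>A\<^esub> \<one>\<^bsub>A\<^esub> \<odot>\<^bsub>quot_mod U (gen U)\<^esub> z = z" if "z \<in> carrier (quot_mod U (gen U))" for z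
    using quot_smult_eq[of "\<one>\<^bsub>A\<^esub>" "\<zero>\<^bsub>A\<^esub>" "\<one>\<^bsub>A\<^esub>" z] that Q.smult_one[OF that] by (simp add: tri_one)
qed (auto simp: tri_add tri_mult intro: left_module.smult_closed[OF S.left_module_quot]
    abelian_monoid.a_closed[OF abelian_group.axioms(1)[OF left_module.axioms(2)[OF S.left_module_quot]]]
    abelian_monoid.zero_closed[OF abelian_group.axioms(1)[OF left_module.axioms(2)[OF S.left_module_quot]]])

lemma lin_zc: "lin B U (second (coker U)) (zc U)"
proof (rule linI)
  fix u assume u: "u \<in> carrier U"
  show "zc U u \<in> carrier (second (coker U))" using u by (simp add: coker_carrier)
  show "zc U (u \<oplus>\<^bsub>U\<^esub> v) = zc U u \<oplus>\<^bsub>second (coker U)\<^esub> zc U v" if "v \<in> carrier U" for v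
    using u that by (simp add: coker_def S.quot_add)
  show "zc U (b \<odot>\<^bsub>U\<^esub> u) = b \<odot>\<^bsub>second (coker U)\<^esub> zc U u" if b: "b \<in> carrier B" for b
  proof -
    have "zc U (b \<odot>\<^bsub>U\<^esub> u) = b \<odot>\<^bsub>quot_mod U (gen U)\<^esub> zc U u" using u b by (simp add: S.quot_smult)
    also have "\<dots> = t (b $ 1 $ 1) (b $ 2 $ 1) (b $ 2 $ 2) \<odot>\<^bsub>quot_mod U (gen U)\<^esub> zc U u"
      using b by (simp add: tri_collapse)
    also have "\<dots> = t \<zero>\<^bsub>A\<^esub> \<zero>\<^bsub>A\<^esub> (b $ 2 $ 2) \<odot>\<^bsub>quot_mod U (gen U)\<^esub> zc U u"
      using b u by (intro quot_smult_eq) (auto simp: S.quot_carrier)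
    finally show ?thesis by (simp add: coker_def)
  qed
qed

text \<open>
  The functor \<open>coker\<close> is left adjoint to \<open>second\<close>: a map to a module without \<open>X\<close>-component vanishes on the
  submodule generated by \<open>X\<close>.
\<close>

lemma lin_coker_lift:
  fixes W :: "('a, 'n) module"
  assumes W: "left_module A W" and k: "lin B U (second W) k"
  shows "\<exists>h. lin A (coker U) W h \<and> (\<forall>u\<in>carrier U. h (zc U u) = k u)"
proof -
  interpret W: left_module A W by (rule W)
  have z: "k x = \<zero>\<^bsub>W\<^esub>" "k (e21 \<odot>\<^bsub>U\<^esub> x) = \<zero>\<^bsub>W\<^esub>" if x: "x \<in> xpart U" for x
    using lin_smult[OF k, of e11 x] lin_smult[OF k, of e21 x] xpartD[OF x] lin_closed[OF k xpartD(1)[OF x]]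
    by (simp_all add: smult_zero[OF W])
  have "k u = \<zero>\<^bsub>second W\<^esub>" if "u \<in> gen U" for u
    using that z e21_closed by (auto simp: gen_def lin_add[OF k])
  then obtain h where h: "lin B (quot_mod U (gen U)) (second W) h" "\<forall>u\<in>carrier U. h (zc U u) = k u"
    using S.lin_quot_lift[OF k left_module_second[OF W]] by blast
  have "lin A (coker U) W h"
    by (rule linI) (use lin_closed[OF h(1)] lin_add[OF h(1)] lin_smult[OF h(1)] in \<open>auto simp: coker_def\<close>)
  then show ?thesis using h(2) by blast
qed

lemma dual_basis_coker:
  assumes d: "dual_basis B U I x \<phi>"
  shows "\<exists>\<psi>. dual_basis A (coker U) I (\<lambda>i. zc U (x i)) \<psi>"
proof -
  have I: "finite I" and x: "\<And>i. i \<in> I \<Longrightarrow> x i \<in> carrier U" and \<phi>: "\<And>i. i \<in> I \<Longrightarrow> lin B U (regular B) (\<phi> i)"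
    using d by (auto simp: dual_basis_def)
  have "\<forall>i. \<exists>h. i \<in> I \<longrightarrow> lin A (coker U) (regular A) h \<and> (\<forall>u\<in>carrier U. h (zc U u) = \<phi> i u $ 2 $ 2)"
    using lin_coker_lift[OF reg lin_entry22[OF \<phi>]] by blast
  from choice[OF this] obtain \<psi> where \<psi>: "\<And>i. i \<in> I \<Longrightarrow> lin A (coker U) (regular A) (\<psi> i)"
    "\<And>i u. i \<in> I \<Longrightarrow> u \<in> carrier U \<Longrightarrow> \<psi> i (zc U u) = \<phi> i u $ 2 $ 2" by blast
  interpret C: left_module A "coker U" by (rule left_module_coker)
  have "z = (\<Oplus>\<^bsub>coker U\<^esub>i\<in>I. \<psi> i z \<odot>\<^bsub>coker U\<^esub> zc U (x i))" if "z \<in> carrier (coker U)" for z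
  proof -
    obtain u where u: "u \<in> carrier U" "z = zc U u" using \<open>z \<in> carrier (coker U)\<close> by (auto simp: coker_carrier)
    have xz: "zc U (x i) \<in> carrier (coker U)" if "i \<in> I" for i using x[OF that] by (simp add: coker_carrier)
    have c: "\<phi> i u $ 2 $ 2 \<in> carrier A" if "i \<in> I" for i using lin_closed[OF \<phi>[OF that] u(1)] by simp
    have "z = (\<Oplus>\<^bsub>coker U\<^esub>i\<in>I. \<phi> i u $ 2 $ 2 \<odot>\<^bsub>coker U\<^esub> zc U (x i))"
      using dual_basis_expand[OF U left_module_second[OF left_module_coker] d lin_zc u(1)] u(2) by simp
    also have "\<dots> = (\<Oplus>\<^bsub>coker U\<^esub>i\<in>I. \<psi> i z \<odot>\<^bsub>coker U\<^esub> zc U (x i))"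
      using c xz by (intro C.M.finsum_cong') (auto simp: u \<psi>(2) intro: C.smult_closed)
    finally show ?thesis .
  qed
  moreover have "zc U (x i) \<in> carrier (coker U)" if "i \<in> I" for i using x[OF that] by (simp add: coker_carrier)
  ultimately show ?thesis unfolding dual_basis_def using I \<psi>(1) by (intro exI[of _ \<psi>]) simp
qed

lemma entry_xpart:
  assumes h: "lin B U (regular B) h" and x: "x \<in> xpart U"
  shows "h x = t (h x $ 1 $ 1) \<zero>\<^bsub>A\<^esub> \<zero>\<^bsub>A\<^esub>"
proof -
  have hx: "h x \<in> carrier B" using lin_closed[OF h xpartD(1)[OF x]] by simp
  have "h x = e11 \<otimes>\<^bsub>B\<^esub> h x" using lin_smult[OF h, of e11 x] xpartD[OF x] by simp
  also have "\<dots> = e11 \<otimes>\<^bsub>B\<^esub> t (h x $ 1 $ 1) (h x $ 2 $ 1) (h x $ 2 $ 2)" using tri_collapse[OF hx] by simp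
  also have "\<dots> = t (h x $ 1 $ 1) \<zero>\<^bsub>A\<^esub> \<zero>\<^bsub>A\<^esub>" using hx by (simp add: tri_mult)
  finally show ?thesis .
qed

lemma lin_entry11:
  assumes h: "lin B U (regular B) h"
  shows "lin A (first U) (regular A) (\<lambda>x. h x $ 1 $ 1)"
proof -
  have c: "h x \<in> carrier B" if "x \<in> xpart U" for x using lin_closed[OF h xpartD(1)[OF that]] by simp
  show ?thesis
    by (rule linI) (use c in \<open>simp_all add: lin_add[OF h] lin_smult[OF h] entry_add entry_mult\<close>)
qed

lemma finsum_first:
  assumes "finite I" "\<And>i. i \<in> I \<Longrightarrow> g i \<in> xpart U"
  shows "(\<Oplus>\<^bsub>first U\<^esub>i\<in>I. g i) = (\<Oplus>\<^bsub>U\<^esub>i\<in>I. g i)"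
  unfolding first_def using assms left_module.axioms(2)[OF left_module_first]
  by (intro finsum_pull) (auto simp: first_def intro: U.M.abelian_group_axioms)

lemma dual_basis_first:
  assumes d: "dual_basis B U I x \<phi>"
  shows "dual_basis A (first U) I (\<lambda>i. e11 \<odot>\<^bsub>U\<^esub> x i) (\<lambda>i u. \<phi> i u $ 1 $ 1)"
proof -
  have I: "finite I" and x: "\<And>i. i \<in> I \<Longrightarrow> x i \<in> carrier U" and \<phi>: "\<And>i. i \<in> I \<Longrightarrow> lin B U (regular B) (\<phi> i)"
    using d by (auto simp: dual_basis_def)
  have ex: "e11 \<odot>\<^bsub>U\<^esub> x i \<in> xpart U" if "i \<in> I" for i using x[OF that] by (simp add: xpart_smult)
  have "p = (\<Oplus>\<^bsub>first U\<^esub>i\<in>I. \<phi> i p $ 1 $ 1 \<odot>\<^bsub>first U\<^esub> (e11 \<odot>\<^bsub>U\<^esub> x i))" if p: "p \<in> xpart U" for p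
  proof -
    have pc: "p \<in> carrier U" using p by (rule xpartD)
    have c: "\<phi> i p $ 1 $ 1 \<in> carrier A" if "i \<in> I" for i using lin_closed[OF \<phi>[OF that] pc] by simp
    have e: "t (\<phi> i p $ 1 $ 1) \<zero>\<^bsub>A\<^esub> \<zero>\<^bsub>A\<^esub> \<odot>\<^bsub>U\<^esub> (e11 \<odot>\<^bsub>U\<^esub> x i) = \<phi> i p \<odot>\<^bsub>U\<^esub> x i" if i: "i \<in> I" for i
      using c[OF i] x[OF i] by (subst (2) entry_xpart[OF \<phi>[OF i] p]) (simp add: smult_smult)
    have "(\<Oplus>\<^bsub>first U\<^esub>i\<in>I. \<phi> i p $ 1 $ 1 \<odot>\<^bsub>first U\<^esub> (e11 \<odot>\<^bsub>U\<^esub> x i))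
      = (\<Oplus>\<^bsub>U\<^esub>i\<in>I. t (\<phi> i p $ 1 $ 1) \<zero>\<^bsub>A\<^esub> \<zero>\<^bsub>A\<^esub> \<odot>\<^bsub>U\<^esub> (e11 \<odot>\<^bsub>U\<^esub> x i))"
      using c ex I by (subst finsum_first) (auto intro: xpart_smult)
    also have "\<dots> = (\<Oplus>\<^bsub>U\<^esub>i\<in>I. \<phi> i p \<odot>\<^bsub>U\<^esub> x i)"
      using e x lin_closed[OF \<phi> pc] by (intro U.M.finsum_cong') (auto intro!: U.smult_closed)
    finally show ?thesis using d pc by (simp add: dual_basis_def)
  qed
  then show ?thesis using I ex lin_entry11[OF \<phi>] by (simp add: dual_basis_def)
qed

end

lemma lin_first:
  assumes "lin B U V f"
  shows "lin A (first U) (first V) f"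
proof (rule linI)
  fix x assume x: "x \<in> carrier (first U)"
  then have xc: "x \<in> carrier U" and e: "e11 \<odot>\<^bsub>U\<^esub> x = x" by auto
  show "f x \<in> carrier (first V)"
    using lin_closed[OF assms xc] lin_smult[OF assms, of e11 x] xc e by (simp del: xpartD add: xpart_def)
  show "f (x \<oplus>\<^bsub>first U\<^esub> y) = f x \<oplus>\<^bsub>first V\<^esub> f y" if "y \<in> carrier (first U)" for y
    using that xc lin_add[OF assms] by auto
  show "f (a \<odot>\<^bsub>first U\<^esub> x) = a \<odot>\<^bsub>first V\<^esub> f x" if "a \<in> carrier A" for a
    using that xc lin_smult[OF assms] by simp
qed

lemma lin_coker_map:
  assumes U: "left_module B U" and V: "left_module B V" and f: "lin B U V f"
  shows "\<exists>h. lin A (coker U) (coker V) h \<and> (\<forall>u\<in>carrier U. h (zc U u) = zc V (f u))"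
  using lin_coker_lift[OF U left_module_coker[OF V] lin_comp[OF f lin_zc[OF V]]] .

lemma projective_first:
  fixes P :: "('a ^ 2 ^ 2, 'm) module"
  assumes P: "projective B P" shows "projective A (first P)"
proof -
  have lP: "left_module B P" using P by (rule B.projective_left_module)
  obtain n :: nat and x \<phi> where d: "dual_basis B P {..<n} x \<phi>" using B.projective_dual_basis[OF P] by blast
  note d' = dual_basis_first[OF lP d]
  show ?thesis by (rule projective_of_dual_basis[OF fg_module_of_dual_basis[OF left_module_first[OF lP] d'] d'])
qed

lemma projective_coker:
  fixes P :: "('a ^ 2 ^ 2, 'm) module"
  assumes P: "projective B P" shows "projective A (coker P)"
proof -
  have lP: "left_module B P" using P by (rule B.projective_left_module)
  obtain n :: nat and x \<phi> where d: "dual_basis B P {..<n} x \<phi>" using B.projective_dual_basis[OF P] by blast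
  obtain \<psi> where d': "dual_basis A (coker P) {..<n} (\<lambda>i. zc P (x i)) \<psi>" using dual_basis_coker[OF lP d] by blast
  show ?thesis by (rule projective_of_dual_basis[OF fg_module_of_dual_basis[OF left_module_coker[OF lP] d'] d'])
qed

text \<open>
  Maps to \<open>B\<close> separate the elements of a projective module, and \<open>e21\<close> acts injectively on \<open>e11 B\<close>.
\<close>

lemma projective_e21_inj:
  fixes P :: "('a ^ 2 ^ 2, 'm) module"
  assumes P: "projective B P" and x: "x \<in> xpart P" and z: "e21 \<odot>\<^bsub>P\<^esub> x = \<zero>\<^bsub>P\<^esub>"
  shows "x = \<zero>\<^bsub>P\<^esub>"
proof (rule B.projective_separate[OF P xpartD(1)[OF x]])
  have lP: "left_module B P" using P by (rule B.projective_left_module)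
  fix h assume "h \<in> carrier (hom_dual B P)"
  then have h: "lin B P (regular B) h" by (simp add: hom_dual_carrier)
  have hx: "h x \<in> carrier B" using lin_closed[OF h xpartD(1)[OF x]] by simp
  have "\<zero>\<^bsub>B\<^esub> = e21 \<otimes>\<^bsub>B\<^esub> h x"
    using lin_smult[OF h, of e21 x] xpartD(1)[OF x] z lin_zero[OF lP B.reg h] by simp
  also have "\<dots> = e21 \<otimes>\<^bsub>B\<^esub> t (h x $ 1 $ 1) \<zero>\<^bsub>A\<^esub> \<zero>\<^bsub>A\<^esub>" using entry_xpart[OF lP h x] by simp
  also have "\<dots> = t \<zero>\<^bsub>A\<^esub> (h x $ 1 $ 1) \<zero>\<^bsub>A\<^esub>" using hx by (simp add: tri_mult)
  finally have "h x $ 1 $ 1 = \<zero>\<^bsub>A\<^esub>" by (simp add: tri_zero tri_eq_iff)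
  then show "h x = \<zero>\<^bsub>B\<^esub>" using entry_xpart[OF lP h x] by (simp add: tri_zero)
qed

text \<open>
  If the \<open>x i\<close> are part of a dual basis of \<open>P\<close>, then the \<open>e11 x i\<close> are part of one of the \<open>X\<close>-component. So
  the coordinates with respect to the latter extend to \<open>P\<close>.
\<close>

lemma projective_extend:
  fixes P :: "('a ^ 2 ^ 2, 'm) module" and V :: "('a ^ 2 ^ 2, 'n) module"
  assumes P: "projective B P" and V: "left_module B V" and u: "lin A (first P) (first V) u"
  shows "\<exists>U. lin B P V U \<and> (\<forall>x\<in>xpart P. U x = u x)"
proof -
  have lP: "left_module B P" using P by (rule B.projective_left_module)
  interpret P: left_module "T2 A" P by (rule lP)
  interpret V: left_module "T2 A" V by (rule V)
  obtain n :: nat and x \<phi> where d: "dual_basis B P {..<n} x \<phi>" using B.projective_dual_basis[OF P] by blast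
  have ex: "e11 \<odot>\<^bsub>P\<^esub> x i \<in> xpart P" and \<phi>: "lin B P (regular B) (\<phi> i)" if "i < n" for i
    using d that by (auto simp: dual_basis_def intro: xpart_smult[OF lP])
  have ue: "u (e11 \<odot>\<^bsub>P\<^esub> x i) \<in> xpart V" if "i < n" for i using lin_closed[OF u, of "e11 \<odot>\<^bsub>P\<^esub> x i"] ex[OF that] by simp
  let ?U = "\<lambda>p. \<Oplus>\<^bsub>V\<^esub>i\<in>{..<n}. \<phi> i p \<odot>\<^bsub>V\<^esub> u (e11 \<odot>\<^bsub>P\<^esub> x i)"
  have "?U p = u p" if p: "p \<in> xpart P" for p
  proof -
    have c: "\<phi> i p $ 1 $ 1 \<in> carrier A" if "i < n" for i using lin_closed[OF \<phi>[OF that] xpartD(1)[OF p]] by simp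
    have s: "t (\<phi> i p $ 1 $ 1) \<zero>\<^bsub>A\<^esub> \<zero>\<^bsub>A\<^esub> \<odot>\<^bsub>V\<^esub> u (e11 \<odot>\<^bsub>P\<^esub> x i) \<in> xpart V" if "i < n" for i
      using c[OF that] xpartD(1)[OF ue[OF that]] by (rule xpart_smult[OF V])
    have "u p = (\<Oplus>\<^bsub>first V\<^esub>i\<in>{..<n}. t (\<phi> i p $ 1 $ 1) \<zero>\<^bsub>A\<^esub> \<zero>\<^bsub>A\<^esub> \<odot>\<^bsub>V\<^esub> u (e11 \<odot>\<^bsub>P\<^esub> x i))"
      using dual_basis_expand[OF left_module_first[OF lP] left_module_first[OF V] dual_basis_first[OF lP d] u, of p] p by simp
    also have "\<dots> = (\<Oplus>\<^bsub>V\<^esub>i\<in>{..<n}. t (\<phi> i p $ 1 $ 1) \<zero>\<^bsub>A\<^esub> \<zero>\<^bsub>A\<^esub> \<odot>\<^bsub>V\<^esub> u (e11 \<odot>\<^bsub>P\<^esub> x i))"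
      using s by (intro finsum_first[OF V]) auto
    also have "\<dots> = ?U p"
    proof (rule V.M.finsum_cong'[OF refl])
      show "(\<lambda>i. \<phi> i p \<odot>\<^bsub>V\<^esub> u (e11 \<odot>\<^bsub>P\<^esub> x i)) \<in> {..<n} \<rightarrow> carrier V"
        using lin_closed[OF \<phi> xpartD(1)[OF p]] xpartD(1)[OF ue] by (auto intro!: V.smult_closed)
      fix i assume "i \<in> {..<n}"
      then have i: "i < n" by simp
      show "t (\<phi> i p $ 1 $ 1) \<zero>\<^bsub>A\<^esub> \<zero>\<^bsub>A\<^esub> \<odot>\<^bsub>V\<^esub> u (e11 \<odot>\<^bsub>P\<^esub> x i) = \<phi> i p \<odot>\<^bsub>V\<^esub> u (e11 \<odot>\<^bsub>P\<^esub> x i)"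
        using entry_xpart[OF lP \<phi>[OF i] p] by simp
    qed
    finally show ?thesis by simp
  qed
  moreover have "lin B P V ?U" using d ue by (intro lin_dual_basis[OF V d]) auto
  ultimately show ?thesis by blast
qed

section \<open>Totally acyclic complexes over the triangular matrix algebra\<close>

text \<open>
  \<open>second (regular A)\<close> is a direct summand of \<open>B\<close>, namely its second column.
\<close>

lemma second_hom_exact:
  fixes P :: "int \<Rightarrow> ('a ^ 2 ^ 2, 'm) module"
  assumes T: "totally_acyclic B P d" and k: "lin B (P i) (second (regular A)) k"
    and z: "\<And>y. y \<in> carrier (P (i - 1)) \<Longrightarrow> k (d (i - 1) y) = \<zero>\<^bsub>A\<^esub>"
  shows "\<exists>k'. lin B (P (i + 1)) (second (regular A)) k' \<and> (\<forall>x\<in>carrier (P i). k' (d i x) = k x)"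
proof -
  have "lin B (P i) (second (regular A)) (\<lambda>x. \<zero>\<^bsub>A\<^esub>)" by (rule linI) auto
  then have "lin B (P i) (regular B) (\<lambda>p. t \<zero>\<^bsub>A\<^esub> \<zero>\<^bsub>A\<^esub> (k p))" using k by (rule lin_lower)
  then obtain h where h: "lin B (P (i + 1)) (regular B) h" "\<forall>x\<in>carrier (P i). h (d i x) = t \<zero>\<^bsub>A\<^esub> \<zero>\<^bsub>A\<^esub> (k x)"
    using totally_acyclicD(4)[OF T, of i "\<lambda>p. t \<zero>\<^bsub>A\<^esub> \<zero>\<^bsub>A\<^esub> (k p)"] z by (auto simp: tri_zero)
  then show ?thesis using lin_entry22[OF h(1)] by (intro exI[of _ "\<lambda>p. h p $ 2 $ 2"]) simp
qed

lemma totally_acyclic_xpart: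
  fixes P :: "int \<Rightarrow> ('a ^ 2 ^ 2, 'm) module"
  assumes T: "totally_acyclic B P d" and x: "x \<in> xpart (P i)" and z: "d i x = \<zero>\<^bsub>P (i + 1)\<^esub>"
  shows "\<exists>y\<in>xpart (P (i - 1)). d (i - 1) y = x"
proof -
  note T' = totally_acyclicD[OF T]
  have l: "left_module B (P (i - 1))" using T'(1) by (rule B.projective_left_module)
  obtain y where y: "y \<in> carrier (P (i - 1))" "x = d (i - 1) y" using T'(3)[OF xpartD(1)[OF x]] z by blast
  have "d (i - 1) (e11 \<odot>\<^bsub>P (i - 1)\<^esub> y) = e11 \<odot>\<^bsub>P i\<^esub> x"
    using lin_smult[OF T'(2)[of "i - 1"], of e11 y] y by simp
  then show ?thesis using xpartD(2)[OF x] xpart_smult[OF l, of "\<one>\<^bsub>A\<^esub>" y] y(1) by auto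
qed

text \<open>
  A map \<open>f\<close> out of the \<open>X\<close>-component extends to a map \<open>F\<close> into \<open>B\<close>. The composition of \<open>F\<close> with the
  differential factors through the cokernel component, whose complex is exact under maps to \<open>A\<close>;
  this gives a correction \<open>G\<close> vanishing on the \<open>X\<close>-component such that \<open>F - G\<close> is a cocycle.
\<close>

lemma totally_acyclic_first:
  fixes P :: "int \<Rightarrow> ('a ^ 2 ^ 2, 'm) module"
  assumes T: "totally_acyclic B P d"
  shows "totally_acyclic A (\<lambda>i. first (P i)) d"
  unfolding totally_acyclic_def
proof (intro conjI allI impI ballI)
  note T' = totally_acyclicD[OF T]
  have lP: "left_module B (P i)" for i using T'(1) by (rule B.projective_left_module)
  have dl: "lin B (P (i - 1)) (P i) (d (i - 1))" for i using T'(2)[of "i - 1"] by simp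
  fix i
  show "projective A (first (P i))" using T'(1) by (rule projective_first)
  show "lin A (first (P i)) (first (P (i + 1))) (d i)" using T'(2) by (rule lin_first)
  show "d i x = \<zero>\<^bsub>first (P (i + 1))\<^esub> \<longleftrightarrow> x \<in> d (i - 1) ` carrier (first (P (i - 1)))" if "x \<in> carrier (first (P i))" for x
    using that totally_acyclic_xpart[OF T, of x i] B.totally_acyclic_zero[OF T] by auto
  fix f assume f: "lin A (first (P i)) (regular A) f \<and> (\<forall>y\<in>carrier (first (P (i - 1))). f (d (i - 1) y) = \<zero>\<^bsub>A\<^esub>)"
  have fc: "f x \<in> carrier A" if "x \<in> xpart (P i)" for x using f that lin_closed[of A "first (P i)" "regular A" f x] by simp
  have "lin A (first (P i)) (first (regular B)) (\<lambda>x. t (f x) \<zero>\<^bsub>A\<^esub> \<zero>\<^bsub>A\<^esub>)"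
  proof (rule linI)
    fix x assume x: "x \<in> carrier (first (P i))"
    show "t (f x) \<zero>\<^bsub>A\<^esub> \<zero>\<^bsub>A\<^esub> \<in> carrier (first (regular B))" using fc[of x] x by (simp del: xpartD add: xpart_def tri_mult)
    show "t (f (x \<oplus>\<^bsub>first (P i)\<^esub> y)) \<zero>\<^bsub>A\<^esub> \<zero>\<^bsub>A\<^esub> = t (f x) \<zero>\<^bsub>A\<^esub> \<zero>\<^bsub>A\<^esub> \<oplus>\<^bsub>first (regular B)\<^esub> t (f y) \<zero>\<^bsub>A\<^esub> \<zero>\<^bsub>A\<^esub>"
      if "y \<in> carrier (first (P i))" for y
      using fc x that f lin_add[of A "first (P i)" "regular A" f x y] by (simp add: tri_add)
    show "t (f (a \<odot>\<^bsub>first (P i)\<^esub> x)) \<zero>\<^bsub>A\<^esub> \<zero>\<^bsub>A\<^esub> = a \<odot>\<^bsub>first (regular B)\<^esub> t (f x) \<zero>\<^bsub>A\<^esub> \<zero>\<^bsub>A\<^esub>"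
      if "a \<in> carrier A" for a
      using fc x that f lin_smult[of A "first (P i)" "regular A" f a x] by (simp add: tri_mult)
  qed
  from projective_extend[OF T'(1) B.reg this]
  obtain F where F: "lin B (P i) (regular B) F" and Fx: "\<forall>x\<in>xpart (P i). F x = t (f x) \<zero>\<^bsub>A\<^esub> \<zero>\<^bsub>A\<^esub>" by (elim exE conjE)
  have Fd: "lin B (P (i - 1)) (regular B) (\<lambda>p. F (d (i - 1) p))" using dl F by (rule lin_comp)
  have dc: "d (i - 1) p \<in> carrier (P i)" if "p \<in> carrier (P (i - 1))" for p using lin_closed[OF dl that] .
  have Fc: "F p \<in> carrier B" if "p \<in> carrier (P i)" for p using lin_closed[OF F that] by simp
  have F11: "F (d (i - 1) p) $ 1 $ 1 = \<zero>\<^bsub>A\<^esub>" if p: "p \<in> carrier (P (i - 1))" for p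
  proof -
    let ?q = "e11 \<odot>\<^bsub>P (i - 1)\<^esub> p"
    have q: "?q \<in> xpart (P (i - 1))" using p by (intro xpart_smult[OF lP]) simp_all
    have dq: "d (i - 1) ?q \<in> xpart (P i)" using lin_closed[OF lin_first[OF dl]] q by simp
    have "F (d (i - 1) p) $ 1 $ 1 = (e11 \<otimes>\<^bsub>B\<^esub> F (d (i - 1) p)) $ 1 $ 1"
      using Fc[OF dc[OF p]] by (simp add: entry_mult)
    also have "e11 \<otimes>\<^bsub>B\<^esub> F (d (i - 1) p) = F (d (i - 1) ?q)" using lin_smult[OF Fd, of e11 p] p by simp
    also have "\<dots> = t (f (d (i - 1) ?q)) \<zero>\<^bsub>A\<^esub> \<zero>\<^bsub>A\<^esub>" using Fx dq by blast
    also have "f (d (i - 1) ?q) = \<zero>\<^bsub>A\<^esub>" using f q by simp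
    finally show ?thesis by simp
  qed
  have zz: "F (d (i - 1) (d (i - 1 - 1) y)) = \<zero>\<^bsub>B\<^esub>" if "y \<in> carrier (P (i - 1 - 1))" for y
    using B.totally_acyclic_zero[OF T that] lin_zero[OF lP B.reg F] by simp
  obtain k where k: "lin B (P (i - 1 + 1)) (second (regular A)) k"
    "\<forall>x\<in>carrier (P (i - 1)). k (d (i - 1) x) = F (d (i - 1) x) $ 2 $ 1"
    using second_hom_exact[OF T lin_entry21[OF Fd F11]] zz by (auto simp: entry_zero)
  obtain l where l: "lin B (P (i - 1 + 1)) (second (regular A)) l"
    "\<forall>x\<in>carrier (P (i - 1)). l (d (i - 1) x) = F (d (i - 1) x) $ 2 $ 2"
    using second_hom_exact[OF T lin_entry22[OF Fd]] zz by (auto simp: entry_zero)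
  have i: "i - 1 + 1 = i" by simp
  let ?G = "\<lambda>p. t \<zero>\<^bsub>A\<^esub> (k p) (l p)"
  have G: "lin B (P i) (regular B) ?G" using lin_lower[OF k(1) l(1)] unfolding i .
  have Gc: "?G p \<in> carrier B" if "p \<in> carrier (P i)" for p using lin_closed[OF G that] by simp
  have H: "lin B (P i) (regular B) (\<lambda>p. F p \<ominus>\<^bsub>regular B\<^esub> ?G p)" by (rule lin_diff[OF B.reg F G])
  have "F (d (i - 1) y) \<ominus>\<^bsub>regular B\<^esub> ?G (d (i - 1) y) = \<zero>\<^bsub>B\<^esub>" if y: "y \<in> carrier (P (i - 1))" for y
  proof -
    have "?G (d (i - 1) y) = F (d (i - 1) y)"
      using k(2) l(2) y F11[OF y] tri_collapse[OF Fc[OF dc[OF y]]] by simp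
    then show ?thesis
      using Fc[OF dc[OF y]] diff_eq_zero_iff[OF left_module.axioms(2)[OF B.reg]] by simp
  qed
  then obtain F' where F': "lin B (P (i + 1)) (regular B) F'" "\<forall>x\<in>carrier (P i). F' (d i x) = F x \<ominus>\<^bsub>regular B\<^esub> ?G x"
    using T'(4)[OF H] by auto
  have "F' (d i x) $ 1 $ 1 = f x" if x: "x \<in> xpart (P i)" for x
  proof -
    have xc: "x \<in> carrier (P i)" using x by (rule xpartD)
    interpret RB: left_module "T2 A" "regular (T2 A)" by (rule B.reg)
    have c: "F' (d i x) \<in> carrier B" using lin_closed[OF F'(1) lin_closed[OF T'(2) xc]] by simp
    have "F' (d i x) \<oplus>\<^bsub>regular B\<^esub> ?G x = F x"
      using F'(2) xc Fc[OF xc] Gc[OF xc] RB.M.a_inv_closed[of "?G x"]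
        RB.M.a_assoc[of "F x" "\<ominus>\<^bsub>regular B\<^esub> ?G x" "?G x"] RB.M.l_neg[of "?G x"] RB.M.r_zero[of "F x"]
      by (simp add: a_minus_def)
    then have "(F' (d i x) \<oplus>\<^bsub>B\<^esub> ?G x) $ 1 $ 1 = F x $ 1 $ 1" by simp
    then show ?thesis using c Gc[OF xc] Fx x by (simp add: entry_add)
  qed
  then show "\<exists>h'. lin A (first (P (i + 1))) (regular A) h' \<and> (\<forall>x\<in>carrier (first (P i)). h' (d i x) = f x)"
    using lin_entry11[OF lP F'(1)] by (intro exI[of _ "\<lambda>x. F' x $ 1 $ 1"]) simp
qed

text \<open>
  The complex of submodules generated by the \<open>X\<close>-components is exact: as \<open>X \<rightarrow> Y\<close> is injective for
  projective modules, these are sums of two copies of \<open>X\<close>, whose complex is exact.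
\<close>

lemma totally_acyclic_gen:
  fixes P :: "int \<Rightarrow> ('a ^ 2 ^ 2, 'm) module"
  assumes T: "totally_acyclic B P d" and u: "u \<in> gen (P i)" and z: "d i u = \<zero>\<^bsub>P (i + 1)\<^esub>"
  shows "\<exists>y\<in>gen (P (i - 1)). d (i - 1) y = u"
proof -
  note T' = totally_acyclicD[OF T]
  have lP: "left_module B (P i)" for i using T'(1) by (rule B.projective_left_module)
  obtain x y where xy: "x \<in> xpart (P i)" "y \<in> xpart (P i)" "u = x \<oplus>\<^bsub>P i\<^esub> e21 \<odot>\<^bsub>P i\<^esub> y" using u by (auto simp: gen_def)
  have dxy: "d i x \<in> xpart (P (i + 1))" "d i y \<in> xpart (P (i + 1))"
    using lin_closed[OF lin_first[OF T'(2)]] xy by simp_all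
  have "d i x \<oplus>\<^bsub>P (i + 1)\<^esub> e21 \<odot>\<^bsub>P (i + 1)\<^esub> d i y = \<zero>\<^bsub>P (i + 1)\<^esub>"
    using z xy e21_closed[OF lP] lin_add[OF T'(2)] lin_smult[OF T'(2), of e21] by simp
  from gen_zero_iff[OF lP dxy this] have z': "d i x = \<zero>\<^bsub>P (i + 1)\<^esub>" "d i y = \<zero>\<^bsub>P (i + 1)\<^esub>"
    using projective_e21_inj[OF T'(1) dxy(2)] by simp_all
  obtain x' where x': "x' \<in> xpart (P (i - 1))" "d (i - 1) x' = x" using totally_acyclic_xpart[OF T xy(1) z'(1)] by blast
  obtain y' where y': "y' \<in> xpart (P (i - 1))" "d (i - 1) y' = y" using totally_acyclic_xpart[OF T xy(2) z'(2)] by blast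
  have dl: "lin B (P (i - 1)) (P i) (d (i - 1))" using T'(2)[of "i - 1"] by simp
  have "d (i - 1) (x' \<oplus>\<^bsub>P (i - 1)\<^esub> e21 \<odot>\<^bsub>P (i - 1)\<^esub> y') = u"
    using x' y' e21_closed[OF lP] lin_add[OF dl] lin_smult[OF dl, of e21] xy(3) by simp
  then show ?thesis using x'(1) y'(1) unfolding gen_def by blast
qed

text \<open>
  The quotient of an exact complex by the exact subcomplex of the submodules generated by the \<open>X\<close>-components
  is exact. Maps from the quotients to \<open>A\<close> are by adjunction maps to \<open>second (regular A)\<close>, under which the
  complex stays exact.
\<close>

lemma totally_acyclic_coker:
  fixes P :: "int \<Rightarrow> ('a ^ 2 ^ 2, 'm) module"
  assumes T: "totally_acyclic B P d"
  shows "\<exists>D. totally_acyclic A (\<lambda>i. coker (P i)) D \<and> (\<forall>i. \<forall>u\<in>carrier (P i). D i (zc (P i) u) = zc (P (i + 1)) (d i u))"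
proof -
  note T' = totally_acyclicD[OF T]
  have lP: "left_module B (P i)" for i using T'(1) by (rule B.projective_left_module)
  have "\<forall>i. \<exists>h. lin A (coker (P i)) (coker (P (i + 1))) h \<and> (\<forall>u\<in>carrier (P i). h (zc (P i) u) = zc (P (i + 1)) (d i u))"
    using lin_coker_map[OF lP lP T'(2)] by blast
  from choice[OF this] obtain D where D: "\<And>i. lin A (coker (P i)) (coker (P (i + 1))) (D i)"
    and Dz: "\<And>i u. u \<in> carrier (P i) \<Longrightarrow> D i (zc (P i) u) = zc (P (i + 1)) (d i u)" by blast
  have "totally_acyclic A (\<lambda>i. coker (P i)) D" unfolding totally_acyclic_def
  proof (intro conjI allI impI ballI)
    fix i
    have dl: "lin B (P (i - 1)) (P i) (d (i - 1))" using T'(2)[of "i - 1"] by simp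
    have dc: "d (i - 1) p \<in> carrier (P i)" if "p \<in> carrier (P (i - 1))" for p using lin_closed[OF dl that] .
    have Dz': "D (i - 1) (zc (P (i - 1)) u) = zc (P i) (d (i - 1) u)" if "u \<in> carrier (P (i - 1))" for u
      using Dz[OF that] by simp
    show "projective A (coker (P i))" using T'(1) by (rule projective_coker)
    show "lin A (coker (P i)) (coker (P (i + 1))) (D i)" by (rule D)
    interpret Pi: left_module "T2 A" "P i" by (rule lP)
    show "D i z = \<zero>\<^bsub>coker (P (i + 1))\<^esub> \<longleftrightarrow> z \<in> D (i - 1) ` carrier (coker (P (i - 1)))" if "z \<in> carrier (coker (P i))" for z
    proof -
      obtain u where u: "u \<in> carrier (P i)" "z = zc (P i) u" using \<open>z \<in> carrier (coker (P i))\<close> by (auto simp: coker_carrier[OF lP])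
      have "D i z = \<zero>\<^bsub>coker (P (i + 1))\<^esub> \<longleftrightarrow> d i u \<in> gen (P (i + 1))"
        using zc_eq_zero_iff[OF lP lin_closed[OF T'(2) u(1)]] by (simp add: u(2) Dz[OF u(1)] coker_zero[OF lP])
      also have "\<dots> \<longleftrightarrow> z \<in> D (i - 1) ` carrier (coker (P (i - 1)))"
      proof
        assume g: "d i u \<in> gen (P (i + 1))"
        have "d (i + 1) (d (i + 1 - 1) u) = \<zero>\<^bsub>P (i + 1 + 1)\<^esub>" using u(1) by (intro B.totally_acyclic_zero[OF T]) simp
        \<comment> \<open>The cycle \<open>d u\<close> of the subcomplex bounds some \<open>v\<close> in it, so \<open>u\<close> may be replaced by the cycle \<open>u - v\<close>.\<close>
        then obtain v where v: "v \<in> gen (P i)" "d i v = d i u" using totally_acyclic_gen[OF T g] by auto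
        have vc: "v \<in> carrier (P i)" using submodule_subset[OF gen_submodule[OF lP]] v(1) by blast
        have "d i (u \<ominus>\<^bsub>P i\<^esub> v) = \<zero>\<^bsub>P (i + 1)\<^esub>"
          using u(1) vc v(2) lin_closed[OF T'(2)]
          by (simp add: lin_minus[OF lP lP T'(2)] diff_eq_zero_iff[OF left_module.axioms(2)[OF lP]])
        then have "u \<ominus>\<^bsub>P i\<^esub> v \<in> d (i - 1) ` carrier (P (i - 1))" using T'(3)[of "u \<ominus>\<^bsub>P i\<^esub> v" i] u(1) vc by simp
        then obtain y where y: "y \<in> carrier (P (i - 1))" "u \<ominus>\<^bsub>P i\<^esub> v = d (i - 1) y" by auto
        have "u \<ominus>\<^bsub>P i\<^esub> (u \<ominus>\<^bsub>P i\<^esub> v) = v"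
          using u(1) vc by (simp add: a_minus_def Pi.M.minus_add Pi.M.a_assoc[symmetric] Pi.M.r_neg)
        then have "zc (P i) u = zc (P i) (d (i - 1) y)"
          using submod.cls_eq_iff[OF submodI[OF lP gen_submodule[OF lP]] u(1) dc[OF y(1)]] v(1) by (simp flip: y(2))
        then show "z \<in> D (i - 1) ` carrier (coker (P (i - 1)))"
          using y(1) by (intro image_eqI[of _ _ "zc (P (i - 1)) y"]) (simp_all add: u(2) Dz' coker_carrier[OF lP])
      next
        assume "z \<in> D (i - 1) ` carrier (coker (P (i - 1)))"
        then obtain y where y: "y \<in> carrier (P (i - 1))" "zc (P i) u = zc (P i) (d (i - 1) y)"
          using Dz' by (auto simp: coker_carrier[OF lP] u(2))
        have "zc (P (i + 1)) (d i u) = D i (zc (P i) (d (i - 1) y))" using Dz[OF u(1)] y(2) by simp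
        also have "\<dots> = zc (P (i + 1)) \<zero>\<^bsub>P (i + 1)\<^esub>" using Dz[OF dc[OF y(1)]] B.totally_acyclic_zero[OF T y(1)] by simp
        also have "\<dots> = gen (P (i + 1))"
          using zc_eq_zero_iff[OF lP, of "\<zero>\<^bsub>P (i + 1)\<^esub>"] gen_submodule[OF lP] lin_closed[OF T'(2) u(1)]
            lin_closed[OF T'(2) Pi.M.zero_closed] lin_zero[OF lP lP T'(2)] unfolding submodule_iff[OF lP] by metis
        finally show "d i u \<in> gen (P (i + 1))" using zc_eq_zero_iff[OF lP lin_closed[OF T'(2) u(1)]] by simp
      qed
      finally show ?thesis .
    qed
    fix h assume h: "lin A (coker (P i)) (regular A) h \<and> (\<forall>y\<in>carrier (coker (P (i - 1))). h (D (i - 1) y) = \<zero>\<^bsub>A\<^esub>)"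
    have hz: "lin B (P i) (second (regular A)) (\<lambda>u. h (zc (P i) u))"
    proof (rule lin_comp[OF lin_zc[OF lP]])
      show "lin B (second (coker (P i))) (second (regular A)) h" using h by (simp add: lin_second_iff)
    qed
    have "h (zc (P i) (d (i - 1) y)) = \<zero>\<^bsub>A\<^esub>" if "y \<in> carrier (P (i - 1))" for y
      using h that Dz'[OF that] by (auto simp: coker_carrier[OF lP])
    then obtain k where k: "lin B (P (i + 1)) (second (regular A)) k" "\<forall>x\<in>carrier (P i). k (d i x) = h (zc (P i) x)"
      using second_hom_exact[OF T hz] by blast
    obtain h' where h': "lin A (coker (P (i + 1))) (regular A) h'" "\<forall>u\<in>carrier (P (i + 1)). h' (zc (P (i + 1)) u) = k u"
      using lin_coker_lift[OF lP reg k(1)] by blast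
    have "h' (D i z) = h z" if "z \<in> carrier (coker (P i))" for z
      using that h'(2) k(2) Dz lin_closed[OF T'(2)] by (auto simp: coker_carrier[OF lP])
    then show "\<exists>h'. lin A (coker (P (i + 1))) (regular A) h' \<and> (\<forall>x\<in>carrier (coker (P i)). h' (D i x) = h x)"
      using h'(1) by blast
  qed
  then show ?thesis using Dz by blast
qed

end

section \<open>Rigidity and projectivity over the triangular matrix algebra\<close>

lemma finsum_restr:
  fixes M :: "('r, 'm) module"
  assumes M: "left_module R M" and N: "submodule N R M" and "finite I" "\<And>i. i \<in> I \<Longrightarrow> g i \<in> N"
  shows "(\<Oplus>\<^bsub>M\<lparr>carrier := N\<rparr>\<^esub>i\<in>I. g i) = (\<Oplus>\<^bsub>M\<^esub>i\<in>I. g i)"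
  using assms(3,4)
  by (intro lin_finsum[OF left_module_restr[OF M N] M lin_incl[OF submodule_subset[OF N]]]) auto

context triangular
begin

text \<open>
  If \<open>X \<rightarrow> Y\<close> is injective, then the submodule generated by \<open>X\<close> is \<open>X \<rightarrow> X\<close>, i.e. \<open>B e11 \<otimes>\<^sub>A X\<close>. So
  the vectors of a dual basis of \<open>X\<close> also belong to one of this submodule.
\<close>

lemma projective_gen:
  fixes M :: "('a ^ 2 ^ 2, 'm) module"
  assumes lM: "left_module B M" and inj: "inj_on (\<lambda>x. e21 \<odot>\<^bsub>M\<^esub> x) (xpart M)" and P: "projective A (first M)"
  shows "projective B (M\<lparr>carrier := gen M\<rparr>)"
proof -
  interpret M: left_module "T2 A" M by (rule lM)
  let ?N = "M\<lparr>carrier := gen M\<rparr>"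
  have lN: "left_module B ?N" by (rule left_module_restr[OF lM gen_submodule[OF lM]])
  interpret N: left_module "T2 A" ?N by (rule lN)
  have lF: "left_module A (first M)" using P by (rule projective_left_module)
  obtain n :: nat and x \<phi> where d: "dual_basis A (first M) {..<n} x \<phi>" using projective_dual_basis[OF P] by blast
  have x: "x i \<in> xpart M" and \<phi>: "lin A (first M) (regular A) (\<phi> i)" if "i < n" for i
    using d that by (auto simp: dual_basis_def)
  have \<phi>c: "\<phi> i p \<in> carrier A" if "i < n" "p \<in> xpart M" for i p
    using lin_closed[OF \<phi>[OF that(1)], of p] that(2) by simp
  have e: "(\<Oplus>\<^bsub>M\<^esub>i\<in>{..<n}. t (\<phi> i p) \<zero>\<^bsub>A\<^esub> \<zero>\<^bsub>A\<^esub> \<odot>\<^bsub>M\<^esub> x i) = p" if p: "p \<in> xpart M" for p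
  proof -
    have "t (\<phi> i p) \<zero>\<^bsub>A\<^esub> \<zero>\<^bsub>A\<^esub> \<odot>\<^bsub>M\<^esub> x i \<in> xpart M" if "i < n" for i
      using \<phi>c[OF that p] x[OF that] by (auto intro: xpart_smult[OF lM])
    then have "(\<Oplus>\<^bsub>first M\<^esub>i\<in>{..<n}. t (\<phi> i p) \<zero>\<^bsub>A\<^esub> \<zero>\<^bsub>A\<^esub> \<odot>\<^bsub>M\<^esub> x i) = (\<Oplus>\<^bsub>M\<^esub>i\<in>{..<n}. t (\<phi> i p) \<zero>\<^bsub>A\<^esub> \<zero>\<^bsub>A\<^esub> \<odot>\<^bsub>M\<^esub> x i)"
      by (intro finsum_first[OF lM]) auto
    then show ?thesis using d p by (simp add: dual_basis_def)
  qed
  \<comment> \<open>The \<open>Y\<close>-component of \<open>u\<close>, transported back to \<open>X\<close>.\<close>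
  define Y where "Y u = (SOME y. y \<in> xpart M \<and> u = e11 \<odot>\<^bsub>M\<^esub> u \<oplus>\<^bsub>M\<^esub> e21 \<odot>\<^bsub>M\<^esub> y)" for u
  have Y: "Y (p \<oplus>\<^bsub>M\<^esub> e21 \<odot>\<^bsub>M\<^esub> q) = q" if p: "p \<in> xpart M" and q: "q \<in> xpart M" for p q
  proof -
    let ?u = "p \<oplus>\<^bsub>M\<^esub> e21 \<odot>\<^bsub>M\<^esub> q"
    have "Y ?u \<in> xpart M \<and> ?u = e11 \<odot>\<^bsub>M\<^esub> ?u \<oplus>\<^bsub>M\<^esub> e21 \<odot>\<^bsub>M\<^esub> Y ?u"
      unfolding Y_def by (rule someI[of _ q]) (use q e11_gen[OF lM p q] in simp)
    then have Yx: "Y ?u \<in> xpart M" and "?u = p \<oplus>\<^bsub>M\<^esub> e21 \<odot>\<^bsub>M\<^esub> Y ?u" using e11_gen[OF lM p q] by simp_all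
    then have "e21 \<odot>\<^bsub>M\<^esub> q = e21 \<odot>\<^bsub>M\<^esub> Y ?u"
      using p M.M.add.l_cancel[of p "e21 \<odot>\<^bsub>M\<^esub> q" "e21 \<odot>\<^bsub>M\<^esub> Y ?u"] e21_closed[OF lM q] e21_closed[OF lM Yx] by simp
    then show ?thesis using inj Yx q by (simp add: inj_on_def)
  qed
  have gen: "\<exists>p q. p \<in> xpart M \<and> q \<in> xpart M \<and> u = p \<oplus>\<^bsub>M\<^esub> e21 \<odot>\<^bsub>M\<^esub> q" if "u \<in> gen M" for u
    using that by (auto simp: gen_def)
  define \<Phi> where "\<Phi> i u = t (\<phi> i (e11 \<odot>\<^bsub>M\<^esub> u)) (\<phi> i (Y u)) \<zero>\<^bsub>A\<^esub>" for i u
  have \<Phi>: "\<Phi> i (p \<oplus>\<^bsub>M\<^esub> e21 \<odot>\<^bsub>M\<^esub> q) = t (\<phi> i p) (\<phi> i q) \<zero>\<^bsub>A\<^esub>" if "p \<in> xpart M" "q \<in> xpart M" for i p q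
    using that by (simp add: \<Phi>_def Y e11_gen[OF lM])
  have \<Phi>l: "lin B ?N (regular B) (\<Phi> i)" if i: "i < n" for i
  proof (rule linI)
    fix u assume "u \<in> carrier ?N"
    then have "u \<in> gen M" by simp
    from gen[OF this] obtain p q where u: "p \<in> xpart M" "q \<in> xpart M" "u = p \<oplus>\<^bsub>M\<^esub> e21 \<odot>\<^bsub>M\<^esub> q"
      by (elim exE conjE)
    show "\<Phi> i u \<in> carrier (regular B)" using u(1,2) \<phi>c[OF i] by (simp add: u(3) \<Phi>)
    show "\<Phi> i (u \<oplus>\<^bsub>?N\<^esub> v) = \<Phi> i u \<oplus>\<^bsub>regular B\<^esub> \<Phi> i v" if "v \<in> carrier ?N" for v
    proof -
      have "v \<in> gen M" using that by simp
      from gen[OF this] obtain p' q' where v: "p' \<in> xpart M" "q' \<in> xpart M" "v = p' \<oplus>\<^bsub>M\<^esub> e21 \<odot>\<^bsub>M\<^esub> q'"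
        by (elim exE conjE)
      have "u \<oplus>\<^bsub>M\<^esub> v = (p \<oplus>\<^bsub>M\<^esub> p') \<oplus>\<^bsub>M\<^esub> e21 \<odot>\<^bsub>M\<^esub> (q \<oplus>\<^bsub>M\<^esub> q')"
        using u v e21_closed[OF lM] by (simp add: M.smult_r_distr M.M.a_ac)
      moreover have "\<phi> i (p \<oplus>\<^bsub>M\<^esub> p') = \<phi> i p \<oplus>\<^bsub>A\<^esub> \<phi> i p'" "\<phi> i (q \<oplus>\<^bsub>M\<^esub> q') = \<phi> i q \<oplus>\<^bsub>A\<^esub> \<phi> i q'"
        using lin_add[OF \<phi>[OF i], of p p'] lin_add[OF \<phi>[OF i], of q q'] u v by simp_all
      ultimately show ?thesis using u(1,2) v(1,2) \<phi>c[OF i] xpart_add[OF lM]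
        by (simp add: \<Phi> u(3)[symmetric] v(3)[symmetric]) (simp add: u(3) v(3) \<Phi> tri_add)
    qed
    show "\<Phi> i (b \<odot>\<^bsub>?N\<^esub> u) = b \<odot>\<^bsub>regular B\<^esub> \<Phi> i u" if b: "b \<in> carrier B" for b
      using b
    proof (rule T2_cases)
      fix a c e assume b': "a \<in> carrier A" "c \<in> carrier A" "e \<in> carrier A" "b = t a c e"
      let ?s = "\<lambda>a p. t a \<zero>\<^bsub>A\<^esub> \<zero>\<^bsub>A\<^esub> \<odot>\<^bsub>M\<^esub> p"
      have xs: "?s a p \<in> xpart M" "?s c p \<in> xpart M" "?s e q \<in> xpart M"
        using b' u by (auto intro: xpart_smult[OF lM])
      have fs: "\<phi> i (?s a p) = a \<otimes>\<^bsub>A\<^esub> \<phi> i p" "\<phi> i (?s c p \<oplus>\<^bsub>M\<^esub> ?s e q) = c \<otimes>\<^bsub>A\<^esub> \<phi> i p \<oplus>\<^bsub>A\<^esub> e \<otimes>\<^bsub>A\<^esub> \<phi> i q"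
        using lin_add[OF \<phi>[OF i], of "?s c p" "?s e q"] lin_smult[OF \<phi>[OF i], of _ p] lin_smult[OF \<phi>[OF i], of _ q] b' u xs by simp_all
      have "\<Phi> i (b \<odot>\<^bsub>M\<^esub> u) = t (\<phi> i (?s a p)) (\<phi> i (?s c p \<oplus>\<^bsub>M\<^esub> ?s e q)) \<zero>\<^bsub>A\<^esub>"
        unfolding b'(4) u(3) smult_gen[OF lM u(1,2) b'(1-3)] using xs by (intro \<Phi> xpart_add[OF lM])
      then show ?thesis using b' \<phi>c[OF i u(1)] \<phi>c[OF i u(2)] by (simp add: fs u(3) \<Phi>[OF u(1,2)] tri_mult)
    qed
  qed
  have xN: "x i \<in> gen M" if "i < n" for i
  proof -
    have "x i = x i \<oplus>\<^bsub>M\<^esub> e21 \<odot>\<^bsub>M\<^esub> \<zero>\<^bsub>M\<^esub>" using x[OF that] by (simp add: smult_zero[OF lM])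
    then show ?thesis using x[OF that] xpart_zero[OF lM] unfolding gen_def by blast
  qed
  have "u = (\<Oplus>\<^bsub>?N\<^esub>i\<in>{..<n}. \<Phi> i u \<odot>\<^bsub>?N\<^esub> x i)" if u': "u \<in> gen M" for u
  proof -
    from gen[OF u'] obtain p q where u: "p \<in> xpart M" "q \<in> xpart M" "u = p \<oplus>\<^bsub>M\<^esub> e21 \<odot>\<^bsub>M\<^esub> q"
      by (elim exE conjE)
    have s: "t (\<phi> i p) \<zero>\<^bsub>A\<^esub> \<zero>\<^bsub>A\<^esub> \<odot>\<^bsub>M\<^esub> x i \<in> xpart M" "t (\<phi> i q) \<zero>\<^bsub>A\<^esub> \<zero>\<^bsub>A\<^esub> \<odot>\<^bsub>M\<^esub> x i \<in> xpart M" if "i < n" for i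
      using \<phi>c[OF that u(1)] \<phi>c[OF that u(2)] x[OF that] by (auto intro: xpart_smult[OF lM])
    have \<Phi>x: "\<Phi> i u \<odot>\<^bsub>M\<^esub> x i = t (\<phi> i p) \<zero>\<^bsub>A\<^esub> \<zero>\<^bsub>A\<^esub> \<odot>\<^bsub>M\<^esub> x i \<oplus>\<^bsub>M\<^esub> e21 \<odot>\<^bsub>M\<^esub> (t (\<phi> i q) \<zero>\<^bsub>A\<^esub> \<zero>\<^bsub>A\<^esub> \<odot>\<^bsub>M\<^esub> x i)" if "i < n" for i
      unfolding u(3) \<Phi>[OF u(1,2)]
      using \<phi>c[OF that u(1)] \<phi>c[OF that u(2)] by (intro smult_xpart[OF lM x[OF that]]) simp_all
    have "(\<Oplus>\<^bsub>?N\<^esub>i\<in>{..<n}. \<Phi> i u \<odot>\<^bsub>?N\<^esub> x i) = (\<Oplus>\<^bsub>M\<^esub>i\<in>{..<n}. \<Phi> i u \<odot>\<^bsub>M\<^esub> x i)"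
    proof -
      have "\<Phi> i u \<odot>\<^bsub>M\<^esub> x i \<in> gen M" if "i < n" for i
        using N.smult_closed[of "\<Phi> i u" "x i"] lin_closed[OF \<Phi>l[OF that], of u] xN[OF that] u' by simp
      then show ?thesis
        using finsum_restr[OF lM gen_submodule[OF lM], of "{..<n}" "\<lambda>i. \<Phi> i u \<odot>\<^bsub>M\<^esub> x i"] by simp
    qed
    also have "\<dots> = (\<Oplus>\<^bsub>M\<^esub>i\<in>{..<n}. t (\<phi> i p) \<zero>\<^bsub>A\<^esub> \<zero>\<^bsub>A\<^esub> \<odot>\<^bsub>M\<^esub> x i \<oplus>\<^bsub>M\<^esub> e21 \<odot>\<^bsub>M\<^esub> (t (\<phi> i q) \<zero>\<^bsub>A\<^esub> \<zero>\<^bsub>A\<^esub> \<odot>\<^bsub>M\<^esub> x i))"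
      using \<Phi>x s e21_closed[OF lM] by (intro M.M.finsum_cong') auto
    also have "\<dots> = (\<Oplus>\<^bsub>M\<^esub>i\<in>{..<n}. t (\<phi> i p) \<zero>\<^bsub>A\<^esub> \<zero>\<^bsub>A\<^esub> \<odot>\<^bsub>M\<^esub> x i) \<oplus>\<^bsub>M\<^esub>
      (\<Oplus>\<^bsub>M\<^esub>i\<in>{..<n}. e21 \<odot>\<^bsub>M\<^esub> (t (\<phi> i q) \<zero>\<^bsub>A\<^esub> \<zero>\<^bsub>A\<^esub> \<odot>\<^bsub>M\<^esub> x i))"
      using s e21_closed[OF lM] by (intro M.M.finsum_addf) auto
    also have "(\<Oplus>\<^bsub>M\<^esub>i\<in>{..<n}. e21 \<odot>\<^bsub>M\<^esub> (t (\<phi> i q) \<zero>\<^bsub>A\<^esub> \<zero>\<^bsub>A\<^esub> \<odot>\<^bsub>M\<^esub> x i)) = e21 \<odot>\<^bsub>M\<^esub> q"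
      using s smult_finsum[OF lM, of "{..<n}" "\<lambda>i. t (\<phi> i q) \<zero>\<^bsub>A\<^esub> \<zero>\<^bsub>A\<^esub> \<odot>\<^bsub>M\<^esub> x i" e21] by (simp add: e[OF u(2)])
    finally show ?thesis by (simp add: e[OF u(1)] u(3)[symmetric])
  qed
  then have d': "dual_basis B ?N {..<n} x \<Phi>" using xN \<Phi>l by (simp add: dual_basis_def)
  show ?thesis by (rule B.projective_of_dual_basis[OF fg_module_of_dual_basis[OF lN d'] d'])
qed

text \<open>
  The module is an extension of \<open>0 \<rightarrow> Coker(X \<rightarrow> Y)\<close> by the submodule generated by \<open>X\<close>.
\<close>

lemma projective_T2I:
  fixes M :: "('a ^ 2 ^ 2, 'm) module"
  assumes M: "fg_module B M" and inj: "inj_on (\<lambda>x. e21 \<odot>\<^bsub>M\<^esub> x) (xpart M)"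
    and F: "projective A (first M)" and C: "projective A (coker M)"
  shows "projective B M"
proof (rule B.projective_extension[OF M])
  have lM: "left_module B M" using M by (rule fg_moduleD)
  interpret S: submod "T2 A" M "gen M" by (rule submodI[OF lM gen_submodule[OF lM]])
  show "submodule (gen M) B M" by (rule gen_submodule[OF lM])
  show "projective B (M\<lparr>carrier := gen M\<rparr>)" by (rule projective_gen[OF lM inj F])
  have s: "b \<odot>\<^bsub>quot_mod M (gen M)\<^esub> z = t \<zero>\<^bsub>A\<^esub> \<zero>\<^bsub>A\<^esub> (b $ 2 $ 2) \<odot>\<^bsub>quot_mod M (gen M)\<^esub> z"
    if "b \<in> carrier B" "z \<in> carrier (quot_mod M (gen M))" for b z
    using quot_smult_eq[OF lM, of "b $ 1 $ 1" "b $ 2 $ 1" "b $ 2 $ 2" z] that by (simp add: tri_collapse)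
  have "lin B (second (coker M)) (quot_mod M (gen M)) (\<lambda>z. z)" "lin B (quot_mod M (gen M)) (second (coker M)) (\<lambda>z. z)"
    by (rule linI; simp add: coker_def s[symmetric])+
  then show "projective B (quot_mod M (gen M))"
    by (rule B.projective_retract[OF projective_second[OF C] S.left_module_quot]) simp
qed

lemma xpart_image:
  assumes U: "left_module B U" and f: "lin B U V f" and s: "f ` carrier U = carrier V"
  shows "f ` xpart U = xpart V"
proof
  show "f ` xpart U \<subseteq> xpart V" using lin_closed[OF lin_first[OF f]] by auto
  show "xpart V \<subseteq> f ` xpart U"
  proof
    fix x assume x: "x \<in> xpart V"
    then have "x \<in> f ` carrier U" unfolding s by simp
    then obtain u where u: "x = f u" "u \<in> carrier U" by (rule imageE)
    have "f (e11 \<odot>\<^bsub>U\<^esub> u) = x" using lin_smult[OF f, of e11 u] u xpartD(2)[OF x] by simp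
    moreover have "e11 \<odot>\<^bsub>U\<^esub> u \<in> xpart U" using u(2) by (intro xpart_smult[OF U]) simp_all
    ultimately show "x \<in> f ` xpart U" by blast
  qed
qed

lemma projective_e21_inj_on:
  fixes P :: "('a ^ 2 ^ 2, 'm) module"
  assumes P: "projective B P"
  shows "inj_on (\<lambda>x. e21 \<odot>\<^bsub>P\<^esub> x) (xpart P)"
proof (rule inj_onI)
  have lP: "left_module B P" using P by (rule B.projective_left_module)
  interpret P: left_module "T2 A" P by (rule lP)
  fix x y assume xy: "x \<in> xpart P" "y \<in> xpart P" "e21 \<odot>\<^bsub>P\<^esub> x = e21 \<odot>\<^bsub>P\<^esub> y"
  have d: "x \<ominus>\<^bsub>P\<^esub> y \<in> xpart P"
    using xy smult_diff_right[OF lP, of x y e11] unfolding xpart_def by simp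
  have "e21 \<odot>\<^bsub>P\<^esub> (x \<ominus>\<^bsub>P\<^esub> y) = \<zero>\<^bsub>P\<^esub>"
    using xy smult_diff_right[OF lP, of x y e21] e21_closed[OF lP]
    by (simp add: diff_eq_zero_iff[OF P.M.abelian_group_axioms])
  then have "x \<ominus>\<^bsub>P\<^esub> y = \<zero>\<^bsub>P\<^esub>" by (rule projective_e21_inj[OF P d])
  then show "x = y" using xy by (simp add: diff_eq_zero_iff[OF P.M.abelian_group_axioms])
qed

text \<open>
  A map between \<open>X\<close>-components extends to the projective module \<open>Q1\<close>; it is factored there and restricted
  again.
\<close>

lemma rigid_presentation_first:
  fixes Q1 :: "('a ^ 2 ^ 2, 'q) module" and Q0 :: "('a ^ 2 ^ 2, 'p) module" and M :: "('a ^ 2 ^ 2, 'm) module"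
  assumes r: "B.rigid_presentation Q1 f Q0 g M" and lM: "left_module B M"
  shows "rigid_presentation (first Q1) f (first Q0) g (first M)"
proof -
  note r' = r[unfolded B.rigid_presentation_def B.presentation_def]
  have Q1: "projective B Q1" and Q0: "projective B Q0" and f: "lin B Q1 Q0 f" and g: "lin B Q0 M g" "g ` carrier Q0 = carrier M"
    and gk: "\<And>x. x \<in> carrier Q0 \<Longrightarrow> g x = \<zero>\<^bsub>M\<^esub> \<longleftrightarrow> x \<in> f ` carrier Q1"
    and rig: "\<And>u. lin B Q1 M u \<Longrightarrow> \<exists>v. lin B Q0 M v \<and> (\<forall>y\<in>carrier Q1. u y = v (f y))" using r' by auto
  note l1 = B.projective_left_module[OF Q1] and l0 = B.projective_left_module[OF Q0]
  show ?thesis unfolding rigid_presentation_def presentation_def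
  proof (intro conjI allI impI ballI)
    show "projective A (first Q1)" "projective A (first Q0)" using Q1 Q0 by (auto intro: projective_first)
    show "lin A (first Q1) (first Q0) f" "lin A (first Q0) (first M) g" using f g(1) by (auto intro: lin_first)
    show "g ` carrier (first Q0) = carrier (first M)" using xpart_image[OF l0 g] by simp
    show "g x = \<zero>\<^bsub>first M\<^esub> \<longleftrightarrow> x \<in> f ` carrier (first Q1)" if "x \<in> carrier (first Q0)" for x
    proof -
      have x: "x \<in> xpart Q0" using that by simp
      have "x \<in> f ` xpart Q1" if "x \<in> f ` carrier Q1"
      proof -
        obtain y where y: "x = f y" "y \<in> carrier Q1" using \<open>x \<in> f ` carrier Q1\<close> by (rule imageE)
        have "f (e11 \<odot>\<^bsub>Q1\<^esub> y) = x" using lin_smult[OF f, of e11 y] y xpartD(2)[OF x] by simp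
        moreover have "e11 \<odot>\<^bsub>Q1\<^esub> y \<in> xpart Q1" using y(2) by (intro xpart_smult[OF l1]) simp_all
        ultimately show ?thesis by blast
      qed
      then show ?thesis using gk[of x] x by auto
    qed
    fix u assume u: "lin A (first Q1) (first M) u"
    obtain U where U: "lin B Q1 M U" "\<forall>x\<in>xpart Q1. U x = u x" using projective_extend[OF Q1 lM u] by blast
    obtain v where v: "lin B Q0 M v" "\<forall>y\<in>carrier Q1. U y = v (f y)" using rig[OF U(1)] by blast
    show "\<exists>v. lin A (first Q0) (first M) v \<and> (\<forall>y\<in>carrier (first Q1). u y = v (f y))"
      using lin_first[OF v(1)] v(2) U(2) by (intro exI[of _ v]) auto
  qed
qed

text \<open>
  A map \<open>Coker Q1 \<rightarrow> Coker M\<close>, composed with the projection of \<open>Q1\<close>, lifts to \<open>Q1 \<rightarrow> M\<close>; it is factored there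
  and passed to the cokernels again.
\<close>

lemma rigid_presentation_coker:
  fixes Q1 :: "('a ^ 2 ^ 2, 'q) module" and Q0 :: "('a ^ 2 ^ 2, 'p) module" and M :: "('a ^ 2 ^ 2, 'm) module"
  assumes r: "B.rigid_presentation Q1 f Q0 g M" and lM: "left_module B M"
  shows "\<exists>f' g'. rigid_presentation (coker Q1) f' (coker Q0) g' (coker M)"
proof -
  note r' = r[unfolded B.rigid_presentation_def B.presentation_def]
  have Q1: "projective B Q1" and Q0: "projective B Q0" and f: "lin B Q1 Q0 f" and g: "lin B Q0 M g" "g ` carrier Q0 = carrier M"
    and gk: "\<And>x. x \<in> carrier Q0 \<Longrightarrow> g x = \<zero>\<^bsub>M\<^esub> \<longleftrightarrow> x \<in> f ` carrier Q1"
    and rig: "\<And>u. lin B Q1 M u \<Longrightarrow> \<exists>v. lin B Q0 M v \<and> (\<forall>y\<in>carrier Q1. u y = v (f y))" using r' by auto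
  note l1 = B.projective_left_module[OF Q1] and l0 = B.projective_left_module[OF Q0]
  interpret Q0: left_module "T2 A" Q0 by (rule l0)
  interpret M: left_module "T2 A" M by (rule lM)
  obtain f' where f': "lin A (coker Q1) (coker Q0) f'" "\<forall>u\<in>carrier Q1. f' (zc Q1 u) = zc Q0 (f u)"
    using lin_coker_map[OF l1 l0 f] by blast
  obtain g' where g': "lin A (coker Q0) (coker M) g'" "\<forall>u\<in>carrier Q0. g' (zc Q0 u) = zc M (g u)"
    using lin_coker_map[OF l0 lM g(1)] by blast
  have "rigid_presentation (coker Q1) f' (coker Q0) g' (coker M)"
    unfolding rigid_presentation_def presentation_def
  proof (intro conjI allI impI ballI)
    show "projective A (coker Q1)" "projective A (coker Q0)" using Q1 Q0 by (auto intro: projective_coker)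
    show "lin A (coker Q1) (coker Q0) f'" "lin A (coker Q0) (coker M) g'" by (fact f' g')+
    have "g' ` carrier (coker Q0) = (\<lambda>u. zc M (g u)) ` carrier Q0"
      unfolding coker_carrier[OF l0] image_image using g'(2) by (intro image_cong) auto
    also have "\<dots> = carrier (coker M)" unfolding coker_carrier[OF lM] g(2)[symmetric] image_image ..
    finally show "g' ` carrier (coker Q0) = carrier (coker M)" .
    show "g' z = \<zero>\<^bsub>coker M\<^esub> \<longleftrightarrow> z \<in> f' ` carrier (coker Q1)" if z: "z \<in> carrier (coker Q0)" for z
    proof
      obtain q where q: "q \<in> carrier Q0" "z = zc Q0 q" using z by (auto simp: coker_carrier[OF l0])
      assume "g' z = \<zero>\<^bsub>coker M\<^esub>"
      then have "zc M (g q) = gen M" using g'(2) q by (simp add: coker_zero[OF lM])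
      then have "g q \<in> gen M" using zc_eq_zero_iff[OF lM lin_closed[OF g(1) q(1)]] by simp
      then obtain x y where xy: "x \<in> xpart M" "y \<in> xpart M" "g q = x \<oplus>\<^bsub>M\<^esub> e21 \<odot>\<^bsub>M\<^esub> y" by (auto simp: gen_def)
      have "x \<in> g ` xpart Q0" "y \<in> g ` xpart Q0" using xy(1,2) xpart_image[OF l0 g] by simp_all
      then obtain a b where ab: "a \<in> xpart Q0" "b \<in> xpart Q0" "x = g a" "y = g b" by auto
      let ?v = "a \<oplus>\<^bsub>Q0\<^esub> e21 \<odot>\<^bsub>Q0\<^esub> b"
      have v: "?v \<in> gen Q0" using ab unfolding gen_def by blast
      have vc: "?v \<in> carrier Q0" using ab e21_closed[OF l0] by simp
      have gv: "g ?v = g q" using ab xy(3) e21_closed[OF l0] lin_smult[OF g(1), of e21 b] by (simp add: lin_add[OF g(1)])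
      have "g (q \<ominus>\<^bsub>Q0\<^esub> ?v) = \<zero>\<^bsub>M\<^esub>"
        using q(1) vc lin_closed[OF g(1) q(1)]
        by (simp only: lin_minus[OF l0 lM g(1)] gv diff_eq_zero_iff[OF M.M.abelian_group_axioms])
      then have "q \<ominus>\<^bsub>Q0\<^esub> ?v \<in> f ` carrier Q1" using gk[of "q \<ominus>\<^bsub>Q0\<^esub> ?v"] q(1) vc by simp
      then obtain y' where y': "q \<ominus>\<^bsub>Q0\<^esub> ?v = f y'" "y' \<in> carrier Q1" by (rule imageE)
      have fy: "f y' \<in> carrier Q0" using lin_closed[OF f y'(2)] .
      have "q \<ominus>\<^bsub>Q0\<^esub> f y' = ?v" unfolding y'(1)[symmetric]
        using q(1) vc by (simp add: a_minus_def Q0.M.minus_add Q0.M.a_assoc[symmetric] Q0.M.r_neg)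
      then have "z = zc Q0 (f y')"
        using submod.cls_eq_iff[OF submodI[OF l0 gen_submodule[OF l0]] q(1) fy] v q(2) by simp
      then show "z \<in> f' ` carrier (coker Q1)"
        using f'(2) y'(2) by (intro image_eqI[of _ _ "zc Q1 y'"]) (simp_all add: coker_carrier[OF l1])
    next
      assume "z \<in> f' ` carrier (coker Q1)"
      then obtain y where y: "y \<in> carrier Q1" "z = zc Q0 (f y)" using f'(2) by (auto simp: coker_carrier[OF l1])
      have "g (f y) = \<zero>\<^bsub>M\<^esub>" using gk[OF lin_closed[OF f y(1)]] y(1) by simp
      then have "g' z = zc M \<zero>\<^bsub>M\<^esub>" using g'(2) lin_closed[OF f y(1)] by (simp add: y(2))
      also have "\<dots> = \<zero>\<^bsub>coker M\<^esub>"
        using zc_eq_zero_iff[OF lM, of "\<zero>\<^bsub>M\<^esub>"] gen_submodule[OF lM] by (simp add: coker_zero[OF lM] submodule_iff[OF lM])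
      finally show "g' z = \<zero>\<^bsub>coker M\<^esub>" .
    qed
    fix u assume u: "lin A (coker Q1) (coker M) u"
    have uz: "lin B Q1 (second (coker M)) (\<lambda>q. u (zc Q1 q))"
    proof (rule lin_comp[OF lin_zc[OF l1]])
      show "lin B (second (coker Q1)) (second (coker M)) u" using u by (simp add: lin_second_iff)
    qed
    have "u (zc Q1 q) \<in> zc M ` carrier M" if "q \<in> carrier Q1" for q
      using lin_closed[OF uz that] by (simp add: coker_carrier[OF lM])
    then obtain U where U: "lin B Q1 M U" "\<And>q. q \<in> carrier Q1 \<Longrightarrow> zc M (U q) = u (zc Q1 q)"
      using B.projective_lift[OF Q1 lM left_module_second[OF left_module_coker[OF lM]] lin_zc[OF lM] uz] by blast
    obtain v where v: "lin B Q0 M v" "\<forall>y\<in>carrier Q1. U y = v (f y)" using rig[OF U(1)] by blast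
    obtain v' where v': "lin A (coker Q0) (coker M) v'" "\<forall>q\<in>carrier Q0. v' (zc Q0 q) = zc M (v q)"
      using lin_coker_map[OF l0 lM v(1)] by blast
    have "u z = v' (f' z)" if "z \<in> carrier (coker Q1)" for z
    proof -
      obtain q where q: "q \<in> carrier Q1" "z = zc Q1 q" using \<open>z \<in> carrier (coker Q1)\<close> by (auto simp: coker_carrier[OF l1])
      show ?thesis using q U(2)[OF q(1)] v(2) v'(2) f'(2) lin_closed[OF f q(1)] by simp
    qed
    then show "\<exists>v. lin A (coker Q0) (coker M) v \<and> (\<forall>z\<in>carrier (coker Q1). u z = v (f' z))" using v'(1) by blast
  qed
  then show ?thesis by blast
qed

text \<open>
  Applying \<open>first\<close> and \<open>coker\<close> to a totally acyclic complex gives complexes in which \<open>first M\<close> and \<open>coker M\<close>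
  are images. For \<open>coker M\<close> this uses that the submodule generated by the \<open>X\<close>-component of \<open>M\<close> is the
  intersection of \<open>M\<close> with the one of \<open>P 0\<close>.
\<close>

lemma cm_tau_tilting_free_T2:
  assumes free: "cm_tau_tilting_free K A"
  shows "cm_tau_tilting_free K B"
  unfolding cm_tau_tilting_free_def
proof (intro allI impI, elim conjE)
  fix M :: "('k, 'a ^ 2 ^ 2) std_module"
  assume gp: "gorenstein_projective B M" and tr: "tau_rigid K B M"
  have M: "fg_module B M" using tr by (simp add: tau_rigid_def)
  have lM: "left_module B M" using M by (rule fg_moduleD)
  interpret M: left_module "T2 A" M by (rule lM)
  from B.gorenstein_projective_imp_totally_acyclic[OF gp]
  obtain P :: "int \<Rightarrow> ('k, 'a ^ 2 ^ 2) std_module" and d \<iota> where T: "totally_acyclic B P d" and \<iota>: "lin B M (P 0) \<iota>"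
    "inj_on \<iota> (carrier M)" "\<iota> ` carrier M = d (-1) ` carrier (P (-1))" by (elim exE conjE)
  from B.tau_rigid_imp[OF tr] obtain Q1 f Q0 g
    where r: "B.rigid_presentation (Q1 :: ('k, 'a ^ 2 ^ 2) std_module) f (Q0 :: ('k, 'a ^ 2 ^ 2) std_module) g M"
    by (elim exE conjE)
  note T' = totally_acyclicD[OF T]
  have lP: "left_module B (P i)" for i using T'(1) by (rule B.projective_left_module)
  have dl: "lin B (P (-1)) (P 0) (d (-1))" using T'(2)[of "-1"] by simp
  have d\<iota>: "d 0 (\<iota> m) = \<zero>\<^bsub>P (0 + 1)\<^esub>" if "m \<in> carrier M" for m
  proof -
    have "\<iota> m \<in> d (0 - 1) ` carrier (P (0 - 1))" using that \<iota>(3) by auto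
    then show ?thesis using T'(3)[OF lin_closed[OF \<iota>(1) that]] by simp
  qed
  have \<iota>x: "\<iota> ` xpart M = d (-1) ` xpart (P (-1))"
  proof
    show "\<iota> ` xpart M \<subseteq> d (-1) ` xpart (P (-1))"
    proof
      fix p assume "p \<in> \<iota> ` xpart M"
      then obtain m where m: "p = \<iota> m" "m \<in> xpart M" by (rule imageE)
      have "\<iota> m \<in> xpart (P 0)" using lin_closed[OF lin_first[OF \<iota>(1)]] m(2) by simp
      then obtain y where "y \<in> xpart (P (0 - 1))" "d (0 - 1) y = \<iota> m"
        using totally_acyclic_xpart[OF T _ d\<iota>[OF xpartD(1)[OF m(2)]]] by blast
      then show "p \<in> d (-1) ` xpart (P (-1))" using m(1) by (intro image_eqI[of _ _ y]) simp_all
    qed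
    show "d (-1) ` xpart (P (-1)) \<subseteq> \<iota> ` xpart M"
    proof
      fix p assume "p \<in> d (-1) ` xpart (P (-1))"
      then obtain y where y: "p = d (-1) y" "y \<in> xpart (P (-1))" by (rule imageE)
      then have "p \<in> \<iota> ` carrier M" unfolding \<iota>(3) by simp
      then obtain m where m: "p = \<iota> m" "m \<in> carrier M" by (rule imageE)
      have "p \<in> xpart (P 0)" using lin_closed[OF lin_first[OF dl], of y] y by simp
      then have "\<iota> (e11 \<odot>\<^bsub>M\<^esub> m) = \<iota> m"
        using lin_smult[OF \<iota>(1), of e11 m] m(2) unfolding m(1) by (simp add: xpartD(2))
      from inj_onD[OF \<iota>(2), OF this] have "e11 \<odot>\<^bsub>M\<^esub> m = m" using m(2) M.smult_closed[of e11 m] by simp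
      then have "m \<in> xpart M" using m(2) unfolding xpart_def by simp
      then show "p \<in> \<iota> ` xpart M" using m(1) by blast
    qed
  qed
  have inj: "inj_on (\<lambda>x. e21 \<odot>\<^bsub>M\<^esub> x) (xpart M)"
  proof (rule inj_onI)
    fix x y assume xy: "x \<in> xpart M" "y \<in> xpart M" "e21 \<odot>\<^bsub>M\<^esub> x = e21 \<odot>\<^bsub>M\<^esub> y"
    have "\<iota> x \<in> xpart (P 0)" "\<iota> y \<in> xpart (P 0)" using lin_closed[OF lin_first[OF \<iota>(1)]] xy by simp_all
    moreover have "e21 \<odot>\<^bsub>P 0\<^esub> \<iota> x = e21 \<odot>\<^bsub>P 0\<^esub> \<iota> y"
      using xy lin_smult[OF \<iota>(1), of e21 x] lin_smult[OF \<iota>(1), of e21 y] by simp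
    ultimately have "\<iota> x = \<iota> y" using projective_e21_inj_on[OF T'(1), of 0] unfolding inj_on_def by blast
    from inj_onD[OF \<iota>(2), OF this] show "x = y" using xy by simp
  qed
  have rf: "rigid_presentation (first Q1) f (first Q0) g (first M)" by (rule rigid_presentation_first[OF r lM])
  have fgf: "fg_module A (first M)"
    using rf left_module_first[OF lM] unfolding rigid_presentation_def presentation_def
    by (elim conjE) (rule fg_module_image[OF projective_fg])
  have pf: "projective A (first M)"
  proof (rule cm_tau_tilting_free_projective[OF free fgf totally_acyclic_first[OF T] _ _ _ rf])
    show "lin A (first M) (first (P 0)) \<iota>" using \<iota>(1) by (rule lin_first)
    show "inj_on \<iota> (carrier (first M))" using \<iota>(2) by (rule inj_on_subset) auto
    show "\<iota> ` carrier (first M) = d (0 - 1) ` carrier (first (P (0 - 1)))" using \<iota>x by simp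
  qed
  obtain f' g' where rc: "rigid_presentation (coker Q1) f' (coker Q0) g' (coker M)"
    using rigid_presentation_coker[OF r lM] by blast
  have fgc: "fg_module A (coker M)"
    using rc left_module_coker[OF lM] unfolding rigid_presentation_def presentation_def
    by (elim conjE) (rule fg_module_image[OF projective_fg])
  obtain D where TD: "totally_acyclic A (\<lambda>i. coker (P i)) D"
    and D: "\<forall>i. \<forall>u\<in>carrier (P i). D i (zc (P i) u) = zc (P (i + 1)) (d i u)"
    using totally_acyclic_coker[OF T] by blast
  obtain \<iota>' where \<iota>': "lin A (coker M) (coker (P 0)) \<iota>'" "\<forall>m\<in>carrier M. \<iota>' (zc M m) = zc (P 0) (\<iota> m)"
    using lin_coker_map[OF lM lP \<iota>(1)] by blast
  have pc: "projective A (coker M)"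
  proof (rule cm_tau_tilting_free_projective[OF free fgc TD _ _ _ rc])
    show "lin A (coker M) (coker (P 0)) \<iota>'" by (rule \<iota>'(1))
    show "inj_on \<iota>' (carrier (coker M))"
      unfolding lin_inj_iff[OF left_module_coker[OF lM] left_module_coker[OF lP] \<iota>'(1)]
    proof (intro ballI impI)
      fix z assume z: "z \<in> carrier (coker M)" "\<iota>' z = \<zero>\<^bsub>coker (P 0)\<^esub>"
      obtain m where m: "m \<in> carrier M" "z = zc M m" using z(1) by (auto simp: coker_carrier[OF lM])
      have "zc (P 0) (\<iota> m) = gen (P 0)" using z(2) \<iota>'(2) m by (simp add: coker_zero[OF lP])
      then have "\<iota> m \<in> gen (P 0)" using zc_eq_zero_iff[OF lP lin_closed[OF \<iota>(1) m(1)]] by simp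
      from totally_acyclic_gen[OF T this d\<iota>[OF m(1)]]
      obtain v where "v \<in> gen (P (-1))" "d (-1) v = \<iota> m" by auto
      then obtain a b where ab: "a \<in> xpart (P (-1))" "b \<in> xpart (P (-1))" "d (-1) (a \<oplus>\<^bsub>P (-1)\<^esub> e21 \<odot>\<^bsub>P (-1)\<^esub> b) = \<iota> m"
        by (auto simp: gen_def)
      have "d (-1) a \<in> \<iota> ` xpart M" "d (-1) b \<in> \<iota> ` xpart M" using ab \<iota>x by simp_all
      then obtain x y where xy: "x \<in> xpart M" "y \<in> xpart M" "d (-1) a = \<iota> x" "d (-1) b = \<iota> y" by auto
      have "\<iota> m = d (-1) a \<oplus>\<^bsub>P 0\<^esub> e21 \<odot>\<^bsub>P 0\<^esub> d (-1) b"
        unfolding ab(3)[symmetric] using ab(1,2) e21_closed[OF lP ab(2)] lin_smult[OF dl, of e21 b] by (simp add: lin_add[OF dl])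
      also have "\<dots> = \<iota> (x \<oplus>\<^bsub>M\<^esub> e21 \<odot>\<^bsub>M\<^esub> y)"
        unfolding xy(3,4) using xy(1,2) e21_closed[OF lM xy(2)] lin_smult[OF \<iota>(1), of e21 y] by (simp add: lin_add[OF \<iota>(1)])
      finally have "\<iota> m = \<iota> (x \<oplus>\<^bsub>M\<^esub> e21 \<odot>\<^bsub>M\<^esub> y)" .
      from inj_onD[OF \<iota>(2), OF this] have "m = x \<oplus>\<^bsub>M\<^esub> e21 \<odot>\<^bsub>M\<^esub> y"
        using m(1) xy(1) e21_closed[OF lM xy(2)] by simp
      then have "m \<in> gen M" using xy(1,2) unfolding gen_def by blast
      then show "z = \<zero>\<^bsub>coker M\<^esub>" using zc_eq_zero_iff[OF lM m(1)] by (simp add: m(2) coker_zero[OF lM])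
    qed
    have "\<iota>' ` carrier (coker M) = (\<lambda>m. zc (P 0) (\<iota> m)) ` carrier M"
      unfolding coker_carrier[OF lM] image_image using \<iota>'(2) by (intro image_cong) auto
    also have "\<dots> = zc (P 0) ` d (-1) ` carrier (P (-1))" unfolding \<iota>(3)[symmetric] image_image ..
    also have "\<dots> = D (-1) ` carrier (coker (P (-1)))"
      unfolding coker_carrier[OF lP] image_image using D[rule_format, of _ "-1"] by (intro image_cong) auto
    finally show "\<iota>' ` carrier (coker M) = D (0 - 1) ` carrier (coker (P (0 - 1)))" by simp
  qed
  show "projective B M" by (rule projective_T2I[OF M inj pf pc])
qed

end

theorem cm_tau_tilting_free_T2_iff:
  assumes "fd_algebra K A"
  shows "cm_tau_tilting_free K A \<longleftrightarrow> cm_tau_tilting_free K (T2 A)"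
proof -
  interpret triangular K A using assms by (rule triangular.intro)
  show ?thesis using cm_tau_tilting_free_T2 cm_tau_tilting_free_of_T2 by blast
qed

theorem theorem1p1:
  fixes K :: "'k ring" and \<Lambda> :: "('k, 'a) module"
  assumes "algebraically_closed K" and "fd_algebra K \<Lambda>"
  shows "(cm_tau_tilting_free K \<Lambda> \<longleftrightarrow> cm_tau_tilting_free K (opp \<Lambda>)) \<and>
    (gorenstein \<Lambda> \<longrightarrow> (cm_tau_tilting_free K \<Lambda> \<longleftrightarrow> cm_tau_tilting_free K (T2 \<Lambda>)))"
  using cm_tau_tilting_free_opp_iff[OF assms(2)] cm_tau_tilting_free_T2_iff[OF assms(2)] by blast

end
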